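(* For $|q|<1$ the following 26 identities hold (in each double sum the summation indices range over $r\ge 0$ together with the indicated range of $n$ or $m$): 1. $\displaystyle\sum_{n\ge 0}\sum_{r\ge 0}\frac{(-1)^rq^{3n(n-1)/2+r^2-2nr}}{(q;q^2)_n(q^2;q^2)_r(q;q)_{n-2r}}=\frac{(q^2,q^4,q^6;q^6)_\infty}{(q;q)_\infty}=(-q;q)_\infty$ 2. $\displaystyle 1+\sum_{n\ge 1}\sum_{r\ge 0}\frac{(-1)^rq^{n(n+1)/2+3r(r-1)/2}(-1;q)_n(q^3;q^3)_{n-r-1}}{(q;q)_{2n-1}(q^3;q^3)_r(q;q)_{n-3r}}=\frac{(q^6,q^6,q^{12};q^{12})_\infty(-q;q)_\infty}{(q;q)_\infty}$ 3. $\displaystyle\sum_{n\ge 0}\sum_{r\ge 0}\frac{q^{n(n+1)/2+2r^2}(-1;q)_n}{(q;q^2)_n(q^2;q^2)_r(q;q)_{n-2r}}=\frac{(q^7,q^7,q^{14};q^{14})_\infty(-q;q)_\infty}{(q;q)_\infty}$ 4. $\displaystyle\sum_{n\ge 0}\sum_{r\ge 0}\frac{q^{n^2+2n+2r^2+2r}}{(q;q^2)_{n+1}(q^2;q^2)_r(q;q)_{n-2r}}=\frac{(q^2,q^{16},q^{18};q^{18})_\infty}{(q;q)_\infty}$ 5. $\displaystyle\sum_{n\ge 0}\sum_{r\ge 0}\frac{q^{n^2+2n+2r^2+2r}(1+q^{2r+2})}{(q;q^2)_{n+1}(q^2;q^2)_r(q;q)_{n-2r}}=\frac{(q^4,q^{14},q^{18};q^{18})_\infty}{(q;q)_\infty}$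 6. $\displaystyle\sum_{n\ge 0}\sum_{r\ge 0}\frac{q^{n^2+2r^2+2r}}{(q;q^2)_n(q^2;q^2)_r(q;q)_{n-2r}}=\frac{(q^6,q^{12},q^{18};q^{18})_\infty}{(q;q)_\infty}$ 7. $\displaystyle\sum_{n\ge 0}\sum_{r\ge 0}\frac{q^{n^2+2r^2}}{(q;q^2)_n(q^2;q^2)_r(q;q)_{n-2r}}=\frac{(q^8,q^{10},q^{18};q^{18})_\infty}{(q;q)_\infty}$ 8. $\displaystyle\sum_{n\ge 0}\sum_{r\ge 0}\frac{(-1)^rq^{n^2+3n+3r(r-1)/2}(q^3;q^3)_{n-r}}{(q;q)_{2n+2}(q^3;q^3)_r(q;q)_{n-3r}}=\frac{(q^3,q^{18},q^{21};q^{21})_\infty}{(q;q)_\infty}$ 9. $\displaystyle 1+\sum_{n\ge 1}\sum_{r\ge 0}\frac{(-1)^rq^{n^2+3r(r-3)/2}(q^3;q^3)_{n-r-1}}{(q;q)_{2n-1}(q^3;q^3)_r(q;q)_{n-3r}}=\frac{(q^6,q^{15},q^{21};q^{21})_\infty}{(q;q)_\infty}$ 10. $\displaystyle 1+\sum_{n\ge 1}\sum_{r\ge 0}\frac{(-1)^rq^{n^2+3r(r-1)/2}(q^3;q^3)_{n-r-1}}{(q;q)_{2n-1}(q^3;q^3)_r(q;q)_{n-3r}}=\frac{(q^9,q^{12},q^{21};q^{21})_\infty}{(q;q)_\infty}$ 11. $\displaystyle 1+\sum_{n\ge 1}\sum_{r\ge 0}\frac{(-1)^rq^{n^2+3r(r-3)}(-q;q^2)_n(q^6;q^6)_{n-r-1}}{(q^2;q^2)_{2n-1}(q^6;q^6)_r(q^2;q^2)_{n-3r}}=\frac{(q^3,q^{21},q^{24};q^{24})_\infty(-q;q^2)_\infty}{(q^2;q^2)_\infty}$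 12. $\displaystyle 1+\sum_{n\ge 1}\sum_{r\ge 0}\frac{(-1)^rq^{n^2+3r(r-1)}(-q;q^2)_n(q^6;q^6)_{n-r-1}}{(q^2;q^2)_{2n-1}(q^6;q^6)_r(q^2;q^2)_{n-3r}}=\frac{(q^9,q^{15},q^{24};q^{24})_\infty(-q;q^2)_\infty}{(q^2;q^2)_\infty}$ 13. $\displaystyle 1+\sum_{n\ge 1}\sum_{r\ge 0}\frac{q^{n(n+1)/2+3r^2}(-1;q)_n(q^3;q^3)_{n-r-1}}{(q;q)_{2n-1}(q^3;q^3)_r(q;q)_{n-3r}}=\frac{(q^{12},q^{12},q^{24};q^{24})_\infty(-q;q)_\infty}{(q;q)_\infty}$ 14. $\displaystyle\sum_{n\ge 0}\sum_{r\ge 0}\frac{q^{n^2+4r^2+4r}}{(q;q^2)_n(q^4;q^4)_r(q^2;q^2)_{n-2r}}=\frac{(q^8,q^{20},q^{28};q^{28})_\infty(-q;q^2)_\infty}{(q^2;q^2)_\infty}$ 15. $\displaystyle\sum_{n\ge 0}\sum_{r\ge 0}\frac{q^{n^2+4r^2}}{(q;q^2)_n(q^4;q^4)_r(q^2;q^2)_{n-2r}}=\frac{(q^{12},q^{16},q^{28};q^{28})_\infty(-q;q^2)_\infty}{(q^2;q^2)_\infty}$ 16. $\displaystyle\sum_{n\ge 0}\sum_{r\ge 0}\frac{q^{n^2+3n+3r^2+3r}(q^3;q^3)_{n-r}}{(q;q)_{2n+2}(q^3;q^3)_r(q;q)_{n-3r}}=\frac{(q^3,q^{30},q^{33};q^{33})_\infty}{(q;q)_\infty}$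 17. $\displaystyle\sum_{n\ge 0}\sum_{r\ge 0}\frac{q^{n^2+3n+3r^2+3r}(q^3;q^3)_{n-r}(1+q^{3r+3})}{(q;q)_{2n+2}(q^3;q^3)_r(q;q)_{n-3r}}=\frac{(q^6,q^{27},q^{33};q^{33})_\infty}{(q;q)_\infty}$ 18. $\displaystyle 1+\sum_{n\ge 1}\sum_{r\ge 0}\frac{q^{n^2+3r^2-3}(q^3;q^3)_{n-r-1}(q^{3r}+q^{6r+3}-1)}{(q;q)_{2n-1}(q^3;q^3)_r(q;q)_{n-3r}}=\frac{(q^9,q^{24},q^{33};q^{33})_\infty}{(q;q)_\infty}$ 19. $\displaystyle 1+\sum_{n\ge 1}\sum_{r\ge 0}\frac{q^{n^2+3r^2+3r}(q^3;q^3)_{n-r-1}}{(q;q)_{2n-1}(q^3;q^3)_r(q;q)_{n-3r}}=\frac{(q^{12},q^{21},q^{33};q^{33})_\infty}{(q;q)_\infty}$ 20. $\displaystyle 1+\sum_{n\ge 1}\sum_{r\ge 0}\frac{q^{n^2+3r^2}(q^3;q^3)_{n-r-1}}{(q;q)_{2n-1}(q^3;q^3)_r(q;q)_{n-3r}}=\frac{(q^{15},q^{18},q^{33};q^{33})_\infty}{(q;q)_\infty}$ 21. $\displaystyle 1+\sum_{m\ge 1}\sum_{r\ge 0}\frac{(-1)^{m+r}q^{m^2+m+r^2+r-2mr}(q^4;q^4)_{m+r-1}(-1;q)_{2m}}{(q;q)_{4m-1}(q;q)_{2r}(q^2;q^2)_{m-r}}+\sum_{m\ge 0}\sum_{r\ge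 0}\frac{(-1)^{m+r}q^{m^2+m+r^2+r-2mr+1}(q^4;q^4)_{m+r}(-1;q)_{2m+1}}{(q;q)_{4m+1}(q;q)_{2r+1}(q^2;q^2)_{m-r}}=\frac{(q^{18},q^{18},q^{36};q^{36})_\infty(-q;q)_\infty}{(q;q)_\infty}$ 22. $\displaystyle 1+\sum_{n\ge 1}\sum_{r\ge 0}\frac{q^{n^2+6r^2-6}(-q;q^2)_n(q^6;q^6)_{n-r-1}(q^{6r}+q^{12r+6}-1)}{(q^2;q^2)_{2n-1}(q^6;q^6)_r(q^2;q^2)_{n-3r}}=\frac{(q^9,q^{39},q^{48};q^{48})_\infty(-q;q^2)_\infty}{(q^2;q^2)_\infty}$ 23. $\displaystyle 1+\sum_{n\ge 1}\sum_{r\ge 0}\frac{q^{n^2+6r^2+6r}(-q;q^2)_n(q^6;q^6)_{n-r-1}}{(q^2;q^2)_{2n-1}(q^6;q^6)_r(q^2;q^2)_{n-3r}}=\frac{(q^{15},q^{33},q^{48};q^{48})_\infty(-q;q^2)_\infty}{(q^2;q^2)_\infty}$ 24. $\displaystyle 1+\sum_{n\ge 1}\sum_{r\ge 0}\frac{q^{n^2+6r^2}(-q;q^2)_n(q^6;q^6)_{n-r-1}}{(q^2;q^2)_{2n-1}(q^6;q^6)_r(q^2;q^2)_{n-3r}}=\frac{(q^{21},q^{27},q^{48};q^{48})_\infty(-q;q^2)_\infty}{(q^2;q^2)_\infty}$ 25. $\displaystyle 1+\sum_{m\ge 1}\sum_{r\ge 0}\frac{(-1)^{m+r}q^{3m^2+r^2+r-2mr}(q^4;q^4)_{m+r-1}}{(q;q)_{4m-1}(q;q)_{2r}(q^2;q^2)_{m-r}}+\sum_{m\ge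 0}\sum_{r\ge 0}\frac{(-1)^{m+r}q^{3m^2+2m+r^2+r-2mr+1}(q^4;q^4)_{m+r}}{(q;q)_{4m+1}(q;q)_{2r+1}(q^2;q^2)_{m-r}}=\frac{(q^{24},q^{28},q^{52};q^{52})_\infty}{(q;q)_\infty}$ 26. $\displaystyle 1+\sum_{m\ge 1}\sum_{r\ge 0}\frac{(-1)^{m+r}q^{2m^2+2r^2+2r-4mr}(q^8;q^8)_{m+r-1}(-q;q^2)_{2m}}{(q^2;q^2)_{4m-1}(q^2;q^2)_{2r}(q^4;q^4)_{m-r}}+\sum_{m\ge 0}\sum_{r\ge 0}\frac{(-1)^{m+r}q^{2m^2+2r^2+2r-4mr+1}(q^8;q^8)_{m+r}(-q;q^2)_{2m+1}}{(q^2;q^2)_{4m+1}(q^2;q^2)_{2r+1}(q^4;q^4)_{m-r}}=\frac{(q^{32},q^{40},q^{72};q^{72})_\infty(-q;q^2)_\infty}{(q^2;q^2)_\infty}$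
   Context: $(x;q)_m=\prod_{j=0}^{m-1}(1-xq^j)$, $(x;q)_\infty=\prod_{j=0}^\infty(1-xq^j)$, and $(x_1,\dots,x_p;q)_\infty=(x_1;q)_\infty\cdots(x_p;q)_\infty$; the same notation is used with $q$ replaced by a power of $q$. By convention the reciprocal of a factor $(q^s;q^s)_m$ with $m<0$ is $0$, and any term containing such a denominator factor is $0$; so only terms with $n\ge 2r$ (resp. $n\ge 3r$, $m\ge r$), according to the denominator factor with index $n-2r$ (resp. $n-3r$, $m-r$), contribute. *)

theory Defs
  imports "HOL-Analysis.Analysis"
begin

definition qpoch :: "complex \<Rightarrow> complex \<Rightarrow> nat \<Rightarrow> complex" where
  "qpoch x q m = (\<Prod>j<m. 1 - x * q ^ j)"

definition qpoch_inf :: "complex list \<Rightarrow> complex \<Rightarrow> complex" where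
  "qpoch_inf xs q = (\<Prod>x\<leftarrow>xs. prodinf (\<lambda>j. 1 - x * q ^ j))"

text \<open>
  The reciprocal of \<open>(b;b)\<^sub>m\<close> for an integer index \<open>m\<close>, by convention \<open>0\<close> if \<open>m < 0\<close>.
  A term containing such a factor of negative index is therefore \<open>0\<close>, whatever the values of
  its other factors (a natural subtraction in the index of a numerator factor, or a negative
  power of \<open>q\<close>).
\<close>

definition qpoch_recip :: "complex \<Rightarrow> int \<Rightarrow> complex" where
  "qpoch_recip b m = (if m < 0 then 0 else 1 / qpoch b b (nat m))"

end

(* Expand the inner sum of each identity by a finite Bailey pair,
     b_r = sum_k (-1)^k f_k / ((Q;Q)_{r-k} (Q;Q)_{r+k+s}),   Q = q^L,  s = 0 or 1,
   with f_k a Gaussian q^(quadratic in k).  A "dilation" identity collapses the sum over r,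
     sum_r d(n,r) / ((Q;Q)_{r-k} (Q;Q)_{r+k+s}) = Q^(k^2+sk) / ((q;q)_{n-Lk} (q;q)_{n+Lk+Ls}),
   for L = 2 (quadratic) and L = 3 (cubic); for L = 4 the pair and the dilation are merged into one
   identity.  Absolute convergence then allows the sum over n to be done first.  For each of the weights
   q^(n^2+Ln s), q^(n(n+1)/2) (-1;q)_n and q^(n^2) (-q;q^2)_n it is a limiting case of the q-Gauss sum,
   and it contributes one more Gaussian factor.  What is left is a bilateral theta series, which the
   Jacobi triple product evaluates.  Half-integral exponents are handled by a square root h of q. *)
theory Submission
  imports Defs
begin

text \<open>The finite identities rest on one fact: with 1/(q;q)_m = 0 for m < 0, the rule
  1/(q;q)_{m-1} = (1 - q^m)/(q;q)_m holds for every integer m. Neighbouring reciprocals are then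
  polynomial multiples of a common one, edges of the range included, so each identity reduces to a
  recurrence whose telescoping certificate is checked by polynomial algebra. In classical terms the
  quadratic dilation is a q-Chu-Vandermonde sum in base q^2, the cubic one a q-Pfaff-Saalschuetz sum
  in base q^3. The pairs with negative quadratic exponent are images of the others under q -> 1/q;
  their b_r grow like Q^(-r^2/2), which is why only Q^(r^2+sr) b_r is required to be bounded. The
  weight with (-1;q)_n leaves a denominator 1 + q^(Lk), which cancels once f is averaged over k and
  -k. Identity 1, whose weight is effectively q^(n^2-n), has its own argument: the growth of its
  factors is controlled jointly, and it yields two theta series, one of which is 0 by
  antisymmetry.\<close>

text \<open>The condition for the purely algebraic part: every (q;q)_n is invertible and integer
  powers of q add. The finite identities hold for such q also outside the unit disc.\<close>

definition generic_base :: "complex \<Rightarrow> bool" where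
  "generic_base q \<longleftrightarrow> q \<noteq> 0 \<and> (\<forall>n>0. q ^ n \<noteq> 1)"

lemma generic_base_nonzero: "generic_base q \<Longrightarrow> q \<noteq> 0"
  by (simp add: generic_base_def)

lemma generic_base_power: "generic_base q \<Longrightarrow> k > 0 \<Longrightarrow> generic_base (q ^ k)"
  by (simp add: generic_base_def flip: power_mult)

lemma generic_base_unit_disc: "q \<noteq> 0 \<Longrightarrow> norm q < 1 \<Longrightarrow> generic_base q"
  unfolding generic_base_def
  by (metis norm_one norm_power power_less_one_iff norm_ge_zero less_irrefl)

section \<open>q-shifted factorials and their reciprocals with integer index\<close>

lemma qpoch_0 [simp]: "qpoch x q 0 = 1"
  by (simp add: qpoch_def)

lemma qpoch_Suc: "qpoch x q (Suc n) = qpoch x q n * (1 - x * q ^ n)"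
  by (simp add: qpoch_def)

lemma qpoch_self_Suc: "qpoch q q (Suc n) = qpoch q q n * (1 - q ^ Suc n)"
  by (simp add: qpoch_def)

lemma qpoch_self_nonzero: "generic_base q \<Longrightarrow> qpoch q q n \<noteq> 0"
  by (simp add: qpoch_def generic_base_def flip: power_Suc)

lemma qpoch_recip_neg [simp]: "m < 0 \<Longrightarrow> qpoch_recip q m = 0"
  by (simp add: qpoch_recip_def)

lemma qpoch_recip_of_nat [simp]: "qpoch_recip q (int n) = 1 / qpoch q q n"
  by (simp add: qpoch_recip_def)

lemma qpoch_recip_0 [simp]: "qpoch_recip q 0 = 1"
  by (simp add: qpoch_recip_def)

text \<open>At m = 0 the factor 1 - q^0 is 0, which is exactly the conventional value at index -1;
  for m < 0 both sides are 0. Hence no lower bound on m.\<close>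

lemma qpoch_recip_pred:
  assumes "generic_base q"
  shows "qpoch_recip q (m - 1) = (1 - q powi m) * qpoch_recip q m"
proof (cases "m \<le> 0")
  case True
  then show ?thesis by (cases "m = 0") auto
next
  case False
  then obtain n where n: "m = int (Suc n)"
    by (metis not_le pos_int_cases gr0_implies_Suc)
  have "1 - q ^ Suc n \<noteq> 0"
    using assms by (auto simp: generic_base_def simp del: power_Suc)
  then show ?thesis
    unfolding n using qpoch_self_nonzero[OF assms]
    by (simp add: qpoch_self_Suc field_simps del: power_Suc of_nat_Suc flip: power_int_of_nat)
       (simp add: algebra_simps)
qed

text \<open>Form for rewriting: the index and the power are given up to provable equality, so that
  the power can be a monomial in local abbreviations and \<open>algebra\<close> meets polynomials
  only.\<close>

lemma qpoch_recip_eq_pred: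
  assumes "generic_base q" "m' = m - 1" "x = q powi m"
  shows "qpoch_recip q m' = (1 - x) * qpoch_recip q m"
  using qpoch_recip_pred[OF assms(1), of m] assms(2,3) by simp

lemma qpoch_mult_recip_Suc:
  assumes "generic_base q" "m \<ge> 1" "k = int m"
  shows "qpoch q q (m - 1) * qpoch_recip q k = 1 / (1 - q ^ m)"
proof -
  obtain n where "m = Suc n" using assms(2) by (cases m) auto
  then show ?thesis using qpoch_self_nonzero[OF assms(1), of n]
    by (simp add: assms(3) qpoch_self_Suc del: power_Suc of_nat_Suc)
qed

lemma cancel_two_factors: "a * b * x = a * b * y \<Longrightarrow> a \<noteq> 0 \<Longrightarrow> b \<noteq> 0 \<Longrightarrow> x = y" for a b :: complex
  by simp

lemma powi_mult: "x \<noteq> 0 \<Longrightarrow> x powi a * x powi b = x powi (a + b)" for x :: complex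
  by (simp add: power_int_add)

lemma minus_one_powi_succ: "(-1 :: complex) powi (k + 1) = - ((-1) powi k)"
  by (simp add: power_int_add)

lemma minus_one_powi_pred: "(-1 :: complex) powi (k - 1) = - ((-1) powi k)"
  using minus_one_powi_succ[of "k - 1"] by simp

lemma sum_nat_telescope: "(\<Sum>j\<le>J. G (Suc j) - G j) = G (Suc J) - (G 0 :: complex)"
  by (induction J) auto

text \<open>In the applications \<open>G\<close> is a certificate that contains a reciprocal of
  negative index at both ends of the range.\<close>

lemma sum_int_telescope_zero:
  fixes F G :: "int \<Rightarrow> complex"
  assumes "\<And>k. F k = G k - G (k - 1)" "G b = 0" "G (a - 1) = 0"
  shows "(\<Sum>k=a..b. F k) = 0"
proof -
  have *: "(\<Sum>k=a..a + int n - 1. F k) = G (a + int n - 1) - G (a - 1)" for n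
  proof (induction n)
    case (Suc n)
    have "{a..a + int (Suc n) - 1} = insert (a + int n) {a..a + int n - 1}" by auto
    then show ?case using Suc assms(1)[of "a + int n"] by simp
  qed simp
  show ?thesis
  proof (cases "a \<le> b")
    case True
    then show ?thesis using *[of "nat (b - a + 1)"] assms by simp
  qed simp
qed

lemma sum_int_reflect: "(\<Sum>k=-R..R. f (- k)) = (\<Sum>k=-R..R. f k)" for R :: int
  by (rule sum.reindex_bij_witness[of _ uminus uminus]) auto

subsection \<open>Quadratic and cubic dilation\<close>

lemma qpoch_self_double: "qpoch q q (2 * c) = qpoch q (q^2) c * qpoch (q^2) (q^2) c"
proof (induction c)
  case (Suc c)
  have "(q^2) ^ c = q ^ (2 * c)" by (simp flip: power_mult)
  then show ?case using Suc
    by (simp add: qpoch_Suc power2_eq_square mult_ac)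
qed simp

text \<open>This is the dilation identity for k = K >= 0 after the shift r = K + j, with M = n - 2K
  and c = 2K + s. As (q;q)_{M-2j} splits into two factorials in base q^2, it is a q-Chu-Vandermonde
  sum; the proof is a first-order recurrence in M. The bound J does not depend on M, so that both
  sums in the recurrence run over the same range.\<close>

lemma quadratic_dilation_aux:
  assumes gen: "generic_base q" and "M \<le> 2 * J"
  shows "(\<Sum>j\<le>J. q powi (2 * int j^2 + 2 * int c * int j) * qpoch_recip q (int M - 2 * int j)
            * qpoch_recip (q^2) (int j) * qpoch_recip (q^2) (int j + int c))
         = qpoch q (q^2) (M + c) * qpoch_recip q (int M) * qpoch_recip q (int M + 2 * int c)"
    (is "(\<Sum>j\<le>J. ?t M j) = ?R M")
  using assms(2)
proof (induction M)
  case 0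
  have q0: "q \<noteq> 0" using gen by (rule generic_base_nonzero)
  have gen2: "generic_base (q^2)" using gen by (simp add: generic_base_power)
  have "(\<Sum>j\<le>J. ?t 0 j) = (\<Sum>j\<in>{0}. ?t 0 j)"
    by (rule sum.mono_neutral_right) auto
  moreover have "qpoch_recip q (2 * int c) = 1 / (qpoch q (q^2) c * qpoch (q^2) (q^2) c)"
    using qpoch_recip_of_nat[of q "2 * c"] by (simp add: qpoch_self_double)
  moreover have "qpoch q (q^2) c \<noteq> 0"
    using qpoch_self_double[of q c] qpoch_self_nonzero[OF gen, of "2 * c"] by auto
  ultimately show ?case by simp
next
  case (Suc M)
  have q0: "q \<noteq> 0" using gen by (rule generic_base_nonzero)
  have gen2: "generic_base (q^2)" using gen by (simp add: generic_base_power)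
  define x where "x = q powi int M"
  define C where "C = q powi (2 * int c)"
  \<comment> \<open>Telescoping certificate, a multiple of the summand for M + 1. It is 0 at j = 0
    because of the factor 1 - q^0, and 0 at j = J + 1 because M + 1 - 2j is negative there.\<close>
  define G where "G j = - x * q * (1 / q powi (2 * int j)) * (1 - q powi (2 * int j)) * (1 - q powi (2 * int j) * C) * ?t (Suc M) j" for j
  have step: "(1 - x * q) * (1 - x * q * C) * ?t (Suc M) j - (1 - x^2 * q * C) * ?t M j = G (Suc j) - G j" for j
  proof -
    define u where "u = q powi (2 * int j)"
    define v where "v = 1 / u"
    have uv: "u * v = 1" using q0 by (simp add: u_def v_def)
    have sqi: "q powi (2 * int (Suc j)) = u * q^2"
      using q0 by (simp add: u_def power_int_add algebra_simps power2_eq_square)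
    have v': "1 / (u * q^2) = v * (1/q^2)" by (simp add: v_def)
    define z where "z = 1/q^2"
    have z: "z * q^2 = 1" using q0 by (simp add: z_def)
    have e: "q powi (2 * int (Suc j)^2 + 2 * int c * int (Suc j))
      = q powi (2 * int j^2 + 2 * int c * int j) * (u^2 * q^2 * C)"
      using q0 by (simp add: u_def C_def power_int_add algebra_simps power2_eq_square power4_eq_xxxx power_int_mult)
    have r1: "qpoch_recip q (int M - 2 * int j) = (1 - x * q * v) * qpoch_recip q (int (Suc M) - 2 * int j)"
      by (rule qpoch_recip_eq_pred[OF gen]) (use q0 in \<open>simp_all add: x_def v_def u_def power_int_add power_int_diff\<close>)
    have r2: "qpoch_recip q (int (Suc M) - 2 * int (Suc j)) = (1 - x * v) * qpoch_recip q (int M - 2 * int j)"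
      by (rule qpoch_recip_eq_pred[OF gen]) (use q0 in \<open>simp_all add: x_def v_def u_def power_int_add power_int_diff\<close>)
    have r3: "qpoch_recip (q^2) (int j) = (1 - u * q^2) * qpoch_recip (q^2) (int (Suc j))"
      by (rule qpoch_recip_eq_pred[OF gen2]) (use q0 in \<open>simp_all add: sqi[symmetric] power_int_power\<close>)
    have r4: "qpoch_recip (q^2) (int j + int c) = (1 - u * q^2 * C) * qpoch_recip (q^2) (int (Suc j) + int c)"
      by (rule qpoch_recip_eq_pred[OF gen2])
         (use q0 in \<open>simp_all add: u_def C_def power_int_add power_int_power power_int_mult algebra_simps power2_eq_square\<close>)
    \<comment> \<open>Every reciprocal is now a multiple of those with index M + 1 - 2j, j + 1 and j
      + 1 + c. What remains is polynomial in x, C, u, v, q, z modulo u v = 1 and z q^2 = 1.\<close>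
    show ?thesis
      unfolding G_def e r2 unfolding r1 sqi v' u_def[symmetric] v_def[symmetric] z_def[symmetric]
      unfolding r3 r4
      using uv z by algebra
  qed
  have "(1 - x * q) * (1 - x * q * C) * (\<Sum>j\<le>J. ?t (Suc M) j) - (1 - x^2 * q * C) * (\<Sum>j\<le>J. ?t M j) = (\<Sum>j\<le>J. G (Suc j) - G j)"
    unfolding step[symmetric] by (simp add: sum_subtractf sum_distrib_left)
  also have "\<dots> = G (Suc J) - G 0"
    by (rule sum_nat_telescope)
  also have "\<dots> = 0" using Suc.prems by (simp add: G_def)
  finally have rec: "(1 - x * q) * (1 - x * q * C) * (\<Sum>j\<le>J. ?t (Suc M) j) = (1 - x^2 * q * C) * ?R M"
    using Suc by simp
  have nz: "1 - x * q \<noteq> 0" "1 - x * q * C \<noteq> 0"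
  proof -
    have "x * q = q ^ Suc M" "x * q * C = q ^ (Suc M + 2 * c)"
      by (simp_all add: x_def C_def power_int_mult power_add power_mult)
    then show "1 - x * q \<noteq> 0" "1 - x * q * C \<noteq> 0"
      using gen unfolding generic_base_def by (metis right_minus_eq zero_less_Suc add_gr_0)+
  qed
  have a1: "qpoch_recip q (int M) = (1 - x * q) * qpoch_recip q (int (Suc M))"
    by (rule qpoch_recip_eq_pred[OF gen]) (use q0 in \<open>simp_all add: x_def power_int_add\<close>)
  have a2: "qpoch_recip q (int M + 2 * int c) = (1 - x * q * C) * qpoch_recip q (int (Suc M) + 2 * int c)"
    by (rule qpoch_recip_eq_pred[OF gen]) (use q0 in \<open>simp_all add: x_def C_def power_int_add\<close>)
  have a3: "qpoch q (q^2) (Suc M + c) = qpoch q (q^2) (M + c) * (1 - x^2 * q * C)"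
    by (simp add: qpoch_Suc x_def C_def power_add power_mult power_int_mult power_int_power flip: power_mult)
       (simp add: mult.commute)
  have "(1 - x * q) * (1 - x * q * C) * (\<Sum>j\<le>J. ?t (Suc M) j) = (1 - x * q) * (1 - x * q * C) * ?R (Suc M)"
    unfolding rec a1 a2 a3 by (simp add: algebra_simps)
  then show ?case using nz by (rule cancel_two_factors)
qed

lemma qpoch_power_Suc:
  "qpoch (q^d) (q^d) (Suc n) = qpoch (q^d) (q^d) n * (1 - q powi (int d * int n + int d))"
  if "q \<noteq> 0"
  using that by (simp add: qpoch_Suc power_int_add power_int_mult mult.commute power_int_power flip: power_mult)

text \<open>Here (q;q)_{M-3j} splits into three factorials in base q^3, and the numerator
  contributes a lower parameter that makes the series balanced: a q-Pfaff-Saalschuetz sum. The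
  method is that of \<open>quadratic_dilation_aux\<close>, with M = n - 3K and c = 2K + s.\<close>

lemma cubic_dilation_aux:
  assumes gen: "generic_base q" and "M + c \<ge> 1" and "M \<le> 3 * J"
  shows "(\<Sum>j\<le>J. q powi (3 * int j^2 + 3 * int c * int j) * qpoch (q^3) (q^3) (M + c - j - 1)
            * qpoch_recip q (int M - 3 * int j) * qpoch_recip (q^3) (int j) * qpoch_recip (q^3) (int j + int c))
         = qpoch q q (2 * M + 3 * c - 1) * qpoch_recip q (int M) * qpoch_recip q (int M + 3 * int c)"
    (is "(\<Sum>j\<le>J. ?t M j) = ?R M")
proof -
  have q0: "q \<noteq> 0" using gen by (rule generic_base_nonzero)
  have gen3: "generic_base (q^3)" using gen by (simp add: generic_base_power)
  define C where "C = q powi (3 * int c)"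
  have rec: "(1 - q powi (int M + 1)) * (1 - q powi (int M + 1) * C) * (\<Sum>j\<le>J. ?t (Suc M) j)
      = (1 - (q powi int M)^2 * C) * (1 - (q powi int M)^2 * q * C) * (\<Sum>j\<le>J. ?t M j)"
    if Mc: "M + c \<ge> 1" and J: "Suc M \<le> 3 * J" for M
  proof -
    define x where "x = q powi int M"
    define G where "G j = - x * q * (1 / q powi (3 * int j)) * (1 - q powi (3 * int j)) * (1 - q powi (3 * int j) * C) * ?t (Suc M) j" for j
    have step: "(1 - x * q) * (1 - x * q * C) * ?t (Suc M) j - (1 - x^2 * C) * (1 - x^2 * q * C) * ?t M j = G (Suc j) - G j" for j
    \<comment> \<open>\<open>M + c - j - 1\<close> is a truncated difference. For 3j <= M + 1 and M
      + c >= 1 it behaves as a true one; for larger j all four terms of the relation vanish.\<close>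
    proof (cases "int (Suc M) - 3 * int j < 0")
      case True
      then show ?thesis by (simp add: G_def)
    next
      case False
      define u where "u = q powi (3 * int j)"
      define v where "v = 1 / u"
      have uv: "u * v = 1" using q0 by (simp add: u_def v_def)
      have sqi: "q powi (3 * int (Suc j)) = u * q^3"
        using q0 by (simp add: u_def power_int_add algebra_simps power3_eq_cube)
      define z where "z = 1/q"
      have z: "z * q = 1" using q0 by (simp add: z_def)
      have v': "1 / (u * q^3) = v * z^3" by (simp add: v_def z_def power_divide)
      have e: "q powi (3 * int (Suc j)^2 + 3 * int c * int (Suc j))
        = q powi (3 * int j^2 + 3 * int c * int j) * (u^2 * q^3 * C)"
        using q0 by (simp add: u_def C_def power_int_add algebra_simps power2_eq_square power3_eq_cube power_int_mult eval_nat_numeral)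
      have r1: "qpoch_recip q (int M - 3 * int j) = (1 - x * q * v) * qpoch_recip q (int (Suc M) - 3 * int j)"
        by (rule qpoch_recip_eq_pred[OF gen]) (use q0 in \<open>simp_all add: x_def v_def u_def power_int_add power_int_diff\<close>)
      have r2: "qpoch_recip q (int M - 3 * int j - 1) = (1 - x * v) * qpoch_recip q (int M - 3 * int j)"
        by (rule qpoch_recip_eq_pred[OF gen]) (use q0 in \<open>simp_all add: x_def v_def u_def power_int_add power_int_diff\<close>)
      have r2': "qpoch_recip q (int (Suc M) - 3 * int (Suc j)) = (1 - x * v * z) * qpoch_recip q (int M - 3 * int j - 1)"
        by (rule qpoch_recip_eq_pred[OF gen]) (use q0 in \<open>simp_all add: x_def v_def u_def z_def power_int_add power_int_diff\<close>)
      have r3: "qpoch_recip (q^3) (int j) = (1 - u * q^3) * qpoch_recip (q^3) (int (Suc j))"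
        by (rule qpoch_recip_eq_pred[OF gen3]) (use q0 in \<open>simp_all add: sqi[symmetric] power_int_power\<close>)
      have r4: "qpoch_recip (q^3) (int j + int c) = (1 - u * q^3 * C) * qpoch_recip (q^3) (int (Suc j) + int c)"
        by (rule qpoch_recip_eq_pred[OF gen3])
           (use q0 in \<open>simp_all add: u_def C_def power_int_add power_int_power power_int_mult algebra_simps power3_eq_cube\<close>)
      have p1: "qpoch (q^3) (q^3) (Suc M + c - j - 1) = qpoch (q^3) (q^3) (M + c - j - 1) * (1 - x^3 * C * v)"
      proof -
        have "Suc M + c - j - 1 = Suc (M + c - j - 1)" using False Mc by linarith
        moreover have "q powi (3 * int (M + c - j - 1) + 3) = x^3 * C * v"
        proof -
          have "3 * int (M + c - j - 1) + 3 = 3 * int M + 3 * int c - 3 * int j" using False Mc by linarith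
          moreover have "q powi (3 * int M) = x^3" unfolding x_def power_int_power' by (simp add: mult.commute del: power_int_of_nat)
          ultimately show ?thesis using q0 by (simp add: power_int_add power_int_diff v_def u_def C_def)
        qed
        ultimately show ?thesis using qpoch_power_Suc[OF q0, of 3 "M + c - j - 1"] by simp
      qed
      have p2: "Suc M + c - Suc j - 1 = M + c - j - 1" by simp
      show ?thesis
        unfolding G_def e r2' r2 sqi v' p2 unfolding r1 p1 u_def[symmetric] v_def[symmetric]
        unfolding r3 r4
        using uv z by algebra
    qed
    have "(1 - x * q) * (1 - x * q * C) * (\<Sum>j\<le>J. ?t (Suc M) j) - (1 - x^2 * C) * (1 - x^2 * q * C) * (\<Sum>j\<le>J. ?t M j) = (\<Sum>j\<le>J. G (Suc j) - G j)"
      unfolding step[symmetric] by (simp add: sum_subtractf sum_distrib_left)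
    also have "\<dots> = G (Suc J) - G 0"
      by (rule sum_nat_telescope)
    also have "\<dots> = 0" using J by (simp add: G_def)
    finally show ?thesis using q0 by (simp add: x_def power_int_add)
  qed
  have nz: "1 - q powi (int M + 1) \<noteq> 0" "1 - q powi (int M + 1) * C \<noteq> 0" for M
  proof -
    have "q powi (int M + 1) = q ^ Suc M" "q powi (int M + 1) * C = q ^ (Suc M + 3 * c)"
      using q0 by (simp_all add: C_def power_int_mult power_add power_mult power_int_add)
    then show "1 - q powi (int M + 1) \<noteq> 0" "1 - q powi (int M + 1) * C \<noteq> 0"
      using gen unfolding generic_base_def by (metis right_minus_eq zero_less_Suc add_gr_0)+
  qed
  have Rrec: "(1 - q powi (int M + 1)) * (1 - q powi (int M + 1) * C) * ?R (Suc M) =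
     (1 - (q powi int M)^2 * C) * (1 - (q powi int M)^2 * q * C) * ?R M" if "M + c \<ge> 1" for M
  proof -
    have a1: "qpoch_recip q (int M) = (1 - q powi (int M + 1)) * qpoch_recip q (int (Suc M))"
      by (rule qpoch_recip_eq_pred[OF gen]) (use q0 in \<open>simp_all add: power_int_add\<close>)
    have a2: "qpoch_recip q (int M + 3 * int c) = (1 - q powi (int M + 1) * C) * qpoch_recip q (int (Suc M) + 3 * int c)"
      by (rule qpoch_recip_eq_pred[OF gen]) (use q0 in \<open>simp_all add: C_def power_int_add\<close>)
    have "2 * Suc M + 3 * c - 1 = Suc (Suc (2 * M + 3 * c - 1))" using that by arith
    then have a3: "qpoch q q (2 * Suc M + 3 * c - 1) = qpoch q q (2 * M + 3 * c - 1) * (1 - q ^ Suc (2 * M + 3 * c - 1)) * (1 - q ^ Suc (Suc (2 * M + 3 * c - 1)))"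
      by (simp only: qpoch_self_Suc)
    have "Suc (2 * M + 3 * c - 1) = 2 * M + 3 * c" using that by linarith
    moreover have "q ^ (2 * M + 3 * c) = (q powi int M)^2 * C"
      by (simp add: C_def power_add power_mult power_int_mult mult.commute flip: power_mult)
    ultimately show ?thesis unfolding a1 a2 a3 by (simp add: mult_ac)
  qed
  show ?thesis
  \<comment> \<open>The recurrence is false at M = c = 0, where its right side has the factor 1 - 1.
    For c = 0 the induction therefore starts at M = 1.\<close>
  proof (cases "c = 0")
    case False
    from assms(3) show ?thesis
    proof (induction M)
      case 0
      have "(\<Sum>j\<le>J. ?t 0 j) = (\<Sum>j\<in>{0}. ?t 0 j)"
        by (rule sum.mono_neutral_right) auto
      moreover have "qpoch (q^3) (q^3) (c - 1) * qpoch_recip (q^3) (int c) = 1 / (1 - q ^ (3 * c))"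
        using False qpoch_mult_recip_Suc[OF gen3, of c] by (simp flip: power_mult)
      moreover have "qpoch q q (3 * c - 1) * qpoch_recip q (3 * int c) = 1 / (1 - q ^ (3 * c))"
        using False by (intro qpoch_mult_recip_Suc[OF gen]) auto
      ultimately show ?case by simp
    next
      case (Suc M)
      have "M + c \<ge> 1" using False by simp
      from rec[OF this Suc.prems] have "(1 - q powi (int M + 1)) * (1 - q powi (int M + 1) * C) * (\<Sum>j\<le>J. ?t (Suc M) j)
          = (1 - q powi (int M + 1)) * (1 - q powi (int M + 1) * C) * ?R (Suc M)"
        unfolding Rrec[OF \<open>M + c \<ge> 1\<close>] by (simp only: Suc.IH[OF Suc_leD[OF Suc.prems]])
      then show ?case using nz by (rule cancel_two_factors)
    qed
  next
    case True
    then have "M \<ge> 1" using assms(2) by simp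
    from this assms(3) show ?thesis
    proof (induction M rule: dec_induct)
      case base
      have "(\<Sum>j\<le>J. ?t 1 j) = (\<Sum>j\<in>{0}. ?t 1 j)"
        by (rule sum.mono_neutral_right) auto
      then show ?case using True qpoch_self_nonzero[OF gen, of 1]
        by (simp add: qpoch_recip_def qpoch_def)
    next
      case (step M)
      have "M + c \<ge> 1" using step by simp
      from rec[OF this step.prems] have "(1 - q powi (int M + 1)) * (1 - q powi (int M + 1) * C) * (\<Sum>j\<le>J. ?t (Suc M) j)
          = (1 - q powi (int M + 1)) * (1 - q powi (int M + 1) * C) * ?R (Suc M)"
        unfolding Rrec[OF \<open>M + c \<ge> 1\<close>] by (simp only: step.IH[OF Suc_leD[OF step.prems]])
      then show ?case using nz by (rule cancel_two_factors)
    qed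
  qed
qed

subsection \<open>Finite Bailey pairs\<close>

text \<open>The Bailey transform relative to a = q^s, up to normalisation, in bilateral form: the
  entries k and -s-k, usually combined, are separate terms. Every R >= n gives the same value; a
  free R lets sums for different n share a range, and the range is invariant under k ->
  -s-k.\<close>

definition bailey_sum :: "int \<Rightarrow> complex \<Rightarrow> int \<Rightarrow> nat \<Rightarrow> (int \<Rightarrow> complex) \<Rightarrow> complex" where
  "bailey_sum s q R n f =
     (\<Sum>k=-R-s..R. (-1) powi k * f k * (qpoch_recip q (int n - k) * qpoch_recip q (int n + k + s)))"

lemma bailey_sum_add: "bailey_sum s q R n (\<lambda>k. f k + g k) = bailey_sum s q R n f + bailey_sum s q R n g"
  and bailey_sum_diff: "bailey_sum s q R n (\<lambda>k. f k - g k) = bailey_sum s q R n f - bailey_sum s q R n g"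
  and bailey_sum_cmult: "bailey_sum s q R n (\<lambda>k. c * f k) = c * bailey_sum s q R n f"
  by (simp_all add: bailey_sum_def algebra_simps sum.distrib sum_subtractf sum_distrib_left)

text \<open>The substitution k -> -s-k exchanges the two reciprocals and preserves the range, so
  that only the sign (-1)^k is affected.\<close>

lemma bailey_sum_reflect:
  "bailey_sum s q R n (\<lambda>k. f (- s - k)) = (-1) powi s * bailey_sum s q R n f"
  unfolding bailey_sum_def sum_distrib_left
proof (rule sum.reindex_bij_witness[of _ "\<lambda>k. - s - k" "\<lambda>k. - s - k"], goal_cases)
  case (5 k)
  have "(-1 :: complex) powi s * (-1) powi (- s - k) = (-1) powi k"
    by (simp add: power_int_minus_one_minus flip: power_int_add)
  then show ?case
    by (simp add: algebra_simps)
qed auto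

lemma bailey_sum_reflect_even:
  assumes "\<And>k. g k = f (- k)"
  shows "bailey_sum 0 q R n g = bailey_sum 0 q R n f"
  using bailey_sum_reflect[of 0 q R n f] assms by (simp add: bailey_sum_def)

lemma bailey_sum_reflect_odd:
  assumes "\<And>k. g k = f (- 1 - k)"
  shows "bailey_sum 1 q R n g = - bailey_sum 1 q R n f"
  using bailey_sum_reflect[of 1 q R n f] assms by (simp add: bailey_sum_def)

text \<open>The factor 1 - q^(n-k) lowers (q;q)_{n-k} to (q;q)_{n-1-k}, after which the denominator
  is invariant under k -> -s-1-k and, by the symmetry of \<open>f\<close>, the terms cancel in
  pairs. As the range is not invariant under this reflection, the proof combines the shift k -> k-1,
  which telescopes, with the reflection k -> -s-k, which preserves the range, and obtains twice the
  sum.\<close>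

lemma bailey_sum_telescope:
  assumes gen: "generic_base q" and "int n \<le> R" and sym: "\<And>k. f (- s - 1 - k) = (-1) powi s * f k"
  shows "bailey_sum s q R n (\<lambda>k. f k * (1 - q ^ n * q powi (- k))) = 0"
proof -
  have q0: "q \<noteq> 0" using gen by (rule generic_base_nonzero)
  define G where "G k = (-1) powi k * f k * (qpoch_recip q (int n - 1 - k) * qpoch_recip q (int n + k + s))" for k
  define g where "g k = f k * (1 - q ^ n * q powi (- k))" for k
  have "(\<Sum>k=-R-s..R. (-1) powi k * (g k + f (k - 1) * (1 - q ^ n * q powi (k + s)))
           * (qpoch_recip q (int n - k) * qpoch_recip q (int n + k + s))) = 0"
  proof (rule sum_int_telescope_zero[where G = G])
    fix k
    have r1: "qpoch_recip q (int n - 1 - k) = (1 - q ^ n * q powi (- k)) * qpoch_recip q (int n - k)"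
      by (rule qpoch_recip_eq_pred[OF gen]) (use q0 in \<open>simp_all add: power_int_diff power_int_minus field_simps\<close>)
    have r2: "qpoch_recip q (int n + (k - 1) + s) = (1 - q ^ n * q powi (k + s)) * qpoch_recip q (int n + k + s)"
      by (rule qpoch_recip_eq_pred[OF gen]) (use q0 in \<open>simp_all add: power_int_add\<close>)
    have r3: "int n - 1 - (k - 1) = int n - k" by simp
    show "(-1) powi k * (g k + f (k - 1) * (1 - q ^ n * q powi (k + s)))
           * (qpoch_recip q (int n - k) * qpoch_recip q (int n + k + s)) = G k - G (k - 1)"
      unfolding G_def r1 r2 r3 minus_one_powi_pred g_def by (simp add: algebra_simps)
  qed (use assms(2) in \<open>auto simp: G_def\<close>)
  then have "bailey_sum s q R n (\<lambda>k. g k + f (k - 1) * (1 - q ^ n * q powi (k + s))) = 0"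
    by (simp add: bailey_sum_def)
  moreover have "f (k - 1) * (1 - q ^ n * q powi (k + s)) = (-1) powi s * g (- s - k)" for k
    using sym[of "- s - k"] by (simp add: g_def)
  ultimately have "bailey_sum s q R n g + (-1) powi s * ((-1) powi s * bailey_sum s q R n g) = 0"
    by (simp add: bailey_sum_add bailey_sum_cmult bailey_sum_reflect)
  then have "2 * bailey_sum s q R n g = 0" by simp
  then show ?thesis by (simp add: g_def[abs_def])
qed

text \<open>The inductive step for all pairs: with X = q^(n+1) the two factors expand to 1 + X^2 q^s
  - X q^(-k) - X q^(k+s), which only shifts the linear part of the Gaussian exponent of f.\<close>

lemma bailey_sum_Suc:
  assumes gen: "generic_base q"
  shows "bailey_sum s q R n f =
    bailey_sum s q R (Suc n) (\<lambda>k. f k * (1 - q ^ Suc n * q powi (- k)) * (1 - q ^ Suc n * q powi (k + s)))"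
  unfolding bailey_sum_def
proof (rule sum.cong, goal_cases)
  case (2 k)
  have q0: "q \<noteq> 0" using gen by (rule generic_base_nonzero)
  have r1: "qpoch_recip q (int n - k) = (1 - q ^ Suc n * q powi (- k)) * qpoch_recip q (int (Suc n) - k)"
    by (rule qpoch_recip_eq_pred[OF gen]) (use q0 in \<open>simp_all add: power_int_diff power_int_add power_int_minus field_simps\<close>)
  have r2: "qpoch_recip q (int n + k + s) = (1 - q ^ Suc n * q powi (k + s)) * qpoch_recip q (int (Suc n) + k + s)"
    by (rule qpoch_recip_eq_pred[OF gen]) (use q0 in \<open>simp_all add: power_int_add\<close>)
  show ?case unfolding r1 r2 by simp
qed simp

lemma bailey_sum_0_0:
  assumes "R \<ge> 0"
  shows "bailey_sum 0 q R 0 f = f 0"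
proof -
  have "bailey_sum 0 q R 0 f = (\<Sum>k\<in>{0}. (-1) powi k * f k * (qpoch_recip q (int 0 - k) * qpoch_recip q (int 0 + k + 0)))"
    unfolding bailey_sum_def using assms by (intro sum.mono_neutral_right) (auto simp: qpoch_recip_def split: if_splits)
  then show ?thesis by simp
qed

lemma bailey_sum_1_0:
  assumes "R \<ge> 0" "generic_base q"
  shows "bailey_sum 1 q R 0 f = (f 0 - f (-1)) / (1 - q)"
proof -
  have "bailey_sum 1 q R 0 f = (\<Sum>k\<in>{0,-1}. (-1) powi k * f k * (qpoch_recip q (int 0 - k) * qpoch_recip q (int 0 + k + 1)))"
    unfolding bailey_sum_def using assms by (intro sum.mono_neutral_right) (auto simp: qpoch_recip_def split: if_splits)
  then show ?thesis
    by (simp add: qpoch_recip_def qpoch_def diff_divide_distrib)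
qed

lemma bailey_sum_cong: "(\<And>k. f k = g k) \<Longrightarrow> bailey_sum s q R n f = bailey_sum s q R n g"
  by (simp add: bailey_sum_def)

lemma qpoch_recip_Suc_mult: "generic_base q \<Longrightarrow> (1 - q ^ Suc n) * qpoch_recip q (int (Suc n)) = qpoch_recip q (int n)"
  using qpoch_recip_eq_pred[of q "int n" "int (Suc n)" "q ^ Suc n"] by (simp flip: power_int_of_nat)

context
  fixes h q :: complex and R :: int
  assumes gen: "generic_base q" and hq: "q = h^2"
begin

lemma h0: "h \<noteq> 0" using gen hq by (auto simp: generic_base_def)

lemma q_powi_eq_h_powi: "q powi k = h powi (2 * k)" using h0 by (simp add: hq power_int_power)

lemma h_powi_mult: "h powi a * h powi b = h powi (a + b)" using h0 by (simp add: power_int_add)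

text \<open>The exponent 3k^2 + 3k is invariant under k -> -1-k, so
  \<open>bailey_sum_telescope\<close> applies; multiplication by q^(-k) lowers the linear
  coefficient from 3 to 1, exponents being those of h.\<close>

lemma pair_3:
  assumes "int n \<le> R"
  shows "bailey_sum 0 q R n (\<lambda>k. h powi (3*k^2 + 3*k)) = q ^ n * bailey_sum 0 q R n (\<lambda>k. h powi (3*k^2 + k))"
proof -
  have "bailey_sum 0 q R n (\<lambda>k. h powi (3*k^2 + 3*k) * (1 - q ^ n * q powi (- k))) = 0"
    by (rule bailey_sum_telescope[OF gen assms]) (simp add: algebra_simps power2_eq_square)
  moreover have "h powi (3*k^2 + 3*k) * (1 - q ^ n * q powi (- k)) = h powi (3*k^2 + 3*k) - q ^ n * h powi (3*k^2 + k)" for k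
  proof -
    have "h powi (3*k^2 + k) = h powi (3*k^2 + 3*k) * q powi (- k)" unfolding q_powi_eq_h_powi h_powi_mult
      by (rule arg_cong[where f="power_int h"], simp add: power2_eq_square algebra_simps)
    then show ?thesis by (simp add: algebra_simps)
  qed
  ultimately show ?thesis by (simp add: bailey_sum_diff bailey_sum_cmult)
qed

lemma bailey_sum_reflect_pair: "bailey_sum 0 q R n (\<lambda>k. h powi (3*k^2 - k)) = bailey_sum 0 q R n (\<lambda>k. h powi (3*k^2 + k))"
  by (rule bailey_sum_reflect_even) simp

lemma bailey_sum_reflect_dual_pair: "bailey_sum 0 q R n (\<lambda>k. h powi (-(k^2) + k)) = bailey_sum 0 q R n (\<lambda>k. h powi (-(k^2) - k))"
  by (rule bailey_sum_reflect_even) simp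

text \<open>Raising n produces the linear coefficients -1 and 3. The first reduces to 1 by
  reflection, the second by \<open>pair_3\<close> at the price of X = q^(n+1), and 1 + X^2 - X (1 +
  X) = 1 - X is the factor that separates 1/(q;q)_n from 1/(q;q)_{n+1}.\<close>

lemma pair_1:
  assumes "int n \<le> R"
  shows "bailey_sum 0 q R n (\<lambda>k. h powi (3*k^2 + k)) = qpoch_recip q (int n)"
  using assms
proof (induction n)
  case 0
  then show ?case by (simp add: bailey_sum_0_0)
next
  case (Suc n)
  define X where "X = q ^ Suc n"
  have *: "h powi (3*k^2 + k) * (1 - X * q powi (- k)) * (1 - X * q powi (k + 0))
     = (1 + X^2) * h powi (3*k^2 + k) - X * (h powi (3*k^2 - k) + h powi (3*k^2 + 3*k))" for k
  proof -
    have e: "h powi (3*k^2 - k) = h powi (3*k^2 + k) * q powi (- k)"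
         "h powi (3*k^2 + 3*k) = h powi (3*k^2 + k) * q powi k" unfolding q_powi_eq_h_powi h_powi_mult
      by (rule arg_cong[where f="power_int h"], simp add: power2_eq_square algebra_simps)+
    have "q powi k * q powi (- k) = 1" using h0 by (simp add: q_powi_eq_h_powi power_int_minus)
    then show ?thesis unfolding e by (simp, algebra)
  qed
  have "bailey_sum 0 q R n (\<lambda>k. h powi (3*k^2 + k)) =
     (1 + X^2) * bailey_sum 0 q R (Suc n) (\<lambda>k. h powi (3*k^2 + k))
      - X * (bailey_sum 0 q R (Suc n) (\<lambda>k. h powi (3*k^2 + k)) + X * bailey_sum 0 q R (Suc n) (\<lambda>k. h powi (3*k^2 + k)))"
    unfolding bailey_sum_Suc[OF gen, of 0 R n] X_def[symmetric] *
    unfolding bailey_sum_diff bailey_sum_cmult bailey_sum_add bailey_sum_reflect_pair pair_3[OF Suc.prems] X_def ..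
  also have "\<dots> = (1 - X) * bailey_sum 0 q R (Suc n) (\<lambda>k. h powi (3*k^2 + k))"
    by (simp add: algebra_simps power2_eq_square)
  finally have "(1 - X) * bailey_sum 0 q R (Suc n) (\<lambda>k. h powi (3*k^2 + k)) = qpoch_recip q (int n)"
    using Suc by simp
  moreover have "1 - X \<noteq> 0" unfolding X_def using gen by (simp add: generic_base_def del: power_Suc)
  ultimately show ?case using qpoch_recip_Suc_mult[OF gen, of n] X_def by (metis mult_cancel_left)
qed

text \<open>The exponents 3k^2 + 5k + 2 and 3k^2 + k are exchanged by k -> -1-k, so their sum is an
  admissible \<open>f\<close> for \<open>bailey_sum_telescope\<close>; the four resulting sums are
  known except for the one in question.\<close>

lemma pair_5:
  assumes "int n \<le> R"
  shows "q * bailey_sum 0 q R n (\<lambda>k. h powi (3*k^2 + 5*k)) = (q ^ (2 * n + 1) + q ^ n - 1) * qpoch_recip q (int n)"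
proof -
  have "bailey_sum 0 q R n (\<lambda>k. (h powi (3*k^2 + 5*k + 2) + h powi (3*k^2 + k)) * (1 - q ^ n * q powi (- k))) = 0"
    by (rule bailey_sum_telescope[OF gen assms]) (simp add: algebra_simps power2_eq_square)
  moreover have "(h powi (3*k^2 + 5*k + 2) + h powi (3*k^2 + k)) * (1 - q ^ n * q powi (- k)) =
      q * h powi (3*k^2 + 5*k) + h powi (3*k^2 + k) - q ^ n * (q * h powi (3*k^2 + 3*k) + h powi (3*k^2 - k))" for k
  proof -
    have e: "h powi (3*k^2 + 5*k + 2) = q * h powi (3*k^2 + 5*k)"
      using h0 by (simp add: power_int_add hq)
    have e2: "h powi (3*k^2 + 3*k) = h powi (3*k^2 + 5*k) * q powi (- k)"
      "h powi (3*k^2 - k) = h powi (3*k^2 + k) * q powi (- k)" unfolding q_powi_eq_h_powi h_powi_mult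
      by (rule arg_cong[where f="power_int h"], simp add: power2_eq_square algebra_simps)+
    show ?thesis unfolding e e2 by (simp add: algebra_simps)
  qed
  ultimately have rel: "q * bailey_sum 0 q R n (\<lambda>k. h powi (3*k^2 + 5*k)) + qpoch_recip q (int n)
     - q ^ n * (q * (q ^ n * qpoch_recip q (int n)) + qpoch_recip q (int n)) = 0"
    by (simp only: bailey_sum_diff bailey_sum_cmult bailey_sum_add bailey_sum_reflect_pair pair_3[OF assms] pair_1[OF assms])
  have "q ^ (2 * n + 1) = q * (q ^ n * q ^ n)" by (simp add: power_add mult_2)
  moreover have "q * S = (q * (X * X) + X - 1) * r" if "q * S + r - X * (q * (X * r) + r) = 0" for X S r
    using that by algebra
  ultimately show ?thesis using rel by metis
qed

lemma dual_pair_3: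
  assumes "int n \<le> R"
  shows "bailey_sum 0 q R n (\<lambda>k. h powi (-(k^2) - k)) = q ^ n * bailey_sum 0 q R n (\<lambda>k. h powi (-(k^2) - 3 * k))"
proof -
  have "bailey_sum 0 q R n (\<lambda>k. h powi (-(k^2) - k) * (1 - q ^ n * q powi (- k))) = 0"
  proof (rule bailey_sum_telescope[OF gen assms], goal_cases)
    case (1 k)
    have "-((- 0 - 1 - k)^2) - (- 0 - 1 - k) = -(k^2) - k" by (simp add: power2_eq_square algebra_simps)
    then show ?case by (simp only: power_int_0_right mult_1_left)
  qed
  moreover have "h powi (-(k^2) - k) * (1 - q ^ n * q powi (- k)) = h powi (-(k^2) - k) - q ^ n * h powi (-(k^2) - 3 * k)" for k
  proof -
    have "h powi (-(k^2) - 3 * k) = h powi (-(k^2) - k) * q powi (- k)" unfolding q_powi_eq_h_powi h_powi_mult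
      by (rule arg_cong[where f="power_int h"], simp add: power2_eq_square algebra_simps)
    then show ?thesis by (simp add: algebra_simps)
  qed
  ultimately show ?thesis by (simp add: bailey_sum_diff bailey_sum_cmult)
qed

text \<open>The image of \<open>pair_1\<close> under q -> 1/q: inverting the base in the two
  reciprocals gives the extra factor q^(n^2+n+k^2), whose k-part turns 3k^2 + k into -k^2 - k in
  powers of h. The proof repeats the induction instead of substituting.\<close>

lemma dual_pair_1:
  assumes "int n \<le> R"
  shows "bailey_sum 0 q R n (\<lambda>k. h powi (-(k^2) - k)) = (-1) ^ n * h powi (-(int n^2) - int n) * qpoch_recip q (int n)"
  using assms
proof (induction n)
  case 0
  then show ?case by (simp add: bailey_sum_0_0)
next
  case (Suc n)
  define X where "X = q ^ Suc n"
  have X0: "X \<noteq> 0" using gen by (simp add: X_def generic_base_def)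
  define B where "B = bailey_sum 0 q R (Suc n) (\<lambda>k. h powi (-(k^2) - k))"
  have *: "h powi (-(k^2) - k) * (1 - X * q powi (- k)) * (1 - X * q powi (k + 0))
     = (1 + X^2) * h powi (-(k^2) - k) - X * (h powi (-(k^2) + k) + h powi (-(k^2) - 3*k))" for k
  proof -
    have e: "h powi (-(k^2) + k) = h powi (-(k^2) - k) * q powi k"
         "h powi (-(k^2) - 3*k) = h powi (-(k^2) - k) * q powi (- k)" unfolding q_powi_eq_h_powi h_powi_mult
      by (rule arg_cong[where f="power_int h"], simp add: power2_eq_square algebra_simps)+
    have "q powi k * q powi (- k) = 1" using h0 by (simp add: q_powi_eq_h_powi power_int_minus)
    then show ?thesis unfolding e by (simp, algebra)
  qed
  have B3: "X * bailey_sum 0 q R (Suc n) (\<lambda>k. h powi (-(k^2) - 3*k)) = B"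
    using dual_pair_3[OF Suc.prems] by (simp add: B_def X_def)
  have "bailey_sum 0 q R n (\<lambda>k. h powi (-(k^2) - k)) =
     (1 + X^2) * B - X * (B + bailey_sum 0 q R (Suc n) (\<lambda>k. h powi (-(k^2) - 3*k)))"
    unfolding bailey_sum_Suc[OF gen, of 0 R n] X_def[symmetric] *
    unfolding bailey_sum_diff bailey_sum_cmult bailey_sum_add bailey_sum_reflect_dual_pair B_def ..
  also have "\<dots> = - X * (1 - X) * B"
    using B3 by (simp add: algebra_simps power2_eq_square)
  finally have "- X * (1 - X) * B = (-1) ^ n * h powi (-(int n^2) - int n) * qpoch_recip q (int n)"
    using Suc by simp
  also have "qpoch_recip q (int n) = (1 - X) * qpoch_recip q (int (Suc n))"
    using qpoch_recip_Suc_mult[OF gen, of n] X_def by simp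
  also have "h powi (-(int n^2) - int n) = X * h powi (-(int (Suc n)^2) - int (Suc n))"
  proof -
    have "X = q powi (int (Suc n))" by (simp only: X_def power_int_of_nat)
    then show ?thesis unfolding q_powi_eq_h_powi
      by (simp only: h_powi_mult) (rule arg_cong[where f="power_int h"], simp add: algebra_simps power2_eq_square)
  qed
  finally have "- X * (1 - X) * B = - X * (1 - X) * ((-1) ^ Suc n * h powi (-(int (Suc n)^2) - int (Suc n)) * qpoch_recip q (int (Suc n)))"
    by (simp add: mult_ac)
  moreover have "- X \<noteq> 0" "1 - X \<noteq> 0" using X0 unfolding X_def using gen by (simp_all add: generic_base_def del: power_Suc)
  ultimately show ?case unfolding B_def by (rule cancel_two_factors)
qed

lemma dual_pair_3':
  assumes "int n \<le> R"
  shows "bailey_sum 0 q R n (\<lambda>k. h powi (-(k^2) - 3 * k)) = (-1) ^ n * h powi (-(int n^2) - 3 * int n) * qpoch_recip q (int n)"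
proof -
  have "q ^ n * bailey_sum 0 q R n (\<lambda>k. h powi (-(k^2) - 3 * k)) = (-1) ^ n * h powi (-(int n^2) - int n) * qpoch_recip q (int n)"
    using dual_pair_3[OF assms] dual_pair_1[OF assms] by simp
  also have "h powi (-(int n^2) - int n) = q ^ n * h powi (-(int n^2) - 3 * int n)"
  proof -
    have "q ^ n = h powi (2 * int n)" using q_powi_eq_h_powi[of "int n"] by simp
    then show ?thesis unfolding h_powi_mult[symmetric] by (simp only: h_powi_mult) (rule arg_cong[where f="power_int h"], simp)
  qed
  finally have "q ^ n * bailey_sum 0 q R n (\<lambda>k. h powi (-(k^2) - 3 * k))
      = q ^ n * ((-1) ^ n * h powi (-(int n^2) - 3 * int n) * qpoch_recip q (int n))" by (simp only: mult_ac)
  then show ?thesis by (rule mult_left_cancel[THEN iffD1, rotated]) (use generic_base_nonzero[OF gen] in simp)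
qed

text \<open>For s = 1 the linear coefficient -1 is not a reflection of 1, so the induction for
  \<open>odd_pair_1\<close> needs this relation.\<close>

lemma odd_pair_rel:
  assumes "int n \<le> R"
  shows "bailey_sum 1 q R n (\<lambda>k. h powi (3*k^2 - k)) = (1 + q ^ Suc n) * bailey_sum 1 q R n (\<lambda>k. h powi (3*k^2 + k))"
proof -
  define s where "s c = bailey_sum 1 q R n (\<lambda>k. h powi (3*k^2 + c*k))" for c
  \<comment> \<open>The reflection k -> -1-k turns the linear coefficient c into 6 - c at the cost
    of h^(3-c) and a sign; c = 3 is its fixed point, so that \<open>s 3\<close> vanishes.\<close>
  have refl: "s c = - (h powi (3 - c)) * s (6 - c)" for c
  proof -
    have "s c = bailey_sum 1 q R n (\<lambda>k. h powi (3 - c) * h powi (3*(-1-k)^2 + (6-c)*(-1-k)))"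
      unfolding s_def h_powi_mult by (rule bailey_sum_cong) (simp add: algebra_simps power2_eq_square)
    also have "\<dots> = h powi (3 - c) * (- s (6 - c))"
    proof -
      have "bailey_sum 1 q R n (\<lambda>k. h powi (3*(-1-k)^2 + (6-c)*(-1-k))) = - s (6 - c)"
        unfolding s_def by (rule bailey_sum_reflect_odd) simp
      then show ?thesis unfolding bailey_sum_cmult by simp
    qed
    finally show ?thesis by simp
  qed
  have s3: "s 3 = 0" using refl[of 3] by simp
  \<comment> \<open>The combination is antisymmetric under k -> -2-k, which exchanges the
    h-exponents 3k^2 + 7k + 2 and 3k^2 + 5k; this is the symmetry required for s = 1.\<close>
  have "bailey_sum 1 q R n (\<lambda>k. (q * h powi (3*k^2 + 7*k) - h powi (3*k^2 + 5*k)) * (1 - q ^ n * q powi (- k))) = 0"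
  proof (rule bailey_sum_telescope[OF gen assms], goal_cases)
    case (1 k)
    have "q = h powi 2" by (simp add: hq)
    then show ?case by (simp only: h_powi_mult) (simp add: algebra_simps power2_eq_square)
  qed
  moreover have "(q * h powi (3*k^2 + 7*k) - h powi (3*k^2 + 5*k)) * (1 - q ^ n * q powi (- k)) =
      q * h powi (3*k^2 + 7*k) - h powi (3*k^2 + 5*k) - q ^ n * (q * h powi (3*k^2 + 5*k) - h powi (3*k^2 + 3*k))" for k
  proof -
    have e2: "h powi (3*k^2 + 3*k) = h powi (3*k^2 + 5*k) * q powi (- k)" unfolding q_powi_eq_h_powi h_powi_mult
      by (rule arg_cong[where f="power_int h"], simp add: power2_eq_square algebra_simps)
    have e3: "h powi (3*k^2 + 7*k) * q powi (- k) = h powi (3*k^2 + 5*k)" unfolding q_powi_eq_h_powi h_powi_mult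
      by (rule arg_cong[where f="power_int h"], simp add: power2_eq_square algebra_simps)
    show ?thesis unfolding e2 unfolding e3[symmetric] by (simp add: algebra_simps)
  qed
  ultimately have "q * s 7 - s 5 - q ^ n * (q * s 5 - s 3) = 0"
    by (simp add: bailey_sum_diff bailey_sum_cmult bailey_sum_add s_def)
  moreover have "q * h powi (-4) = h powi (-2)" "q * h powi (-2) = 1"
    using h0 by (simp_all add: hq power_int_minus field_simps eval_nat_numeral)
  moreover have "s 7 = - (h powi (-4)) * s (-1)" "s 5 = - (h powi (-2)) * s 1" using refl[of 7] refl[of 5] by simp_all
  moreover have elim: "q * t = q * ((1 + q * X) * u)"
    if "q * v - w - X * (q * w - y) = 0" "q * a = b" "q * b = 1" "v = - a * t" "w = - b * u" "y = 0"
    for X a b t u v w y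
    using that by algebra
  ultimately have "q * s (-1) = q * ((1 + q ^ Suc n) * s 1)" using s3 unfolding power_Suc by (intro elim)
  then show ?thesis using gen by (simp add: generic_base_def s_def)
qed

text \<open>As for \<open>pair_1\<close>, except that the sum with linear coefficient 3 is now 0,
  being antisymmetric under k -> -1-k; the remaining factor is 1 + X^2 q - X (1 + X q) = 1 -
  X.\<close>

lemma odd_pair_1:
  assumes "int n \<le> R"
  shows "bailey_sum 1 q R n (\<lambda>k. h powi (3*k^2 + k)) = qpoch_recip q (int n)"
  using assms
proof (induction n)
  case 0
  have "1 - q \<noteq> 0" using gen unfolding generic_base_def by (metis power_one_right right_minus_eq zero_less_one)
  moreover have "R \<ge> 0" using 0 by simp
  ultimately show ?case by (simp add: bailey_sum_1_0[OF _ gen] flip: hq)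
next
  case (Suc n)
  define X where "X = q ^ Suc n"
  define B where "B = bailey_sum 1 q R (Suc n) (\<lambda>k. h powi (3*k^2 + k))"
  have *: "h powi (3*k^2 + k) * (1 - X * q powi (- k)) * (1 - X * q powi (k + 1))
     = (1 + X^2*q) * h powi (3*k^2 + k) - X * h powi (3*k^2 - k) - X * q * h powi (3*k^2 + 3*k)" for k
  proof -
    have e: "h powi (3*k^2 - k) = h powi (3*k^2 + k) * q powi (- k)"
         "h powi (3*k^2 + 3*k) = h powi (3*k^2 + k) * q powi k" unfolding q_powi_eq_h_powi h_powi_mult
      by (rule arg_cong[where f="power_int h"], simp add: power2_eq_square algebra_simps)+
    have "q powi k * q powi (- k) = 1" using h0 by (simp add: q_powi_eq_h_powi power_int_minus)
    moreover have "q powi (k + 1) = q powi k * q" using generic_base_nonzero[OF gen] by (simp add: power_int_add)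
    ultimately show ?thesis unfolding e by algebra
  qed
  have s3: "bailey_sum 1 q R (Suc n) (\<lambda>k. h powi (3*k^2 + 3*k)) = 0"
  proof -
    have "bailey_sum 1 q R (Suc n) (\<lambda>k. h powi (3*k^2 + 3*k)) = bailey_sum 1 q R (Suc n) (\<lambda>k. h powi (3*(-1-k)^2 + 3*(-1-k)))"
      by (rule bailey_sum_cong) (simp add: algebra_simps power2_eq_square)
    also have "\<dots> = - bailey_sum 1 q R (Suc n) (\<lambda>k. h powi (3*k^2 + 3*k))"
      by (subst bailey_sum_reflect_odd) simp_all
    finally show ?thesis by simp
  qed
  have "bailey_sum 1 q R n (\<lambda>k. h powi (3*k^2 + k)) = (1 + X^2*q) * B - X * ((1 + q ^ Suc (Suc n)) * B) - X * q * 0"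
    unfolding bailey_sum_Suc[OF gen, of 1 R n] X_def[symmetric] *
    unfolding bailey_sum_diff bailey_sum_cmult bailey_sum_add s3 odd_pair_rel[OF Suc.prems] B_def ..
  also have "\<dots> = (1 - X) * B"
    by (simp add: algebra_simps power2_eq_square X_def)
  finally have "(1 - X) * B = qpoch_recip q (int n)"
    using Suc by simp
  moreover have "1 - X \<noteq> 0" unfolding X_def using gen by (simp add: generic_base_def del: power_Suc)
  ultimately show ?case using qpoch_recip_Suc_mult[OF gen, of n] X_def unfolding B_def by (metis mult_cancel_left)
qed

text \<open>The image of \<open>odd_pair_1\<close> under q -> 1/q followed by k -> -1-k. The
  coefficient 1 drops out by antisymmetry, and the coefficient 5 is eliminated by telescoping a
  combination that is antisymmetric under k -> -2-k.\<close>

lemma odd_dual_pair: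
  assumes "int n \<le> R"
  shows "bailey_sum 1 q R n (\<lambda>k. h powi (-(k^2) - 3*k)) = (-1) ^ n * h powi (-(int n^2) - 3 * int n) * qpoch_recip q (int n)"
  using assms
proof (induction n)
  case 0
  have "1 - q \<noteq> 0" using gen unfolding generic_base_def by (metis power_one_right right_minus_eq zero_less_one)
  moreover have "R \<ge> 0" using 0 by simp
  ultimately show ?case by (simp add: bailey_sum_1_0[OF _ gen] flip: hq)
next
  case (Suc n)
  define X where "X = q ^ Suc n"
  have X0: "X \<noteq> 0" "q \<noteq> 0" using gen by (simp_all add: X_def generic_base_def)
  define d where "d c = bailey_sum 1 q R (Suc n) (\<lambda>k. h powi (-(k^2) - c*k))" for c
  have *: "h powi (-(k^2) - 3*k) * (1 - X * q powi (- k)) * (1 - X * q powi (k + 1))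
     = (1 + X^2*q) * h powi (-(k^2) - 3*k) - X * h powi (-(k^2) - 5*k) - X * q * h powi (-(k^2) - 1*k)" for k
  proof -
    have e: "h powi (-(k^2) - 5*k) = h powi (-(k^2) - 3*k) * q powi (- k)"
         "h powi (-(k^2) - 1*k) = h powi (-(k^2) - 3*k) * q powi k" unfolding q_powi_eq_h_powi h_powi_mult
      by (rule arg_cong[where f="power_int h"], simp add: power2_eq_square algebra_simps)+
    have "q powi k * q powi (- k) = 1" using h0 by (simp add: q_powi_eq_h_powi power_int_minus)
    moreover have "q powi (k + 1) = q powi k * q" using generic_base_nonzero[OF gen] by (simp add: power_int_add)
    ultimately show ?thesis unfolding e by algebra
  qed
  have d1: "d 1 = 0"
  proof -
    have "d 1 = bailey_sum 1 q R (Suc n) (\<lambda>k. h powi (-((-1-k)^2) - 1*(-1-k)))"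
      unfolding d_def by (rule bailey_sum_cong, rule arg_cong[where f="power_int h"]) (simp add: algebra_simps power2_eq_square)
    also have "\<dots> = - d 1"
      unfolding d_def by (subst bailey_sum_reflect_odd) simp_all
    finally show ?thesis by simp
  qed
  have "bailey_sum 1 q R (Suc n) (\<lambda>k. (h powi (-(k^2) - 3*k) - q * h powi (-(k^2) - 1*k)) * (1 - X * q powi (- k))) = 0"
    unfolding X_def
  proof (rule bailey_sum_telescope[OF gen Suc.prems], goal_cases)
    case (1 k)
    have "q = h powi 2" by (simp add: hq)
    then show ?case by (simp only: h_powi_mult) (simp add: algebra_simps power2_eq_square)
  qed
  moreover have "(h powi (-(k^2) - 3*k) - q * h powi (-(k^2) - 1*k)) * (1 - X * q powi (- k))
     = (1 + X*q) * h powi (-(k^2) - 3*k) - X * h powi (-(k^2) - 5*k) - q * h powi (-(k^2) - 1*k)" for k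
  proof -
    have e: "h powi (-(k^2) - 5*k) = h powi (-(k^2) - 3*k) * q powi (- k)"
         "h powi (-(k^2) - 1*k) = h powi (-(k^2) - 3*k) * q powi k" unfolding q_powi_eq_h_powi h_powi_mult
      by (rule arg_cong[where f="power_int h"], simp add: power2_eq_square algebra_simps)+
    have "q powi k * q powi (- k) = 1" using h0 by (simp add: q_powi_eq_h_powi power_int_minus)
    then show ?thesis unfolding e by algebra
  qed
  ultimately have d5: "X * d 5 = (1 + X*q) * d 3"
    using d1 by (simp only: bailey_sum_diff bailey_sum_cmult d_def) simp
  have "bailey_sum 1 q R n (\<lambda>k. h powi (-(k^2) - 3*k)) = (1 + X^2*q) * d 3 - X * d 5 - X * q * d 1"
    unfolding bailey_sum_Suc[OF gen, of 1 R n] X_def[symmetric] *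
    unfolding bailey_sum_diff bailey_sum_cmult bailey_sum_add d_def ..
  also have "\<dots> = - (X * q) * (1 - X) * d 3"
    unfolding d5 d1 by (simp add: algebra_simps power2_eq_square)
  finally have "- (X * q) * (1 - X) * d 3 = (-1) ^ n * h powi (-(int n^2) - 3 * int n) * qpoch_recip q (int n)"
    using Suc by simp
  also have "qpoch_recip q (int n) = (1 - X) * qpoch_recip q (int (Suc n))"
    using qpoch_recip_Suc_mult[OF gen, of n] X_def by simp
  also have "h powi (-(int n^2) - 3 * int n) = X * q * h powi (-(int (Suc n)^2) - 3 * int (Suc n))"
  proof -
    have "X * q = q powi (int n + 2)" using X0 by (simp add: X_def power_int_add power2_eq_square mult_ac)
    then show ?thesis unfolding q_powi_eq_h_powi
      by (simp only: h_powi_mult) (rule arg_cong[where f="power_int h"], simp add: algebra_simps power2_eq_square)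
  qed
  finally have "- (X * q) * (1 - X) * d 3 = - (X * q) * (1 - X) * ((-1) ^ Suc n * h powi (-(int (Suc n)^2) - 3 * int (Suc n)) * qpoch_recip q (int (Suc n)))"
    by (simp add: mult_ac)
  moreover have "- (X * q) \<noteq> 0" "1 - X \<noteq> 0" using X0 unfolding X_def using gen by (simp_all add: generic_base_def del: power_Suc)
  ultimately show ?case unfolding d_def by (rule cancel_two_factors)
qed

end

section \<open>A second quadratic dilation, and the dilation identities for arbitrary k\<close>

text \<open>The other q-Chu-Vandermonde evaluation in base q^2, the one with argument q^2, and the
  image of \<open>quadratic_dilation_aux\<close> under q -> 1/q. It serves the first identity, whose
  exponent is not positive definite in the way of the others.\<close>

lemma dual_quadratic_dilation_aux:
  assumes gen: "generic_base q" and hq: "q = h^2" and "M \<le> 2 * J"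
  shows "(\<Sum>j\<le>J. h powi (4 * int j + (int M - 2 * int j)^2 + (int M - 2 * int j)) * qpoch_recip q (int M - 2 * int j)
            * qpoch_recip (q^2) (int j) * qpoch_recip (q^2) (int j + int c))
         = qpoch q (q^2) (M + c) * q ^ M * qpoch_recip q (int M) * qpoch_recip q (int M + 2 * int c)"
    (is "(\<Sum>j\<le>J. ?t M j) = ?R M")
  using assms(3)
proof (induction M)
  case 0
  have gen2: "generic_base (q^2)" using gen by (simp add: generic_base_power)
  have "(\<Sum>j\<le>J. ?t 0 j) = (\<Sum>j\<in>{0}. ?t 0 j)"
    by (rule sum.mono_neutral_right) auto
  moreover have "qpoch_recip q (2 * int c) = 1 / (qpoch q (q^2) c * qpoch (q^2) (q^2) c)"
    using qpoch_recip_of_nat[of q "2 * c"] by (simp add: qpoch_self_double)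
  moreover have "qpoch q (q^2) c \<noteq> 0"
    using qpoch_self_double[of q c] qpoch_self_nonzero[OF gen, of "2 * c"] by auto
  ultimately show ?case by simp
next
  case (Suc M)
  have q0: "q \<noteq> 0" using gen by (rule generic_base_nonzero)
  have h0: "h \<noteq> 0" using q0 hq by auto
  have gen2: "generic_base (q^2)" using gen by (simp add: generic_base_power)
  define x where "x = q powi int M"
  define C where "C = q powi (2 * int c)"
  define y where "y = 1 / (x * q)"
  have y: "x * q * y = 1" using q0 by (simp add: y_def x_def)
  define G where "G j = - x * q * (1 / q powi (2 * int j)) * (1 - q powi (2 * int j)) * (1 - q powi (2 * int j) * C) * ?t (Suc M) j" for j
  have step: "(1 - x * q) * (1 - x * q * C) * ?t (Suc M) j - q * (1 - x^2 * q * C) * ?t M j = G (Suc j) - G j" for j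
  proof -
    define u where "u = q powi (2 * int j)"
    define v where "v = 1 / u"
    have uv: "u * v = 1" using q0 by (simp add: u_def v_def)
    have sqi: "q powi (2 * int (Suc j)) = u * q^2"
      using q0 by (simp add: u_def power_int_add algebra_simps power2_eq_square)
    define z where "z = 1/q^2"
    have z: "z * q^2 = 1" using q0 by (simp add: z_def)
    have v': "1 / (u * q^2) = v * z" by (simp add: v_def z_def)
    have yp: "y = q powi (- int M - 1)" using q0 by (simp add: y_def x_def power_int_diff power_int_minus field_simps)
    have qp: "q powi k = h powi (2 * k)" for k using h0 by (simp add: hq power_int_power)
    have hm: "h powi a * h powi b = h powi (a + b)" for a b using h0 by (simp add: power_int_add)
    have e1: "h powi (4 * int j + (int M - 2 * int j)^2 + (int M - 2 * int j))
       = h powi (4 * int j + (int (Suc M) - 2 * int j)^2 + (int (Suc M) - 2 * int j)) * (y * u)"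
      unfolding yp u_def qp hm
      by (rule arg_cong[where f="power_int h"]) (simp add: algebra_simps power2_eq_square)
    have q3: "q ^ 3 = q powi 3" by simp
    have e: "h powi (4 * int (Suc j) + (int (Suc M) - 2 * int (Suc j))^2 + (int (Suc M) - 2 * int (Suc j)))
      = h powi (4 * int j + (int (Suc M) - 2 * int j)^2 + (int (Suc M) - 2 * int j)) * ((u * u) * (q ^ 3 * (y * y)))"
      unfolding yp u_def q3 qp hm
      by (rule arg_cong[where f="power_int h"]) (simp add: algebra_simps power2_eq_square)
    have r1: "qpoch_recip q (int M - 2 * int j) = (1 - x * q * v) * qpoch_recip q (int (Suc M) - 2 * int j)"
      by (rule qpoch_recip_eq_pred[OF gen]) (use q0 in \<open>simp_all add: x_def v_def u_def power_int_add power_int_diff\<close>)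
    have r2: "qpoch_recip q (int (Suc M) - 2 * int (Suc j)) = (1 - x * v) * qpoch_recip q (int M - 2 * int j)"
      by (rule qpoch_recip_eq_pred[OF gen]) (use q0 in \<open>simp_all add: x_def v_def u_def power_int_add power_int_diff\<close>)
    have r3: "qpoch_recip (q^2) (int j) = (1 - u * q^2) * qpoch_recip (q^2) (int (Suc j))"
      by (rule qpoch_recip_eq_pred[OF gen2]) (use q0 in \<open>simp_all add: sqi[symmetric] power_int_power\<close>)
    have r4: "qpoch_recip (q^2) (int j + int c) = (1 - u * q^2 * C) * qpoch_recip (q^2) (int (Suc j) + int c)"
      by (rule qpoch_recip_eq_pred[OF gen2])
         (use q0 in \<open>simp_all add: u_def C_def power_int_add power_int_power power_int_mult algebra_simps power2_eq_square\<close>)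
    show ?thesis
      unfolding G_def e e1 r2 unfolding r1 sqi v' u_def[symmetric] v_def[symmetric]
      unfolding r3 r4
      using uv z y by algebra
  qed
  have "(1 - x * q) * (1 - x * q * C) * (\<Sum>j\<le>J. ?t (Suc M) j) - q * (1 - x^2 * q * C) * (\<Sum>j\<le>J. ?t M j) = (\<Sum>j\<le>J. G (Suc j) - G j)"
    unfolding step[symmetric] by (simp add: sum_subtractf sum_distrib_left)
  also have "\<dots> = G (Suc J) - G 0" by (rule sum_nat_telescope)
  also have "\<dots> = 0" using Suc.prems by (simp add: G_def)
  finally have rec: "(1 - x * q) * (1 - x * q * C) * (\<Sum>j\<le>J. ?t (Suc M) j) = q * (1 - x^2 * q * C) * ?R M"
    using Suc by simp
  have nz: "1 - x * q \<noteq> 0" "1 - x * q * C \<noteq> 0"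
  proof -
    have "x * q = q ^ Suc M" "x * q * C = q ^ (Suc M + 2 * c)"
      by (simp_all add: x_def C_def power_int_mult power_add power_mult)
    then show "1 - x * q \<noteq> 0" "1 - x * q * C \<noteq> 0"
      using gen unfolding generic_base_def by (metis right_minus_eq zero_less_Suc add_gr_0)+
  qed
  have a1: "qpoch_recip q (int M) = (1 - x * q) * qpoch_recip q (int (Suc M))"
    by (rule qpoch_recip_eq_pred[OF gen]) (use q0 in \<open>simp_all add: x_def power_int_add\<close>)
  have a2: "qpoch_recip q (int M + 2 * int c) = (1 - x * q * C) * qpoch_recip q (int (Suc M) + 2 * int c)"
    by (rule qpoch_recip_eq_pred[OF gen]) (use q0 in \<open>simp_all add: x_def C_def power_int_add\<close>)
  have a3: "qpoch q (q^2) (Suc M + c) = qpoch q (q^2) (M + c) * (1 - x^2 * q * C)"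
    by (simp add: qpoch_Suc x_def C_def power_add power_mult power_int_mult power_int_power flip: power_mult)
       (simp add: mult.commute)
  have "(1 - x * q) * (1 - x * q * C) * (\<Sum>j\<le>J. ?t (Suc M) j) = (1 - x * q) * (1 - x * q * C) * ?R (Suc M)"
    unfolding rec a1 a2 a3 power_Suc by (simp only: mult_ac)
  then show ?case using nz by (rule cancel_two_factors)
qed

text \<open>Both sides of a dilation identity are invariant under k -> -s-k, which for s at most 1
  sends every negative k to a non-negative one.\<close>

lemma int_symmetric_cases:
  assumes "s \<le> 1" "\<And>K. P (int K)" "\<And>k. P (- int s - k) \<Longrightarrow> P k"
  shows "P k"
proof (cases "k \<ge> 0")
  case True then show ?thesis using assms(2)[of "nat k"] by simp
next
  case False
  then have "- int s - k = int (nat (- int s - k))" using assms(1) by linarith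
  then show ?thesis using assms(2)[of "nat (- int s - k)"] assms(3)[of k] by metis
qed

lemma sum_shift_atMost:
  fixes K n :: nat
  assumes "K \<le> n" "\<And>r. r < K \<Longrightarrow> f r = (0 :: complex)"
  shows "(\<Sum>r\<le>n. f r) = (\<Sum>j\<le>n-K. f (K + j))"
proof -
  have "(\<Sum>r\<le>n. f r) = (\<Sum>r\<in>{K..n}. f r)"
    using assms by (intro sum.mono_neutral_right) auto
  also have "\<dots> = (\<Sum>j\<le>n-K. f (K + j))"
    by (rule sum.reindex_bij_witness[of _ "\<lambda>j. K + j" "\<lambda>r. r - K"]) (use assms in auto)
  finally show ?thesis .
qed

lemma quadratic_dilation:
  assumes gen: "generic_base q" and s: "s \<le> 1"
  shows "(\<Sum>r\<le>n. q powi (2 * int r^2 + 2 * int s * int r) * qpoch_recip q (int n - 2 * int r)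
            * (qpoch_recip (q^2) (int r - k) * qpoch_recip (q^2) (int r + k + int s)))
       = qpoch q (q^2) (n + s) * q powi (2 * k^2 + 2 * int s * k)
           * (qpoch_recip q (int n - 2 * k) * qpoch_recip q (int n + 2 * k + 2 * int s))"
    (is "?L k = ?R k")
proof (rule int_symmetric_cases[OF s, of "\<lambda>k. ?L k = ?R k"])
  fix k assume *: "?L (- int s - k) = ?R (- int s - k)"
  have e: "2 * (- int s - k)^2 + 2 * int s * (- int s - k) = 2 * k^2 + 2 * int s * k"
    "int n - 2 * (- int s - k) = int n + 2 * k + 2 * int s" "int n + 2 * (- int s - k) + 2 * int s = int n - 2 * k"
    by (simp_all add: algebra_simps power2_eq_square)
  have e2: "int r - (- int s - k) = int r + k + int s" "int r + (- int s - k) + int s = int r - k" for r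
    by simp_all
  show "?L k = ?R k" using *[unfolded e e2] by (simp only: mult_ac)
next
  fix K
  have q0: "q \<noteq> 0" using gen by (rule generic_base_nonzero)
  show "?L (int K) = ?R (int K)"
  proof (cases "2 * K \<le> n")
    case False
    have "?L (int K) = (\<Sum>r\<le>n. 0)"
    proof (rule sum.cong, goal_cases)
      case (2 r)
      show ?case using False by (cases "r < K") auto
    qed simp
    then show ?thesis using False by simp
  next
    case True
    have "?L (int K) = (\<Sum>j\<le>n-K. q powi (2 * int (K+j)^2 + 2 * int s * int (K+j)) * qpoch_recip q (int n - 2 * int (K+j))
            * (qpoch_recip (q^2) (int (K+j) - int K) * qpoch_recip (q^2) (int (K+j) + int K + int s)))"
      using True by (intro sum_shift_atMost) auto
    also have "\<dots> = q powi (2 * int K^2 + 2 * int s * int K) * (\<Sum>j\<le>n-K. q powi (2 * int j^2 + 2 * int (2*K+s) * int j) * qpoch_recip q (int (n-2*K) - 2 * int j)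
            * qpoch_recip (q^2) (int j) * qpoch_recip (q^2) (int j + int (2*K+s)))"
      unfolding sum_distrib_left
    proof (rule sum.cong, goal_cases)
      case (2 j)
      \<comment> \<open>The cross term 4Kj of the square joins 2sj, which is where the parameter c =
        2K + s of the auxiliary sum comes from.\<close>
      have e: "q powi (2 * int (K+j)^2 + 2 * int s * int (K+j)) = q powi (2 * int K^2 + 2 * int s * int K) * q powi (2 * int j^2 + 2 * int (2*K+s) * int j)"
        unfolding powi_mult[OF q0] by (rule arg_cong[where f="power_int q"]) (simp add: algebra_simps power2_eq_square)
      have e2: "int n - 2 * int (K+j) = int (n-2*K) - 2 * int j" "int (K+j) - int K = int j" "int (K+j) + int K + int s = int j + int (2*K+s)"
        using True by auto
      show ?case unfolding e e2 by (simp only: mult_ac)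
    qed simp
    also have "(\<Sum>j\<le>n-K. q powi (2 * int j^2 + 2 * int (2*K+s) * int j) * qpoch_recip q (int (n-2*K) - 2 * int j)
            * qpoch_recip (q^2) (int j) * qpoch_recip (q^2) (int j + int (2*K+s)))
         = qpoch q (q^2) (n - 2*K + (2*K+s)) * qpoch_recip q (int (n-2*K)) * qpoch_recip q (int (n-2*K) + 2 * int (2*K+s))"
      by (rule quadratic_dilation_aux[OF gen]) simp
    also have "n - 2*K + (2*K+s) = n + s" using True by simp
    also have "int (n-2*K) + 2 * int (2*K+s) = int n + 2 * int K + 2 * int s" using True by simp
    also have "int (n-2*K) = int n - 2 * int K" using True by simp
    finally show ?thesis by (simp only: mult_ac)
  qed
qed

lemma dual_quadratic_dilation:
  assumes gen: "generic_base q" and hq: "q = h^2"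
  shows "(\<Sum>r\<le>n. h powi (4 * int r + (int n - 2 * int r)^2 + (int n - 2 * int r)) * qpoch_recip q (int n - 2 * int r)
            * (qpoch_recip (q^2) (int r - k) * qpoch_recip (q^2) (int r + k)))
       = qpoch q (q^2) n * q ^ n * (qpoch_recip q (int n - 2 * k) * qpoch_recip q (int n + 2 * k))"
    (is "?L k = ?R k")
proof (rule int_symmetric_cases[of 0 "\<lambda>k. ?L k = ?R k"])
  fix k assume *: "?L (- int 0 - k) = ?R (- int 0 - k)"
  have e: "int n - 2 * (- int 0 - k) = int n + 2 * k" "int n + 2 * (- int 0 - k) = int n - 2 * k"
    by simp_all
  have e2: "int r - (- int 0 - k) = int r + k" "int r + (- int 0 - k) = int r - k" for r
    by simp_all
  show "?L k = ?R k" using *[unfolded e e2] by (simp only: mult_ac)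
next
  fix K
  have q0: "q \<noteq> 0" using gen by (rule generic_base_nonzero)
  have h0: "h \<noteq> 0" using q0 hq by auto
  show "?L (int K) = ?R (int K)"
  proof (cases "2 * K \<le> n")
    case False
    have "?L (int K) = (\<Sum>r\<le>n. 0)"
    proof (rule sum.cong, goal_cases)
      case (2 r)
      show ?case using False by (cases "r < K") auto
    qed simp
    then show ?thesis using False by simp
  next
    case True
    have "?L (int K) = (\<Sum>j\<le>n-K. h powi (4 * int (K+j) + (int n - 2 * int (K+j))^2 + (int n - 2 * int (K+j))) * qpoch_recip q (int n - 2 * int (K+j))
            * (qpoch_recip (q^2) (int (K+j) - int K) * qpoch_recip (q^2) (int (K+j) + int K)))"
      using True by (intro sum_shift_atMost) auto
    also have "\<dots> = q ^ (2*K) * (\<Sum>j\<le>n-K. h powi (4 * int j + (int (n-2*K) - 2 * int j)^2 + (int (n-2*K) - 2 * int j)) * qpoch_recip q (int (n-2*K) - 2 * int j)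
            * qpoch_recip (q^2) (int j) * qpoch_recip (q^2) (int j + int (2*K)))"
      unfolding sum_distrib_left
    proof (rule sum.cong, goal_cases)
      case (2 j)
      have e2: "int n - 2 * int (K+j) = int (n-2*K) - 2 * int j" "int (K+j) - int K = int j" "int (K+j) + int K = int j + int (2*K)"
        using True by auto
      have "q ^ (2*K) = h ^ (4 * K)" by (simp add: hq flip: power_mult)
      also have "\<dots> = h powi (4 * int K)" using power_int_of_nat[of h "4 * K"] by simp
      finally have e: "h powi (4 * int (K+j) + (int (n-2*K) - 2 * int j)^2 + (int (n-2*K) - 2 * int j))
         = q ^ (2*K) * h powi (4 * int j + (int (n-2*K) - 2 * int j)^2 + (int (n-2*K) - 2 * int j))"
        by (simp only: powi_mult[OF h0]) (rule arg_cong[where f="power_int h"], simp)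
      show ?case unfolding e2 e by (simp only: mult_ac)
    qed simp
    also have "(\<Sum>j\<le>n-K. h powi (4 * int j + (int (n-2*K) - 2 * int j)^2 + (int (n-2*K) - 2 * int j)) * qpoch_recip q (int (n-2*K) - 2 * int j)
            * qpoch_recip (q^2) (int j) * qpoch_recip (q^2) (int j + int (2*K)))
         = qpoch q (q^2) (n - 2*K + 2*K) * q ^ (n - 2*K) * qpoch_recip q (int (n-2*K)) * qpoch_recip q (int (n-2*K) + 2 * int (2*K))"
      by (rule dual_quadratic_dilation_aux[OF gen hq]) simp
    also have "n - 2*K + 2*K = n" using True by simp
    also have "int (n-2*K) + 2 * int (2*K) = int n + 2 * int K" using True by simp
    also have "int (n-2*K) = int n - 2 * int K" using True by simp
    also have "q ^ (2*K) * (qpoch q (q^2) n * q ^ (n - 2*K) * qpoch_recip q (int n - 2 * int K) * qpoch_recip q (int n + 2 * int K))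
       = qpoch q (q^2) n * (q ^ (2*K) * q ^ (n - 2*K)) * (qpoch_recip q (int n - 2 * int K) * qpoch_recip q (int n + 2 * int K))"
      by (simp only: mult_ac)
    also have "q ^ (2*K) * q ^ (n - 2*K) = q ^ n" using True by (simp flip: power_add)
    finally show ?thesis .
  qed
qed simp

text \<open>The case n = s = 0 is excluded: both numerator factorials would have index -1 there.
  That row of the double sum is supplied by hand in \<open>cubic_even_sum\<close>.\<close>

lemma cubic_dilation:
  assumes gen: "generic_base q" and s: "s \<le> 1" and ns: "n + s \<ge> 1"
  shows "(\<Sum>r\<le>n. q powi (3 * int r^2 + 3 * int s * int r) * qpoch (q^3) (q^3) (n + s - r - 1) * qpoch_recip q (int n - 3 * int r)
            * (qpoch_recip (q^3) (int r - k) * qpoch_recip (q^3) (int r + k + int s)))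
       = qpoch q q (2 * n + 3 * s - 1) * q powi (3 * k^2 + 3 * int s * k)
           * (qpoch_recip q (int n - 3 * k) * qpoch_recip q (int n + 3 * k + 3 * int s))"
    (is "?L k = ?R k")
proof (rule int_symmetric_cases[OF s, of "\<lambda>k. ?L k = ?R k"])
  fix k assume *: "?L (- int s - k) = ?R (- int s - k)"
  have e: "3 * (- int s - k)^2 + 3 * int s * (- int s - k) = 3 * k^2 + 3 * int s * k"
    "int n - 3 * (- int s - k) = int n + 3 * k + 3 * int s" "int n + 3 * (- int s - k) + 3 * int s = int n - 3 * k"
    by (simp_all add: algebra_simps power2_eq_square)
  have e2: "int r - (- int s - k) = int r + k + int s" "int r + (- int s - k) + int s = int r - k" for r
    by simp_all
  show "?L k = ?R k" using *[unfolded e e2] by (simp only: mult_ac)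
next
  fix K
  have q0: "q \<noteq> 0" using gen by (rule generic_base_nonzero)
  show "?L (int K) = ?R (int K)"
  proof (cases "3 * K \<le> n")
    case False
    have "?L (int K) = (\<Sum>r\<le>n. 0)"
    proof (rule sum.cong, goal_cases)
      case (2 r)
      show ?case using False by (cases "r < K") auto
    qed simp
    then show ?thesis using False by simp
  next
    case True
    have "?L (int K) = (\<Sum>j\<le>n-K. q powi (3 * int (K+j)^2 + 3 * int s * int (K+j)) * qpoch (q^3) (q^3) (n + s - (K+j) - 1) * qpoch_recip q (int n - 3 * int (K+j))
            * (qpoch_recip (q^3) (int (K+j) - int K) * qpoch_recip (q^3) (int (K+j) + int K + int s)))"
      using True by (intro sum_shift_atMost) auto
    also have "\<dots> = q powi (3 * int K^2 + 3 * int s * int K) * (\<Sum>j\<le>n-K. q powi (3 * int j^2 + 3 * int (2*K+s) * int j) * qpoch (q^3) (q^3) (n-3*K + (2*K+s) - j - 1) * qpoch_recip q (int (n-3*K) - 3 * int j)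
            * qpoch_recip (q^3) (int j) * qpoch_recip (q^3) (int j + int (2*K+s)))"
      unfolding sum_distrib_left
    proof (rule sum.cong, goal_cases)
      case (2 j)
      have e: "q powi (3 * int (K+j)^2 + 3 * int s * int (K+j)) = q powi (3 * int K^2 + 3 * int s * int K) * q powi (3 * int j^2 + 3 * int (2*K+s) * int j)"
        unfolding powi_mult[OF q0] by (rule arg_cong[where f="power_int q"]) (simp add: algebra_simps power2_eq_square)
      have e2: "int n - 3 * int (K+j) = int (n-3*K) - 3 * int j" "int (K+j) - int K = int j" "int (K+j) + int K + int s = int j + int (2*K+s)"
        "n + s - (K+j) - 1 = n-3*K + (2*K+s) - j - 1"
        using True by auto
      show ?case unfolding e e2 by (simp only: mult_ac)
    qed simp
    also have "(\<Sum>j\<le>n-K. q powi (3 * int j^2 + 3 * int (2*K+s) * int j) * qpoch (q^3) (q^3) (n-3*K + (2*K+s) - j - 1) * qpoch_recip q (int (n-3*K) - 3 * int j)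
            * qpoch_recip (q^3) (int j) * qpoch_recip (q^3) (int j + int (2*K+s)))
         = qpoch q q (2 * (n - 3*K) + 3 * (2*K+s) - 1) * qpoch_recip q (int (n-3*K)) * qpoch_recip q (int (n-3*K) + 3 * int (2*K+s))"
      by (rule cubic_dilation_aux[OF gen]) (use ns True in auto)
    also have "2 * (n - 3*K) + 3 * (2*K+s) - 1 = 2 * n + 3 * s - 1" using True by simp
    also have "int (n-3*K) + 3 * int (2*K+s) = int n + 3 * int K + 3 * int s" using True by simp
    also have "int (n-3*K) = int n - 3 * int K" using True by simp
    finally show ?thesis by (simp only: mult_ac)
  qed
qed

subsection \<open>Quartic dilation\<close>

text \<open>
  There is no convenient closed form of the inner sum here, so the two sides of \<open>quartic_pair\<close>
  are compared through a common second-order recurrence in \<open>n\<close>, found by creative telescoping;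
  \<open>G\<close> is its certificate.
\<close>

lemma quartic_lhs_rec:
  fixes n :: nat and R :: int and q :: complex
  defines "b \<equiv> \<lambda>n. \<Sum>k=-R..R. (-1) powi k * (q powi (10*k^2 + 2*k) + q powi (10*k^2 - 2*k))
      * (qpoch_recip q (int n - 4*k) * qpoch_recip q (int n + 4*k))"
  assumes gen: "generic_base q" and "int n + 2 \<le> R" and "x = q ^ Suc n"
  shows "(1 - x*q) * (1 - x^2/q) * (1 - x^2) * (1 - x^2*q) * b (Suc (Suc n))
       + (1 - x^2/q) * (x*q + x^3 - q - 1) * b (Suc n) + q * b n = 0"
proof -
  have q0: "q \<noteq> 0" using gen by (rule generic_base_nonzero)
  define y where "y = 1 / q"
  have y: "y * q = 1" using q0 by (simp add: y_def)
  define V where "V n k = qpoch_recip q (int n - 4*k) * qpoch_recip q (int n + 4*k)" for n k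
  define A2 where "A2 = (1 - x*q) * (1 - x^2*y) * (1 - x^2) * (1 - x^2*q)"
  define A1 where "A1 = (1 - x^2*y) * (x*q + x^3 - q - 1)"
  define G where "G k = x^2 * q^2 * (-1) powi k * q powi (10*k^2 + 10*k) * (qpoch_recip q (int n - 2 - 4*k) * qpoch_recip q (int n + 2 + 4*k))" for k
  define a where "a k = (-1) powi k * (q powi (10*k^2 + 2*k) + q powi (10*k^2 - 2*k))" for k
  have "(\<Sum>k=-R..R. a k * (A2 * V (Suc (Suc n)) k + A1 * V (Suc n) k + q * V n k)) = 0"
  proof (rule sum_int_telescope_zero[where G = G])
    fix k
    \<comment> \<open>The reciprocals involve q^(4k) only, but the symmetrised numerator contributes
      q^(2k) + q^(-2k), so v = q^(2k) is the variable in which everything is polynomial.\<close>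
    define v where "v = q powi (2*k)"
    define w where "w = q powi (- (2*k))"
    have vw: "v * w = 1" using q0 by (simp add: v_def w_def power_int_minus)
    define N1 where "N1 = qpoch_recip q (int n + 2 - 4*k)"
    define N2 where "N2 = qpoch_recip q (int n + 2 + 4*k)"
    have w2: "w^2 = q powi (- 4*k)" "v^2 = q powi (4*k)" by (simp_all add: w_def v_def power_int_power')
    have red: "qpoch_recip q (m - 1) = (1 - z) * qpoch_recip q m" if "z = q powi m" for m z
      by (rule qpoch_recip_eq_pred[OF gen]) (use that in simp_all)
    have xp: "x = q powi (int n + 1)" "x * q = q powi (int n + 2)" "x * y = q powi (int n)" "x * y^2 = q powi (int n - 1)"
      using q0 by (simp_all add: assms(4) y_def power_int_add power_int_diff power2_eq_square)
    have p1: "qpoch_recip q (int n + 1 - 4*k) = (1 - x*q*w^2) * N1"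
      using red[of "x*q*w^2" "int n + 2 - 4*k"] unfolding N1_def w2 xp(2) powi_mult[OF q0] by (simp add: algebra_simps)
    have p2: "qpoch_recip q (int n - 4*k) = (1 - x*w^2) * qpoch_recip q (int n + 1 - 4*k)"
      using red[of "x*w^2" "int n + 1 - 4*k"] unfolding w2 xp(1) powi_mult[OF q0] by (simp add: algebra_simps)
    have p3: "qpoch_recip q (int n - 1 - 4*k) = (1 - x*y*w^2) * qpoch_recip q (int n - 4*k)"
      using red[of "x*y*w^2" "int n - 4*k"] unfolding w2 xp(3) powi_mult[OF q0] by (simp add: algebra_simps)
    have p4: "qpoch_recip q (int n - 2 - 4*k) = (1 - x*y^2*w^2) * qpoch_recip q (int n - 1 - 4*k)"
      using red[of "x*y^2*w^2" "int n - 1 - 4*k"] unfolding w2 xp(4) powi_mult[OF q0] by (simp add: algebra_simps)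
    have m1: "qpoch_recip q (int n + 1 + 4*k) = (1 - x*q * v^2) * N2"
      using red[of "x*q * v^2" "int n + 2 + 4*k"] unfolding N2_def w2 xp(2) powi_mult[OF q0] by (simp add: algebra_simps)
    have m2: "qpoch_recip q (int n + 4*k) = (1 - x * v^2) * qpoch_recip q (int n + 1 + 4*k)"
      using red[of "x * v^2" "int n + 1 + 4*k"] unfolding w2 xp(1) powi_mult[OF q0] by (simp add: algebra_simps)
    have m3: "qpoch_recip q (int n - 1 + 4*k) = (1 - x*y * v^2) * qpoch_recip q (int n + 4*k)"
      using red[of "x*y * v^2" "int n + 4*k"] unfolding w2 xp(3) powi_mult[OF q0] by (simp add: algebra_simps)
    have m4: "qpoch_recip q (int n - 2 + 4*k) = (1 - x*y^2 * v^2) * qpoch_recip q (int n - 1 + 4*k)"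
      using red[of "x*y^2 * v^2" "int n - 1 + 4*k"] unfolding w2 xp(4) powi_mult[OF q0] by (simp add: algebra_simps)
    have e: "int n + 2 + 4 * (k - 1) = int n - 2 + 4*k" "int n - 2 - 4 * (k - 1) = int n + 2 - 4*k"
      "int (Suc (Suc n)) - 4*k = int n + 2 - 4*k" "int (Suc (Suc n)) + 4*k = int n + 2 + 4*k"
      "int (Suc n) - 4*k = int n + 1 - 4*k" "int (Suc n) + 4*k = int n + 1 + 4*k" by simp_all
    define Z where "Z = q powi (10*k^2)"
    have z1: "q powi (10*k^2 + 10*k) = Z * v^5"
      unfolding Z_def v_def power_int_power' powi_mult[OF q0] by (rule arg_cong[where f="power_int q"]) simp
    have z2: "q powi (10*(k-1)^2 + 10*(k-1)) = Z * w^5"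
      unfolding Z_def w_def power_int_power' powi_mult[OF q0] by (rule arg_cong[where f="power_int q"]) (simp add: algebra_simps power2_eq_square)
    have z3: "q powi (10*k^2 + 2*k) + q powi (10*k^2 - 2*k) = Z * (v + w)"
      using q0 by (simp add: Z_def v_def w_def power_int_add power_int_diff power_int_minus field_simps)
    \<comment> \<open>The actual content of the recurrence: after removal of the common reciprocals,
      an identity in v and w modulo v w = 1 and y q = 1. Its two sides are the recurrence and the
      difference of certificates.\<close>
    have poly: "Z * (v + w) * (A2 + A1 * ((1 - x*q*w^2) * (1 - x*q * v^2)) + q * ((1 - x*q*w^2) * (1 - x*w^2) * (1 - x*q * v^2) * (1 - x * v^2)))
       = x^2*q^2 * (Z * v^5) * ((1 - x*q*w^2) * (1 - x*w^2) * (1 - x*y*w^2) * (1 - x*y^2*w^2))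
       + x^2*q^2 * (Z * w^5) * ((1 - x*q * v^2) * (1 - x * v^2) * (1 - x*y * v^2) * (1 - x*y^2 * v^2))"
      using vw y unfolding A1_def A2_def by algebra
    show "a k * (A2 * V (Suc (Suc n)) k + A1 * V (Suc n) k + q * V n k) = G k - G (k - 1)"
    proof -
      have "a k * (A2 * V (Suc (Suc n)) k + A1 * V (Suc n) k + q * V n k) = (-1) powi k * N1 * N2 * (Z * (v + w) * (A2 + A1 * ((1 - x*q*w^2) * (1 - x*q * v^2)) + q * ((1 - x*q*w^2) * (1 - x*w^2) * (1 - x*q * v^2) * (1 - x * v^2))))"
        unfolding a_def V_def z3 e p2 m2 unfolding p1 m1 N1_def[symmetric] N2_def[symmetric] by algebra
      also have "\<dots> = G k - G (k - 1)"
        unfolding poly G_def minus_one_powi_pred z1 z2 e p4 m4 unfolding p3 m3 p2 m2 unfolding p1 m1 N1_def[symmetric] N2_def[symmetric] by algebra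
      finally show ?thesis .
    qed
  next
    show "G R = 0" "G (-R - 1) = 0" using assms(3) by (simp_all add: G_def)
  qed
  moreover have "b m = (\<Sum>k=-R..R. a k * V m k)" for m by (simp add: b_def a_def V_def)
  ultimately have "A2 * b (Suc (Suc n)) + A1 * b (Suc n) + q * b n = 0"
    by (simp add: algebra_simps sum.distrib sum_distrib_left)
  then show ?thesis by (simp add: A2_def A1_def y_def)
qed

text \<open>The recurrence of \<open>quartic_lhs_rec\<close> transported to the other side: the
  coefficients differ by what the normalising factor h^(n-n^2)/(q;q)_{2n-1} changes from n to n + 1
  and n + 2. The case n = 0 is left out because (q^4;q^4)_{n-i-1} would have index -1.\<close>

lemma quartic_rhs_rec:
  fixes n :: nat and q :: complex
  defines "\<rho> \<equiv> \<lambda>n i. (-1) ^ i * q powi (int i^2 - int i) * qpoch (q^4) (q^4) (n - i - 1)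
       * qpoch_recip (q^2) (int i) * qpoch_recip q (int n - 2 * int i)"
  assumes gen: "generic_base q" and "n \<ge> 1" and "n + 2 \<le> J" and "x = q ^ Suc n"
  shows "(1 - x*q) * (\<Sum>i\<le>J. \<rho> (Suc (Suc n)) i) + x * (x*q + x^3 - q - 1) * (\<Sum>i\<le>J. \<rho> (Suc n) i)
     + x^2 * (1 - x^2/q^2) * (\<Sum>i\<le>J. \<rho> n i) = 0"
proof -
  have q0: "q \<noteq> 0" using gen by (rule generic_base_nonzero)
  have gen2: "generic_base (q^2)" using gen by (simp add: generic_base_power)
  define y where "y = 1 / q"
  have y: "y * q = 1" using q0 by (simp add: y_def)
  \<comment> \<open>The rational part of the certificate, a Laurent polynomial in w = q^(2i) written
    with z = 1/w.\<close>
  define m where "m w z = - (1 - x*q) - x^2*q^2 * (1 - x^2*y^2) * z + (1 - x*q) * x^4 * z^2" for w z :: complex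
  define W where "W i = q powi (2 * int i)" for i :: nat
  define B where "B i = (-1) ^ i * q powi (int i^2 - int i) * qpoch_recip (q^2) (int i)" for i :: nat
  define G where "G i = m (W i) (1 / W i) * (1 - W i) * (B i * qpoch (q^4) (q^4) (Suc n - i - 1) * qpoch_recip q (int n + 2 - 2 * int i))" for i
  have step: "(1 - x*q) * \<rho> (Suc (Suc n)) i + x * (x*q + x^3 - q - 1) * \<rho> (Suc n) i + x^2 * (1 - x^2*y^2) * \<rho> n i
       = G (Suc i) - G i" for i
  proof (cases "int n + 2 - 2 * int i < 0")
    case True
    then show ?thesis by (simp add: \<rho>_def G_def)
  next
    case False
    have le: "i \<le> n" using False assms(3) by linarith
    define w where "w = W i"
    define z where "z = 1 / w"
    have wz: "w * z = 1" using q0 by (simp add: w_def z_def W_def)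
    have zp: "z = q powi (- 2 * int i)" by (simp add: z_def w_def W_def power_int_minus field_simps)
    have red: "qpoch_recip q (m - 1) = (1 - z) * qpoch_recip q m" if "z = q powi m" for m z
      by (rule qpoch_recip_eq_pred[OF gen]) (use that in simp_all)
    have xp: "x = q powi (int n + 1)" "x * q = q powi (int n + 2)"
      using q0 by (simp_all add: assms(5) power_int_add power2_eq_square)
    define N where "N = qpoch_recip q (int n + 2 - 2 * int i)"
    have p1: "qpoch_recip q (int n + 1 - 2 * int i) = (1 - x*q*z) * N"
      using red[of "x*q*z" "int n + 2 - 2 * int i"] unfolding N_def zp xp(2) powi_mult[OF q0] by (simp add: algebra_simps)
    have p2: "qpoch_recip q (int n - 2 * int i) = (1 - x*z) * qpoch_recip q (int n + 1 - 2 * int i)"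
      using red[of "x*z" "int n + 1 - 2 * int i"] unfolding zp xp(1) powi_mult[OF q0] by (simp add: algebra_simps)
    have Ws: "W (Suc i) = w * q^2"
      using q0 by (simp add: W_def w_def power_int_add algebra_simps power2_eq_square)
    have Wsi: "1 / W (Suc i) = z * y^2" unfolding Ws by (simp add: z_def y_def power_divide)
    have Bs: "(1 - W (Suc i)) * B (Suc i) = - w * B i"
    proof -
      have "qpoch_recip (q^2) (int i) = (1 - W (Suc i)) * qpoch_recip (q^2) (int (Suc i))"
        by (rule qpoch_recip_eq_pred[OF gen2]) (use q0 in \<open>simp_all add: W_def power_int_power\<close>)
      moreover have "q powi (int (Suc i)^2 - int (Suc i)) = w * q powi (int i^2 - int i)"
        unfolding w_def W_def powi_mult[OF q0] by (rule arg_cong[where f="power_int q"]) (simp add: algebra_simps power2_eq_square)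
      ultimately show ?thesis by (simp add: B_def)
    qed
    have GS: "G (Suc i) = - w * m (w * q^2) (z * y^2) * (B i * qpoch (q^4) (q^4) (n - i - 1) * qpoch_recip q (int n - 2 * int i))"
    proof -
      have e: "Suc n - Suc i - 1 = n - i - 1" "int n + 2 - 2 * int (Suc i) = int n - 2 * int i" by simp_all
      have "G (Suc i) = m (W (Suc i)) (1 / W (Suc i)) * ((1 - W (Suc i)) * B (Suc i))
          * (qpoch (q^4) (q^4) (n - i - 1) * qpoch_recip q (int n - 2 * int i))"
        unfolding G_def e by (simp only: mult_ac)
      then show ?thesis unfolding Bs unfolding Wsi unfolding Ws by (simp only: mult_ac mult_minus_left mult_minus_right)
    qed
    have rho1: "\<rho> (Suc (Suc n)) i = B i * qpoch (q^4) (q^4) (Suc n - i) * N"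
      "\<rho> (Suc n) i = B i * qpoch (q^4) (q^4) (Suc n - i - 1) * ((1 - x*q*z) * N)"
      "\<rho> n i = B i * qpoch (q^4) (q^4) (n - i - 1) * qpoch_recip q (int n - 2 * int i)"
      unfolding \<rho>_def B_def N_def p1[unfolded N_def, symmetric] by (simp_all add: algebra_simps)
    have k1: "qpoch (q^4) (q^4) (Suc n - i) = (1 - x^4*z^2) * qpoch (q^4) (q^4) (Suc n - i - 1)"
    proof -
      have e: "Suc n - i = Suc (Suc n - i - 1)" using False assms(3) by linarith
      have "(q^4) ^ Suc (Suc n - i - 1) = q powi (4 * int (Suc n - i))" unfolding e[symmetric]
        by (simp only: power_int_mult power_int_of_nat[symmetric] of_nat_numeral)
      also have "4 * int (Suc n - i) = (int n + 1) * 4 + (- 2 * int i) * 2" using le by (simp add: of_nat_diff algebra_simps)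
      also have "q powi \<dots> = x^4 * z^2" unfolding xp zp power_int_power' powi_mult[OF q0] by simp
      finally have "(q^4) ^ Suc (Suc n - i - 1) = x^4 * z^2" .
      moreover have "qpoch (q^4) (q^4) (Suc n - i) = qpoch (q^4) (q^4) (Suc n - i - 1) * (1 - (q^4) ^ Suc (Suc n - i - 1))"
        by (subst (1) e, rule qpoch_self_Suc)
      ultimately show ?thesis by (simp only: mult.commute)
    qed
    \<comment> \<open>Multiplying by 1/(q;q)_{n-2i} makes the relation true for all i: where the
      truncated index n - i - 1 could misbehave, n - 2i is negative and both sides are 0.\<close>
    have k2: "qpoch (q^4) (q^4) (Suc n - i - 1) * qpoch_recip q (int n - 2 * int i)
       = (1 - x^4*y^4*z^2) * (qpoch (q^4) (q^4) (n - i - 1) * qpoch_recip q (int n - 2 * int i))"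
    proof (cases "int n - 2 * int i < 0")
      case True then show ?thesis by simp
    next
      case F: False
      have e: "n - i = Suc (n - i - 1)" using F assms(3) by linarith
      have yp: "y = q powi (-1)" by (simp add: y_def power_int_minus divide_inverse)
      have "(q^4) ^ Suc (n - i - 1) = q powi (4 * int (n - i))" unfolding e[symmetric]
        by (simp only: power_int_mult power_int_of_nat[symmetric] of_nat_numeral)
      also have "4 * int (n - i) = (int n + 1) * 4 + (- 1) * 4 + (- 2 * int i) * 2" using le by (simp add: of_nat_diff algebra_simps)
      also have "q powi \<dots> = x^4 * y^4 * z^2" unfolding xp zp yp power_int_power' powi_mult[OF q0] by simp
      finally have "(q^4) ^ Suc (n - i - 1) = x^4 * y^4 * z^2" .
      moreover have "qpoch (q^4) (q^4) (n - i) = qpoch (q^4) (q^4) (n - i - 1) * (1 - (q^4) ^ Suc (n - i - 1))"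
        by (subst (1) e, rule qpoch_self_Suc)
      moreover have "Suc n - i - 1 = n - i" by simp
      ultimately show ?thesis by simp
    qed
    define P where "P = qpoch (q^4) (q^4) (Suc n - i - 1)"
    define P' where "P' = qpoch (q^4) (q^4) (n - i - 1)"
    define N' where "N' = qpoch_recip q (int n - 2 * int i)"
    have N': "N' = (1 - x*z) * ((1 - x*q*z) * N)" unfolding N'_def p2 p1 ..
    have PP: "P * N' = (1 - x^4*y^4*z^2) * (P' * N')" using k2 by (simp add: P_def P'_def N'_def)
    have i1: "(1 - x*q) * (1 - x^4*z^2) + x * (x*q + x^3 - q - 1) * (1 - x*q*z) + m w z * (1 - w) - (1 - x*q) * w * ((1 - x*z) * (1 - x*q*z)) = 0"
      using wz y unfolding m_def by algebra
    have i2: "x^2 * (1 - x^2*y^2) + w * m (w * q^2) (z * y^2) = - (1 - x*q) * w * (1 - x^4*y^4*z^2)"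
      using wz y unfolding m_def by algebra
    have "(1 - x*q) * \<rho> (Suc (Suc n)) i + x * (x*q + x^3 - q - 1) * \<rho> (Suc n) i + G i
       = B i * P * N * ((1 - x*q) * (1 - x^4*z^2) + x * (x*q + x^3 - q - 1) * (1 - x*q*z) + m w z * (1 - w))"
      unfolding rho1 k1 G_def P_def[symmetric] N_def[symmetric] w_def[symmetric] z_def[symmetric] by algebra
    also have "\<dots> = B i * P * N * ((1 - x*q) * w * ((1 - x*z) * (1 - x*q*z)))"
      using i1 by algebra
    also have "\<dots> = B i * (1 - x*q) * w * (P * N')" unfolding N' by algebra
    also have "\<dots> = - (B i * (P' * N')) * (x^2 * (1 - x^2*y^2) + w * m (w * q^2) (z * y^2))"
      unfolding PP i2 by algebra
    also have "\<dots> = G (Suc i) - x^2 * (1 - x^2*y^2) * \<rho> n i"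
      unfolding GS rho1 P'_def[symmetric] N'_def[symmetric] by algebra
    finally show ?thesis by algebra
  qed
  have "(1 - x*q) * (\<Sum>i\<le>J. \<rho> (Suc (Suc n)) i) + x * (x*q + x^3 - q - 1) * (\<Sum>i\<le>J. \<rho> (Suc n) i)
     + x^2 * (1 - x^2*y^2) * (\<Sum>i\<le>J. \<rho> n i) = (\<Sum>i\<le>J. G (Suc i) - G i)"
    unfolding step[symmetric] by (simp add: sum.distrib sum_distrib_left)
  also have "\<dots> = G (Suc J) - G 0" by (rule sum_nat_telescope)
  also have "\<dots> = 0" using assms(4) by (simp add: G_def W_def)
  finally show ?thesis by (simp add: y_def power_divide)
qed

text \<open>Both sides obey the same second-order recurrence after normalisation. The factor 2 comes
  from the symmetrised numerator; the induction divides by (1 - xq)(1 - x^2/q), which is non-zero as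
  q is not a root of unity.\<close>

lemma quartic_pair_aux:
  fixes n :: nat and q h :: complex and R :: int and J :: nat
  defines "b \<equiv> \<lambda>n. \<Sum>k=-R..R. (-1) powi k * (q powi (10*k^2 + 2*k) + q powi (10*k^2 - 2*k))
      * (qpoch_recip q (int n - 4*k) * qpoch_recip q (int n + 4*k))"
  defines "\<rho> \<equiv> \<lambda>n i. (-1) ^ i * q powi (int i^2 - int i) * qpoch (q^4) (q^4) (n - i - 1)
       * qpoch_recip (q^2) (int i) * qpoch_recip q (int n - 2 * int i)"
  assumes gen: "generic_base q" and hq: "q = h^2"
  shows "n \<ge> 1 \<Longrightarrow> int n \<le> R \<Longrightarrow> n \<le> J \<Longrightarrow> b n * qpoch q q (2 * n - 1) = 2 * h powi (int n - int n^2) * (\<Sum>i\<le>J. \<rho> n i)"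
proof (induction n rule: less_induct)
  case (less n)
  have q0: "q \<noteq> 0" using gen by (rule generic_base_nonzero)
  have h0: "h \<noteq> 0" using q0 hq by auto
  have nz: "1 - q ^ k \<noteq> 0" if "k > 0" for k using gen that by (simp add: generic_base_def)
  \<comment> \<open>For n < 4 and k non-zero, one of n - 4k and n + 4k is negative, so the initial
    values come from k = 0 alone.\<close>
  have b_small: "b n = 2 * qpoch_recip q (int n)^2" if "n < 4"
  proof -
    have "b n = (\<Sum>k\<in>{0}. (-1) powi k * (q powi (10*k^2 + 2*k) + q powi (10*k^2 - 2*k))
      * (qpoch_recip q (int n - 4*k) * qpoch_recip q (int n + 4*k)))"
      unfolding b_def
    proof (rule sum.mono_neutral_right, goal_cases)
      case 3
      have "qpoch_recip q (int n - 4*k) = 0 \<or> qpoch_recip q (int n + 4*k) = 0" if "k \<noteq> 0" for k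
        using \<open>n < 4\<close> that by (cases "k > 0") auto
      then show ?case by auto
    qed (use less.prems in auto)
    then show ?thesis by (simp add: power2_eq_square)
  qed
  consider "n = 1" | "n = 2" | m where "n = Suc (Suc m)" "m \<ge> 1"
    using less.prems(1) by (metis One_nat_def Suc_1 Suc_leI le_neq_implies_less less_Suc_eq_0_disj not_less_eq_eq old.nat.exhaust zero_less_Suc)
  then show ?case
  proof cases
    case 1
    have "(\<Sum>i\<le>J. \<rho> n i) = (\<Sum>i\<in>{0}. \<rho> n i)"
      using 1 by (intro sum.mono_neutral_right) (auto simp: \<rho>_def)
    then have s: "(\<Sum>i\<le>J. \<rho> n i) = 1 / (1 - q)"
      using 1 by (simp add: \<rho>_def qpoch_recip_def qpoch_def)
    have "qpoch_recip q (int n) = 1 / (1 - q)" "qpoch q q (2 * n - 1) = 1 - q" "h powi (int n - int n^2) = 1"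
      using 1 by (simp_all add: qpoch_recip_def qpoch_def)
    moreover have "b n = 2 * (1 / (1 - q))^2" using b_small 1 calculation(1) by simp
    moreover have "2 * u^2 * (1 - q) = 2 * 1 * u" if "(1 - q) * u = 1" for u using that by algebra
    moreover have "(1 - q) * (1 / (1 - q)) = 1" using nz[of 1] by simp
    ultimately show ?thesis unfolding s by metis
  next
    case 2
    have "(\<Sum>i\<le>J. \<rho> n i) = (\<Sum>i\<in>{0,1}. \<rho> n i)"
      using 2 less.prems by (intro sum.mono_neutral_right) (auto simp: \<rho>_def)
    then have s: "(\<Sum>i\<le>J. \<rho> n i) = (1 - q^4) / ((1 - q) * (1 - q^2)) - 1 / (1 - q^2)"
      using 2 by (simp add: \<rho>_def qpoch_recip_def qpoch_def numeral_2_eq_2)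
    have r2: "qpoch_recip q (int n) = 1 / ((1 - q) * (1 - q^2))"
      using 2 by (simp add: qpoch_recip_def qpoch_def numeral_2_eq_2)
    have p3: "qpoch q q (2 * n - 1) = (1 - q) * (1 - q^2) * (1 - q^3)"
      using 2 by (simp add: qpoch_def numeral_3_eq_3 numeral_2_eq_2)
    have "h powi (int n - int n^2) = 1 / q" using 2 by (simp add: power_int_minus hq divide_inverse)
    moreover have "1 - q \<noteq> 0" "1 - q^2 \<noteq> 0" using nz[of 1] nz[of 2] by auto
    moreover have "(1 - q^4) / ((1 - q) * (1 - q^2)) - 1 / (1 - q^2) = q * (1 - q^3) / ((1 - q) * (1 - q^2))"
      using calculation(2,3) by (simp add: divide_simps) (simp add: algebra_simps eval_nat_numeral)
    ultimately show ?thesis unfolding s p3 using b_small 2 r2 q0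
      by (simp add: power2_eq_square)
  next
    case (3 m)
    define x where "x = q ^ Suc m"
    define y where "y = 1 / q"
    define p where "p = qpoch q q (2 * m - 1)"
    define e where "e = h powi (int (Suc m) - int (Suc m)^2)"
    have y: "q * y = 1" using q0 by (simp add: y_def)
    have x0: "x \<noteq> 0" using q0 by (simp add: x_def)
    have xi: "x * (1 / x) = 1" using x0 by simp
    have x2: "x^2 * y^2 = q ^ (2 * m)" "x^2 * y = q ^ Suc (2 * m)" "x^2 = q ^ Suc (Suc (2 * m))" "x^2 * q = q ^ Suc (Suc (Suc (2 * m)))"
      using q0 by (simp_all add: x_def y_def power2_eq_square mult_2 mult_2_right power_add field_simps)
    have d: "2 * m = Suc (2 * m - 1)" "2 * Suc m - 1 = Suc (2 * m)" "2 * Suc (Suc m) - 1 = Suc (Suc (Suc (2 * m)))" using 3 by simp_all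
    have p0: "qpoch q q (2 * m) = p * (1 - x^2*y^2)"
      using qpoch_self_Suc[of q "2 * m - 1"] unfolding d(1)[symmetric] x2(1) p_def .
    have p1: "qpoch q q (2 * Suc m - 1) = p * ((1 - x^2*y^2) * (1 - x^2*y))"
      unfolding d(2) qpoch_self_Suc[of q "2*m"] p0 x2(2) by (simp only: mult_ac)
    have p2: "qpoch q q (2 * Suc (Suc m) - 1) = p * ((1 - x^2*y^2) * (1 - x^2*y)) * ((1 - x^2) * (1 - x^2*q))"
      unfolding d(3) qpoch_self_Suc[of q "Suc (Suc (2*m))"] qpoch_self_Suc[of q "Suc (2*m)"] qpoch_self_Suc[of q "2*m"] p0
        x2(2-4)[symmetric]
      by (simp only: mult_ac)
    have e0: "h powi (int m - int m^2) = e * (x * y)"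
    proof -
      have "x * y = q ^ m" using q0 by (simp add: x_def y_def)
      also have "\<dots> = h powi (2 * int m)" by (simp only: hq power_int_mult power_int_of_nat power_int_numeral)
      finally show ?thesis unfolding e_def
        by (simp only: powi_mult[OF h0]) (rule arg_cong[where f="power_int h"], simp add: algebra_simps power2_eq_square)
    qed
    have e2: "h powi (int (Suc (Suc m)) - int (Suc (Suc m))^2) = e * (1 / x)"
    proof -
      have "x = h powi (2 * int (Suc m))" by (simp only: x_def hq power_int_mult power_int_of_nat power_int_numeral)
      then have "1 / x = h powi (- (2 * int (Suc m)))" by (simp only: power_int_minus divide_inverse mult_1_left)
      then show ?thesis unfolding e_def
        by (simp only: powi_mult[OF h0]) (rule arg_cong[where f="power_int h"], simp add: algebra_simps power2_eq_square)
    qed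
    have I0: "b m * p = 2 * (e * (x * y)) * (\<Sum>i\<le>J. \<rho> m i)"
      using less.IH[of m] 3 less.prems unfolding e0 p_def by simp
    have I1: "b (Suc m) * (p * ((1 - x^2*y^2) * (1 - x^2*y))) = 2 * e * (\<Sum>i\<le>J. \<rho> (Suc m) i)"
      using less.IH[of "Suc m"] 3 less.prems unfolding p1 e_def by simp
    have L: "(1 - x*q) * (1 - x^2*y) * (1 - x^2) * (1 - x^2*q) * b (Suc (Suc m))
       + (1 - x^2*y) * (x*q + x^3 - q - 1) * b (Suc m) + q * b m = 0"
      using quartic_lhs_rec[OF gen, of m R x] less.prems 3 by (simp add: x_def b_def y_def)
    have R: "(1 - x*q) * (\<Sum>i\<le>J. \<rho> (Suc (Suc m)) i) + x * (x*q + x^3 - q - 1) * (\<Sum>i\<le>J. \<rho> (Suc m) i)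
       + x^2 * (1 - x^2*y^2) * (\<Sum>i\<le>J. \<rho> m i) = 0"
      using quartic_rhs_rec[OF gen, of m J x] less.prems 3 by (simp add: x_def \<rho>_def y_def power_divide)
    \<comment> \<open>Pure elimination: the two earlier values are replaced in the left recurrence,
      which then becomes a multiple of the right one.\<close>
    have alg: "(1 - x*q) * (1 - x^2*y) * (b2 * (p * ((1 - x^2*y^2) * (1 - x^2*y)) * ((1 - x^2) * (1 - x^2*q))))
        = (1 - x*q) * (1 - x^2*y) * (2 * (e * xi) * r2)"
      if "b0 * p = 2 * (e * (x * y)) * r0" "b1 * (p * ((1 - x^2*y^2) * (1 - x^2*y))) = 2 * e * r1"
         "(1 - x*q) * (1 - x^2*y) * (1 - x^2) * (1 - x^2*q) * b2 + (1 - x^2*y) * (x*q + x^3 - q - 1) * b1 + q * b0 = 0"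
         "(1 - x*q) * r2 + x * (x*q + x^3 - q - 1) * r1 + x^2 * (1 - x^2*y^2) * r0 = 0"
         "q * y = 1" "x * xi = 1"
      for b0 b1 b2 r0 r1 r2 xi
    proof -
      have "(1 - x*q) * (1 - x^2*y) * (b2 * (p * ((1 - x^2*y^2) * (1 - x^2*y)) * ((1 - x^2) * (1 - x^2*q))))
        = - (1 - x^2*y) * (x*q + x^3 - q - 1) * (b1 * (p * ((1 - x^2*y^2) * (1 - x^2*y)))) - q * (b0 * p) * ((1 - x^2*y^2) * (1 - x^2*y))"
        using that(3) by algebra
      also have "\<dots> = - (1 - x^2*y) * (x*q + x^3 - q - 1) * (2 * e * r1) - (2 * (e * x)) * r0 * ((1 - x^2*y^2) * (1 - x^2*y))"
        unfolding that(1,2) using that(5) by algebra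
      also have "\<dots> = (1 - x^2*y) * 2 * e * xi * (- (x * (x*q + x^3 - q - 1) * r1) - x^2 * (1 - x^2*y^2) * r0)"
        using that(6) by algebra
      also have "- (x * (x*q + x^3 - q - 1) * r1) - x^2 * (1 - x^2*y^2) * r0 = (1 - x*q) * r2"
        using that(4) by algebra
      finally show ?thesis by (simp only: mult_ac)
    qed
    have nz': "1 - x*q \<noteq> 0" "1 - x^2*y \<noteq> 0"
      unfolding x2(2) using nz[of "Suc (Suc m)"] nz[of "Suc (2*m)"] by (simp_all add: x_def mult_ac)
    show ?thesis unfolding 3(1) p2 e2 by (rule cancel_two_factors[OF alg[OF I0 I1 L R y xi] nz'])
  qed
qed

text \<open>The exponent 10k^2 + 2k is 6k^2 + 2k from the pair \<open>pair_1\<close> in base q^4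
  plus 4k^2 from a dilation with L = 4. The sum over k is half the symmetrised one, by k ->
  -k.\<close>

lemma quartic_pair:
  fixes n :: nat and q h :: complex and R :: int
  assumes gen: "generic_base q" and hq: "q = h^2" and n: "n \<ge> 1" "int n \<le> R"
  shows "(\<Sum>i\<le>n. (-1) ^ i * h powi (2 * int i^2 - 2 * int i + int n - int n^2) * qpoch (q^4) (q^4) (n - i - 1)
       * qpoch_recip (q^2) (int i) * qpoch_recip q (int n - 2 * int i)) / qpoch q q (2 * n - 1)
     = (\<Sum>k=-R..R. (-1) powi k * q powi (10*k^2 + 2*k) * (qpoch_recip q (int n - 4*k) * qpoch_recip q (int n + 4*k)))"
proof -
  have h0: "h \<noteq> 0" using generic_base_nonzero[OF gen] hq by auto
  define f where "f k = (-1) powi k * q powi (10*k^2 + 2*k) * (qpoch_recip q (int n - 4*k) * qpoch_recip q (int n + 4*k))" for k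
  have "(\<Sum>k=-R..R. (-1) powi k * (q powi (10*k^2 + 2*k) + q powi (10*k^2 - 2*k))
      * (qpoch_recip q (int n - 4*k) * qpoch_recip q (int n + 4*k))) = (\<Sum>k=-R..R. f k + f (- k))"
    by (rule sum.cong) (simp_all add: f_def power_int_minus_one_minus algebra_simps)
  also have "\<dots> = 2 * (\<Sum>k=-R..R. f k)"
    by (simp add: sum.distrib sum_int_reflect)
  finally have *: "2 * (\<Sum>k=-R..R. f k) * qpoch q q (2 * n - 1) = 2 * h powi (int n - int n^2) *
     (\<Sum>i\<le>n. (-1) ^ i * q powi (int i^2 - int i) * qpoch (q^4) (q^4) (n - i - 1) * qpoch_recip (q^2) (int i) * qpoch_recip q (int n - 2 * int i))"
    using quartic_pair_aux[OF gen hq n(1) n(2) order_refl] by simp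
  define A where "A i = (-1) ^ i * q powi (int i^2 - int i) * qpoch (q^4) (q^4) (n - i - 1) * qpoch_recip (q^2) (int i) * qpoch_recip q (int n - 2 * int i)" for i
  have e: "h powi (2 * int i^2 - 2 * int i + int n - int n^2) = h powi (int n - int n^2) * q powi (int i^2 - int i)" for i
    unfolding hq power_int_power powi_mult[OF h0] by (rule arg_cong[where f="power_int h"]) simp
  have "(\<Sum>i\<le>n. (-1) ^ i * h powi (2 * int i^2 - 2 * int i + int n - int n^2) * qpoch (q^4) (q^4) (n - i - 1)
       * qpoch_recip (q^2) (int i) * qpoch_recip q (int n - 2 * int i)) = h powi (int n - int n^2) * (\<Sum>i\<le>n. A i)"
    unfolding e sum_distrib_left A_def by (rule sum.cong) (simp_all only: mult_ac)
  also have "\<dots> = (\<Sum>k=-R..R. f k) * qpoch q q (2 * n - 1)"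
    using *[folded A_def] by simp
  finally show ?thesis using qpoch_self_nonzero[OF gen] by (simp add: f_def)
qed

subsection \<open>Infinite products\<close>

definition pinf :: "complex \<Rightarrow> complex \<Rightarrow> complex" where
  "pinf x q = prodinf (\<lambda>j. 1 - x * q ^ j)"

lemma qpoch_inf_single: "qpoch_inf [x] q = pinf x q"
  by (simp add: qpoch_inf_def pinf_def)

lemma convergent_prod_qpoch:
  fixes x q :: complex
  assumes "norm q < 1"
  shows "convergent_prod (\<lambda>j. 1 - x * q ^ j)"
proof (rule abs_convergent_prod_imp_convergent_prod, rule summable_imp_abs_convergent_prod)
  show "summable (\<lambda>j. norm (1 - x * q ^ j - 1))"
    using assms by (simp add: norm_mult norm_power)
qed

lemma qpoch_LIMSEQ:
  assumes "norm q < 1"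
  shows "(\<lambda>n. qpoch x q n) \<longlonglongrightarrow> pinf x q"
  using convergent_prod_LIMSEQ[OF convergent_prod_qpoch[OF assms, of x]]
  unfolding pinf_def qpoch_def lessThan_Suc_atMost[symmetric]
  by (rule LIMSEQ_imp_Suc)

lemma qpoch_add: "qpoch x q (m + n) = qpoch x q m * qpoch (x * q ^ m) q n"
  by (induction n) (simp_all add: qpoch_Suc power_add mult_ac)

lemma pinf_split:
  assumes "norm q < 1"
  shows "pinf x q = qpoch x q m * pinf (x * q ^ m) q"
proof -
  have "(\<lambda>n. qpoch x q (n + m)) \<longlonglongrightarrow> pinf x q"
    using qpoch_LIMSEQ[OF assms] by (rule LIMSEQ_ignore_initial_segment)
  moreover have "(\<lambda>n. qpoch x q (n + m)) \<longlonglongrightarrow> qpoch x q m * pinf (x * q ^ m) q"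
    unfolding add.commute[of _ m] qpoch_add by (intro tendsto_intros qpoch_LIMSEQ assms)
  ultimately show ?thesis by (rule LIMSEQ_unique)
qed

lemma pinf_nonzero:
  assumes "norm q < 1" "norm x < 1"
  shows "pinf x q \<noteq> 0"
  unfolding pinf_def
proof (rule prodinf_nonzero[OF convergent_prod_qpoch[OF assms(1)]])
  fix j
  have "norm (x * q ^ j) \<le> norm x * 1"
    unfolding norm_mult norm_power using assms by (intro mult_left_mono power_le_one) auto
  then show "1 - x * q ^ j \<noteq> 0" using assms(2) by (metis eq_iff_diff_eq_0 mult.right_neutral norm_one not_less)
qed

lemma qpoch_bounded:
  assumes "norm q < 1"
  shows "\<exists>C. \<forall>n. norm (qpoch x q n) \<le> C"
  using convergent_imp_Bseq[of "qpoch x q"] qpoch_LIMSEQ[OF assms] by (auto simp: convergent_def Bseq_def)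

lemma qpoch_inverse_bounded:
  assumes "norm q < 1" "norm x < 1"
  shows "\<exists>C. \<forall>n. norm (1 / qpoch x q n) \<le> C"
proof -
  have "(\<lambda>n. 1 / qpoch x q n) \<longlonglongrightarrow> 1 / pinf x q"
    by (intro tendsto_intros qpoch_LIMSEQ pinf_nonzero assms)
  then show ?thesis using convergent_imp_Bseq[of "\<lambda>n. 1 / qpoch x q n"] by (auto simp: convergent_def Bseq_def)
qed

text \<open>Uniform in the closed unit disc since |1 - x q^j| <= 1 + |q|^j <= exp(|q|^j). The
  uniformity provides a majorant for (c q^m; q)_\<infinity> simultaneously in c and m.\<close>

lemma pinf_bounded:
  assumes "norm q < 1"
  shows "\<exists>C. \<forall>x. norm x \<le> 1 \<longrightarrow> norm (pinf x q) \<le> C"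
proof (intro exI allI impI)
  fix x :: complex assume x: "norm x \<le> 1"
  have "norm (qpoch x q n) \<le> exp (1 / (1 - norm q))" for n
  proof -
    have "norm (qpoch x q n) \<le> (\<Prod>j<n. norm (1 - x * q ^ j))" by (simp add: qpoch_def prod_norm)
    also have "\<dots> \<le> (\<Prod>j<n. exp (norm q ^ j))"
    proof (rule prod_mono, safe)
      fix j
      have "norm (1 - x * q ^ j) \<le> 1 + norm (x * q ^ j)" by (metis norm_triangle_ineq4 norm_one)
      also have "norm (x * q ^ j) \<le> 1 * norm q ^ j"
        unfolding norm_mult norm_power using x by (intro mult_right_mono) auto
      also have "1 + 1 * norm q ^ j \<le> exp (norm q ^ j)" using exp_ge_add_one_self by simp
      finally show "norm (1 - x * q ^ j) \<le> exp (norm q ^ j)" by simp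
    qed simp
    also have "\<dots> = exp (\<Sum>j<n. norm q ^ j)" by (simp add: exp_sum)
    also have "(\<Sum>j<n. norm q ^ j) \<le> (\<Sum>j. norm q ^ j)"
      using assms by (intro sum_le_suminf) auto
    also have "\<dots> = 1 / (1 - norm q)" using assms by (simp add: suminf_geometric)
    finally show ?thesis by simp
  qed
  then show "norm (pinf x q) \<le> exp (1 / (1 - norm q))"
    by (intro Lim_bounded[OF tendsto_norm[OF qpoch_LIMSEQ[OF assms]]]) auto
qed

lemma pinf_0 [simp]: "pinf 0 q = 1"
  by (simp add: pinf_def)

lemma pinf_LIMSEQ_1:
  assumes "norm q < 1" "norm x < 1"
  shows "(\<lambda>n. pinf (x * q ^ n) q) \<longlonglongrightarrow> 1"
proof -
  have "(\<lambda>n. pinf x q / qpoch x q n) \<longlonglongrightarrow> pinf x q / pinf x q"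
    by (intro tendsto_intros qpoch_LIMSEQ pinf_nonzero assms)
  moreover have "pinf x q / qpoch x q n = pinf (x * q ^ n) q" for n
    using pinf_split[OF assms(1), of x n] pinf_nonzero[OF assms] by auto
  ultimately show ?thesis using pinf_nonzero[OF assms] by simp
qed

subsection \<open>A limiting case of the q-Gauss sum\<close>

context
  fixes q :: complex
  assumes q: "norm q < 1" and gen: "generic_base q"
begin

text \<open>Majorant for the product in \<open>gauss_term\<close> when |c| and |e| are at most 1:
  each factor is then at most 2 |q|^j. Successive ratios 2 |q|^n tend to 0, so the series
  converges.\<close>

definition gauss_dom :: "nat \<Rightarrow> real" where "gauss_dom m = (\<Prod>j<m. norm q ^ j * 2)"

lemma gauss_dom_pos: "gauss_dom m \<ge> 0"
  by (simp add: gauss_dom_def prod_nonneg)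

lemma summable_gauss_dom: "summable gauss_dom"
proof -
  have "(\<lambda>n. norm q ^ n) \<longlonglongrightarrow> 0" using q by (intro LIMSEQ_power_zero) auto
  then have "eventually (\<lambda>n. norm q ^ n < 1/4) sequentially"
    by (rule order_tendstoD) simp
  then obtain N where N: "\<And>n. n \<ge> N \<Longrightarrow> norm q ^ n < 1/4"
    by (auto simp: eventually_sequentially)
  show ?thesis
  proof (rule summable_ratio_test)
    show "(1/2 :: real) < 1" by simp
    fix n assume "n \<ge> N"
    then have "norm q ^ n * 2 \<le> 1/2" using N[of n] by simp
    from mult_right_mono[OF this gauss_dom_pos[of n]]
    have "gauss_dom (Suc n) \<le> 1/2 * gauss_dom n" by (simp add: gauss_dom_def mult_ac)
    then show "norm (gauss_dom (Suc n)) \<le> 1/2 * norm (gauss_dom n)"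
      using gauss_dom_pos[of n] gauss_dom_pos[of "Suc n"] by simp
  qed
qed

text \<open>The summand (a;q)_m (-c/a)^m q^(m(m-1)/2) / ((q;q)_m (c;q)_m) of the limiting q-Gauss
  sum, multiplied by (c;q)_\<infinity> and written with e = c/a. In this form e = 0 is allowed and
  nothing is divided by (c;q)_m.\<close>

definition gauss_term :: "complex \<Rightarrow> complex \<Rightarrow> nat \<Rightarrow> complex" where
  "gauss_term e c m = (\<Prod>j<m. q ^ j * (c * q ^ j - e)) * pinf (c * q ^ m) q / qpoch q q m"

definition gauss_cert :: "complex \<Rightarrow> complex \<Rightarrow> nat \<Rightarrow> complex" where
  "gauss_cert e c m = (case m of 0 \<Rightarrow> 0
     | Suc l \<Rightarrow> c * (\<Prod>j<l. q ^ j * (c * q ^ Suc j - e)) * q ^ l * pinf (c * q ^ m) q / qpoch q q l)"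

lemma gauss_prod_bound:
  assumes "norm c \<le> 1" "norm e \<le> 1"
  shows "norm (\<Prod>j<m. q ^ j * (c * q ^ f j - e)) \<le> gauss_dom m"
  unfolding gauss_dom_def prod_norm[symmetric]
proof (rule prod_mono, safe)
  fix j
  have "norm (c * q ^ f j - e) \<le> norm (c * q ^ f j) + norm e" by (rule norm_triangle_ineq4)
  also have "norm (c * q ^ f j) \<le> 1 * 1"
    unfolding norm_mult norm_power using assms q by (intro mult_mono power_le_one) auto
  finally have "norm (c * q ^ f j - e) \<le> 2" using assms by simp
  then show "norm (q ^ j * (c * q ^ f j - e)) \<le> norm q ^ j * 2"
    unfolding norm_mult norm_power by (intro mult_left_mono) auto
qed simp

lemma norm_mult_power_le: "norm c \<le> 1 \<Longrightarrow> norm (c * q ^ m) \<le> 1"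
  unfolding norm_mult norm_power using q by (intro mult_le_one power_le_one) auto

lemma gauss_term_bound:
  "\<exists>C. \<forall>e c m. norm c \<le> 1 \<longrightarrow> norm e \<le> 1 \<longrightarrow> norm (gauss_term e c m) \<le> gauss_dom m * C"
proof -
  obtain A where A: "\<And>x. norm x \<le> 1 \<Longrightarrow> norm (pinf x q) \<le> A" using pinf_bounded[OF q] by blast
  obtain B where B: "\<And>m. norm (1 / qpoch q q m) \<le> B" using qpoch_inverse_bounded[OF q q] by blast
  have A0: "A \<ge> 0" using A[of 0] by (simp add: order_trans[OF norm_ge_zero])
  show ?thesis
  proof (intro exI allI impI)
    fix e c :: complex and m assume *: "norm c \<le> 1" "norm e \<le> 1"
    have "norm (gauss_term e c m) = norm (\<Prod>j<m. q ^ j * (c * q ^ j - e)) * (norm (pinf (c * q ^ m) q) * norm (1 / qpoch q q m))"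
      by (simp add: gauss_term_def norm_mult norm_divide)
    also have "\<dots> \<le> gauss_dom m * (A * B)"
      using * A0 by (intro mult_mono gauss_prod_bound A B norm_mult_power_le mult_nonneg_nonneg gauss_dom_pos) auto
    finally show "norm (gauss_term e c m) \<le> gauss_dom m * (A * B)" .
  qed
qed

lemma summable_gauss_term:
  assumes "norm c \<le> 1" "norm e \<le> 1"
  shows "summable (\<lambda>m. norm (gauss_term e c m))"
proof -
  obtain C where C: "norm (gauss_term e c m) \<le> gauss_dom m * C" for m using gauss_term_bound assms by blast
  show ?thesis
    by (rule summable_comparison_test'[OF summable_mult2[OF summable_gauss_dom], of 0 _ C]) (use C in auto)
qed

lemma gauss_cert_LIMSEQ:
  assumes "norm c \<le> 1" "norm e \<le> 1"
  shows "gauss_cert e c \<longlonglongrightarrow> 0"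
proof -
  obtain A where A: "\<And>x. norm x \<le> 1 \<Longrightarrow> norm (pinf x q) \<le> A" using pinf_bounded[OF q] by blast
  obtain B where B: "\<And>m. norm (1 / qpoch q q m) \<le> B" using qpoch_inverse_bounded[OF q q] by blast
  have A0: "A \<ge> 0" using A[of 0] by (simp add: order_trans[OF norm_ge_zero])
  have "(\<lambda>l. gauss_cert e c (Suc l)) \<longlonglongrightarrow> 0"
  proof (rule Lim_null_comparison)
    show "(\<lambda>l. gauss_dom l * (A * B)) \<longlonglongrightarrow> 0"
      using summable_LIMSEQ_zero[OF summable_gauss_dom] by (rule tendsto_mult_left_zero)
    show "eventually (\<lambda>l. norm (gauss_cert e c (Suc l)) \<le> gauss_dom l * (A * B)) sequentially"
    proof (intro always_eventually allI)
      fix l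
      have "norm (gauss_cert e c (Suc l)) = norm (c * q ^ l) * (norm (\<Prod>j<l. q ^ j * (c * q ^ Suc j - e)) * (norm (pinf (c * q ^ Suc l) q) * norm (1 / qpoch q q l)))"
        by (simp add: gauss_cert_def norm_mult norm_divide)
      also have "\<dots> \<le> 1 * (gauss_dom l * (A * B))"
        using assms A0 by (intro mult_mono gauss_prod_bound[of c e "Suc"] A B norm_mult_power_le mult_nonneg_nonneg gauss_dom_pos) auto
      finally show "norm (gauss_cert e c (Suc l)) \<le> gauss_dom l * (A * B)" by simp
    qed
  qed
  then show ?thesis by (rule LIMSEQ_imp_Suc)
qed

text \<open>Replacing c by cq changes the summand by a difference in m. Together with
  \<open>gauss_cert_LIMSEQ\<close> this makes the series independent of c along c, cq, cq^2,
  ...\<close>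

lemma gauss_step: "gauss_term e c m - gauss_term e (c * q) m = gauss_cert e c m - gauss_cert e c (Suc m)"
proof (cases m)
  case 0
  have "pinf c q = (1 - c) * pinf (c * q) q" using pinf_split[OF q, of c 1] by (simp add: qpoch_def)
  then show ?thesis by (simp add: 0 gauss_term_def gauss_cert_def algebra_simps)
next
  case (Suc l)
  define P where "P = (\<Prod>j<l. q ^ j * (c * q ^ Suc j - e))"
  define r where "r = qpoch_recip q (int (Suc l))"
  define z where "z = pinf (c * q ^ Suc (Suc l)) q"
  define x where "x = q ^ Suc l"
  have z1: "pinf (c * q ^ Suc l) q = (1 - c * x) * z"
    using pinf_split[OF q, of "c * q ^ Suc l" 1] by (simp add: qpoch_def z_def x_def mult_ac)
  have z2: "pinf (c * q * q ^ m) q = z" by (simp add: z_def Suc mult_ac)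
  have l1: "1 / qpoch q q l = (1 - x) * r"
    using qpoch_recip_eq_pred[OF gen, of "int l" "int (Suc l)" x] by (simp add: r_def x_def flip: power_int_of_nat)
  have p1: "(\<Prod>j<m. q ^ j * (c * q ^ j - e)) = (c - e) * q ^ l * P"
  proof -
    have "(\<Prod>j<n. q ^ Suc j * (c * q ^ Suc j - e)) = q ^ n * (\<Prod>j<n. q ^ j * (c * q ^ Suc j - e))" for n
      by (induction n) (simp_all add: mult_ac)
    then show ?thesis unfolding Suc prod.lessThan_Suc_shift P_def by (simp add: mult_ac)
  qed
  have p2: "(\<Prod>j<m. q ^ j * (c * q * q ^ j - e)) = q ^ l * (c * x - e) * P"
    by (simp add: Suc P_def x_def mult_ac)
  have p3: "(\<Prod>j<Suc l. q ^ j * (c * q ^ Suc j - e)) = q ^ l * (c * x - e) * P"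
    by (simp add: P_def x_def mult_ac)
  have d: "a / qpoch q q (Suc l) = a * r" for a unfolding r_def qpoch_recip_of_nat by simp
  have d': "a / qpoch q q l = a * ((1 - x) * r)" for a unfolding l1[symmetric] by simp
  have t1: "gauss_term e c m = (c - e) * q ^ l * P * ((1 - c * x) * z) * r"
    unfolding gauss_term_def p1 unfolding Suc z1 d ..
  have t2: "gauss_term e (c * q) m = q ^ l * (c * x - e) * P * z * r"
    unfolding gauss_term_def p2 z2 unfolding Suc d ..
  have t3: "gauss_cert e c m = c * P * q ^ l * ((1 - c * x) * z) * ((1 - x) * r)"
    unfolding gauss_cert_def Suc nat.case z1 d' P_def ..
  have t4: "gauss_cert e c (Suc m) = c * (q ^ l * (c * x - e) * P) * x * z * r"
    unfolding gauss_cert_def Suc nat.case p3 d z_def x_def ..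
  show ?thesis unfolding t1 t2 t3 t4 by algebra
qed

lemma gauss_suminf_shift:
  assumes "norm c \<le> 1" "norm e \<le> 1"
  shows "suminf (gauss_term e (c * q)) = suminf (gauss_term e c)"
proof -
  have c': "norm (c * q) \<le> 1" using norm_mult_power_le[of c 1] assms by simp
  have "(\<lambda>m. gauss_cert e c m - gauss_cert e c (Suc m)) sums (gauss_cert e c 0 - 0)"
    by (rule telescope_sums'[OF gauss_cert_LIMSEQ[OF assms]])
  then have "(\<lambda>m. gauss_term e c m - gauss_term e (c * q) m) sums 0"
    unfolding gauss_step by (simp add: gauss_cert_def)
  moreover have "(\<lambda>m. gauss_term e c m - gauss_term e (c * q) m) sums (suminf (gauss_term e c) - suminf (gauss_term e (c * q)))"
    by (intro sums_diff summable_sums summable_norm_cancel[OF summable_gauss_term] assms c')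
  ultimately show ?thesis using sums_unique2 by fastforce
qed

text \<open>The sum is the same for all c q^n, and Tannery's theorem lets n tend to infinity; the
  resulting series depends on e only.\<close>

lemma gauss_suminf_limit:
  assumes "norm c < 1" "norm e \<le> 1"
  shows "suminf (gauss_term e c) = (\<Sum>m. (\<Prod>j<m. q ^ j * (- e)) / qpoch q q m)"
proof -
  obtain C where C: "\<And>c m. norm c \<le> 1 \<Longrightarrow> norm (gauss_term e c m) \<le> gauss_dom m * C"
    using gauss_term_bound assms(2) by blast
  have const: "suminf (gauss_term e (c * q ^ n)) = suminf (gauss_term e c)" for n
  proof (induction n)
    case (Suc n)
    then show ?case
      using gauss_suminf_shift[of "c * q ^ n" e] norm_mult_power_le[of c n] assms by (simp add: mult_ac)
  qed simp
  have "(\<lambda>n. suminf (\<lambda>m. gauss_term e (c * q ^ n) m)) \<longlonglongrightarrow> (\<Sum>m. (\<Prod>j<m. q ^ j * (- e)) / qpoch q q m)"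
  proof (rule tannerys_theorem[THEN conjunct2, THEN conjunct2])
    fix m
    have lim: "(\<lambda>n. c * q ^ n) \<longlonglongrightarrow> 0"
      by (rule tendsto_mult_right_zero, rule LIMSEQ_power_zero[OF q])
    have "(\<lambda>n. (\<Prod>j<m. q ^ j * (c * q ^ n * q ^ j - e)) * pinf (c * q ^ m * q ^ n) q / qpoch q q m)
        \<longlonglongrightarrow> (\<Prod>j<m. q ^ j * (0 * q ^ j - e)) * 1 / qpoch q q m"
      by (intro tendsto_intros lim pinf_LIMSEQ_1 q qpoch_self_nonzero gen)
         (use norm_mult_power_le[of 1 m] assms q in \<open>simp add: norm_mult norm_power mult_le_less_imp_less power_le_one mult.commute order_le_less_trans[OF mult_left_le]\<close>)
    then show "(\<lambda>n. gauss_term e (c * q ^ n) m) \<longlonglongrightarrow> (\<Prod>j<m. q ^ j * (- e)) / qpoch q q m"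
      by (simp add: gauss_term_def mult_ac)
  next
    show "eventually (\<lambda>(m, n). norm (gauss_term e (c * q ^ n) m) \<le> gauss_dom m * C) (at_top \<times>\<^sub>F sequentially)"
      using C norm_mult_power_le assms by (intro always_eventually) auto
    show "summable (\<lambda>m. gauss_dom m * C)" by (intro summable_mult2 summable_gauss_dom)
  qed simp
  then show ?thesis unfolding const by (simp add: LIMSEQ_const_iff)
qed

text \<open>The limiting series need not be evaluated: it is the same for c and for the special
  choice c = e, where the factor with j = 0 kills every term but the first.\<close>

theorem gauss_sum:
  assumes "norm c < 1" "norm e < 1"
  shows "gauss_term e c sums pinf e q"
proof -
  have "suminf (gauss_term e e) = (\<Sum>m\<in>{0}. gauss_term e e m)"
    by (rule suminf_finite) (auto simp: gauss_term_def prod_zero_iff intro!: bexI[of _ 0])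
  also have "\<dots> = pinf e q" by (simp add: gauss_term_def)
  finally have "suminf (gauss_term e c) = pinf e q"
    using gauss_suminf_limit[of c e] gauss_suminf_limit[of e e] assms by simp
  then show ?thesis
    using summable_sums[OF summable_norm_cancel[OF summable_gauss_term]] assms by (metis less_imp_le)
qed

end

subsection \<open>Summation over the outer index\<close>

text \<open>Passes from a series in which k and -k are grouped, as Tannery's theorem produces it, to
  an unconditional sum over the integers.\<close>

lemma has_sum_int_of_symmetric:
  fixes f :: "int \<Rightarrow> complex"
  assumes "summable (\<lambda>n. norm (f (int n)))" "summable (\<lambda>n. norm (f (- int n)))"
    and s: "(\<lambda>n. if n = 0 then f 0 else f (int n) + f (- int n)) sums s"
  shows "(f has_sum s) UNIV"
proof -
  have s1: "((f \<circ> int) has_sum (\<Sum>n. f (int n))) UNIV"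
    using norm_summable_imp_has_sum[OF assms(1) summable_sums[OF summable_norm_cancel[OF assms(1)]]] by (simp add: o_def)
  have a2: "summable (\<lambda>n. norm (f (- int (Suc n))))"
    using assms(2) by (subst summable_Suc_iff[of "\<lambda>n. norm (f (- int n))"])
  have s2: "((f \<circ> (\<lambda>n. - int (Suc n))) has_sum (\<Sum>n. f (- int (Suc n)))) UNIV"
    using norm_summable_imp_has_sum[OF a2 summable_sums[OF summable_norm_cancel[OF a2]]] by (simp add: o_def)
  have "(f has_sum (\<Sum>n. f (int n)) + (\<Sum>n. f (- int (Suc n)))) (range int \<union> range (\<lambda>n. - int (Suc n)))"
  proof (rule has_sum_Un_disjoint)
    show "(f has_sum (\<Sum>n. f (int n))) (range int)"
      using s1 by (subst has_sum_reindex) (auto simp: inj_on_def)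
    show "(f has_sum (\<Sum>n. f (- int (Suc n)))) (range (\<lambda>n. - int (Suc n)))"
      using s2 by (subst has_sum_reindex) (auto simp: inj_on_def)
    show "range int \<inter> range (\<lambda>n. - int (Suc n)) = {}" by force
  qed
  moreover have "range int \<union> range (\<lambda>n. - int (Suc n)) = UNIV"
  proof -
    have "k \<in> range int \<union> range (\<lambda>n. - int (Suc n))" for k
      by (cases k rule: int_cases) auto
    then show ?thesis by blast
  qed
  moreover have "(\<lambda>n. f (int n) + (if n = 0 then 0 else f (- int n))) sums ((\<Sum>n. f (int n)) + (\<Sum>n. f (- int (Suc n))))"
  proof (intro sums_add summable_sums summable_norm_cancel[OF assms(1)])
    have "(\<lambda>n. if Suc n = 0 then 0 else f (- int (Suc n))) sums (\<Sum>n. f (- int (Suc n)))"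
      using summable_sums[OF summable_norm_cancel[OF a2]] by simp
    from sums_Suc[OF this] show "(\<lambda>n. if n = 0 then 0 else f (- int n)) sums (\<Sum>n. f (- int (Suc n)))" by simp
  qed
  then have "(\<lambda>n. if n = 0 then f 0 else f (int n) + f (- int n)) sums ((\<Sum>n. f (int n)) + (\<Sum>n. f (- int (Suc n))))"
    by (rule sums_cong[THEN iffD1, rotated]) auto
  ultimately show ?thesis using sums_unique2[OF s] by simp
qed

text \<open>Common source of all weights: when the ratio of successive values of w from K on has the
  stated shape, the sum started at n = K is \<open>gauss_term\<close> with c = q^N, N = 2K + S + 1,
  because 1/(q;q)_{2K+S+m} = (q^(N+m);q)_\<infinity> / (q;q)_\<infinity>. S may be negative as long
  as N >= 1.\<close>

lemma gauss_weighted: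
  fixes q e :: complex and w :: "nat \<Rightarrow> complex"
  assumes q: "norm q < 1" and gen: "generic_base q" and e: "norm e < 1" and N: "int N = 2 * int K + S + 1" "N \<ge> 1"
    and step: "\<And>m. w (Suc (K + m)) = w (K + m) * (q ^ m * (q ^ N * q ^ m - e))"
  shows "((\<lambda>n. w n * (qpoch_recip q (int n - int K) * qpoch_recip q (int n + int K + S))) has_sum (w K * pinf e q / pinf q q)) UNIV"
proof -
  define f where "f n = w n * (qpoch_recip q (int n - int K) * qpoch_recip q (int n + int K + S))" for n
  have p0: "pinf q q \<noteq> 0" using q by (simp add: pinf_nonzero)
  obtain N' where N': "N = Suc N'" using N(2) by (cases N) auto
  have w: "w (K + m) = w K * (\<Prod>j<m. q ^ j * (q ^ N * q ^ j - e))" for m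
    by (induction m) (use step in \<open>simp_all add: mult_ac\<close>)
  have f: "f (K + m) = w K / pinf q q * gauss_term q e (q ^ N) m" for m
  proof -
    have i: "int (K + m) - int K = int m" "int (K + m) + int K + S = int (N' + m)" using N N' by simp_all
    have "pinf q q = qpoch q q (N' + m) * pinf (q * q ^ (N' + m)) q" by (rule pinf_split[OF q])
    moreover have "q * q ^ (N' + m) = q ^ N * q ^ m" by (simp add: N' power_add)
    ultimately have r: "pinf (q ^ N * q ^ m) q = pinf q q * (1 / qpoch q q (N' + m))"
      using qpoch_self_nonzero[OF gen] by simp
    show ?thesis
      unfolding f_def i qpoch_recip_of_nat w gauss_term_def[OF q gen] r using p0 by simp
  qed
  have qN: "norm (q ^ N) < 1" using q N(2) by (simp add: norm_power power_less_one_iff)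
  have "(\<lambda>m. f (K + m)) sums (w K / pinf q q * pinf e q)"
    unfolding f by (intro sums_mult gauss_sum[OF q gen qN e])
  moreover have "summable (\<lambda>m. norm (f (K + m)))"
    unfolding f norm_mult by (intro summable_mult summable_gauss_term[OF q gen]) (use qN e in auto)
  ultimately have "((\<lambda>m. f (K + m)) has_sum (w K / pinf q q * pinf e q)) UNIV"
    by (intro norm_summable_imp_has_sum)
  then have "(f has_sum (w K / pinf q q * pinf e q)) (range (\<lambda>m. K + m))"
    by (subst has_sum_reindex) (auto simp: o_def)
  then have "(f has_sum (w K / pinf q q * pinf e q)) UNIV"
  proof (rule has_sum_cong_neutral[THEN iffD1, rotated -1], goal_cases)
    case (1 n)
    then have "n < K" by (metis DiffD2 le_add_diff_inverse not_less rangeI)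
    then show ?case by (simp add: f_def)
  qed auto
  then show ?thesis unfolding f_def[abs_def] times_divide_eq_left .
qed

text \<open>The case e = 0. The condition on K says that the larger of K and -K-S, where the summand
  starts, is non-negative, so that the range n >= 0 loses no term; the second alternative is the
  first after K -> -K-S.\<close>

lemma weight_square:
  fixes K S :: int
  assumes q: "norm q < 1" "q \<noteq> 0" and K: "K \<ge> 0 \<and> 2 * K + S \<ge> 0 \<or> K + S \<le> 0 \<and> 2 * K + S \<le> 0"
  shows "((\<lambda>n. q powi (int n^2 + S * int n) * (qpoch_recip q (int n - K) * qpoch_recip q (int n + K + S)))
     has_sum (q powi (K^2 + S * K) / pinf q q)) UNIV"
proof -
  have gen: "generic_base q" using q by (simp add: generic_base_unit_disc)
  have *: "((\<lambda>n. q powi (int n^2 + S * int n) * (qpoch_recip q (int n - K) * qpoch_recip q (int n + K + S)))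
     has_sum (q powi (K^2 + S * K) / pinf q q)) UNIV" if K0: "K \<ge> 0" and KS: "2 * K + S \<ge> 0" for K
  proof -
    obtain k where k: "K = int k" using zero_le_imp_eq_int[OF K0] by blast
    have "((\<lambda>n. q powi (int n^2 + S * int n) * (qpoch_recip q (int n - int k) * qpoch_recip q (int n + int k + S)))
     has_sum (q powi (int k^2 + S * int k) * pinf 0 q / pinf q q)) UNIV"
    proof (rule gauss_weighted[OF q(1) gen, where e = 0 and N = "nat (2 * K + S + 1)" and K = k and S = S
        and w = "\<lambda>n. q powi (int n^2 + S * int n)"])
      fix m
      have e: "q ^ nat (2 * K + S + 1) = q powi (2 * K + S + 1)" by (rule power_int_nonneg_exp[symmetric]) (use KS in simp)
      have "q ^ m * (q ^ nat (2 * K + S + 1) * q ^ m) = q powi (int m + ((2 * K + S + 1) + int m))"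
        unfolding e unfolding power_int_of_nat[symmetric] powi_mult[OF q(2)] ..
      then show "q powi (int (Suc (k + m))^2 + S * int (Suc (k + m))) = q powi (int (k + m)^2 + S * int (k + m)) * (q ^ m * (q ^ nat (2 * K + S + 1) * q ^ m - 0))"
        unfolding diff_0_right
        by (simp only: powi_mult[OF q(2)]) (rule arg_cong[where f="power_int q"], simp add: k power2_eq_square algebra_simps)
    qed (use KS k in auto)
    then show ?thesis by (simp add: k)
  qed
  from K show ?thesis
  proof
    assume "K + S \<le> 0 \<and> 2 * K + S \<le> 0"
    then have "((\<lambda>n. q powi (int n^2 + S * int n) * (qpoch_recip q (int n - (- K - S)) * qpoch_recip q (int n + (- K - S) + S)))
     has_sum (q powi ((- K - S)^2 + S * (- K - S)) / pinf q q)) UNIV" by (intro *) auto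
    moreover have "(- K - S)^2 + S * (- K - S) = K^2 + S * K" by (simp add: power2_eq_square algebra_simps)
    moreover have "int n - (- K - S) = int n + K + S" "int n + (- K - S) + S = int n - K" for n by simp_all
    ultimately show ?thesis by (simp only: mult_ac)
  qed (use * in auto)
qed

lemma triangular_Suc: "Suc n * (Suc n + 1) div 2 = n * (n + 1) div 2 + Suc n"
proof -
  have "Suc n * (Suc n + 1) = n * (n + 1) + 2 * Suc n" by simp
  then show ?thesis by simp
qed

text \<open>The case e = -q^(K+1). Here (-1;q)_K (-q^(K+1);q)_\<infinity> = 2 (-q;q)_\<infinity> /
  (1 + q^K), so the value is Gaussian only up to this denominator.\<close>

lemma weight_triangular:
  fixes K :: int
  assumes q: "norm q < 1" "q \<noteq> 0" and hq: "q = h^2"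
  shows "((\<lambda>n. q ^ (n * (n + 1) div 2) * qpoch (-1) q n * (qpoch_recip q (int n - K) * qpoch_recip q (int n + K)))
     has_sum (2 * h powi (K^2 + K) / (1 + q powi K) * (pinf (-q) q / pinf q q))) UNIV"
proof -
  have gen: "generic_base q" using q by (simp add: generic_base_unit_disc)
  have h0: "h \<noteq> 0" using q hq by auto
  have *: "((\<lambda>n. q ^ (n * (n + 1) div 2) * qpoch (-1) q n * (qpoch_recip q (int n - int k) * qpoch_recip q (int n + int k)))
     has_sum (2 * h powi (int k^2 + int k) / (1 + q powi int k) * (pinf (-q) q / pinf q q))) UNIV" for k
  proof -
    have "((\<lambda>n. q ^ (n * (n + 1) div 2) * qpoch (-1) q n * (qpoch_recip q (int n - int k) * qpoch_recip q (int n + int k + 0)))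
     has_sum (q ^ (k * (k + 1) div 2) * qpoch (-1) q k * pinf (- (q * q ^ k)) q / pinf q q)) UNIV"
    \<comment> \<open>At n = k + m the ratio of the weight is q^(n+1) (1 + q^n) = q^m (q^(2k+1+m) +
      q^(k+1)), from which e is read off.\<close>
    proof (rule gauss_weighted[OF q(1) gen, of _ "2 * k + 1"])
      show "norm (- (q * q ^ k)) < 1" using q power_less_one_iff[of "norm q" "Suc k"] by (simp add: norm_mult norm_power)
      fix m
      show "q ^ (Suc (k + m) * (Suc (k + m) + 1) div 2) * qpoch (-1) q (Suc (k + m)) =
         q ^ ((k + m) * (k + m + 1) div 2) * qpoch (-1) q (k + m) * (q ^ m * (q ^ (2 * k + 1) * q ^ m - - (q * q ^ k)))"
        unfolding triangular_Suc power_add[of q _ "Suc (k + m)"] qpoch_Suc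
        by (simp add: algebra_simps power_add mult_2 mult_2_right)
    qed auto
    moreover have "q ^ (k * (k + 1) div 2) * qpoch (-1) q k * pinf (- (q * q ^ k)) q / pinf q q
       = 2 * h powi (int k^2 + int k) / (1 + q powi int k) * (pinf (-q) q / pinf q q)"
    proof -
      have a: "pinf (-q) q = qpoch (-q) q k * pinf (- (q * q ^ k)) q" using pinf_split[OF q(1), of "-q" k] by simp
      have b: "qpoch (-1) q k * (1 + q ^ k) = 2 * qpoch (-q) q k"
        using qpoch_Suc[of "-1" q k] qpoch_add[of "-1" q 1 k] by (simp add: qpoch_def)
      have c: "1 + q ^ k \<noteq> 0"
      proof (cases k)
        case (Suc l)
        then have "norm (q ^ k) < 1" using q power_less_one_iff[of "norm q" k] by (simp add: norm_power norm_mult)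
        then show ?thesis by (metis add.inverse_inverse add_eq_0_iff norm_minus_cancel norm_one less_irrefl)
      qed simp
      have d: "q ^ (k * (k + 1) div 2) = h powi (int k^2 + int k)"
      proof -
        have "2 * (k * (k + 1) div 2) = k * (k + 1)" by (rule dvd_mult_div_cancel) simp
        then have "q ^ (k * (k + 1) div 2) = h ^ (k * (k + 1))" by (simp only: hq power_mult[symmetric])
        also have "\<dots> = h powi (int (k * (k + 1)))" by (simp only: power_int_of_nat)
        finally show ?thesis by (simp add: power2_eq_square algebra_simps)
      qed
      have "qpoch (-1) q k = 2 * qpoch (-q) q k / (1 + q ^ k)" using b c by (simp add: field_simps)
      then show ?thesis unfolding a d by simp
    qed
    ultimately show ?thesis by simp
  qed
  show ?thesis
  proof (cases "K \<ge> 0")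
    case True
    then show ?thesis using *[of "nat K"] by simp
  next
    case False
    define k where "k = nat (- K)"
    have K: "K = - int k" using False by (simp add: k_def)
    have e: "h powi (int k^2 + int k) / (1 + q powi int k) = h powi (K^2 + K) / (1 + q powi K)"
    proof -
      have "1 + q powi K = (1 + q powi int k) * q powi K" unfolding K using q(2) by (simp add: power_int_minus field_simps)
      moreover have "h powi (K^2 + K) = h powi (int k^2 + int k) * q powi K"
        unfolding hq power_int_power powi_mult[OF h0] K by (rule arg_cong[where f="power_int h"]) simp
      moreover have "q powi K \<noteq> 0" using q(2) by simp
      ultimately show ?thesis by simp
    qed
    have "int n - K = int n + int k" "int n + K = int n - int k" for n by (simp_all add: K)
    then show ?thesis using *[of k] unfolding times_divide_eq_right[symmetric] e by (simp only: mult_ac)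
  qed
qed

text \<open>The case e = -q^(2K+1) in base q^2; the finite factor (-q;q^2)_K and the infinite
  product combine to (-q;q^2)_\<infinity>, so no denominator depends on K.\<close>

lemma weight_odd_square:
  fixes K :: int
  assumes q: "norm q < 1" "q \<noteq> 0"
  shows "((\<lambda>n. q ^ (n^2) * qpoch (-q) (q^2) n * (qpoch_recip (q^2) (int n - K) * qpoch_recip (q^2) (int n + K)))
     has_sum (q powi (K^2) * (pinf (-q) (q^2) / pinf (q^2) (q^2)))) UNIV"
proof -
  have q2: "norm (q^2) < 1" using q by (simp add: norm_power power_less_one_iff)
  have gen: "generic_base (q^2)" using q q2 by (simp add: generic_base_unit_disc)
  have *: "((\<lambda>n. q ^ (n^2) * qpoch (-q) (q^2) n * (qpoch_recip (q^2) (int n - int k) * qpoch_recip (q^2) (int n + int k)))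
     has_sum (q powi (int k^2) * (pinf (-q) (q^2) / pinf (q^2) (q^2)))) UNIV" for k
  proof -
    have "((\<lambda>n. q ^ (n^2) * qpoch (-q) (q^2) n * (qpoch_recip (q^2) (int n - int k) * qpoch_recip (q^2) (int n + int k + 0)))
     has_sum (q ^ (k^2) * qpoch (-q) (q^2) k * pinf (- q * (q^2) ^ k) (q^2) / pinf (q^2) (q^2))) UNIV"
    proof (rule gauss_weighted[OF q2 gen, of _ "2 * k + 1"])
      show "norm (- q * (q^2) ^ k) < 1"
        using q power_less_one_iff[of "norm q" "Suc (2 * k)"] by (simp add: norm_mult norm_power power_mult)
      fix m
      have "q ^ ((Suc (k + m))^2) = q ^ ((k + m)^2) * (q * q ^ (2 * k) * q ^ (2 * m))"
      proof -
        have "(Suc (k + m))^2 = (k + m)^2 + (1 + 2 * k + 2 * m)" by (simp add: power2_eq_square)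
        then show ?thesis by (simp only: power_add power_one_right mult.assoc)
      qed
      then show "q ^ ((Suc (k + m))^2) * qpoch (-q) (q^2) (Suc (k + m)) =
         q ^ ((k + m)^2) * qpoch (-q) (q^2) (k + m) * ((q^2) ^ m * ((q^2) ^ (2 * k + 1) * (q^2) ^ m - - q * (q^2) ^ k))"
        unfolding qpoch_Suc
        by (simp add: algebra_simps power_add mult_2 power_mult power2_eq_square power_mult_distrib)
    qed auto
    moreover have "pinf (-q) (q^2) = qpoch (-q) (q^2) k * pinf (- q * (q^2) ^ k) (q^2)" by (rule pinf_split[OF q2])
    moreover have "q powi (int k^2) = q ^ (k^2)" by (metis of_nat_power power_int_of_nat)
    ultimately show ?thesis by (simp add: mult.assoc)
  qed
  show ?thesis
  proof (cases "K \<ge> 0")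
    case True
    then show ?thesis using *[of "nat K"] by simp
  next
    case False
    define k where "k = nat (- K)"
    have K: "K = - int k" using False by (simp add: k_def)
    have "int n - K = int n + int k" "int n + K = int n - int k" "K^2 = int k^2" for n by (simp_all add: K)
    then show ?thesis using *[of k] by (simp only: mult_ac)
  qed
qed

subsection \<open>The Jacobi triple product\<close>

text \<open>The finite form of the Jacobi triple product, a disguised q-binomial theorem, proved by
  a recurrence in N. R exceeds N strictly because the certificate at k = R involves the terms k and
  k + 1 at level N.\<close>

lemma finite_triple_product:
  fixes h :: complex and A B N :: nat and R :: int
  assumes gen: "generic_base h" and BA: "B < A" and R: "int N < R"
  defines "Q \<equiv> h ^ (2 * A)"
  shows "qpoch (h ^ (A - B)) Q N * qpoch (h ^ (A + B)) Q N
     = qpoch Q Q (2 * N) * (\<Sum>k=-R..R. (-1) powi k * h powi (int A * k^2 + int B * k) * (qpoch_recip Q (int N - k) * qpoch_recip Q (int N + k)))"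
  using R
proof (induction N)
  case 0
  have "(\<Sum>k=-R..R. (-1) powi k * h powi (int A * k^2 + int B * k) * (qpoch_recip Q (int 0 - k) * qpoch_recip Q (int 0 + k)))
     = (\<Sum>k\<in>{0}. (-1) powi k * h powi (int A * k^2 + int B * k) * (qpoch_recip Q (int 0 - k) * qpoch_recip Q (int 0 + k)))"
    using 0 by (intro sum.mono_neutral_right) (auto simp: qpoch_recip_def split: if_splits)
  then show ?case by simp
next
  case (Suc N)
  have h0: "h \<noteq> 0" using gen by (rule generic_base_nonzero)
  have genQ: "generic_base Q" unfolding Q_def using gen BA by (intro generic_base_power) auto
  have Q0: "Q \<noteq> 0" using genQ by (rule generic_base_nonzero)
  have Qp: "Q powi k = h powi (2 * int A * k)" for k by (simp add: Q_def power_int_power)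
  define x where "x = h powi (int A + int B)"
  define y where "y = h powi (int A - int B)"
  have xy: "x * y = Q"
    unfolding x_def y_def powi_mult[OF h0] using Qp[of 1] by simp
  have xp: "h ^ (A + B) = x" unfolding x_def by (metis of_nat_add power_int_of_nat)
  have yp: "h ^ (A - B) = y" unfolding y_def using BA by (metis less_imp_le of_nat_diff power_int_of_nat)
  define \<theta> where "\<theta> k = (-1) powi k * h powi (int A * k^2 + int B * k)" for k
  define V where "V N k = qpoch_recip Q (int N - k) * qpoch_recip Q (int N + k)" for N k
  define X where "X = Q powi int N"
  define F where "F k = (1 - X^2 * Q) * (1 - X^2 * Q^2) * (\<theta> k * V (Suc N) k) - (1 - x * X) * (1 - y * X) * (\<theta> k * V N k)" for k
  \<comment> \<open>Two-term certificate: neither term alone is compatible with both neighbours k +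
    1 and k - 1 of the theta coefficient.\<close>
  define G where "G k = X * Q * Q powi k * \<theta> k * V N (k + 1) - X * Q powi (- k) * \<theta> (k + 1) * V N k" for k
  have "(\<Sum>k=-R..R. F k) = 0"
  proof (rule sum_int_telescope_zero[where G = G])
    fix k
    define u where "u = Q powi k"
    define v where "v = Q powi (- k)"
    have uv: "u * v = 1" using Q0 by (simp add: u_def v_def power_int_minus)
    define n1 where "n1 = qpoch_recip Q (int N + 1 - k)"
    define n2 where "n2 = qpoch_recip Q (int N + 1 + k)"
    have a1: "qpoch_recip Q (int N - k) = (1 - X * Q * v) * n1"
      unfolding n1_def by (rule qpoch_recip_eq_pred[OF genQ]) (use Q0 in \<open>simp_all add: X_def v_def power_int_add power_int_diff power_int_minus field_simps\<close>)
    have a2: "qpoch_recip Q (int N - (k + 1)) = (1 - X * v) * qpoch_recip Q (int N - k)"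
      by (rule qpoch_recip_eq_pred[OF genQ]) (use Q0 in \<open>simp_all add: X_def v_def power_int_add power_int_diff power_int_minus field_simps\<close>)
    have b1: "qpoch_recip Q (int N + k) = (1 - X * Q * u) * n2"
      unfolding n2_def by (rule qpoch_recip_eq_pred[OF genQ]) (use Q0 in \<open>simp_all add: X_def u_def power_int_add\<close>)
    have b2: "qpoch_recip Q (int N + (k - 1)) = (1 - X * u) * qpoch_recip Q (int N + k)"
      by (rule qpoch_recip_eq_pred[OF genQ]) (use Q0 in \<open>simp_all add: X_def u_def power_int_add\<close>)
    have c: "int N - (k - 1) = int N + 1 - k" "int N + (k + 1) = int N + 1 + k" "int (Suc N) - k = int N + 1 - k"
       "int (Suc N) + k = int N + 1 + k" "k - 1 + 1 = k" by simp_all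
    have t1: "\<theta> (k + 1) = - x * u * \<theta> k"
    proof -
      have "h powi (int A * (k+1)^2 + int B * (k+1)) = x * u * h powi (int A * k^2 + int B * k)"
        unfolding x_def u_def Qp powi_mult[OF h0] by (rule arg_cong[where f="power_int h"]) (simp add: power2_eq_square algebra_simps)
      then show ?thesis unfolding \<theta>_def minus_one_powi_succ by simp
    qed
    have t2: "\<theta> (k - 1) = - y * v * \<theta> k"
    proof -
      have "h powi (int A * (k-1)^2 + int B * (k-1)) = y * v * h powi (int A * k^2 + int B * k)"
        unfolding y_def v_def Qp powi_mult[OF h0] by (rule arg_cong[where f="power_int h"]) (simp add: power2_eq_square algebra_simps)
      then show ?thesis unfolding \<theta>_def minus_one_powi_pred by simp
    qed
    have qk: "Q powi (k - 1) * Q = u" "Q powi (- (k - 1)) = Q * v"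
      using Q0 by (simp_all add: u_def v_def power_int_diff power_int_minus field_simps)
    have g1: "G k = X * Q * u * \<theta> k * (((1 - X * v) * ((1 - X * Q * v) * n1)) * n2) - X * v * (- x * u * \<theta> k) * (((1 - X * Q * v) * n1) * ((1 - X * Q * u) * n2))"
      unfolding G_def V_def t1 c a2 a1 b1 u_def[symmetric] v_def[symmetric] n2_def[symmetric] ..
    have g2: "G (k - 1) = X * u * (- y * v * \<theta> k) * (((1 - X * Q * v) * n1) * ((1 - X * Q * u) * n2)) - X * (Q * v) * \<theta> k * (n1 * ((1 - X * u) * ((1 - X * Q * u) * n2)))"
    proof -
      have "X * Q * Q powi (k - 1) = X * u" unfolding qk(1)[symmetric] by (simp only: mult_ac)
      then show ?thesis unfolding G_def V_def c t2 qk(2) b2 a1 b1 n1_def[symmetric] by simp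
    qed
    have f: "F k = (1 - X^2 * Q) * (1 - X^2 * Q^2) * (\<theta> k * (n1 * n2)) - (1 - x * X) * (1 - y * X) * (\<theta> k * (((1 - X * Q * v) * n1) * ((1 - X * Q * u) * n2)))"
      unfolding F_def V_def c a1 b1 n1_def[symmetric] n2_def[symmetric] ..
    show "F k = G k - G (k - 1)"
      unfolding f g1 g2 using uv xy by algebra
  qed (use Suc.prems in \<open>simp_all add: G_def V_def\<close>)
  then have *: "(1 - X^2 * Q) * (1 - X^2 * Q^2) * (\<Sum>k=-R..R. \<theta> k * V (Suc N) k) = (1 - x * X) * (1 - y * X) * (\<Sum>k=-R..R. \<theta> k * V N k)"
    by (simp add: F_def sum_subtractf sum_distrib_left)
  have IH: "qpoch y Q N * qpoch x Q N = qpoch Q Q (2 * N) * (\<Sum>k=-R..R. \<theta> k * V N k)"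
    using Suc unfolding xp yp \<theta>_def V_def by simp
  have Qs: "qpoch Q Q (2 * Suc N) = qpoch Q Q (2 * N) * ((1 - X^2 * Q) * (1 - X^2 * Q^2))"
  proof -
    have "2 * Suc N = Suc (Suc (2 * N))" by simp
    moreover have "Q ^ Suc (2 * N) = X^2 * Q" "Q ^ Suc (Suc (2 * N)) = X^2 * Q^2"
      by (simp_all add: X_def power_mult power2_eq_square power_mult_distrib)
    ultimately show ?thesis by (simp only: qpoch_self_Suc mult.assoc)
  qed
  have "qpoch y Q (Suc N) * qpoch x Q (Suc N) = (qpoch y Q N * qpoch x Q N) * ((1 - x * X) * (1 - y * X))"
    by (simp add: qpoch_Suc X_def mult_ac)
  also have "\<dots> = qpoch Q Q (2 * N) * ((1 - x * X) * (1 - y * X) * (\<Sum>k=-R..R. \<theta> k * V N k))"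
    unfolding IH by (simp only: mult_ac)
  also have "\<dots> = qpoch Q Q (2 * Suc N) * (\<Sum>k=-R..R. \<theta> k * V (Suc N) k)"
    unfolding *[symmetric] Qs by (simp only: mult_ac)
  finally show ?case unfolding xp yp \<theta>_def V_def by simp
qed

text \<open>The limit of \<open>finite_triple_product\<close> by Tannery's theorem. B < A gives A
  k^2 + B k >= |k|, hence a geometric majorant for the theta terms, while the q-binomial
  coefficients are bounded uniformly and tend to 1/(Q;Q)_\<infinity>.\<close>

theorem jacobi_triple_product:
  fixes h :: complex and A B :: nat
  assumes h: "norm h < 1" "h \<noteq> 0" and BA: "B < A"
  defines "Q \<equiv> h ^ (2 * A)"
  shows "((\<lambda>k. (-1) powi k * h powi (int A * k^2 + int B * k)) has_sum
     (pinf (h ^ (A - B)) Q * pinf (h ^ (A + B)) Q * pinf Q Q)) UNIV"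
proof -
  have gen: "generic_base h" using h by (simp add: generic_base_unit_disc)
  have genQ: "generic_base Q" unfolding Q_def using gen BA by (intro generic_base_power) auto
  have Q: "norm Q < 1" unfolding Q_def norm_power using h BA by (subst power_less_one_iff) auto
  define \<theta> where "\<theta> k = (-1) powi k * h powi (int A * k^2 + int B * k)" for k
  have bound: "norm (\<theta> k) \<le> norm h ^ nat \<bar>k\<bar>" for k
  proof -
    have "\<bar>k\<bar> \<le> int A * k^2 + int B * k"
    proof -
      have "int B * \<bar>k\<bar> + \<bar>k\<bar> \<le> int A * \<bar>k\<bar>" using BA mult_right_mono[of "int B + 1" "int A" "\<bar>k\<bar>"] by (simp add: algebra_simps)
      moreover have "int A * \<bar>k\<bar> \<le> int A * k^2"
      proof (rule mult_left_mono)
        show "\<bar>k\<bar> \<le> k^2" using self_le_power[of "\<bar>k\<bar>" 2] by (cases "k = 0") auto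
      qed simp
      moreover have "- (int B * k) \<le> int B * \<bar>k\<bar>" using mult_left_mono[of "- k" "\<bar>k\<bar>" "int B"] by simp
      ultimately show ?thesis by linarith
    qed
    then have "norm h powi (int A * k^2 + int B * k) \<le> norm h powi \<bar>k\<bar>"
      using h by (intro power_int_decreasing) auto
    then show ?thesis by (simp add: \<theta>_def norm_mult norm_power_int power_int_nonneg_exp)
  qed
  \<comment> \<open>Grouping k with -k turns the bilateral sum into an ordinary series, which is
    possible since the coefficients \<open>c N j\<close> are even in k.\<close>
  define b where "b j = (if j = 0 then \<theta> 0 else \<theta> (int j) + \<theta> (- int j))" for j :: nat
  have b_bound: "norm (b j) \<le> 2 * norm h ^ j" for j
  proof (cases "j = 0")
    case False
    then show ?thesis using norm_triangle_ineq[of "\<theta> (int j)" "\<theta> (- int j)"] bound[of "int j"] bound[of "- int j"]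
      by (simp add: b_def)
  qed (use bound[of 0] in \<open>simp add: b_def\<close>)
  define c where "c N j = qpoch Q Q (2 * N) * (qpoch_recip Q (int N - int j) * qpoch_recip Q (int N + int j))" for N j
  obtain C1 where C1: "\<And>n. norm (qpoch Q Q n) \<le> C1" using qpoch_bounded[OF Q] by blast
  obtain C2 where C2: "\<And>n. norm (1 / qpoch Q Q n) \<le> C2" using qpoch_inverse_bounded[OF Q Q] by blast
  have C0: "C1 \<ge> 0" "C2 \<ge> 0" using C1[of 0] C2[of 0] norm_ge_zero order_trans by blast+
  have rc: "norm (qpoch_recip Q m) \<le> C2" for m using C2[of "nat m"] C0 by (simp add: qpoch_recip_def)
  have c_bound: "norm (c N j) \<le> C1 * (C2 * C2)" for N j
    unfolding c_def norm_mult using C0 by (intro mult_mono C1 rc mult_nonneg_nonneg) auto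
  have c_lim: "(\<lambda>N. c N j) \<longlonglongrightarrow> 1 / pinf Q Q" for j
  proof -
    have pz: "pinf Q Q \<noteq> 0" using Q by (simp add: pinf_nonzero)
    have f2: "filterlim (\<lambda>N. 2 * N) sequentially (sequentially :: nat filter)" by (rule filterlim_subseq) (simp add: strict_mono_def)
    have l1: "(\<lambda>N. qpoch Q Q (2 * N)) \<longlonglongrightarrow> pinf Q Q" by (rule filterlim_compose[OF qpoch_LIMSEQ[OF Q] f2])
    have l2: "(\<lambda>N. 1 / qpoch Q Q N) \<longlonglongrightarrow> 1 / pinf Q Q" by (intro tendsto_intros qpoch_LIMSEQ Q pz)
    have l3: "(\<lambda>N. qpoch_recip Q (int N - int j)) \<longlonglongrightarrow> 1 / pinf Q Q"
    proof (rule LIMSEQ_offset[of _ j])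
      show "(\<lambda>n. qpoch_recip Q (int (n + j) - int j)) \<longlonglongrightarrow> 1 / pinf Q Q" using l2 by simp
    qed
    have l4: "(\<lambda>N. qpoch_recip Q (int N + int j)) \<longlonglongrightarrow> 1 / pinf Q Q"
      unfolding of_nat_add[symmetric] qpoch_recip_of_nat by (rule LIMSEQ_ignore_initial_segment[OF l2])
    have "(\<lambda>N. c N j) \<longlonglongrightarrow> pinf Q Q * (1 / pinf Q Q * (1 / pinf Q Q))"
      unfolding c_def by (intro tendsto_mult l1 l3 l4)
    then show ?thesis using pz by simp
  qed
  have fin: "qpoch (h ^ (A - B)) Q N * qpoch (h ^ (A + B)) Q N = (\<Sum>j. c N j * b j)" for N
  proof -
    define g where "g k = \<theta> k * (qpoch_recip Q (int N - k) * qpoch_recip Q (int N + k))" for k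
    have "(\<Sum>k=- int (Suc N)..int (Suc N). g k) = (\<Sum>j\<le>Suc N. if j = 0 then g 0 else g (int j) + g (- int j))" for N
    proof (induction N)
      case 0
      have "{- int (Suc 0)..int (Suc 0)} = {-1,0,1}" by auto
      then show ?case by (simp add: algebra_simps)
    next
      case (Suc N)
      have "{- int (Suc (Suc N))..int (Suc (Suc N))} = insert (- int (Suc (Suc N))) (insert (int (Suc (Suc N))) {- int (Suc N)..int (Suc N)})" by auto
      then show ?case using Suc by (simp add: algebra_simps)
    qed
    then have "qpoch Q Q (2 * N) * (\<Sum>k=- int (Suc N)..int (Suc N). g k)
        = qpoch Q Q (2 * N) * (\<Sum>j\<le>Suc N. if j = 0 then g 0 else g (int j) + g (- int j))" by metis
    also have "\<dots> = (\<Sum>j\<le>Suc N. c N j * b j)"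
      unfolding sum_distrib_left by (rule sum.cong) (simp_all add: g_def c_def b_def algebra_simps)
    also have "(\<Sum>j\<le>Suc N. c N j * b j) = (\<Sum>j. c N j * b j)"
      by (rule suminf_finite[symmetric]) (auto simp: c_def)
    finally show ?thesis
      using finite_triple_product[OF gen BA, of N "int (Suc N)"] by (simp add: g_def \<theta>_def Q_def)
  qed
  have "(\<lambda>N. \<Sum>j. c N j * b j) \<longlonglongrightarrow> (\<Sum>j. 1 / pinf Q Q * b j)"
  proof (rule tannerys_theorem[THEN conjunct2, THEN conjunct2])
    show "(\<lambda>N. c N j * b j) \<longlonglongrightarrow> 1 / pinf Q Q * b j" for j by (intro tendsto_mult c_lim tendsto_const)
    show "eventually (\<lambda>(j, N). norm (c N j * b j) \<le> (C1 * (C2 * C2)) * (2 * norm h ^ j)) (at_top \<times>\<^sub>F sequentially)"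
    proof (intro always_eventually allI, clarify)
      fix j N
      show "norm (c N j * b j) \<le> (C1 * (C2 * C2)) * (2 * norm h ^ j)"
        unfolding norm_mult by (rule mult_mono[OF c_bound b_bound]) (use C0 in auto)
    qed
    show "summable (\<lambda>j. (C1 * (C2 * C2)) * (2 * norm h ^ j))"
      using h by (intro summable_mult summable_geometric) auto
  qed simp
  moreover have "(\<lambda>N. qpoch (h ^ (A - B)) Q N * qpoch (h ^ (A + B)) Q N) \<longlonglongrightarrow> pinf (h ^ (A - B)) Q * pinf (h ^ (A + B)) Q"
    by (intro tendsto_mult qpoch_LIMSEQ Q)
  ultimately have lim: "(\<Sum>j. 1 / pinf Q Q * b j) = pinf (h ^ (A - B)) Q * pinf (h ^ (A + B)) Q"
    unfolding fin by (rule LIMSEQ_unique)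
  have sb: "summable b"
    by (rule summable_comparison_test'[of "\<lambda>j. 2 * norm h ^ j" 0]) (use b_bound h in auto)
  have "suminf b = pinf (h ^ (A - B)) Q * pinf (h ^ (A + B)) Q * pinf Q Q"
    using lim unfolding suminf_mult[OF sb] using pinf_nonzero[OF Q Q] by (simp add: field_simps)
  then have bs: "b sums (pinf (h ^ (A - B)) Q * pinf (h ^ (A + B)) Q * pinf Q Q)"
    using summable_sums[OF sb] by simp
  have "summable (\<lambda>n. norm (\<theta> (int n)))" "summable (\<lambda>n. norm (\<theta> (- int n)))"
    using h bound[of "int _"] bound[of "- int _"]
    by (auto intro!: summable_comparison_test'[OF summable_geometric[of "norm h"], of 0])
  from has_sum_int_of_symmetric[OF this bs[unfolded b_def[abs_def]]] show ?thesis by (simp add: \<theta>_def)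
qed

subsection \<open>Interchanging the summations\<close>

text \<open>Used with introduction rules, so that a uniform bound for a long product of factorials
  in several indices is found without naming constants.\<close>

definition bounded_fun :: "('a \<Rightarrow> complex) \<Rightarrow> bool" where
  "bounded_fun f \<longleftrightarrow> (\<exists>C. \<forall>x. norm (f x) \<le> C)"

lemma bounded_fun_const: "bounded_fun (\<lambda>x. c)"
  by (auto simp: bounded_fun_def)

lemma bounded_fun_mult: "bounded_fun f \<Longrightarrow> bounded_fun g \<Longrightarrow> bounded_fun (\<lambda>x. f x * g x)"
proof -
  assume "bounded_fun f" "bounded_fun g"
  then obtain C D where C: "\<And>x. norm (f x) \<le> C" and D: "\<And>x. norm (g x) \<le> D" by (auto simp: bounded_fun_def)
  have "norm (f x * g x) \<le> C * D" for x
    unfolding norm_mult using C[of x] by (intro mult_mono C D) (auto intro: order_trans[OF norm_ge_zero])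
  then show ?thesis by (auto simp: bounded_fun_def)
qed

lemma bounded_fun_add:
  assumes "bounded_fun f" "bounded_fun g"
  shows "bounded_fun (\<lambda>x. f x + g x)"
proof -
  obtain C D where C: "\<And>x. norm (f x) \<le> C" and D: "\<And>x. norm (g x) \<le> D" using assms by (auto simp: bounded_fun_def)
  have "norm (f x + g x) \<le> C + D" for x by (rule norm_triangle_le[OF add_mono[OF C D]])
  then show ?thesis by (auto simp: bounded_fun_def)
qed

lemma bounded_fun_diff:
  assumes "bounded_fun f" "bounded_fun g"
  shows "bounded_fun (\<lambda>x. f x - g x)"
  using bounded_fun_add[OF assms(1) bounded_fun_mult[OF bounded_fun_const[of "-1"] assms(2)]] by simp

lemma bounded_fun_if:
  assumes "bounded_fun f" "bounded_fun g"
  shows "bounded_fun (\<lambda>x. if P x then f x else g x)"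
proof -
  obtain C D where C: "\<And>x. norm (f x) \<le> C" and D: "\<And>x. norm (g x) \<le> D" using assms by (auto simp: bounded_fun_def)
  have "norm (if P x then f x else g x) \<le> max C D" for x using C[of x] D[of x] by auto
  then show ?thesis unfolding bounded_fun_def by blast
qed

lemma bounded_fun_compose: "bounded_fun f \<Longrightarrow> bounded_fun (\<lambda>x. f (g x))"
  by (auto simp: bounded_fun_def)

lemma bounded_fun_qpoch: "norm q < 1 \<Longrightarrow> bounded_fun (\<lambda>x. qpoch a q (m x))"
  using qpoch_bounded[of q a] by (auto simp: bounded_fun_def)

lemma bounded_fun_inverse_qpoch: "norm q < 1 \<Longrightarrow> norm a < 1 \<Longrightarrow> bounded_fun (\<lambda>x. 1 / qpoch a q (m x))"
  using qpoch_inverse_bounded[of q a] by (auto simp: bounded_fun_def)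

lemma bounded_fun_divide_qpoch:
  "norm q < 1 \<Longrightarrow> norm a < 1 \<Longrightarrow> bounded_fun f \<Longrightarrow> bounded_fun (\<lambda>x. f x / qpoch a q (m x))"
  using bounded_fun_mult[OF _ bounded_fun_inverse_qpoch, of f q a m] by simp

lemma bounded_fun_qpoch_recip: "norm q < 1 \<Longrightarrow> bounded_fun (\<lambda>x. qpoch_recip q (m x))"
  unfolding qpoch_recip_def by (intro bounded_fun_if bounded_fun_const bounded_fun_inverse_qpoch)

lemma bounded_fun_sign: "bounded_fun (\<lambda>x. (-1) ^ m x)" "bounded_fun (\<lambda>x. (-1) powi k x)"
  by (auto simp: bounded_fun_def norm_power norm_power_int intro!: exI[of _ 1])

lemma bounded_fun_power: "norm q \<le> 1 \<Longrightarrow> bounded_fun (\<lambda>x. q ^ m x)"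
  by (auto simp: bounded_fun_def norm_power power_le_one intro!: exI[of _ 1])

lemma bounded_fun_powi:
  assumes "norm q \<le> 1" "q \<noteq> 0" "\<And>x. E x \<ge> - c"
  shows "bounded_fun (\<lambda>x. q powi E x)"
proof -
  have "norm (q powi E x) \<le> norm q powi (- c)" for x
    unfolding norm_power_int using assms by (intro power_int_decreasing) auto
  then show ?thesis by (auto simp: bounded_fun_def)
qed

lemmas bounded_fun_intros = bounded_fun_const bounded_fun_mult bounded_fun_divide_qpoch bounded_fun_qpoch
  bounded_fun_qpoch_recip bounded_fun_sign bounded_fun_power bounded_fun_if bounded_fun_add bounded_fun_diff

lemma summable_on_geometric_product:
  fixes z :: real
  assumes "0 < z" "z < 1"
  shows "(\<lambda>(n, r). z ^ n * z ^ r) summable_on (UNIV \<times> UNIV)"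
    and "(\<lambda>(n, k). z ^ n * z ^ nat \<bar>k\<bar>) summable_on (UNIV \<times> (UNIV :: int set))"
proof -
  have g: "((\<lambda>n. z ^ n) has_sum (1 / (1 - z))) UNIV"
    using assms by (intro norm_summable_imp_has_sum geometric_sums summable_geometric) (auto simp: norm_power)
  have s: "(\<lambda>n. z ^ n * S) summable_on UNIV" for S
    using has_sum_cmult_left[OF g, of S] by (auto simp: summable_on_def)
  have prod: "(\<lambda>(n, r). z ^ n * f r) summable_on (UNIV \<times> UNIV)" if "(f has_sum S) UNIV" "\<And>r. f r \<ge> 0" for f :: "'b \<Rightarrow> real" and S
    by (rule summable_on_SigmaI[where g = "\<lambda>n. z ^ n * S"]) (use that assms s in \<open>auto intro: has_sum_cmult_right\<close>)
  show "(\<lambda>(n, r). z ^ n * z ^ r) summable_on (UNIV \<times> UNIV)"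
    using prod[OF g] assms by simp
  have i: "((\<lambda>k. z ^ nat \<bar>k\<bar>) has_sum (1 / (1 - z))) (range int)"
    using g by (subst has_sum_reindex) (auto simp: o_def)
  have j: "((\<lambda>k. z ^ nat \<bar>k\<bar>) has_sum (1 / (1 - z) * z)) (range (\<lambda>n. - int (Suc n)))"
  proof -
    have "((\<lambda>n. z ^ n * z) has_sum (1 / (1 - z) * z)) UNIV" by (rule has_sum_cmult_left[OF g])
    moreover have "(\<lambda>k. z ^ nat \<bar>k\<bar>) \<circ> (\<lambda>n. - int (Suc n)) = (\<lambda>n. z ^ n * z)"
    proof
      fix n
      have "nat \<bar>- int (Suc n)\<bar> = Suc n" by simp
      then show "((\<lambda>k. z ^ nat \<bar>k\<bar>) \<circ> (\<lambda>n. - int (Suc n))) n = z ^ n * z" by (simp only: o_def power_Suc mult.commute)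
    qed
    ultimately show ?thesis by (subst has_sum_reindex) (auto simp: inj_on_def)
  qed
  have "range int \<inter> range (\<lambda>n. - int (Suc n)) = {}" by force
  moreover have "range int \<union> range (\<lambda>n. - int (Suc n)) = UNIV"
  proof -
    have "k \<in> range int \<union> range (\<lambda>n. - int (Suc n))" for k by (cases k rule: int_cases) auto
    then show ?thesis by blast
  qed
  ultimately have "((\<lambda>k :: int. z ^ nat \<bar>k\<bar>) has_sum (1 / (1 - z) + 1 / (1 - z) * z)) UNIV"
    using has_sum_Un_disjoint[OF i j] by simp
  then show "(\<lambda>(n, k). z ^ n * z ^ nat \<bar>k\<bar>) summable_on (UNIV \<times> (UNIV :: int set))"
    using assms by (intro prod) auto
qed

lemma has_sum_finite_support:
  fixes f :: "'a \<Rightarrow> complex"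
  assumes "finite A" "\<And>x. x \<notin> A \<Longrightarrow> f x = 0"
  shows "(f has_sum (\<Sum>x\<in>A. f x)) UNIV"
  by (rule has_sum_finite_neutralI[of A]) (use assms in auto)

text \<open>Both double families are absolutely summable and have the same row sums, so the first
  total equals the second, which is then summed by columns. The column range -n-1..n covers s = 0
  and s = 1 alike.\<close>

lemma double_sum_interchange:
  fixes t :: "nat \<Rightarrow> nat \<Rightarrow> complex" and g :: "nat \<Rightarrow> int \<Rightarrow> complex"
  assumes y: "0 < y" "y < 1"
    and t0: "\<And>n r. r > n \<Longrightarrow> t n r = 0" and tb: "\<And>n r. norm (t n r) \<le> C * y ^ n"
    and g0: "\<And>n k. k < - int n - 1 \<or> k > int n \<Longrightarrow> g n k = 0" and gb: "\<And>n k. norm (g n k) \<le> D * y ^ n"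
    and eq: "\<And>n. (\<Sum>r\<le>n. t n r) = (\<Sum>k=-int n - 1..int n. g n k)"
    and G: "\<And>k. ((\<lambda>n. g n k) has_sum G k) UNIV" and Z: "(G has_sum Z) UNIV"
  shows "((\<lambda>(n, r). t n r) has_sum Z) (UNIV \<times> UNIV)"
proof -
  \<comment> \<open>The decay y^n is spent in halves: since r <= n on the support, z^n z^n is at
    most z^n z^r, which is summable in both indices.\<close>
  define z where "z = sqrt y"
  have z: "0 < z" "z < 1" using y by (simp_all add: z_def)
  have yz: "y ^ n = z ^ n * z ^ n" for n using y by (simp add: z_def flip: power_mult_distrib)
  have C0: "C \<ge> 0" using order_trans[OF norm_ge_zero tb[of 0 0]] by simp
  have D0: "D \<ge> 0" using order_trans[OF norm_ge_zero gb[of 0 0]] by simp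
  have "(\<lambda>x. norm (case x of (n, r) \<Rightarrow> t n r)) summable_on (UNIV \<times> UNIV)"
  proof (rule Infinite_Sum.abs_summable_on_comparison_test'[where g = "\<lambda>x. C * (case x of (n, r) \<Rightarrow> z ^ n * z ^ r)"], goal_cases)
    case 1
    show ?case by (rule summable_on_cmult_right[OF summable_on_geometric_product(1)[OF z]])
  next
    case (2 x)
    obtain n r where x: "x = (n, r)" by (cases x)
    show ?case
    proof (cases "r \<le> n")
      case True
      have "norm (t n r) \<le> C * (z ^ n * z ^ n)" using tb[of n r] by (simp add: yz)
      also have "\<dots> \<le> C * (z ^ n * z ^ r)"
        using C0 z True by (intro mult_left_mono power_decreasing) auto
      finally show ?thesis using C0 z by (simp add: x abs_mult)
    qed (use C0 z t0 in \<open>simp add: x\<close>)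
  qed
  then obtain a where a: "((\<lambda>(n, r). t n r) has_sum a) (UNIV \<times> UNIV)"
    using abs_summable_summable unfolding summable_on_def by blast
  have "((\<lambda>r. (case (n, r) of (n, r) \<Rightarrow> t n r)) has_sum (\<Sum>r\<le>n. t n r)) UNIV" for n
    using has_sum_finite_support[of "{..n}" "t n"] t0 by auto
  then have a': "((\<lambda>n. \<Sum>r\<le>n. t n r) has_sum a) UNIV"
    by (intro has_sum_SigmaD[OF a]) auto
  have "(\<lambda>x. norm (case x of (n, k) \<Rightarrow> g n k)) summable_on (UNIV \<times> UNIV)"
  \<comment> \<open>The factor 1/z is needed because |k| can reach n + 1.\<close>
  proof (rule Infinite_Sum.abs_summable_on_comparison_test'[where g = "\<lambda>x. (D / z) * (case x of (n, k) \<Rightarrow> z ^ n * z ^ nat \<bar>k\<bar>)"], goal_cases)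
    case 1
    show ?case by (rule summable_on_cmult_right[OF summable_on_geometric_product(2)[OF z]])
  next
    case (2 x)
    obtain n k where x: "x = (n, k)" by (cases x)
    show ?case
    proof (cases "k < - int n - 1 \<or> k > int n")
      case False
      then have kn: "nat \<bar>k\<bar> \<le> Suc n" by auto
      have "norm (g n k) \<le> D * (z ^ n * z ^ n)" using gb[of n k] by (simp add: yz)
      also have "\<dots> = (D / z) * (z ^ n * z ^ Suc n)" using z by simp
      also have "\<dots> \<le> (D / z) * (z ^ n * z ^ nat \<bar>k\<bar>)"
        using D0 z kn by (intro mult_left_mono power_decreasing) auto
      finally show ?thesis using D0 z by (simp add: x abs_mult)
    qed (use D0 z g0 in \<open>simp add: x\<close>)
  qed
  then obtain b where b: "((\<lambda>(n, k). g n k) has_sum b) (UNIV \<times> UNIV)"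
    using abs_summable_summable unfolding summable_on_def by blast
  have "((\<lambda>k. (case (n, k) of (n, k) \<Rightarrow> g n k)) has_sum (\<Sum>k=-int n - 1..int n. g n k)) UNIV" for n
    unfolding prod.case by (rule has_sum_finite_support) (auto intro!: g0)
  then have b': "((\<lambda>n. \<Sum>r\<le>n. t n r) has_sum b) UNIV"
    unfolding eq by (intro has_sum_SigmaD[OF b]) auto
  from b have "((\<lambda>(k, n). g n k) has_sum b) (UNIV \<times> UNIV)"
    by (subst (asm) has_sum_swap) simp
  then have "(G has_sum b) UNIV" by (rule has_sum_SigmaD) (use G in simp)
  then have "b = Z" using Z has_sum_unique by blast
  moreover have "a = b" using a' b' has_sum_unique by blast
  ultimately show ?thesis using a by simp
qed

subsection \<open>Bailey pairs and dilation\<close>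

text \<open>Besides the pair relation it records growth: b and f themselves may be unbounded, as for
  the dual pairs, but they always occur multiplied by q^(r^2+sr) and q^(k^2+sk).\<close>

definition bailey_pair :: "int \<Rightarrow> complex \<Rightarrow> (nat \<Rightarrow> complex) \<Rightarrow> (int \<Rightarrow> complex) \<Rightarrow> bool" where
  "bailey_pair s q b f \<longleftrightarrow> (\<forall>R r. int r \<le> R \<longrightarrow> b r = bailey_sum s q R r f)
     \<and> bounded_fun (\<lambda>r. q powi (int r^2 + s * int r) * b r) \<and> bounded_fun (\<lambda>k. f k * q powi (k^2 + s * k))"

text \<open>The decay in n is provided by w alone: d absorbs the growth of b, and the factor created
  by the dilation absorbs that of f. This is what makes both families admissible in
  \<open>double_sum_interchange\<close>.\<close>

theorem dilation_sum:
  fixes b w :: "nat \<Rightarrow> complex" and d :: "nat \<Rightarrow> nat \<Rightarrow> complex" and f P \<omega> :: "int \<Rightarrow> complex"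
  assumes y: "0 < y" "y < 1"
    and s: "s = 0 \<or> s = (1 :: int)"
    and pair: "bailey_pair s q b f"
    and dil: "\<And>n k. (\<Sum>r\<le>n. d n r * (qpoch_recip q (int r - k) * qpoch_recip q (int r + k + s))) = q powi (k^2 + s * k) * V n k"
    and w: "\<And>k. ((\<lambda>n. w n * V n k) has_sum \<omega> k) UNIV" "\<And>n. norm (w n) \<le> A * y ^ n"
    and d: "\<And>n r. r > n \<Longrightarrow> d n r = 0" "\<And>n r. norm (d n r) \<le> B * norm (q powi (int r^2 + s * int r))"
    and V: "\<And>n k. k < - int n - 1 \<or> k > int n \<Longrightarrow> V n k = 0" "\<And>n k. norm (V n k) \<le> D"
    and Z: "((\<lambda>k. (-1) powi k * f k * q powi (k^2 + s * k) * \<omega> k) has_sum Z) UNIV"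
  shows "((\<lambda>(n, r). w n * d n r * b r) has_sum Z) (UNIV \<times> UNIV)"
proof -
  define g where "g n k = w n * ((-1) powi k * (f k * q powi (k^2 + s * k)) * V n k)" for n k
  obtain E where E: "\<And>r. norm (q powi (int r^2 + s * int r) * b r) \<le> E"
    using pair by (auto simp: bailey_pair_def bounded_fun_def)
  obtain F where F: "\<And>k. norm (f k * q powi (k^2 + s * k)) \<le> F"
    using pair by (auto simp: bailey_pair_def bounded_fun_def)
  have A0: "A \<ge> 0" using order_trans[OF norm_ge_zero w(2)[of 0]] by simp
  have F0: "F \<ge> 0" and D0: "D \<ge> 0" and E0: "E \<ge> 0" using order_trans[OF norm_ge_zero F[of 0]] order_trans[OF norm_ge_zero V(2)[of 0 0]] order_trans[OF norm_ge_zero E[of 0]] by auto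
  show ?thesis
  proof (rule double_sum_interchange[OF y, where g = g])
    show "w n * d n r * b r = 0" if "r > n" for n r using d(1)[OF that] by simp
    show "norm (w n * d n r * b r) \<le> (A * (\<bar>B\<bar> * E)) * y ^ n" for n r
    proof -
      have "norm (d n r * b r) \<le> \<bar>B\<bar> * norm (q powi (int r^2 + s * int r)) * norm (b r)"
        unfolding norm_mult by (intro mult_right_mono order_trans[OF d(2)]) auto
      also have "\<dots> \<le> \<bar>B\<bar> * E" using E[of r] by (simp add: norm_mult mult.assoc mult_left_mono)
      finally have "norm (d n r * b r) \<le> \<bar>B\<bar> * E" .
      then have "norm (w n) * norm (d n r * b r) \<le> (A * y ^ n) * (\<bar>B\<bar> * E)"
        using A0 y by (intro mult_mono w(2)) auto
      then show ?thesis by (simp add: norm_mult mult_ac)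
    qed
    show "g n k = 0" if "k < - int n - 1 \<or> k > int n" for n k using V(1)[OF that] by (simp add: g_def)
    show "norm (g n k) \<le> (A * (F * D)) * y ^ n" for n k
    proof -
      have "norm ((-1) powi k * (f k * q powi (k^2 + s * k)) * V n k) = norm (f k * q powi (k^2 + s * k)) * norm (V n k)"
        by (simp add: norm_mult norm_power_int)
      also have "\<dots> \<le> F * D" using F0 by (intro mult_mono F V) auto
      finally have "norm (w n) * norm ((-1) powi k * (f k * q powi (k^2 + s * k)) * V n k) \<le> (A * y ^ n) * (F * D)"
        using A0 y by (intro mult_mono w(2)) auto
      then show ?thesis by (simp add: g_def norm_mult mult_ac)
    qed
    show "(\<Sum>r\<le>n. w n * d n r * b r) = (\<Sum>k=-int n - 1..int n. g n k)" for n
    proof -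
      define U where "U r k = qpoch_recip q (int r - k) * qpoch_recip q (int r + k + s)" for r k
      have "b r = (\<Sum>k=-int n - 1..int n. (-1) powi k * f k * U r k)" if "r \<le> n" for r
      proof -
        have "b r = bailey_sum s q (int n) r f" using pair that by (simp add: bailey_pair_def)
        also have "\<dots> = (\<Sum>k=-int n - 1..int n. (-1) powi k * f k * U r k)"
          unfolding bailey_sum_def U_def using s that by (intro sum.mono_neutral_left) auto
        finally show ?thesis .
      qed
      then have "(\<Sum>r\<le>n. w n * d n r * b r) = (\<Sum>r\<le>n. w n * d n r * (\<Sum>k=-int n - 1..int n. (-1) powi k * f k * U r k))"
        by (intro sum.cong) auto
      also have "\<dots> = (\<Sum>r\<le>n. \<Sum>k=-int n - 1..int n. w n * ((-1) powi k * f k * (d n r * U r k)))"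
        by (simp add: sum_distrib_left mult_ac)
      also have "\<dots> = (\<Sum>k=-int n - 1..int n. \<Sum>r\<le>n. w n * ((-1) powi k * f k * (d n r * U r k)))"
        by (rule sum.swap)
      also have "\<dots> = (\<Sum>k=-int n - 1..int n. w n * ((-1) powi k * f k * (\<Sum>r\<le>n. d n r * U r k)))"
        by (simp add: sum_distrib_left)
      also have "\<dots> = (\<Sum>k=-int n - 1..int n. g n k)"
        unfolding U_def dil g_def by (simp add: mult_ac)
      finally show ?thesis .
    qed
    show "((\<lambda>n. g n k) has_sum ((-1) powi k * f k * q powi (k^2 + s * k) * \<omega> k)) UNIV" for k
      using has_sum_cmult_right[OF w(1), of "(-1) powi k * f k * q powi (k^2 + s * k)" k] by (simp add: g_def mult_ac)
    show "((\<lambda>k. (-1) powi k * f k * q powi (k^2 + s * k) * \<omega> k) has_sum Z) UNIV" by (rule Z)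
  qed
qed

lemma int_abs_le_square: "\<bar>k\<bar> \<le> k^2" for k :: int
  using self_le_power[of "\<bar>k\<bar>" 2] by (cases "k = 0") auto

lemma int_square_bounds: "k \<le> k^2" "- k \<le> k^2" "3 * k \<le> k^2 + 3" for k :: int
proof -
  show "k \<le> k^2" "- k \<le> k^2" using int_abs_le_square[of k] by auto
  have "0 \<le> (2 * k - 3)^2" by simp
  then show "3 * k \<le> k^2 + 3" by (simp add: power2_eq_square algebra_simps)
qed

text \<open>For s = 0 only the even part of f matters. The even part is what
  \<open>weight_triangular\<close> requires: averaging q^(K/2) and q^(-K/2) produces the factor 1 +
  q^K that cancels its denominator.\<close>

lemma bailey_pair_symmetrize:
  assumes "bailey_pair 0 q b f"
  shows "bailey_pair 0 q b (\<lambda>k. (f k + f (- k)) / 2)"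
proof -
  have "bailey_sum 0 q R r (\<lambda>k. (f k + f (- k)) / 2) = bailey_sum 0 q R r f" for R r
  proof -
    have "bailey_sum 0 q R r (\<lambda>k. (f k + f (- k)) / 2) = bailey_sum 0 q R r (\<lambda>k. (1/2) * (f k + f (- k)))"
      by (rule bailey_sum_cong) simp
    also have "\<dots> = (1/2) * (bailey_sum 0 q R r f + bailey_sum 0 q R r (\<lambda>k. f (- k)))"
      by (simp only: bailey_sum_cmult bailey_sum_add)
    also have "bailey_sum 0 q R r (\<lambda>k. f (- k)) = bailey_sum 0 q R r f"
      by (rule bailey_sum_reflect_even) simp
    finally show ?thesis by simp
  qed
  moreover have "bounded_fun (\<lambda>k. ((f k + f (- k)) / 2) * q powi (k^2 + 0 * k))"
  proof -
    have *: "bounded_fun (\<lambda>k. f k * q powi (k^2 + 0 * k))" using assms by (simp add: bailey_pair_def)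
    have "bounded_fun (\<lambda>k. (1/2) * (f k * q powi (k^2 + 0 * k) + f (- k) * q powi ((- k)^2 + 0 * (- k))))"
      by (intro bounded_fun_intros * bounded_fun_compose[OF *])
    moreover have "((f k + f (- k)) / 2) * q powi (k^2 + 0 * k)
        = (1/2) * (f k * q powi (k^2 + 0 * k) + f (- k) * q powi ((- k)^2 + 0 * (- k)))" for k
      by (simp add: field_simps)
    ultimately show ?thesis by (simp only:)
  qed
  ultimately show ?thesis using assms by (simp add: bailey_pair_def)
qed

context
  fixes h q :: complex
  assumes h: "h \<noteq> 0" "norm h < 1" and hq: "q = h^2"
begin

lemma q_lt: "norm q < 1" "q \<noteq> 0" "generic_base q"
proof -
  show "norm q < 1" "q \<noteq> 0" using h by (simp_all add: hq norm_power power_less_one_iff)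
  then show "generic_base q" by (simp add: generic_base_unit_disc)
qed

lemma bounded_qr: "s \<in> {0,1} \<Longrightarrow> bounded_fun (\<lambda>r. q powi (int r^2 + s * int r))"
  by (rule bounded_fun_powi[of _ 0]) (use q_lt in auto)

lemma bounded_h_powi: "bounded_fun (\<lambda>x. h powi F x * q powi E x)"
  if "\<And>x. - c \<le> F x + 2 * E x" for E F :: "'a \<Rightarrow> int"
proof -
  have "h powi F x * q powi E x = h powi (F x + 2 * E x)" for x
    using h by (simp add: hq power_int_power power_int_add)
  then show ?thesis using bounded_fun_powi[of h c "\<lambda>x. F x + 2 * E x"] h that by simp
qed

lemma bounded_dual: "bounded_fun (\<lambda>r. q powi E r * ((-1) ^ r * h powi F r * qpoch_recip q (int r)))"
  if "\<And>r. - c \<le> F r + 2 * E r" for E F :: "nat \<Rightarrow> int"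
proof -
  have "bounded_fun (\<lambda>r. (-1) ^ r * ((h powi F r * q powi E r) * qpoch_recip q (int r)))"
    by (intro bounded_fun_intros bounded_h_powi[of c] that q_lt)
  then show ?thesis by (simp add: mult_ac)
qed

lemma bailey_pair_1: "bailey_pair 0 q (\<lambda>r. qpoch_recip q (int r)) (\<lambda>k. h powi (3*k^2 + k))"
  unfolding bailey_pair_def
proof (intro conjI)
  show "bounded_fun (\<lambda>r. q powi (int r^2 + 0 * int r) * qpoch_recip q (int r))"
    by (intro bounded_fun_intros bounded_qr q_lt) simp
  show "bounded_fun (\<lambda>k. h powi (3*k^2 + k) * q powi (k^2 + 0 * k))"
  proof (rule bounded_h_powi[of 0])
    show "- 0 \<le> 3*k^2 + k + 2 * (k^2 + 0 * k)" for k :: int using int_square_bounds[of k]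
      by (simp only: mult_zero_left mult_1_left add_0_right minus_zero; linarith)
  qed
qed (use pair_1[OF q_lt(3) hq] in auto)

lemma bailey_pair_3: "bailey_pair 0 q (\<lambda>r. q ^ r * qpoch_recip q (int r)) (\<lambda>k. h powi (3*k^2 + 3*k))"
  unfolding bailey_pair_def
proof (intro conjI)
  show "bounded_fun (\<lambda>r. q powi (int r^2 + 0 * int r) * (q ^ r * qpoch_recip q (int r)))"
    by (intro bounded_fun_intros bounded_qr q_lt less_imp_le[OF q_lt(1)]) simp
  show "bounded_fun (\<lambda>k. h powi (3*k^2 + 3*k) * q powi (k^2 + 0 * k))"
  proof (rule bounded_h_powi[of 0])
    show "- 0 \<le> 3*k^2 + 3*k + 2 * (k^2 + 0 * k)" for k :: int using int_square_bounds[of k]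
      by (simp only: mult_zero_left mult_1_left add_0_right minus_zero; linarith)
  qed
qed (use pair_1[OF q_lt(3) hq] pair_3[OF q_lt(3) hq] in auto)

lemma bailey_pair_5: "bailey_pair 0 q (\<lambda>r. (q ^ (2 * r + 1) + q ^ r - 1) / q * qpoch_recip q (int r)) (\<lambda>k. h powi (3*k^2 + 5*k))"
  unfolding bailey_pair_def
proof (intro conjI allI impI)
  show "bounded_fun (\<lambda>r. q powi (int r^2 + 0 * int r) * ((q ^ (2 * r + 1) + q ^ r - 1) / q * qpoch_recip q (int r)))"
    unfolding divide_inverse
    by (intro bounded_fun_intros bounded_qr q_lt less_imp_le[OF q_lt(1)]) simp
  show "bounded_fun (\<lambda>k. h powi (3*k^2 + 5*k) * q powi (k^2 + 0 * k))"
  proof (rule bounded_h_powi[of 0])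
    show "- 0 \<le> 3*k^2 + 5*k + 2 * (k^2 + 0 * k)" for k :: int using int_square_bounds[of k]
      by (simp only: mult_zero_left mult_1_left add_0_right minus_zero; linarith)
  qed
  fix R r assume "int r \<le> R"
  note p5 = pair_5[OF q_lt(3) hq this]
  have "bailey_sum 0 q R r (\<lambda>k. h powi (3*k^2 + 5*k)) = q * bailey_sum 0 q R r (\<lambda>k. h powi (3*k^2 + 5*k)) / q"
    using q_lt(2) by simp
  then show "(q ^ (2 * r + 1) + q ^ r - 1) / q * qpoch_recip q (int r) = bailey_sum 0 q R r (\<lambda>k. h powi (3*k^2 + 5*k))"
    unfolding p5 by simp
qed

lemma bailey_pair_dual_1:
  "bailey_pair 0 q (\<lambda>r. (-1) ^ r * h powi (-(int r^2) - int r) * qpoch_recip q (int r)) (\<lambda>k. h powi (-(k^2) - k))"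
  unfolding bailey_pair_def
proof (intro conjI)
  show "bounded_fun (\<lambda>r. q powi (int r^2 + 0 * int r) * ((-1) ^ r * h powi (-(int r^2) - int r) * qpoch_recip q (int r)))"
  proof (rule bounded_dual[of 0])
    show "- 0 \<le> -(int r^2) - int r + 2 * (int r^2 + 0 * int r)" for r using int_square_bounds[of "int r"]
      by (simp only: mult_zero_left mult_1_left add_0_right minus_zero; linarith)
  qed
  show "bounded_fun (\<lambda>k. h powi (-(k^2) - k) * q powi (k^2 + 0 * k))"
  proof (rule bounded_h_powi[of 0])
    show "- 0 \<le> -(k^2) - k + 2 * (k^2 + 0 * k)" for k :: int using int_square_bounds[of k]
      by (simp only: mult_zero_left mult_1_left add_0_right minus_zero; linarith)
  qed
qed (use dual_pair_1[OF q_lt(3) hq] in auto)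

lemma bailey_pair_dual_3:
  "bailey_pair 0 q (\<lambda>r. (-1) ^ r * h powi (-(int r^2) - 3 * int r) * qpoch_recip q (int r)) (\<lambda>k. h powi (-(k^2) - 3 * k))"
  unfolding bailey_pair_def
proof (intro conjI)
  show "bounded_fun (\<lambda>r. q powi (int r^2 + 0 * int r) * ((-1) ^ r * h powi (-(int r^2) - 3 * int r) * qpoch_recip q (int r)))"
  \<comment> \<open>The total h-exponent r^2 - 3r is negative at r = 1 and r = 2, so the bound uses
    a negative lower limit; -3 is what \<open>int_square_bounds\<close> provides.\<close>
  proof (rule bounded_dual[of 3])
    show "- 3 \<le> -(int r^2) - 3 * int r + 2 * (int r^2 + 0 * int r)" for r using int_square_bounds[of "int r"]
      by (simp only: mult_zero_left mult_1_left add_0_right minus_zero; linarith)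
  qed
  show "bounded_fun (\<lambda>k. h powi (-(k^2) - 3 * k) * q powi (k^2 + 0 * k))"
  proof (rule bounded_h_powi[of 3])
    show "- 3 \<le> -(k^2) - 3 * k + 2 * (k^2 + 0 * k)" for k :: int using int_square_bounds[of k]
      by (simp only: mult_zero_left mult_1_left add_0_right minus_zero; linarith)
  qed
qed (use dual_pair_3'[OF q_lt(3) hq] in auto)

lemma bailey_pair_odd_1: "bailey_pair 1 q (\<lambda>r. qpoch_recip q (int r)) (\<lambda>k. h powi (3*k^2 + k))"
  unfolding bailey_pair_def
proof (intro conjI)
  show "bounded_fun (\<lambda>r. q powi (int r^2 + 1 * int r) * qpoch_recip q (int r))"
    by (intro bounded_fun_intros bounded_qr q_lt) simp
  show "bounded_fun (\<lambda>k. h powi (3*k^2 + k) * q powi (k^2 + 1 * k))"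
  proof (rule bounded_h_powi[of 0])
    show "- 0 \<le> 3*k^2 + k + 2 * (k^2 + 1 * k)" for k :: int using int_square_bounds[of k]
      unfolding mult_1_left minus_zero by (simp add: distrib_left; linarith)
  qed
qed (use odd_pair_1[OF q_lt(3) hq] in auto)

lemma bailey_pair_odd_2: "bailey_pair 1 q (\<lambda>r. (1 + q ^ Suc r) * qpoch_recip q (int r)) (\<lambda>k. h powi (3*k^2 - k))"
  unfolding bailey_pair_def
proof (intro conjI)
  show "bounded_fun (\<lambda>r. q powi (int r^2 + 1 * int r) * ((1 + q ^ Suc r) * qpoch_recip q (int r)))"
    by (intro bounded_fun_intros bounded_qr q_lt less_imp_le[OF q_lt(1)]) simp
  show "bounded_fun (\<lambda>k. h powi (3*k^2 - k) * q powi (k^2 + 1 * k))"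
  proof (rule bounded_h_powi[of 0])
    show "- 0 \<le> 3*k^2 - k + 2 * (k^2 + 1 * k)" for k :: int using int_square_bounds[of k]
      unfolding mult_1_left minus_zero by (simp add: distrib_left; linarith)
  qed
qed (use odd_pair_1[OF q_lt(3) hq] odd_pair_rel[OF q_lt(3) hq] in auto)

lemma bailey_pair_odd_dual:
  "bailey_pair 1 q (\<lambda>r. (-1) ^ r * h powi (-(int r^2) - 3 * int r) * qpoch_recip q (int r)) (\<lambda>k. h powi (-(k^2) - 3 * k))"
  unfolding bailey_pair_def
proof (intro conjI)
  show "bounded_fun (\<lambda>r. q powi (int r^2 + 1 * int r) * ((-1) ^ r * h powi (-(int r^2) - 3 * int r) * qpoch_recip q (int r)))"
  proof (rule bounded_dual[of 0])
    show "- 0 \<le> -(int r^2) - 3 * int r + 2 * (int r^2 + 1 * int r)" for r using int_square_bounds[of "int r"]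
      unfolding mult_1_left minus_zero by (simp add: distrib_left; linarith)
  qed
  show "bounded_fun (\<lambda>k. h powi (-(k^2) - 3 * k) * q powi (k^2 + 1 * k))"
  proof (rule bounded_h_powi[of 0])
    show "- 0 \<le> -(k^2) - 3 * k + 2 * (k^2 + 1 * k)" for k :: int using int_square_bounds[of k]
      unfolding mult_1_left minus_zero by (simp add: distrib_left; linarith)
  qed
qed (use odd_dual_pair[OF q_lt(3) hq] in auto)

text \<open>A negative linear coefficient is reduced to a positive one by k -> -k, which exchanges
  the first two products.\<close>

lemma theta_sum:
  fixes A :: nat and B :: int
  assumes "\<bar>B\<bar> < int A"
  shows "((\<lambda>k. (-1) powi k * h powi (int A * k^2 + B * k)) has_sum
     (pinf (h ^ nat (int A - B)) (h ^ (2 * A)) * pinf (h ^ nat (int A + B)) (h ^ (2 * A)) * pinf (h ^ (2 * A)) (h ^ (2 * A)))) UNIV"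
proof -
  define b where "b = nat \<bar>B\<bar>"
  have b: "b < A" using assms by (simp add: b_def)
  note J = jacobi_triple_product[OF h(2,1) b]
  show ?thesis
  proof (cases "B \<ge> 0")
    case True
    then have "B = int b" by (simp add: b_def)
    moreover have "nat (int A - int b) = A - b" "nat (int A + int b) = A + b" by auto
    ultimately show ?thesis using J by simp
  next
    case False
    then have B: "B = - int b" by (simp add: b_def)
    have n: "nat (int A - B) = A + b" "nat (int A + B) = A - b" unfolding B by auto
    have "((\<lambda>k. (-1) powi k * h powi (int A * k^2 + B * k)) has_sum
       (pinf (h ^ (A - b)) (h ^ (2 * A)) * pinf (h ^ (A + b)) (h ^ (2 * A)) * pinf (h ^ (2 * A)) (h ^ (2 * A)))) UNIV"
      using J by (subst has_sum_reindex_bij_witness[of UNIV uminus uminus UNIV]) (auto simp: B power_int_minus_one_minus)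
    then show ?thesis unfolding n by (simp only: mult_ac)
  qed
qed

end

subsection \<open>Weights\<close>

text \<open>The values -S < K < 0 are left out: the summand would start at a negative n, and the sum
  over n >= 0 would miss terms. The indices K = Lk with S = Ls and s in {0,1} never fall into this
  gap.\<close>

definition summation_weight :: "int \<Rightarrow> complex \<Rightarrow> (nat \<Rightarrow> complex) \<Rightarrow> (int \<Rightarrow> complex) \<Rightarrow> bool" where
  "summation_weight S q w \<omega> \<longleftrightarrow> (\<exists>A y. 0 < y \<and> y < 1 \<and> (\<forall>n. norm (w n) \<le> A * y ^ n))
     \<and> (\<forall>K. K \<ge> 0 \<or> K \<le> - S \<longrightarrow> ((\<lambda>n. w n * (qpoch_recip q (int n - K) * qpoch_recip q (int n + K + S))) has_sum \<omega> K) UNIV)"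

lemma summation_weight_square:
  assumes q: "norm q < 1" "q \<noteq> 0" and S: "S \<ge> 0"
  shows "summation_weight S q (\<lambda>n. q powi (int n^2 + S * int n)) (\<lambda>K. q powi (K^2 + S * K) / pinf q q)"
  unfolding summation_weight_def
proof (intro conjI exI allI impI)
  show "0 < norm q" "norm q < 1" using q by auto
  fix n
  have "int n \<le> int n^2 + S * int n" using int_square_bounds(1)[of "int n"] S by (simp add: add_increasing2)
  then have "norm q powi (int n^2 + S * int n) \<le> norm q powi int n" using q by (intro power_int_decreasing) auto
  then show "norm (q powi (int n^2 + S * int n)) \<le> 1 * norm q ^ n" by (simp add: norm_power_int)
next
  fix K assume "K \<ge> 0 \<or> K \<le> - S"
  then show "((\<lambda>n. q powi (int n^2 + S * int n) * (qpoch_recip q (int n - K) * qpoch_recip q (int n + K + S))) has_sum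
      (q powi (K^2 + S * K) / pinf q q)) UNIV"
    using S by (intro weight_square q) auto
qed

lemma summation_weight_triangular:
  assumes q: "norm q < 1" "q \<noteq> 0" and hq: "q = h^2"
  shows "summation_weight 0 q (\<lambda>n. q ^ (n * (n + 1) div 2) * qpoch (-1) q n)
     (\<lambda>K. 2 * h powi (K^2 + K) / (1 + q powi K) * (pinf (-q) q / pinf q q))"
proof -
  obtain C where C: "\<And>n. norm (qpoch (-1) q n) \<le> C" using qpoch_bounded[OF q(1)] by blast
  have C0: "C \<ge> 0" using order_trans[OF norm_ge_zero C[of 0]] by simp
  have "norm (q ^ (n * (n + 1) div 2) * qpoch (-1) q n) \<le> C * norm q ^ n" for n
  proof -
    have "n * 2 \<le> n * (n + 1)" by (cases n) auto
    from div_le_mono[OF this, of 2] have "n \<le> n * (n + 1) div 2"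
      by (simp only: nonzero_mult_div_cancel_right zero_neq_numeral not_False_eq_True)
    then have "norm q ^ (n * (n + 1) div 2) \<le> norm q ^ n" using q by (intro power_decreasing) auto
    then have "norm q ^ (n * (n + 1) div 2) * norm (qpoch (-1) q n) \<le> norm q ^ n * C"
      using C0 by (intro mult_mono C) auto
    then show ?thesis by (simp add: norm_mult norm_power mult_ac)
  qed
  moreover have "0 < norm q" "norm q < 1" using q by auto
  ultimately show ?thesis unfolding summation_weight_def using weight_triangular[OF q hq]
    by (intro conjI exI[of _ C] exI[of _ "norm q"]) auto
qed

lemma summation_weight_odd_square:
  assumes q: "norm q < 1" "q \<noteq> 0"
  shows "summation_weight 0 (q^2) (\<lambda>n. q ^ (n^2) * qpoch (-q) (q^2) n)
     (\<lambda>K. q powi (K^2) * (pinf (-q) (q^2) / pinf (q^2) (q^2)))"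
proof -
  have q2: "norm (q^2) < 1" using q by (simp add: norm_power power_less_one_iff)
  obtain C where C: "\<And>n. norm (qpoch (-q) (q^2) n) \<le> C" using qpoch_bounded[OF q2] by blast
  have C0: "C \<ge> 0" using order_trans[OF norm_ge_zero C[of 0]] by simp
  have "norm (q ^ (n^2) * qpoch (-q) (q^2) n) \<le> C * norm q ^ n" for n
  proof -
    have "n \<le> n^2" by (simp add: power2_nat_le_imp_le power2_eq_square)
    then have "norm q ^ (n^2) \<le> norm q ^ n" using q by (intro power_decreasing) auto
    then have "norm q ^ (n^2) * norm (qpoch (-q) (q^2) n) \<le> norm q ^ n * C"
      using C0 by (intro mult_mono C) auto
    then show ?thesis by (simp add: norm_mult norm_power mult_ac)
  qed
  moreover have "0 < norm q" "norm q < 1" using q by auto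
  ultimately show ?thesis unfolding summation_weight_def using weight_odd_square[OF q]
    by (intro conjI exI[of _ C] exI[of _ "norm q"]) auto
qed

subsection \<open>Double sums with quadratic and cubic dilation\<close>

lemma qpoch_recip_product_bounded:
  assumes "norm q < 1"
  shows "\<exists>D. \<forall>n k. norm (qpoch_recip q (a n k) * qpoch_recip q (b n k)) \<le> D"
proof -
  have "bounded_fun (\<lambda>x. qpoch_recip q (a (fst x) (snd x)) * qpoch_recip q (b (fst x) (snd x)))"
    using assms by (intro bounded_fun_intros)
  then show ?thesis by (auto simp: bounded_fun_def)
qed

lemma qpoch_odd_nonzero: "generic_base q \<Longrightarrow> qpoch q (q^2) n \<noteq> 0"
  using qpoch_self_double[of q n] qpoch_self_nonzero[of q "2 * n"] by auto

text \<open>The specialisation to K = Lk and S = Ls, with d factored into Q^(r^2+sr), Q = q^L, and a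
  bounded part e.\<close>

lemma dilation_sum_weight:
  fixes b w :: "nat \<Rightarrow> complex" and d e :: "nat \<Rightarrow> nat \<Rightarrow> complex" and f \<omega> :: "int \<Rightarrow> complex" and L :: nat and s :: int
  assumes q: "norm q < 1" "q \<noteq> 0" and L: "L \<ge> 1"
    and s: "s = 0 \<or> s = (1 :: int)"
    and pair: "bailey_pair s (q ^ L) b f" and w: "summation_weight (int L * s) q w \<omega>"
    and dil: "\<And>n (k :: int). (\<Sum>r\<le>n. d n r * (qpoch_recip (q ^ L) (int r - k) * qpoch_recip (q ^ L) (int r + k + s)))
        = (q ^ L) powi (k^2 + s * k) * (qpoch_recip q (int n - int L * k) * qpoch_recip q (int n + int L * k + int L * s))"
    and d: "\<And>n r. r > n \<Longrightarrow> d n r = 0" "\<And>n r. d n r = (q ^ L) powi (int r^2 + s * int r) * e n r"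
    and e: "bounded_fun (\<lambda>x. e (fst x) (snd x))"
    and Z: "((\<lambda>k. (-1) powi k * f k * (q ^ L) powi (k^2 + s * k) * \<omega> (int L * k)) has_sum Z) UNIV"
  shows "((\<lambda>(n, r). w n * d n r * b r) has_sum Z) (UNIV \<times> UNIV)"
proof -
  obtain A y where y: "0 < y" "y < 1" "\<And>n. norm (w n) \<le> A * y ^ n" using w by (auto simp: summation_weight_def)
  obtain B where B: "\<And>n r. norm (e n r) \<le> B" using e by (auto simp: bounded_fun_def)
  obtain D where D: "\<And>n (k :: int). norm (qpoch_recip q (int n - int L * k) * qpoch_recip q (int n + int L * k + int L * s)) \<le> D"
    using qpoch_recip_product_bounded[OF q(1), of "\<lambda>n (k :: int). int n - int L * k" "\<lambda>n (k :: int). int n + int L * k + int L * s"] by blast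
  show ?thesis
  proof (rule dilation_sum[OF y(1,2) s pair dil _ y(3) d(1) _ _ D Z])
    show "((\<lambda>n. w n * (qpoch_recip q (int n - int L * k) * qpoch_recip q (int n + int L * k + int L * s))) has_sum \<omega> (int L * k)) UNIV" for k
    proof -
      \<comment> \<open>For k < 0 also k <= -s, as s is 0 or 1, so Lk avoids the gap between -Ls and
        0.\<close>
      have "int L * k \<ge> 0 \<or> int L * k \<le> - (int L * s)"
      proof (cases "k \<ge> 0")
        case False
        then have "k \<le> - s" using s by auto
        then have "int L * k \<le> int L * (- s)" by (intro mult_left_mono) auto
        then show ?thesis by simp
      qed simp
      then show ?thesis using w unfolding summation_weight_def by blast
    qed
    show "norm (d n r) \<le> B * norm ((q ^ L) powi (int r^2 + s * int r))" for n r
      unfolding d(2) norm_mult using B[of n r] by (simp add: mult.commute mult_right_mono)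
    show "qpoch_recip q (int n - int L * k) * qpoch_recip q (int n + int L * k + int L * s) = 0" if k: "k < - int n - 1 \<or> k > int n" for n k
      using k
    proof
      assume "k > int n"
      then have "int L * k \<ge> 1 * k" using L by (intro mult_right_mono) auto
      then have "int n - int L * k < 0" using \<open>k > int n\<close> by linarith
      then show ?thesis by simp
    next
      assume *: "k < - int n - 1"
      have "int L * (k + s) \<le> 1 * (k + s)" using L s * by (intro mult_right_mono_neg) auto
      moreover have "k + s < - int n" using s * by auto
      ultimately have "int n + int L * k + int L * s < 0" unfolding distrib_left by linarith
      then show ?thesis by simp
    qed
  qed
qed

lemma quadratic_sum:
  fixes s :: nat
  assumes q: "norm q < 1" "q \<noteq> 0" and s: "s \<le> 1"
    and pair: "bailey_pair (int s) (q^2) b f" and w: "summation_weight (2 * int s) q w \<omega>"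
    and Z: "((\<lambda>k. (-1) powi k * f k * q powi (2 * (k^2 + int s * k)) * \<omega> (2 * k)) has_sum Z) UNIV"
  shows "((\<lambda>(n, r). w n * (q powi (2 * (int r^2 + int s * int r)) * (qpoch_recip q (int n - 2 * int r) / qpoch q (q^2) (n + s))) * b r) has_sum Z) (UNIV \<times> UNIV)"
proof (rule dilation_sum_weight[where L = 2 and s = "int s" and f = f and \<omega> = \<omega>
      and e = "\<lambda>n r. qpoch_recip q (int n - 2 * int r) / qpoch q (q^2) (n + s)"])
  have gen: "generic_base q" using q by (simp add: generic_base_unit_disc)
  fix n k
  have "(\<Sum>r\<le>n. q powi (2 * (int r^2 + int s * int r)) * (qpoch_recip q (int n - 2 * int r) / qpoch q (q^2) (n + s))
        * (qpoch_recip (q^2) (int r - k) * qpoch_recip (q^2) (int r + k + int s)))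
     = (\<Sum>r\<le>n. q powi (2 * int r^2 + 2 * int s * int r) * qpoch_recip q (int n - 2 * int r)
        * (qpoch_recip (q^2) (int r - k) * qpoch_recip (q^2) (int r + k + int s))) / qpoch q (q^2) (n + s)"
    unfolding sum_divide_distrib by (rule sum.cong) (simp_all add: algebra_simps)
  also have "\<dots> = q powi (2 * k^2 + 2 * int s * k) * (qpoch_recip q (int n - 2 * k) * qpoch_recip q (int n + 2 * k + 2 * int s))"
    unfolding quadratic_dilation[OF gen s] using qpoch_odd_nonzero[OF gen] by simp
  finally show "(\<Sum>r\<le>n. q powi (2 * (int r^2 + int s * int r)) * (qpoch_recip q (int n - 2 * int r) / qpoch q (q^2) (n + s))
        * (qpoch_recip (q^2) (int r - k) * qpoch_recip (q^2) (int r + k + int s)))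
     = (q^2) powi (k^2 + int s * k) * (qpoch_recip q (int n - int 2 * k) * qpoch_recip q (int n + int 2 * k + int 2 * int s))"
    by (simp add: power_int_power algebra_simps)
next
  have "norm (q^2) < 1" using q by (simp add: norm_power power_less_one_iff)
  then show "bounded_fun (\<lambda>x. qpoch_recip q (int (fst x) - 2 * int (snd x)) / qpoch q (q^2) (fst x + s))"
    using q by (intro bounded_fun_intros)
qed (use q s pair w Z in \<open>auto simp: power_int_power algebra_simps\<close>)

lemma cubic_odd_sum:
  assumes q: "norm q < 1" "q \<noteq> 0"
    and pair: "bailey_pair 1 (q^3) b f" and w: "summation_weight 3 q w \<omega>"
    and Z: "((\<lambda>k. (-1) powi k * f k * q powi (3 * (k^2 + k)) * \<omega> (3 * k)) has_sum Z) UNIV"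
  shows "((\<lambda>(n, r). w n * (q powi (3 * (int r^2 + int r)) * (qpoch (q^3) (q^3) (n - r) * qpoch_recip q (int n - 3 * int r) / qpoch q q (2 * n + 2))) * b r) has_sum Z) (UNIV \<times> UNIV)"
proof (rule dilation_sum_weight[where L = 3 and s = 1 and f = f and \<omega> = \<omega>
      and e = "\<lambda>n r. qpoch (q^3) (q^3) (n - r) * qpoch_recip q (int n - 3 * int r) / qpoch q q (2 * n + 2)"])
  have gen: "generic_base q" using q by (simp add: generic_base_unit_disc)
  fix n k
  have "(\<Sum>r\<le>n. q powi (3 * (int r^2 + int r)) * (qpoch (q^3) (q^3) (n - r) * qpoch_recip q (int n - 3 * int r) / qpoch q q (2 * n + 2))
        * (qpoch_recip (q^3) (int r - k) * qpoch_recip (q^3) (int r + k + 1)))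
     = (\<Sum>r\<le>n. q powi (3 * int r^2 + 3 * int 1 * int r) * qpoch (q^3) (q^3) (n + 1 - r - 1) * qpoch_recip q (int n - 3 * int r)
        * (qpoch_recip (q^3) (int r - k) * qpoch_recip (q^3) (int r + k + int 1))) / qpoch q q (2 * n + 3 * 1 - 1)"
    unfolding sum_divide_distrib by (rule sum.cong) (simp_all add: algebra_simps)
  also have "\<dots> = q powi (3 * k^2 + 3 * int 1 * k) * (qpoch_recip q (int n - 3 * k) * qpoch_recip q (int n + 3 * k + 3 * int 1))"
    using cubic_dilation[OF gen, of 1 n k] qpoch_self_nonzero[OF gen] by simp
  finally show "(\<Sum>r\<le>n. q powi (3 * (int r^2 + int r)) * (qpoch (q^3) (q^3) (n - r) * qpoch_recip q (int n - 3 * int r) / qpoch q q (2 * n + 2))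
        * (qpoch_recip (q^3) (int r - k) * qpoch_recip (q^3) (int r + k + 1)))
     = (q^3) powi (k^2 + 1 * k) * (qpoch_recip q (int n - int 3 * k) * qpoch_recip q (int n + int 3 * k + int 3 * 1))"
    by (simp add: power_int_power algebra_simps)
next
  have "norm (q^3) < 1" using q by (simp add: norm_power power_less_one_iff)
  then show "bounded_fun (\<lambda>x. qpoch (q^3) (q^3) (fst x - snd x) * qpoch_recip q (int (fst x) - 3 * int (snd x)) / qpoch q q (2 * fst x + 2))"
    using q by (intro bounded_fun_intros)
qed (use q pair w Z in \<open>auto simp: power_int_power algebra_simps\<close>)

text \<open>In the row n = 0 the factorials (q^3;q^3)_{n-r-1} and (q;q)_{2n-1} have negative index.
  The row is replaced by 1 at r = 0 and 0 elsewhere, which satisfies the dilation identity for n = 0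
  and accounts for the summand 1 in front of these identities.\<close>

lemma cubic_even_sum:
  assumes q: "norm q < 1" "q \<noteq> 0"
    and pair: "bailey_pair 0 (q^3) b f" and w: "summation_weight 0 q w \<omega>"
    and Z: "((\<lambda>k. (-1) powi k * f k * q powi (3 * k^2) * \<omega> (3 * k)) has_sum Z) UNIV"
  shows "((\<lambda>(n, r). w n * (q powi (3 * int r^2) * (if n = 0 then (if r = 0 then 1 else 0)
       else qpoch (q^3) (q^3) (n - r - 1) * qpoch_recip q (int n - 3 * int r) / qpoch q q (2 * n - 1))) * b r) has_sum Z) (UNIV \<times> UNIV)"
proof (rule dilation_sum_weight[where L = 3 and s = 0 and f = f and \<omega> = \<omega>
      and e = "\<lambda>n r. if n = 0 then (if r = 0 then 1 else 0) else qpoch (q^3) (q^3) (n - r - 1) * qpoch_recip q (int n - 3 * int r) / qpoch q q (2 * n - 1)"])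
  have gen: "generic_base q" using q by (simp add: generic_base_unit_disc)
  fix n k
  show "(\<Sum>r\<le>n. q powi (3 * int r^2) * (if n = 0 then (if r = 0 then 1 else 0) else qpoch (q^3) (q^3) (n - r - 1) * qpoch_recip q (int n - 3 * int r) / qpoch q q (2 * n - 1))
        * (qpoch_recip (q^3) (int r - k) * qpoch_recip (q^3) (int r + k + 0)))
     = (q^3) powi (k^2 + 0 * k) * (qpoch_recip q (int n - int 3 * k) * qpoch_recip q (int n + int 3 * k + int 3 * 0))"
  proof (cases "n = 0")
    case True
    then show ?thesis by (cases "k = 0") (auto simp: qpoch_recip_def)
  next
    case False
    then have "(\<Sum>r\<le>n. q powi (3 * int r^2) * (if n = 0 then (if r = 0 then 1 else 0) else qpoch (q^3) (q^3) (n - r - 1) * qpoch_recip q (int n - 3 * int r) / qpoch q q (2 * n - 1))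
        * (qpoch_recip (q^3) (int r - k) * qpoch_recip (q^3) (int r + k + 0)))
     = (\<Sum>r\<le>n. q powi (3 * int r^2 + 3 * int 0 * int r) * qpoch (q^3) (q^3) (n + 0 - r - 1) * qpoch_recip q (int n - 3 * int r)
        * (qpoch_recip (q^3) (int r - k) * qpoch_recip (q^3) (int r + k + int 0))) / qpoch q q (2 * n + 3 * 0 - 1)"
      unfolding sum_divide_distrib by (intro sum.cong) simp_all
    also have "\<dots> = q powi (3 * k^2 + 3 * int 0 * k) * (qpoch_recip q (int n - 3 * k) * qpoch_recip q (int n + 3 * k + 3 * int 0))"
      using cubic_dilation[OF gen, of 0 n k] qpoch_self_nonzero[OF gen] False by simp
    finally show ?thesis by (simp add: power_int_power)
  qed
next
  have "norm (q^3) < 1" using q by (simp add: norm_power power_less_one_iff)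
  then show "bounded_fun (\<lambda>x. if fst x = 0 then (if snd x = 0 then 1 else 0) else qpoch (q^3) (q^3) (fst x - snd x - 1)
      * qpoch_recip q (int (fst x) - 3 * int (snd x)) / qpoch q q (2 * fst x - 1))"
    using q by (intro bounded_fun_intros)
qed (use q pair w Z in \<open>auto simp: power_int_power\<close>)

subsection \<open>The identities with quadratic and cubic dilation\<close>

lemma qpoch_inf_triple: "qpoch_inf [x, y, z] q = pinf x q * pinf y q * pinf z q"
  by (simp add: qpoch_inf_def pinf_def mult.assoc)

lemma has_sum_pair_cong:
  assumes "((\<lambda>(n, r). f n r) has_sum S) A" "\<And>n r. f n r = g n r" "S = T"
  shows "((\<lambda>(n, r). g n r) has_sum T) A"
  using assms by simp

text \<open>Splits off the row n = 0 that \<open>cubic_even_sum\<close> fixed by hand.\<close>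

lemma has_sum_first_row:
  fixes t f :: "nat \<Rightarrow> nat \<Rightarrow> complex"
  assumes t: "((\<lambda>(n, r). t n r) has_sum Z) (UNIV \<times> UNIV)"
    and t0: "\<And>r. t 0 r = (if r = 0 then 1 else 0)" and f: "\<And>n r. n \<ge> 1 \<Longrightarrow> t n r = f n r" and Z: "Z = Z'"
  shows "\<exists>S. ((\<lambda>(n, r). f n r) has_sum S) ({1..} \<times> UNIV) \<and> 1 + S = Z'"
proof -
  let ?A = "{0} \<times> UNIV :: (nat \<times> nat) set" and ?B = "{1..} \<times> UNIV :: (nat \<times> nat) set"
  have "((\<lambda>(n, r). t n r) has_sum (\<Sum>x\<in>{(0,0)}. case x of (n, r) \<Rightarrow> t n r)) ?A"
    by (rule has_sum_finite_neutralI[of "{(0,0)}"]) (auto simp: t0 split: if_splits)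
  then have a: "((\<lambda>(n, r). t n r) has_sum 1) ?A" by (simp add: t0)
  have "?B = UNIV \<times> UNIV - ?A" by auto
  then have b: "((\<lambda>(n, r). t n r) has_sum (Z - 1)) ?B"
    using has_sum_Diff[OF t a] by simp
  have "((\<lambda>(n, r). f n r) has_sum (Z - 1)) ?B"
    using b by (rule has_sum_cong[THEN iffD1, rotated]) (auto simp: f)
  then show ?thesis by (intro exI[of _ "Z - 1"]) (simp add: Z)
qed

lemma one_plus_powi_nonzero:
  fixes q :: complex
  assumes q: "norm q < 1" "q \<noteq> 0"
  shows "1 + q powi k \<noteq> 0"
proof
  assume "1 + q powi k = 0"
  then have "norm q powi k = 1" by (metis add_eq_0_iff norm_minus_cancel norm_one norm_power_int add.inverse_inverse)
  moreover have "norm q powi k \<noteq> 1" if "k \<noteq> 0"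
    using q power_int_strict_decreasing[of 0 k "norm q"] power_int_strict_decreasing[of k 0 "norm q"] that by (cases "k > 0") auto
  ultimately have "k = 0" by auto
  with \<open>1 + q powi k = 0\<close> show False by simp
qed

definition cubic_term :: "complex \<Rightarrow> nat \<Rightarrow> nat \<Rightarrow> complex" where
  "cubic_term q n r = (if n = 0 then (if r = 0 then 1 else 0)
     else qpoch (q^3) (q^3) (n - r - 1) * qpoch_recip q (int n - 3 * int r) / qpoch q q (2 * n - 1))"

context
  fixes h q :: complex
  assumes h: "h \<noteq> 0" "norm h < 1" and hq: "q = h^2"
begin

lemma theta_closing:
  fixes A :: nat and B :: int
  assumes "\<bar>B\<bar> < int A" "\<And>k. g k = (-1) powi k * h powi (int A * k^2 + B * k) * c"
  shows "(g has_sum (qpoch_inf [h ^ nat (int A - B), h ^ nat (int A + B), h ^ (2 * A)] (h ^ (2 * A)) * c)) UNIV"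
  unfolding assms(2) qpoch_inf_triple by (intro has_sum_cmult_left theta_sum[OF h hq] assms(1))

lemma powi_triple:
  assumes "int a * E + 2 * F + 2 * G = T"
  shows "(-1) powi k * (h ^ a) powi E * q powi F * (q powi G / p) = (-1) powi k * h powi T * (1 / p)"
proof -
  have "(h ^ a) powi E * q powi F * q powi G = h powi T"
    unfolding hq power_int_power powi_mult[OF h(1)] using assms by simp
  then have "(-1) powi k * ((h ^ a) powi E * q powi F * q powi G) * (1 / p) = (-1) powi k * h powi T * (1 / p)" by simp
  then show ?thesis by (simp add: mult.assoc)
qed

text \<open>The mean of h^(y+K) and h^(y-K) is h^(y-K) (1 + q^K) / 2: it cancels both the
  denominator 1 + q^K and the factor 2 of the triangular weight, and a single Gaussian is
  left.\<close>

lemma powi_triangular: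
  assumes "int a * E = y + K" "int a * E' = y - K" "y + 2 * F + w = T"
  shows "(-1) powi k * (((h ^ a) powi E + (h ^ a) powi E') / 2) * q powi F * (2 * h powi (w + K) / (1 + q powi K) * p)
     = (-1) powi k * h powi T * p"
proof -
  have qK: "q powi K = h powi (2 * K)" by (simp add: hq power_int_power)
  have nz: "1 + h powi (2 * K) \<noteq> 0" using one_plus_powi_nonzero[OF q_lt(1,2)[OF h hq], of K] qK by simp
  have e: "(h ^ a) powi E + (h ^ a) powi E' = h powi (y - K) * (1 + h powi (2 * K))"
    unfolding power_int_power assms(1,2) distrib_left powi_mult[OF h(1)] by (simp add: algebra_simps)
  have "h powi (y - K) * q powi F * h powi (w + K) = h powi T"
    unfolding hq power_int_power powi_mult[OF h(1)] using assms(3) by (intro arg_cong[where f="power_int h"]) simp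
  then have "(-1) powi k * (h powi (y - K) * q powi F * h powi (w + K)) * p * ((1 + h powi (2 * K)) / (1 + h powi (2 * K)))
     = (-1) powi k * h powi T * p" using nz by simp
  moreover have "s * (u * v / 2) * x * (2 * z / v * p) = s * (u * x * z) * p * (v / v)" for s u v x z :: complex
    by (simp add: mult_ac)
  ultimately show ?thesis unfolding e qK by (simp only:)
qed

text \<open>In powers of h the dilation contributes 6k^2 and the weight at K = 3k contributes 18k^2,
  together 24k^2; 3F is the exponent of the pair in base q^3.\<close>

lemma cubic_even_square:
  assumes "bailey_pair 0 (q^3) b (\<lambda>k. (h^3) powi F k)"
    and "\<And>k. 3 * F k + 24 * k^2 = int A * k^2 + B * k" "\<bar>B\<bar> < int A"
  shows "((\<lambda>(n, r). q powi (int n^2) * (q powi (3 * int r^2) * cubic_term q n r) * b r) has_sum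
    (qpoch_inf [h ^ nat (int A - B), h ^ nat (int A + B), h ^ (2 * A)] (h ^ (2 * A)) / qpoch_inf [q] q)) (UNIV \<times> UNIV)"
proof -
  have "((\<lambda>k. (-1) powi k * (h^3) powi F k * q powi (3 * k^2) * (q powi ((3 * k)^2 + 0 * (3 * k)) / pinf q q)) has_sum
    (qpoch_inf [h ^ nat (int A - B), h ^ nat (int A + B), h ^ (2 * A)] (h ^ (2 * A)) * (1 / pinf q q))) UNIV"
  proof (rule theta_closing[OF assms(3)], rule powi_triple)
    show "int 3 * F k + 2 * (3 * k^2) + 2 * ((3 * k)^2 + 0 * (3 * k)) = int A * k^2 + B * k" for k
      using assms(2)[of k] by (simp add: power2_eq_square)
  qed
  from cubic_even_sum[OF q_lt(1,2)[OF h hq] assms(1) summation_weight_square[OF q_lt(1,2)[OF h hq] order_refl] this]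
  show ?thesis by (simp add: cubic_term_def qpoch_inf_single)
qed

text \<open>Dilation and weight contribute 6k^2 + 9k^2. A linear coefficient e = 1 or e = -1 in base
  h^3 gives h^(3k) or h^(-3k), exactly matching 1 + q^(3k); after symmetrisation both signs agree
  and the theta series has no linear term.\<close>

lemma cubic_even_triangular:
  assumes "bailey_pair 0 (q^3) b (\<lambda>k. (h^3) powi (c * k^2 + e * k))"
    and "int A = 3 * c + 15" "A > 0" "e = 1 \<or> e = -1"
  shows "((\<lambda>(n, r). (q ^ (n * (n + 1) div 2) * qpoch (-1) q n) * (q powi (3 * int r^2) * cubic_term q n r) * b r) has_sum
    (qpoch_inf [h ^ A, h ^ A, h ^ (2 * A)] (h ^ (2 * A)) * (qpoch_inf [-q] q / qpoch_inf [q] q))) (UNIV \<times> UNIV)"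
proof -
  let ?f = "\<lambda>k. ((h^3) powi (c * k^2 + e * k) + (h^3) powi (c * (- k)^2 + e * (- k))) / 2"
  have "((\<lambda>k. (-1) powi k * ?f k * q powi (3 * k^2) * (2 * h powi ((3 * k)^2 + 3 * k) / (1 + q powi (3 * k)) * (pinf (-q) q / pinf q q))) has_sum
    (qpoch_inf [h ^ nat (int A - 0), h ^ nat (int A + 0), h ^ (2 * A)] (h ^ (2 * A)) * (pinf (-q) q / pinf q q))) UNIV"
  proof (rule theta_closing)
    fix k
    have T: "3 * c * k^2 + 2 * (3 * k^2) + (3 * k)^2 = int A * k^2 + 0 * k"
      unfolding assms(2) by (simp add: power2_eq_square algebra_simps)
    consider "e = 1" | "e = -1" using assms(4) by blast
    then show "(-1) powi k * ?f k * q powi (3 * k^2) * (2 * h powi ((3 * k)^2 + 3 * k) / (1 + q powi (3 * k)) * (pinf (-q) q / pinf q q))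
        = (-1) powi k * h powi (int A * k^2 + 0 * k) * (pinf (-q) q / pinf q q)"
    proof cases
      case 1
      show ?thesis by (rule powi_triangular[OF _ _ T]) (simp_all add: 1 algebra_simps)
    next
      case 2
      show ?thesis unfolding add.commute[of "(h^3) powi (c * k^2 + e * k)"]
        by (rule powi_triangular[OF _ _ T]) (simp_all add: 2 algebra_simps)
    qed
  qed (use assms in auto)
  from cubic_even_sum[OF q_lt(1,2)[OF h hq] bailey_pair_symmetrize[OF assms(1)] summation_weight_triangular[OF q_lt(1,2)[OF h hq] hq] this]
  show ?thesis by (simp add: cubic_term_def qpoch_inf_single)
qed

text \<open>With s = 1 the h-exponents are 6(k^2+k) from the dilation and 18(k^2+k) from the weight
  q^(n^2+3n) at K = 3k.\<close>

lemma cubic_odd_square: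
  assumes "bailey_pair 1 (q^3) b (\<lambda>k. (h^3) powi F k)"
    and "\<And>k. 3 * F k + 24 * (k^2 + k) = int A * k^2 + B * k" "\<bar>B\<bar> < int A"
  shows "((\<lambda>(n, r). q powi (int n^2 + 3 * int n) * (q powi (3 * (int r^2 + int r)) * (qpoch (q^3) (q^3) (n - r) * qpoch_recip q (int n - 3 * int r) / qpoch q q (2 * n + 2))) * b r) has_sum
    (qpoch_inf [h ^ nat (int A - B), h ^ nat (int A + B), h ^ (2 * A)] (h ^ (2 * A)) / qpoch_inf [q] q)) (UNIV \<times> UNIV)"
proof -
  have "((\<lambda>k. (-1) powi k * (h^3) powi F k * q powi (3 * (k^2 + k)) * (q powi ((3 * k)^2 + 3 * (3 * k)) / pinf q q)) has_sum
    (qpoch_inf [h ^ nat (int A - B), h ^ nat (int A + B), h ^ (2 * A)] (h ^ (2 * A)) * (1 / pinf q q))) UNIV"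
  proof (rule theta_closing[OF assms(3)], rule powi_triple)
    show "int 3 * F k + 2 * (3 * (k^2 + k)) + 2 * ((3 * k)^2 + 3 * (3 * k)) = int A * k^2 + B * k" for k
      using assms(2)[of k] by (simp add: power2_eq_square algebra_simps)
  qed
  from cubic_odd_sum[OF q_lt(1,2)[OF h hq] assms(1) summation_weight_square[OF q_lt(1,2)[OF h hq], of 3] this]
  show ?thesis by (simp add: qpoch_inf_single)
qed

text \<open>The 12 is 4 from the dilation in base q^2 and 8 from the weight at K = 2k, counted in
  powers of h; the pair in base q^2 has h^2 = q as its square root of the base.\<close>

lemma quadratic_square:
  fixes s :: nat
  assumes "s \<le> 1" "bailey_pair (int s) (q^2) b (\<lambda>k. q powi F k)"
    and "\<And>k. 2 * F k + 12 * (k^2 + int s * k) = int A * k^2 + B * k" "\<bar>B\<bar> < int A"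
  shows "((\<lambda>(n, r). q powi (int n^2 + 2 * int s * int n) * (q powi (2 * (int r^2 + int s * int r)) * (qpoch_recip q (int n - 2 * int r) / qpoch q (q^2) (n + s))) * b r) has_sum
    (qpoch_inf [h ^ nat (int A - B), h ^ nat (int A + B), h ^ (2 * A)] (h ^ (2 * A)) / qpoch_inf [q] q)) (UNIV \<times> UNIV)"
proof -
  have pair: "bailey_pair (int s) (q^2) b (\<lambda>k. (h^2) powi F k)" using assms(2) unfolding hq .
  have "((\<lambda>k. (-1) powi k * (h^2) powi F k * q powi (2 * (k^2 + int s * k)) * (q powi ((2 * k)^2 + 2 * int s * (2 * k)) / pinf q q)) has_sum
    (qpoch_inf [h ^ nat (int A - B), h ^ nat (int A + B), h ^ (2 * A)] (h ^ (2 * A)) * (1 / pinf q q))) UNIV"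
  proof (rule theta_closing[OF assms(4)], rule powi_triple)
    show "int 2 * F k + 2 * (2 * (k^2 + int s * k)) + 2 * ((2 * k)^2 + 2 * int s * (2 * k)) = int A * k^2 + B * k" for k
      using assms(3)[of k] by (simp add: power2_eq_square algebra_simps)
  qed
  from quadratic_sum[OF q_lt(1,2)[OF h hq] assms(1) pair summation_weight_square[OF q_lt(1,2)[OF h hq], of "2 * int s"] this]
  show ?thesis by (simp add: qpoch_inf_single)
qed

lemma quadratic_triangular:
  assumes "bailey_pair 0 (q^2) b (\<lambda>k. q powi (3 * k^2 + k))"
  shows "((\<lambda>(n, r). (q ^ (n * (n + 1) div 2) * qpoch (-1) q n) * (q powi (2 * int r^2) * (qpoch_recip q (int n - 2 * int r) / qpoch q (q^2) n)) * b r) has_sum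
    (qpoch_inf [h ^ 14, h ^ 14, h ^ 28] (h ^ 28) * (qpoch_inf [-q] q / qpoch_inf [q] q))) (UNIV \<times> UNIV)"
proof -
  have pair: "bailey_pair 0 (q^2) b (\<lambda>k. (h^2) powi (3 * k^2 + k))" using assms unfolding hq .
  let ?f = "\<lambda>k. ((h^2) powi (3 * k^2 + k) + (h^2) powi (3 * (- k)^2 + - k)) / 2"
  have "((\<lambda>k. (-1) powi k * ?f k * q powi (2 * (k^2 + int 0 * k)) * (2 * h powi ((2 * k)^2 + 2 * k) / (1 + q powi (2 * k)) * (pinf (-q) q / pinf q q))) has_sum
    (qpoch_inf [h ^ nat (int 14 - 0), h ^ nat (int 14 + 0), h ^ (2 * 14)] (h ^ (2 * 14)) * (pinf (-q) q / pinf q q))) UNIV"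
  proof (rule theta_closing)
    fix k
    have T: "6 * k^2 + 2 * (2 * (k^2 + int 0 * k)) + (2 * k)^2 = int 14 * k^2 + 0 * k"
      by (simp add: power2_eq_square)
    show "(-1) powi k * ?f k * q powi (2 * (k^2 + int 0 * k)) * (2 * h powi ((2 * k)^2 + 2 * k) / (1 + q powi (2 * k)) * (pinf (-q) q / pinf q q))
        = (-1) powi k * h powi (int 14 * k^2 + 0 * k) * (pinf (-q) q / pinf q q)"
      by (rule powi_triangular[OF _ _ T]) (simp_all add: algebra_simps)
  qed simp
  moreover have "bailey_pair (int 0) (q^2) b ?f" using bailey_pair_symmetrize[OF pair] by simp
  moreover have "summation_weight (2 * int 0) q (\<lambda>n. q ^ (n * (n + 1) div 2) * qpoch (-1) q n)
     (\<lambda>K. 2 * h powi (K^2 + K) / (1 + q powi K) * (pinf (-q) q / pinf q q))"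
    using summation_weight_triangular[OF q_lt(1,2)[OF h hq] hq] by simp
  ultimately show ?thesis
    using quadratic_sum[OF q_lt(1,2)[OF h hq], of 0 b ?f] by (simp add: qpoch_inf_single)
qed

end

context
  fixes q :: complex
  assumes q: "q \<noteq> 0" "norm q < 1"
begin

text \<open>The base is now q^2, so q itself plays the role of h. Dilation and weight contribute
  6k^2 and 9k^2, as the weight gives q^(K^2) rather than its square.\<close>

lemma cubic_odd_weight:
  assumes "bailey_pair 0 ((q^2)^3) b (\<lambda>k. (q^3) powi F k)"
    and "\<And>k. 3 * F k + 15 * k^2 = int A * k^2 + B * k" "\<bar>B\<bar> < int A"
  shows "((\<lambda>(n, r). (q ^ (n^2) * qpoch (-q) (q^2) n) * ((q^2) powi (3 * int r^2) * cubic_term (q^2) n r) * b r) has_sum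
    (qpoch_inf [q ^ nat (int A - B), q ^ nat (int A + B), q ^ (2 * A)] (q ^ (2 * A)) * (qpoch_inf [-q] (q^2) / qpoch_inf [q^2] (q^2)))) (UNIV \<times> UNIV)"
proof -
  have "((\<lambda>k. (-1) powi k * (q^3) powi F k * (q^2) powi (3 * k^2) * (q powi ((3 * k)^2) * (pinf (-q) (q^2) / pinf (q^2) (q^2)))) has_sum
    (qpoch_inf [q ^ nat (int A - B), q ^ nat (int A + B), q ^ (2 * A)] (q ^ (2 * A)) * (pinf (-q) (q^2) / pinf (q^2) (q^2)))) UNIV"
  proof (rule theta_closing[OF q refl assms(3)])
    fix k
    have "(q^3) powi F k * (q^2) powi (3 * k^2) * q powi ((3 * k)^2) = q powi (int A * k^2 + B * k)"
      unfolding power_int_power powi_mult[OF q(1)]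
      by (rule arg_cong[where f="power_int q"]) (use assms(2)[of k] in \<open>simp add: power2_eq_square\<close>)
    then show "(-1) powi k * (q^3) powi F k * (q^2) powi (3 * k^2) * (q powi ((3 * k)^2) * (pinf (-q) (q^2) / pinf (q^2) (q^2)))
       = (-1) powi k * q powi (int A * k^2 + B * k) * (pinf (-q) (q^2) / pinf (q^2) (q^2))"
      by (metis mult.assoc)
  qed
  from cubic_even_sum[OF q_lt(1,2)[OF q refl] assms(1) summation_weight_odd_square[OF q(2,1)] this]
  show ?thesis unfolding cubic_term_def qpoch_inf_single .
qed

lemma quadratic_odd_weight:
  assumes "bailey_pair 0 ((q^2)^2) b (\<lambda>k. (q^2) powi F k)"
    and "\<And>k. 2 * F k + 8 * k^2 = int A * k^2 + B * k" "\<bar>B\<bar> < int A"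
  shows "((\<lambda>(n, r). (q ^ (n^2) * qpoch (-q) (q^2) n) * ((q^2) powi (2 * int r^2) * (qpoch_recip (q^2) (int n - 2 * int r) / qpoch (q^2) ((q^2)^2) n)) * b r) has_sum
    (qpoch_inf [q ^ nat (int A - B), q ^ nat (int A + B), q ^ (2 * A)] (q ^ (2 * A)) * (qpoch_inf [-q] (q^2) / qpoch_inf [q^2] (q^2)))) (UNIV \<times> UNIV)"
proof -
  have "((\<lambda>k. (-1) powi k * (q^2) powi F k * (q^2) powi (2 * (k^2 + int 0 * k)) * (q powi ((2 * k)^2) * (pinf (-q) (q^2) / pinf (q^2) (q^2)))) has_sum
    (qpoch_inf [q ^ nat (int A - B), q ^ nat (int A + B), q ^ (2 * A)] (q ^ (2 * A)) * (pinf (-q) (q^2) / pinf (q^2) (q^2)))) UNIV"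
  proof (rule theta_closing[OF q refl assms(3)])
    fix k
    have "(q^2) powi F k * (q^2) powi (2 * (k^2 + int 0 * k)) * q powi ((2 * k)^2) = q powi (int A * k^2 + B * k)"
      unfolding power_int_power powi_mult[OF q(1)]
      by (rule arg_cong[where f="power_int q"]) (use assms(2)[of k] in \<open>simp add: power2_eq_square\<close>)
    then show "(-1) powi k * (q^2) powi F k * (q^2) powi (2 * (k^2 + int 0 * k)) * (q powi ((2 * k)^2) * (pinf (-q) (q^2) / pinf (q^2) (q^2)))
       = (-1) powi k * q powi (int A * k^2 + B * k) * (pinf (-q) (q^2) / pinf (q^2) (q^2))"
      by (metis mult.assoc)
  qed
  moreover have "bailey_pair (int 0) ((q^2)^2) b (\<lambda>k. (q^2) powi F k)" using assms(1) by simp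
  moreover have "summation_weight (2 * int 0) (q^2) (\<lambda>n. q ^ (n^2) * qpoch (-q) (q^2) n)
     (\<lambda>K. q powi (K^2) * (pinf (-q) (q^2) / pinf (q^2) (q^2)))"
    using summation_weight_odd_square[OF q(2,1)] by simp
  ultimately show ?thesis
    using quadratic_sum[OF q_lt(1,2)[OF q refl], of 0 b "\<lambda>k. (q^2) powi F k"] by (simp add: qpoch_inf_single)
qed

end

lemma qpoch_inf_swap: "qpoch_inf [x, y, z] q = qpoch_inf [y, x, z] q"
  by (simp add: qpoch_inf_def)

text \<open>Brings the summand of the general sum into the order in which the identities display it;
  the remaining obligation concerns powers of q and signs only. X is a possible extra polynomial
  factor of b_r.\<close>

lemma cubic_match:
  assumes "n \<ge> 1" "q^3 = p" "a * b * \<beta> = E * X * qpoch_recip p (int r)"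
  shows "a * (b * cubic_term q n r) * \<beta>
    = E * qpoch p p (n - r - 1) * X / (qpoch q q (2 * n - 1) * qpoch p p r) * qpoch_recip q (int n - 3 * int r)"
proof -
  have "a * (b * cubic_term q n r) * \<beta> = (a * b * \<beta>) * cubic_term q n r" by (simp add: mult_ac)
  then show ?thesis unfolding assms(3) cubic_term_def using assms(1,2) by (simp add: mult_ac)
qed

lemmas cubic_match_1 = cubic_match[where X = 1, unfolded mult_1_right]

lemma cubic_odd_match:
  assumes "a * b * \<beta> = E * X * qpoch_recip p (int r)"
  shows "a * (b * (Q * R / D)) * \<beta> = E * Q * X / (D * qpoch p p r) * R"
proof -
  have "a * (b * (Q * R / D)) * \<beta> = (a * b * \<beta>) * (Q * R / D)" by (simp add: mult_ac)
  then show ?thesis unfolding assms by (simp add: mult_ac)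
qed

lemmas cubic_odd_match_1 = cubic_odd_match[where X = 1, unfolded mult_1_right]

lemma quadratic_match:
  assumes "a * b * \<beta> = E * qpoch_recip p (int r)"
  shows "a * (b * (R / D)) * \<beta> = E / (D * qpoch p p r) * R"
proof -
  have "a * (b * (R / D)) * \<beta> = (a * b * \<beta>) * (R / D)" by (simp add: mult_ac)
  then show ?thesis unfolding assms by (simp add: mult_ac)
qed

text \<open>One rule for each shape of the obligation left by the match lemmas: with or without a
  sign s, with or without a q-factorial u in the weight, and with a polynomial factor Y, possibly
  over a power c of q. Each reduces it to an equation between monomials.\<close>

lemma regroup:
  fixes w b x e s u R :: complex
  shows "w * b * x = e \<Longrightarrow> w * b * (x * R) = e * R"
    and "w * b * x = e \<Longrightarrow> w * b * (s * x * R) = s * e * R"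
    and "w * b * x = e \<Longrightarrow> (w * u) * b * (x * R) = e * u * R"
    and "w * b * x = e \<Longrightarrow> (w * u) * b * (s * x * R) = s * e * u * R"
    and "w * b = e \<Longrightarrow> Y = X \<Longrightarrow> w * b * (Y * R) = e * X * R"
    and "w * b = e * c \<Longrightarrow> c \<noteq> 0 \<Longrightarrow> Y = X \<Longrightarrow> w * b * (Y / c * R) = e * X * R"
    and "w * b = e * c \<Longrightarrow> c \<noteq> 0 \<Longrightarrow> Y = X \<Longrightarrow> (w * u) * b * (Y / c * R) = (e * u) * X * R"
proof -
  show "w * b * x = e \<Longrightarrow> w * b * (x * R) = e * R" "w * b * x = e \<Longrightarrow> w * b * (s * x * R) = s * e * R"
    "w * b * x = e \<Longrightarrow> (w * u) * b * (x * R) = e * u * R" "w * b * x = e \<Longrightarrow> (w * u) * b * (s * x * R) = s * e * u * R"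
    "w * b = e \<Longrightarrow> Y = X \<Longrightarrow> w * b * (Y * R) = e * X * R" by (auto simp: mult_ac)
  show *: "w * b = e * c \<Longrightarrow> c \<noteq> 0 \<Longrightarrow> Y = X \<Longrightarrow> w * b * (Y / c * R) = e * X * R" for e R
    by simp
  have "(w * u) * b * (Y / c * R) = w * b * (Y / c * (u * R))" by (simp add: mult_ac)
  then show "w * b = e * c \<Longrightarrow> c \<noteq> 0 \<Longrightarrow> Y = X \<Longrightarrow> (w * u) * b * (Y / c * R) = (e * u) * X * R"
    using *[of e "u * R"] by (simp add: mult_ac)
qed

section \<open>The identities with weight in base q\<close>

context
  fixes h q :: complex
  assumes h: "h \<noteq> 0" "norm h < 1" and hq: "q = h^2"
begin

lemma as_powi:
  "q ^ N = h powi (2 * int N)" "q powi E = h powi (2 * E)" "(h^3) powi E = h powi (3 * E)"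
proof -
  show "q ^ N = h powi (2 * int N)" by (metis hq of_nat_mult of_nat_numeral power_int_of_nat power_mult)
qed (simp_all add: hq power_int_power)

text \<open>The integer divisions by 2 in the exponents are exact since each dividend is even;
  passing from q to h doubles the exponents and removes the division.\<close>

lemma half_powi:
  fixes n r :: nat
  shows "q powi (E + 3 * int r * (int r - 1) div 2) = h powi (2 * E + 3 * int r * (int r - 1))"
    and "q powi (E + 3 * int r * (int r - 3) div 2) = h powi (2 * E + 3 * int r * (int r - 3))"
    and "2 * (int n * (int n + 1) div 2) = int n * (int n + 1)"
    and "q ^ (n * (n + 1) div 2) = h powi (int n * (int n + 1))"
    and "q ^ (n * (n + 1) div 2 + m) = h powi (int n * (int n + 1) + 2 * int m)"
proof -
  show 1: "2 * (int n * (int n + 1) div 2) = int n * (int n + 1)" by simp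
  have 2: "int (n * (n + 1) div 2) = int n * (int n + 1) div 2" by (simp add: zdiv_int algebra_simps)
  show "q ^ (n * (n + 1) div 2) = h powi (int n * (int n + 1))" unfolding as_powi 2 1 ..
  show "q ^ (n * (n + 1) div 2 + m) = h powi (int n * (int n + 1) + 2 * int m)"
    unfolding as_powi of_nat_add distrib_left[of "2::int"] 2 1 ..
  have "2 * (3 * int r * (int r - 1) div 2) = 3 * int r * (int r - 1)"
    "2 * (3 * int r * (int r - 3) div 2) = 3 * int r * (int r - 3)" by simp_all
  then show "q powi (E + 3 * int r * (int r - 1) div 2) = h powi (2 * E + 3 * int r * (int r - 1))"
    "q powi (E + 3 * int r * (int r - 3) div 2) = h powi (2 * E + 3 * int r * (int r - 3))"
    unfolding as_powi distrib_left[of "2::int"] by simp_all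
qed

lemma cube: "h^3 \<noteq> 0" "norm (h^3) < 1" "q^3 = (h^3)^2"
  using h by (simp_all add: hq norm_power power_less_one_iff flip: power_mult)

lemmas cubic_pairs = bailey_pair_1[OF cube] bailey_pair_3[OF cube] bailey_pair_5[OF cube]
  bailey_pair_dual_1[OF cube] bailey_pair_dual_3[OF cube]

lemmas odd_pairs = bailey_pair_odd_1[OF cube] bailey_pair_odd_2[OF cube] bailey_pair_odd_dual[OF cube]

lemma linear_pairs:
  "bailey_pair 0 (q^3) (\<lambda>r. qpoch_recip (q^3) (int r)) (\<lambda>k. (h^3) powi (3 * k^2 + 1 * k))"
  "bailey_pair 0 (q^3) (\<lambda>r. (-1) ^ r * (h^3) powi (-(int r^2) - int r) * qpoch_recip (q^3) (int r))
     (\<lambda>k. (h^3) powi ((-1) * k^2 + (-1) * k))"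
  using cubic_pairs(1,4) by simp_all

lemma quadratic_pairs:
  "bailey_pair (int 0) (q^2) (\<lambda>r. qpoch_recip (q^2) (int r)) (\<lambda>k. q powi (3 * k^2 + k))"
  "bailey_pair (int 0) (q^2) (\<lambda>r. (q^2) ^ r * qpoch_recip (q^2) (int r)) (\<lambda>k. q powi (3 * k^2 + 3 * k))"
  "bailey_pair (int 1) (q^2) (\<lambda>r. qpoch_recip (q^2) (int r)) (\<lambda>k. q powi (3 * k^2 + k))"
  "bailey_pair (int 1) (q^2) (\<lambda>r. (1 + (q^2) ^ Suc r) * qpoch_recip (q^2) (int r)) (\<lambda>k. q powi (3 * k^2 - k))"
  using bailey_pair_1[OF q_lt(2,1)[OF h hq] refl] bailey_pair_3[OF q_lt(2,1)[OF h hq] refl]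
    bailey_pair_odd_1[OF q_lt(2,1)[OF h hq] refl] bailey_pair_odd_2[OF q_lt(2,1)[OF h hq] refl] by simp_all

lemma identity_20:
  "(\<exists>S. ((\<lambda>(n, r). q ^ (n^2 + 3 * r^2) * qpoch (q^3) (q^3) (n - r - 1) / (qpoch q q (2 * n - 1) * qpoch (q^3) (q^3) r) * qpoch_recip q (int n - 3 * int r))
        has_sum S) ({1..} \<times> UNIV)
      \<and> 1 + S = qpoch_inf [q^15, q^18, q^33] (q^33) / qpoch_inf [q] q)"
\<comment> \<open>A = 33 and B = 3 are read off from 3 (3k^2 + k) + 24k^2; the triple product then
  has h^30, h^36 and h^66, that is q^15, q^18 and q^33. The later identities choose A and B in the
  same way.\<close>
proof (rule has_sum_first_row[OF cubic_even_square[OF h hq cubic_pairs(1), of 33 3]], goal_cases)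
  case (4 n r)
  show ?case
    by (rule cubic_match_1[OF 4 refl], rule regroup(1)[where x = 1, unfolded mult_1_left mult_1_right], (unfold half_powi power_mult[symmetric])?, unfold as_powi powi_mult[OF h(1)]) (simp_all add: h(1) power2_eq_square algebra_simps)
qed (simp_all add: cubic_term_def hq h(1) flip: power_mult)

lemma identity_19:
  "(\<exists>S. ((\<lambda>(n, r). q ^ (n^2 + 3 * r^2 + 3 * r) * qpoch (q^3) (q^3) (n - r - 1) / (qpoch q q (2 * n - 1) * qpoch (q^3) (q^3) r) * qpoch_recip q (int n - 3 * int r))
        has_sum S) ({1..} \<times> UNIV)
      \<and> 1 + S = qpoch_inf [q^12, q^21, q^33] (q^33) / qpoch_inf [q] q)"
proof (rule has_sum_first_row[OF cubic_even_square[OF h hq cubic_pairs(2), of 33 9]], goal_cases)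
  case (4 n r)
  show ?case
    by (rule cubic_match_1[OF 4 refl], rule regroup(1), (unfold half_powi power_mult[symmetric])?, unfold as_powi powi_mult[OF h(1)]) (simp_all add: h(1) power2_eq_square algebra_simps)
qed (simp_all add: cubic_term_def hq h(1) flip: power_mult)

lemma identity_18:
  "(\<exists>S. ((\<lambda>(n, r). q powi (int n^2 + 3 * int r^2 - 3) * qpoch (q^3) (q^3) (n - r - 1) * (q ^ (3 * r) + q ^ (6 * r + 3) - 1) / (qpoch q q (2 * n - 1) * qpoch (q^3) (q^3) r) * qpoch_recip q (int n - 3 * int r))
        has_sum S) ({1..} \<times> UNIV)
      \<and> 1 + S = qpoch_inf [q^9, q^24, q^33] (q^33) / qpoch_inf [q] q)"
proof (rule has_sum_first_row[OF cubic_even_square[OF h hq cubic_pairs(3), of 33 15]], goal_cases)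
  case (4 n r)
  show ?case
    by (rule cubic_match[OF 4 refl], rule regroup(6), (unfold half_powi power_mult[symmetric])?, unfold as_powi powi_mult[OF h(1)]) (simp_all add: h(1) power2_eq_square algebra_simps)
qed (simp_all add: cubic_term_def hq h(1) flip: power_mult)

lemma identity_10:
  "(\<exists>S. ((\<lambda>(n, r). (-1)^r * q powi (int n^2 + 3 * int r * (int r - 1) div 2) * qpoch (q^3) (q^3) (n - r - 1) / (qpoch q q (2 * n - 1) * qpoch (q^3) (q^3) r) * qpoch_recip q (int n - 3 * int r))
        has_sum S) ({1..} \<times> UNIV)
      \<and> 1 + S = qpoch_inf [q^9, q^12, q^21] (q^21) / qpoch_inf [q] q)"
proof (rule has_sum_first_row[OF cubic_even_square[OF h hq cubic_pairs(4), of 21 "-3"]], goal_cases)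
  case (4 n r)
  show ?case
    by (rule cubic_match_1[OF 4 refl], rule regroup(2), (unfold half_powi power_mult[symmetric])?, unfold as_powi powi_mult[OF h(1)]) (simp_all add: h(1) power2_eq_square algebra_simps)
qed (simp_all add: cubic_term_def hq h(1) qpoch_inf_swap[of "h^24"] flip: power_mult)

lemma identity_9:
  "(\<exists>S. ((\<lambda>(n, r). (-1)^r * q powi (int n^2 + 3 * int r * (int r - 3) div 2) * qpoch (q^3) (q^3) (n - r - 1) / (qpoch q q (2 * n - 1) * qpoch (q^3) (q^3) r) * qpoch_recip q (int n - 3 * int r))
        has_sum S) ({1..} \<times> UNIV)
      \<and> 1 + S = qpoch_inf [q^6, q^15, q^21] (q^21) / qpoch_inf [q] q)"
proof (rule has_sum_first_row[OF cubic_even_square[OF h hq cubic_pairs(5), of 21 "-9"]], goal_cases)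
  case (4 n r)
  show ?case
    by (rule cubic_match_1[OF 4 refl], rule regroup(2), (unfold half_powi power_mult[symmetric])?, unfold as_powi powi_mult[OF h(1)]) (simp_all add: h(1) power2_eq_square algebra_simps)
qed (simp_all add: cubic_term_def hq h(1) qpoch_inf_swap[of "h^30"] flip: power_mult)

lemma identity_13:
  "(\<exists>S. ((\<lambda>(n, r). q ^ (n * (n + 1) div 2 + 3 * r^2) * qpoch (-1) q n * qpoch (q^3) (q^3) (n - r - 1) / (qpoch q q (2 * n - 1) * qpoch (q^3) (q^3) r) * qpoch_recip q (int n - 3 * int r))
        has_sum S) ({1..} \<times> UNIV)
      \<and> 1 + S = qpoch_inf [q^12, q^12, q^24] (q^24) * qpoch_inf [-q] q / qpoch_inf [q] q)"
proof (rule has_sum_first_row[OF cubic_even_triangular[OF h hq linear_pairs(1), of 24]], goal_cases)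
  case (5 n r)
  show ?case
    by (rule cubic_match_1[OF 5 refl], rule regroup(3)[where x = 1, unfolded mult_1_left mult_1_right], (unfold half_powi power_mult[symmetric])?, unfold as_powi powi_mult[OF h(1)]) (simp_all add: h(1) power2_eq_square algebra_simps)
qed (simp_all add: cubic_term_def hq h(1) flip: power_mult)

lemma identity_2:
  "(\<exists>S. ((\<lambda>(n, r). (-1)^r * q powi (int n * (int n + 1) div 2 + 3 * int r * (int r - 1) div 2) * qpoch (-1) q n * qpoch (q^3) (q^3) (n - r - 1) / (qpoch q q (2 * n - 1) * qpoch (q^3) (q^3) r) * qpoch_recip q (int n - 3 * int r))
        has_sum S) ({1..} \<times> UNIV)
      \<and> 1 + S = qpoch_inf [q^6, q^6, q^12] (q^12) * qpoch_inf [-q] q / qpoch_inf [q] q)"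
proof (rule has_sum_first_row[OF cubic_even_triangular[OF h hq linear_pairs(2), of 12]], goal_cases)
  case (5 n r)
  show ?case
    by (rule cubic_match_1[OF 5 refl], rule regroup(4), (unfold half_powi power_mult[symmetric])?, unfold as_powi powi_mult[OF h(1)]) (simp_all add: h(1) power2_eq_square algebra_simps)
qed (simp_all add: cubic_term_def hq h(1) flip: power_mult)

lemma identity_16:
  "((\<lambda>(n, r). q ^ (n^2 + 3 * n + 3 * r^2 + 3 * r) * qpoch (q^3) (q^3) (n - r) / (qpoch q q (2 * n + 2) * qpoch (q^3) (q^3) r) * qpoch_recip q (int n - 3 * int r))
        has_sum (qpoch_inf [q^3, q^30, q^33] (q^33) / qpoch_inf [q] q)) (UNIV \<times> UNIV)"
proof (rule has_sum_pair_cong[OF cubic_odd_square[OF h hq odd_pairs(1), of 33 27]], goal_cases)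
  case (3 n r)
  show ?case
    by (rule cubic_odd_match_1, rule regroup(1)[where x = 1, unfolded mult_1_left mult_1_right], (unfold half_powi power_mult[symmetric])?, unfold as_powi powi_mult[OF h(1)]) (simp_all add: h(1) power2_eq_square algebra_simps)
qed (simp_all add: cubic_term_def hq h(1) flip: power_mult)

lemma identity_17:
  "((\<lambda>(n, r). q ^ (n^2 + 3 * n + 3 * r^2 + 3 * r) * qpoch (q^3) (q^3) (n - r) * (1 + q ^ (3 * r + 3)) / (qpoch q q (2 * n + 2) * qpoch (q^3) (q^3) r) * qpoch_recip q (int n - 3 * int r))
        has_sum (qpoch_inf [q^6, q^27, q^33] (q^33) / qpoch_inf [q] q)) (UNIV \<times> UNIV)"
proof (rule has_sum_pair_cong[OF cubic_odd_square[OF h hq odd_pairs(2), of 33 21]], goal_cases)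
  case (3 n r)
  show ?case
    by (rule cubic_odd_match, rule regroup(5), (unfold half_powi power_mult[symmetric])?, unfold as_powi powi_mult[OF h(1)]) (simp_all add: h(1) power2_eq_square algebra_simps)
qed (simp_all add: cubic_term_def hq h(1) flip: power_mult)

lemma identity_8:
  "((\<lambda>(n, r). (-1)^r * q powi (int n^2 + 3 * int n + 3 * int r * (int r - 1) div 2) * qpoch (q^3) (q^3) (n - r) / (qpoch q q (2 * n + 2) * qpoch (q^3) (q^3) r) * qpoch_recip q (int n - 3 * int r))
        has_sum (qpoch_inf [q^3, q^18, q^21] (q^21) / qpoch_inf [q] q)) (UNIV \<times> UNIV)"
proof (rule has_sum_pair_cong[OF cubic_odd_square[OF h hq odd_pairs(3), of 21 15]], goal_cases)
  case (3 n r)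
  show ?case
    by (rule cubic_odd_match_1, rule regroup(2), (unfold half_powi power_mult[symmetric])?, unfold as_powi powi_mult[OF h(1)]) (simp_all add: h(1) power2_eq_square algebra_simps)
qed (simp_all add: cubic_term_def hq h(1) flip: power_mult)

lemma identity_7:
  "((\<lambda>(n, r). q ^ (n^2 + 2 * r^2) / (qpoch q (q^2) n * qpoch (q^2) (q^2) r) * qpoch_recip q (int n - 2 * int r))
        has_sum (qpoch_inf [q^8, q^10, q^18] (q^18) / qpoch_inf [q] q)) (UNIV \<times> UNIV)"
proof (rule has_sum_pair_cong[OF quadratic_square[OF h hq _ quadratic_pairs(1), of 18 2]], goal_cases)
  case (4 n r)
  show ?case
    by (unfold add_0_right, rule quadratic_match, rule regroup(1)[where x = 1, unfolded mult_1_left mult_1_right], (unfold half_powi power_mult[symmetric])?, unfold as_powi powi_mult[OF h(1)]) (simp_all add: h(1) power2_eq_square algebra_simps)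
qed (simp_all add: cubic_term_def hq h(1) flip: power_mult)

lemma identity_6:
  "((\<lambda>(n, r). q ^ (n^2 + 2 * r^2 + 2 * r) / (qpoch q (q^2) n * qpoch (q^2) (q^2) r) * qpoch_recip q (int n - 2 * int r))
        has_sum (qpoch_inf [q^6, q^12, q^18] (q^18) / qpoch_inf [q] q)) (UNIV \<times> UNIV)"
proof (rule has_sum_pair_cong[OF quadratic_square[OF h hq _ quadratic_pairs(2), of 18 6]], goal_cases)
  case (4 n r)
  show ?case
    by (unfold add_0_right, rule quadratic_match, rule regroup(1), (unfold half_powi power_mult[symmetric])?, unfold as_powi powi_mult[OF h(1)]) (simp_all add: h(1) power2_eq_square algebra_simps)
qed (simp_all add: cubic_term_def hq h(1) flip: power_mult)

lemma identity_4:
  "((\<lambda>(n, r). q ^ (n^2 + 2 * n + 2 * r^2 + 2 * r) / (qpoch q (q^2) (n + 1) * qpoch (q^2) (q^2) r) * qpoch_recip q (int n - 2 * int r))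
        has_sum (qpoch_inf [q^2, q^16, q^18] (q^18) / qpoch_inf [q] q)) (UNIV \<times> UNIV)"
proof (rule has_sum_pair_cong[OF quadratic_square[OF h hq _ quadratic_pairs(3), of 18 14]], goal_cases)
  case (4 n r)
  show ?case
    by (rule quadratic_match, rule regroup(1)[where x = 1, unfolded mult_1_left mult_1_right], (unfold half_powi power_mult[symmetric])?, unfold as_powi powi_mult[OF h(1)]) (simp_all add: h(1) power2_eq_square algebra_simps)
qed (simp_all add: cubic_term_def hq h(1) flip: power_mult)

lemma identity_5:
  "((\<lambda>(n, r). q ^ (n^2 + 2 * n + 2 * r^2 + 2 * r) * (1 + q ^ (2 * r + 2)) / (qpoch q (q^2) (n + 1) * qpoch (q^2) (q^2) r) * qpoch_recip q (int n - 2 * int r))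
        has_sum (qpoch_inf [q^4, q^14, q^18] (q^18) / qpoch_inf [q] q)) (UNIV \<times> UNIV)"
proof (rule has_sum_pair_cong[OF quadratic_square[OF h hq _ quadratic_pairs(4), of 18 10]], goal_cases)
  case (4 n r)
  show ?case
    by (rule quadratic_match, rule regroup(5), (unfold half_powi power_mult[symmetric])?, unfold as_powi powi_mult[OF h(1)]) (simp_all add: h(1) power2_eq_square algebra_simps)
qed (simp_all add: cubic_term_def hq h(1) flip: power_mult)

lemma identity_3:
  "((\<lambda>(n, r). q ^ (n * (n + 1) div 2 + 2 * r^2) * qpoch (-1) q n / (qpoch q (q^2) n * qpoch (q^2) (q^2) r) * qpoch_recip q (int n - 2 * int r))
        has_sum (qpoch_inf [q^7, q^7, q^14] (q^14) * qpoch_inf [-q] q / qpoch_inf [q] q)) (UNIV \<times> UNIV)"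
proof (rule has_sum_pair_cong[OF quadratic_triangular[OF h hq quadratic_pairs(1)[unfolded of_nat_0]]], goal_cases)
  case (1 n r)
  show ?case
    by (rule quadratic_match, rule regroup(3)[where x = 1, unfolded mult_1_left mult_1_right], (unfold half_powi power_mult[symmetric])?, unfold as_powi powi_mult[OF h(1)]) (simp_all add: h(1) power2_eq_square algebra_simps)
qed (simp_all add: cubic_term_def hq h(1) flip: power_mult)

end

section \<open>The identities with weight in base q^2\<close>

context
  fixes q :: complex
  assumes q: "q \<noteq> 0" "norm q < 1"
begin

lemma powers: "(q^2)^3 = q^6" "(q^2)^2 = q^4"
  by (simp_all flip: power_mult)

lemma as_powi_self: "q ^ N = q powi int N" "(q powi a) powi b = q powi (a * b)"
  by (simp_all add: power_int_mult)

lemma base: "q^3 \<noteq> 0" "norm (q^3) < 1" "(q^2)^3 = (q^3)^2" "q^2 \<noteq> 0" "norm (q^2) < 1"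
  using q by (simp_all add: norm_power power_less_one_iff flip: power_mult)

lemmas odd_weight_cubic_pairs = bailey_pair_1[OF base(1-3)] bailey_pair_3[OF base(1-3)] bailey_pair_5[OF base(1-3)]
  bailey_pair_dual_1[OF base(1-3)] bailey_pair_dual_3[OF base(1-3)]

lemmas odd_weight_quadratic_pairs = bailey_pair_1[OF base(4,5) refl] bailey_pair_3[OF base(4,5) refl]

text \<open>From 1 - z^2 = (1 - z)(1 + z). It explains why identities 14 and 15 show no factor
  (-q;q^2)_n: the factor from the weight cancels part of the denominator that quadratic dilation in
  base q^2 brings.\<close>

lemma qpoch_double_base: "qpoch (q^2) (q^4) n = qpoch q (q^2) n * qpoch (-q) (q^2) n"
proof -
  have "1 - q^2 * (q^4) ^ j = (1 - q * (q^2) ^ j) * (1 - (-q) * (q^2) ^ j)" for j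
  proof -
    have "q^2 * (q^4) ^ j = (q * (q^2) ^ j)^2"
      unfolding power_mult_distrib by (simp add: mult.commute flip: power_mult)
    moreover have "1 - z^2 = (1 - z) * (1 + z)" for z :: complex by (simp add: power2_eq_square algebra_simps)
    ultimately show ?thesis by simp
  qed
  then show ?thesis unfolding qpoch_def prod.distrib[symmetric] by simp
qed

lemma odd_weight_match:
  assumes "w * b * \<beta> = E * qpoch_recip p (int r)"
  shows "(w * qpoch (-q) (q^2) n) * (b * (R / qpoch (q^2) (q^4) n)) * \<beta> = E / (qpoch q (q^2) n * qpoch p p r) * R"
proof -
  have "qpoch (q^2) (q^4) n \<noteq> 0"
    using qpoch_odd_nonzero[OF generic_base_unit_disc[OF base(4,5)], of n] powers(2) by simp
  then have nz: "qpoch (-q) (q^2) n \<noteq> 0" unfolding qpoch_double_base by simp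
  have "(w * qpoch (-q) (q^2) n) * (b * (R / qpoch (q^2) (q^4) n)) * \<beta>
      = (w * b * \<beta>) * (R / qpoch q (q^2) n) * (qpoch (-q) (q^2) n / qpoch (-q) (q^2) n)"
    unfolding qpoch_double_base by (simp add: mult_ac)
  then show ?thesis unfolding assms using nz by (simp add: mult_ac)
qed

lemma identity_24:
  "(\<exists>S. ((\<lambda>(n, r). q ^ (n^2 + 6 * r^2) * qpoch (-q) (q^2) n * qpoch (q^6) (q^6) (n - r - 1) / (qpoch (q^2) (q^2) (2 * n - 1) * qpoch (q^6) (q^6) r) * qpoch_recip (q^2) (int n - 3 * int r))
        has_sum S) ({1..} \<times> UNIV)
      \<and> 1 + S = qpoch_inf [q^21, q^27, q^48] (q^48) * qpoch_inf [-q] (q^2) / qpoch_inf [q^2] (q^2))"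
proof (rule has_sum_first_row[OF cubic_odd_weight[OF q odd_weight_cubic_pairs(1), of 24 "3"]], goal_cases)
  case (4 n r)
  show ?case
    by (unfold powers, rule cubic_match_1[OF 4 powers(1)], rule regroup(3)[where x = 1, unfolded mult_1_left mult_1_right], (unfold power_mult[symmetric])?, unfold as_powi_self powi_mult[OF q(1)]) (simp_all add: q(1) power2_eq_square algebra_simps)
qed (simp_all add: cubic_term_def powers q(1))

lemma identity_23:
  "(\<exists>S. ((\<lambda>(n, r). q ^ (n^2 + 6 * r^2 + 6 * r) * qpoch (-q) (q^2) n * qpoch (q^6) (q^6) (n - r - 1) / (qpoch (q^2) (q^2) (2 * n - 1) * qpoch (q^6) (q^6) r) * qpoch_recip (q^2) (int n - 3 * int r))
        has_sum S) ({1..} \<times> UNIV)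
      \<and> 1 + S = qpoch_inf [q^15, q^33, q^48] (q^48) * qpoch_inf [-q] (q^2) / qpoch_inf [q^2] (q^2))"
proof (rule has_sum_first_row[OF cubic_odd_weight[OF q odd_weight_cubic_pairs(2), of 24 "9"]], goal_cases)
  case (4 n r)
  show ?case
    by (unfold powers, rule cubic_match_1[OF 4 powers(1)], rule regroup(3), (unfold power_mult[symmetric])?, unfold as_powi_self powi_mult[OF q(1)]) (simp_all add: q(1) power2_eq_square algebra_simps)
qed (simp_all add: cubic_term_def powers q(1))

lemma identity_22:
  "(\<exists>S. ((\<lambda>(n, r). q powi (int n^2 + 6 * int r^2 - 6) * qpoch (-q) (q^2) n * qpoch (q^6) (q^6) (n - r - 1) * (q ^ (6 * r) + q ^ (12 * r + 6) - 1) / (qpoch (q^2) (q^2) (2 * n - 1) * qpoch (q^6) (q^6) r) * qpoch_recip (q^2) (int n - 3 * int r))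
        has_sum S) ({1..} \<times> UNIV)
      \<and> 1 + S = qpoch_inf [q^9, q^39, q^48] (q^48) * qpoch_inf [-q] (q^2) / qpoch_inf [q^2] (q^2))"
proof (rule has_sum_first_row[OF cubic_odd_weight[OF q odd_weight_cubic_pairs(3), of 24 "15"]], goal_cases)
  case (4 n r)
  show ?case
    by (unfold powers, rule cubic_match[OF 4 powers(1)], rule regroup(7), (unfold power_mult[symmetric])?, unfold as_powi_self powi_mult[OF q(1)]) (simp_all add: q(1) power2_eq_square algebra_simps)
qed (simp_all add: cubic_term_def powers q(1))

lemma identity_12:
  "(\<exists>S. ((\<lambda>(n, r). (-1)^r * q powi (int n^2 + 3 * int r * (int r - 1)) * qpoch (-q) (q^2) n * qpoch (q^6) (q^6) (n - r - 1) / (qpoch (q^2) (q^2) (2 * n - 1) * qpoch (q^6) (q^6) r) * qpoch_recip (q^2) (int n - 3 * int r))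
        has_sum S) ({1..} \<times> UNIV)
      \<and> 1 + S = qpoch_inf [q^9, q^15, q^24] (q^24) * qpoch_inf [-q] (q^2) / qpoch_inf [q^2] (q^2))"
proof (rule has_sum_first_row[OF cubic_odd_weight[OF q odd_weight_cubic_pairs(4), of 12 "-3"]], goal_cases)
  case (4 n r)
  show ?case
    by (unfold powers, rule cubic_match_1[OF 4 powers(1)], rule regroup(4), (unfold power_mult[symmetric])?, unfold as_powi_self powi_mult[OF q(1)]) (simp_all add: q(1) power2_eq_square algebra_simps)
qed (simp_all add: cubic_term_def powers q(1) qpoch_inf_swap[of "q^15"])

lemma identity_11:
  "(\<exists>S. ((\<lambda>(n, r). (-1)^r * q powi (int n^2 + 3 * int r * (int r - 3)) * qpoch (-q) (q^2) n * qpoch (q^6) (q^6) (n - r - 1) / (qpoch (q^2) (q^2) (2 * n - 1) * qpoch (q^6) (q^6) r) * qpoch_recip (q^2) (int n - 3 * int r))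
        has_sum S) ({1..} \<times> UNIV)
      \<and> 1 + S = qpoch_inf [q^3, q^21, q^24] (q^24) * qpoch_inf [-q] (q^2) / qpoch_inf [q^2] (q^2))"
proof (rule has_sum_first_row[OF cubic_odd_weight[OF q odd_weight_cubic_pairs(5), of 12 "-9"]], goal_cases)
  case (4 n r)
  show ?case
    by (unfold powers, rule cubic_match_1[OF 4 powers(1)], rule regroup(4), (unfold power_mult[symmetric])?, unfold as_powi_self powi_mult[OF q(1)]) (simp_all add: q(1) power2_eq_square algebra_simps)
qed (simp_all add: cubic_term_def powers q(1) qpoch_inf_swap[of "q^21"])

lemma identity_15:
  "((\<lambda>(n, r). q ^ (n^2 + 4 * r^2) / (qpoch q (q^2) n * qpoch (q^4) (q^4) r) * qpoch_recip (q^2) (int n - 2 * int r))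
        has_sum (qpoch_inf [q^12, q^16, q^28] (q^28) * qpoch_inf [-q] (q^2) / qpoch_inf [q^2] (q^2))) (UNIV \<times> UNIV)"
proof (rule has_sum_pair_cong[OF quadratic_odd_weight[OF q odd_weight_quadratic_pairs(1), of 14 2]], goal_cases)
  case (3 n r)
  show ?case
    by (unfold powers, rule odd_weight_match, rule regroup(1)[where x = 1, unfolded mult_1_left mult_1_right], (unfold power_mult[symmetric])?, unfold as_powi_self powi_mult[OF q(1)]) (simp_all add: q(1) power2_eq_square algebra_simps)
qed (simp_all add: cubic_term_def powers q(1))

lemma identity_14:
  "((\<lambda>(n, r). q ^ (n^2 + 4 * r^2 + 4 * r) / (qpoch q (q^2) n * qpoch (q^4) (q^4) r) * qpoch_recip (q^2) (int n - 2 * int r))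
        has_sum (qpoch_inf [q^8, q^20, q^28] (q^28) * qpoch_inf [-q] (q^2) / qpoch_inf [q^2] (q^2))) (UNIV \<times> UNIV)"
proof (rule has_sum_pair_cong[OF quadratic_odd_weight[OF q odd_weight_quadratic_pairs(2), of 14 6]], goal_cases)
  case (3 n r)
  show ?case
    by (unfold powers, rule odd_weight_match, rule regroup(1), (unfold power_mult[symmetric])?, unfold as_powi_self powi_mult[OF q(1)]) (simp_all add: q(1) power2_eq_square algebra_simps)
qed (simp_all add: cubic_term_def powers q(1))

end

subsection \<open>The first identity\<close>

lemma qpoch_triple: "qpoch x q (3 * n) = qpoch x (q^3) n * qpoch (x * q) (q^3) n * qpoch (x * q^2) (q^3) n"
proof (induction n)
  case (Suc n)
  have "qpoch x q (3 * Suc n) = qpoch x q (Suc (Suc (Suc (3 * n))))" by (rule arg_cong[where f="qpoch x q"]) simp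
  also have "\<dots> = qpoch x q (3 * n) * (1 - x * q ^ (3 * n)) * (1 - x * q * q ^ (3 * n)) * (1 - x * q^2 * q ^ (3 * n))"
    by (simp add: qpoch_Suc power2_eq_square mult_ac)
  finally show ?case unfolding Suc qpoch_Suc power_mult by (simp add: mult_ac)
qed simp

lemma qpoch_square_self: "qpoch (q^2) (q^2) n = qpoch q q n * qpoch (-q) q n"
proof -
  have "1 - q^2 * (q^2) ^ j = (1 - q * q ^ j) * (1 - (-q) * q ^ j)" for j
  proof -
    have "q^2 * (q^2) ^ j = (q * q ^ j)^2"
      unfolding power_mult_distrib by (simp add: mult.commute flip: power_mult)
    moreover have "1 - z^2 = (1 - z) * (1 + z)" for z :: complex by (simp add: power2_eq_square algebra_simps)
    ultimately show ?thesis by simp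
  qed
  then show ?thesis unfolding qpoch_def prod.distrib[symmetric] by simp
qed

text \<open>Sorting the factors of (q^2;q^2)_{3n} by residue modulo 3 gives the three products in
  base q^6, and (q^2;q^2)_n = (q;q)_n (-q;q)_n removes the denominator in the limit.\<close>

lemma triple_product_eq:
  assumes q: "norm q < 1"
  shows "qpoch_inf [q^2, q^4, q^6] (q^6) / qpoch_inf [q] q = qpoch_inf [-q] q"
proof -
  have q2: "norm (q^2) < 1" "norm (q^6) < 1" using q by (simp_all add: norm_power power_less_one_iff)
  have "(\<lambda>n. qpoch (q^2) (q^2) (3 * n)) \<longlonglongrightarrow> pinf (q^2) (q^2)"
    using LIMSEQ_subseq_LIMSEQ[OF qpoch_LIMSEQ[OF q2(1)], of "\<lambda>n. 3 * n"] by (simp add: strict_mono_def o_def)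
  moreover have "qpoch (q^2) (q^2) (3 * n) = qpoch (q^2) (q^6) n * qpoch (q^4) (q^6) n * qpoch (q^6) (q^6) n" for n
    unfolding qpoch_triple by (simp flip: power_mult power_add)
  moreover have "(\<lambda>n. qpoch (q^2) (q^6) n * qpoch (q^4) (q^6) n * qpoch (q^6) (q^6) n)
      \<longlonglongrightarrow> pinf (q^2) (q^6) * pinf (q^4) (q^6) * pinf (q^6) (q^6)"
    by (intro tendsto_mult qpoch_LIMSEQ q2)
  ultimately have 1: "pinf (q^2) (q^6) * pinf (q^4) (q^6) * pinf (q^6) (q^6) = pinf (q^2) (q^2)"
    using LIMSEQ_unique by auto
  have "(\<lambda>n. qpoch q q n * qpoch (-q) q n) \<longlonglongrightarrow> pinf q q * pinf (-q) q"
    by (intro tendsto_mult qpoch_LIMSEQ q)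
  with qpoch_LIMSEQ[OF q2(1), of "q^2"] have "pinf (q^2) (q^2) = pinf q q * pinf (-q) q"
    unfolding qpoch_square_self by (rule LIMSEQ_unique)
  then show ?thesis unfolding qpoch_inf_triple qpoch_inf_single 1 using pinf_nonzero[OF q q] by simp
qed

text \<open>Write 1 = (1 - q^(n+K)) + q^(n+K). The first part lowers (q;q)_{n+K} by one and is
  \<open>weight_square\<close> with S = -1; the second turns q^(n^2-n) into q^K q^(n^2), the case S
  = 0.\<close>

lemma weight_shifted_square:
  fixes K :: int
  assumes q: "norm q < 1" "q \<noteq> 0"
  shows "((\<lambda>n. q powi (int n^2 - int n) * (qpoch_recip q (int n - K) * qpoch_recip q (int n + K)))
     has_sum (q powi (K^2 - K) / pinf q q + q powi (K^2 + K) / pinf q q)) UNIV"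
proof -
  have gen: "generic_base q" using q by (simp add: generic_base_unit_disc)
  have a: "((\<lambda>n. q powi (int n^2 + (-1) * int n) * (qpoch_recip q (int n - K) * qpoch_recip q (int n + K + (-1))))
     has_sum (q powi (K^2 + (-1) * K) / pinf q q)) UNIV"
    by (rule weight_square[OF q]) auto
  have b: "((\<lambda>n. q powi K * (q powi (int n^2 + 0 * int n) * (qpoch_recip q (int n - K) * qpoch_recip q (int n + K + 0))))
     has_sum (q powi K * (q powi (K^2 + 0 * K) / pinf q q))) UNIV"
    by (intro has_sum_cmult_right weight_square[OF q]) auto
  have e: "q powi (int n^2 - int n) * (qpoch_recip q (int n - K) * qpoch_recip q (int n + K))
    = q powi (int n^2 + (-1) * int n) * (qpoch_recip q (int n - K) * qpoch_recip q (int n + K + (-1)))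
      + q powi K * (q powi (int n^2 + 0 * int n) * (qpoch_recip q (int n - K) * qpoch_recip q (int n + K + 0)))" for n
  proof -
    have p: "q powi K * q powi (int n^2) = q powi (int n^2 - int n) * q powi (int n + K)"
      unfolding powi_mult[OF q(2)] by (simp add: algebra_simps)
    have r: "qpoch_recip q (int n + K + (-1)) = (1 - q powi (int n + K)) * qpoch_recip q (int n + K)"
      by (rule qpoch_recip_eq_pred[OF gen _ refl]) simp
    have "q powi K * (q powi (int n^2 + 0 * int n) * (qpoch_recip q (int n - K) * qpoch_recip q (int n + K + 0)))
       = (q powi K * q powi (int n^2)) * (qpoch_recip q (int n - K) * qpoch_recip q (int n + K))" by simp
    then show ?thesis unfolding p r by (simp add: left_diff_distrib right_diff_distrib)
  qed
  have "q powi K * (q powi (K^2 + 0 * K) / pinf q q) = q powi (K^2 + K) / pinf q q"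
    using powi_mult[OF q(2), of K "K^2"] by (simp add: add.commute)
  then show ?thesis using has_sum_add[OF a b] unfolding e[symmetric] by (simp del: times_divide_eq_right)
qed

text \<open>The substitution k -> 1-k fixes 3k^2 - 3k and reverses the sign, so the sum equals its
  negative. Absolute convergence, needed for the substitution, follows by comparison with the theta
  series of q^(k^2).\<close>

lemma antisymmetric_theta_sum:
  fixes q :: complex
  assumes q: "norm q < 1" "q \<noteq> 0"
  shows "((\<lambda>k :: int. (-1) powi k * q powi (3 * k^2 - 3 * k)) has_sum 0) UNIV"
proof -
  let ?f = "\<lambda>k :: int. (-1) powi k * q powi (3 * k^2 - 3 * k)"
  have "(\<lambda>k. (-1) powi k * q powi (int 1 * k^2 + 0 * k)) summable_on UNIV"
    using theta_sum[OF q(2,1) refl, of 0 1] by (auto simp: summable_on_def)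
  then have "(\<lambda>k. norm ((-1) powi k * q powi (int 1 * k^2 + 0 * k))) summable_on UNIV"
    by (simp add: summable_on_iff_abs_summable_on_complex)
  then have s: "(\<lambda>k. norm q powi (- 2) * norm q powi (k^2)) summable_on UNIV"
    by (intro summable_on_cmult_right) (simp add: norm_mult norm_power_int)
  have "(\<lambda>k. norm (?f k)) summable_on UNIV"
  proof (rule Infinite_Sum.abs_summable_on_comparison_test'[OF s])
    fix k :: int
    have "0 \<le> (4 * k - 3)^2" by simp
    then have "- 2 + k^2 \<le> 3 * k^2 - 3 * k" by (simp add: power2_eq_square algebra_simps)
    then have "norm q powi (3 * k^2 - 3 * k) \<le> norm q powi (- 2 + k^2)" using q by (intro power_int_decreasing) auto
    also have "\<dots> = norm q powi (- 2) * norm q powi (k^2)" using q by (intro power_int_add) simp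
    finally show "norm (?f k) \<le> norm q powi (- 2) * norm q powi (k^2)"
      by (simp add: norm_mult norm_power_int)
  qed
  then have "?f summable_on UNIV" by (rule abs_summable_summable)
  then obtain S where S: "(?f has_sum S) UNIV" by (auto simp: summable_on_def)
  have "bij_betw (\<lambda>k :: int. 1 - k) UNIV UNIV"
    by (rule bij_betw_byWitness[where f' = "\<lambda>k. 1 - k"]) auto
  from has_sum_reindex_bij_betw[OF this, of ?f S] S
  have "((\<lambda>k. ?f (1 - k)) has_sum S) UNIV" by simp
  moreover have "?f (1 - k) = - ?f k" for k
  proof -
    have "(-1 :: complex) powi (1 - k) * (-1) powi k = -1" "(-1 :: complex) powi k * (-1) powi k = 1"
      by (simp_all add: power_int_add[symmetric] power_int_mult_distrib[symmetric])
    then have "(-1 :: complex) powi (1 - k) = - ((-1) powi k)"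
      by (metis minus_mult_left mult.assoc mult_1 mult_1_right)
    moreover have "3 * (1 - k)^2 - 3 * (1 - k) = 3 * k^2 - 3 * k" by (simp add: power2_eq_square algebra_simps)
    ultimately show ?thesis by (simp only: mult_minus_left)
  qed
  ultimately have "((\<lambda>k. - ?f k) has_sum S) UNIV" by simp
  moreover have "((\<lambda>k. - ?f k) has_sum (- S)) UNIV" using S by (simp add: has_sum_uminus)
  ultimately have "S = - S" by (rule has_sum_unique)
  then show ?thesis using S by simp
qed

context
  fixes h q :: complex
  assumes h: "h \<noteq> 0" "norm h < 1" and hq: "q = h^2"
begin

text \<open>The dual pair in base q^2 contributes q^(-k^2-k), and the factor q^n of the dual
  dilation turns the weight q^(n^2-2n) into q^(n^2-n). The growth conditions are checked on the
  total exponents, hence the direct use of \<open>double_sum_interchange\<close>. The value of the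
  weight at K = 2k splits the theta series into the exponents 3k^2 - 3k, which sum to 0, and 3k^2 +
  k.\<close>

lemma dual_dilation_sum:
  "((\<lambda>(n, r). q powi (int n^2 - 2 * int n) * (h powi (4 * int r + (int n - 2 * int r)^2 + (int n - 2 * int r)) * qpoch_recip q (int n - 2 * int r)
       * ((-1) ^ r * q powi (-(int r^2) - int r) * qpoch_recip (q^2) (int r))) / qpoch q (q^2) n)
    has_sum (qpoch_inf [q^2, q^4, q^6] (q^6) / qpoch_inf [q] q)) (UNIV \<times> UNIV)"
proof -
  note q = q_lt(1,2)[OF h hq]
  have gen: "generic_base q" using q by (simp add: generic_base_unit_disc)
  have q2: "norm (q^2) < 1" using q by (simp add: norm_power power_less_one_iff)
  let ?V = "\<lambda>n k. qpoch_recip q (int n - 2 * k) * qpoch_recip q (int n + 2 * k)"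
  let ?t = "\<lambda>n r. q powi (int n^2 - 2 * int n) * (h powi (4 * int r + (int n - 2 * int r)^2 + (int n - 2 * int r)) * qpoch_recip q (int n - 2 * int r)
       * ((-1) ^ r * q powi (-(int r^2) - int r) * qpoch_recip (q^2) (int r))) / qpoch q (q^2) n"
  let ?g = "\<lambda>n k. q powi (int n^2 - int n) * ((-1) powi k * q powi (-(k^2) - k) * ?V n k)"
  have pair: "(-1) ^ r * q powi (-(int r^2) - int r) * qpoch_recip (q^2) (int r)
      = (\<Sum>k=-R..R. (-1) powi k * q powi (-(k^2) - k) * (qpoch_recip (q^2) (int r - k) * qpoch_recip (q^2) (int r + k)))"
    if "int r \<le> R" for r R
    using bailey_pair_dual_1[OF q(2,1) refl] that unfolding bailey_pair_def bailey_sum_def by simp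
  \<comment> \<open>On the support 2|k| <= n one has k^2 <= n^2/4, and the claim reduces to 3n^2 -
    10n + 12 >= 0, which has negative discriminant.\<close>
  have poly: "int n - 3 \<le> int n^2 - int n - k^2 - k" if "2 * k \<le> int n" "- (2 * k) \<le> int n" for n k
  proof -
    have "(2 * k)^2 \<le> int n^2" using that by (intro abs_le_square_iff[THEN iffD1]) auto
    moreover have "0 \<le> 3 * int n^2 - 10 * int n + 12"
    proof -
      have "0 \<le> (3 * int n - 5)^2" by simp
      then show ?thesis by (simp add: power2_eq_square algebra_simps)
    qed
    ultimately show ?thesis using that by (simp add: power_mult_distrib)
  qed
  have decay: "norm (q powi E) \<le> norm q powi (-3) * norm q ^ n" if "int n - 3 \<le> E" for E n
  proof -
    have "norm (q powi E) \<le> norm q powi (-3 + int n)" unfolding norm_power_int using q that by (intro power_int_decreasing) auto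
    also have "\<dots> = norm q powi (-3) * norm q powi int n" using q by (intro power_int_add) simp
    finally show ?thesis by simp
  qed
  have "bounded_fun (\<lambda>x. qpoch_recip q (int (fst x) - 2 * int (snd x)) * (((-1) ^ snd x * qpoch_recip (q^2) (int (snd x)))) / qpoch q (q^2) (fst x))"
    using q q2 by (intro bounded_fun_intros) auto
  then obtain C where C: "\<And>n r. norm (qpoch_recip q (int n - 2 * int r) * (((-1) ^ r * qpoch_recip (q^2) (int r))) / qpoch q (q^2) n) \<le> C"
    by (auto simp: bounded_fun_def)
  obtain D where D: "\<And>n (k :: int). norm (?V n k) \<le> D"
    using qpoch_recip_product_bounded[OF q(1), of "\<lambda>n (k :: int). int n - 2 * k" "\<lambda>n (k :: int). int n + 2 * k"] by blast
  show ?thesis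
  proof (rule double_sum_interchange[where y = "norm q" and g = ?g and C = "norm q powi (-3) * C" and D = "norm q powi (-3) * D"])
    show "0 < norm q" "norm q < 1" using q by auto
    show "?t n r = 0" if "r > n" for n r using that by simp
    show "?g n k = 0" if "k < - int n - 1 \<or> k > int n" for n k using that by auto
    show "norm (?g n k) \<le> norm q powi (-3) * D * norm q ^ n" for n k
    proof (cases "2 * k \<le> int n \<and> - (2 * k) \<le> int n")
      case True
      have "norm (?g n k) = norm (q powi (int n^2 - int n - k^2 - k)) * norm (?V n k)"
      proof -
        have e: "q powi (int n^2 - int n) * q powi (-(k^2) - k) = q powi (int n^2 - int n - k^2 - k)"
          unfolding powi_mult[OF q(2)] by (simp add: algebra_simps)
        have "?g n k = (-1) powi k * ((q powi (int n^2 - int n) * q powi (-(k^2) - k)) * ?V n k)" by (simp only: mult_ac)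
        then have "norm (?g n k) = norm ((-1) powi k * (q powi (int n^2 - int n - k^2 - k) * ?V n k))" by (simp only: e)
        then show ?thesis by (simp only: norm_mult[of "(-1) powi k"] norm_mult[of "q powi (int n^2 - int n - k^2 - k)"]) (simp add: norm_power_int)
      qed
      also have "\<dots> \<le> (norm q powi (-3) * norm q ^ n) * D" using True by (intro mult_mono decay poly D) auto
      finally show ?thesis by (simp only: mult_ac)
    next
      case False
      then have "?V n k = 0" by auto
      moreover have "0 \<le> D" using order_trans[OF norm_ge_zero D] .
      ultimately show ?thesis by (simp only: mult_zero_right norm_zero) simp
    qed
    show "norm (?t n r) \<le> norm q powi (-3) * C * norm q ^ n" for n r
    proof (cases "2 * int r \<le> int n")
      case True
      let ?X = "qpoch_recip q (int n - 2 * int r) * (((-1) ^ r * qpoch_recip (q^2) (int r))) / qpoch q (q^2) n"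
      \<comment> \<open>The total exponent in powers of h, equal to 3n^2 - 3n + 2r^2 - 4nr. Where n
        >= 2r, the product (n - 2r)(3n - 2r) is non-negative, and this controls the mixed
        term.\<close>
      define E where "E = 2 * (int n^2 - 2 * int n) + (4 * int r + (int n - 2 * int r)^2 + (int n - 2 * int r)) + 2 * (-(int r^2) - int r)"
      have "(int n - 2 * int r) * (3 * int n - 2 * int r) \<ge> 0" using True by (intro mult_nonneg_nonneg) auto
      moreover have "0 \<le> (3 * int n - 5)^2" by simp
      ultimately have E: "2 * int n - 6 \<le> E" by (simp add: E_def power2_eq_square algebra_simps)
      have "q powi (int n^2 - 2 * int n) * h powi (4 * int r + (int n - 2 * int r)^2 + (int n - 2 * int r)) * q powi (-(int r^2) - int r) = h powi E"
        unfolding hq power_int_power powi_mult[OF h(1)] E_def by simp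
      moreover have "?t n r = (q powi (int n^2 - 2 * int n) * h powi (4 * int r + (int n - 2 * int r)^2 + (int n - 2 * int r)) * q powi (-(int r^2) - int r)) * ?X"
        by (simp add: mult_ac)
      ultimately have "norm (?t n r) = norm h powi E * norm ?X" by (simp only: norm_mult norm_power_int)
      also have "\<dots> \<le> (norm q powi (-3) * norm q ^ n) * C"
      proof (rule mult_mono)
        have "norm h powi E \<le> norm h powi (2 * int n - 6)" using h E by (intro power_int_decreasing) auto
        also have "\<dots> = norm q powi (-3) * norm q powi (int n)"
          unfolding hq norm_power power_int_power using h by (subst power_int_add[symmetric]) (auto simp: algebra_simps)
        finally show "norm h powi E \<le> norm q powi (-3) * norm q ^ n" by simp
      qed (use C in auto)
      finally show ?thesis by (simp only: mult_ac)
    next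
      case False
      then have "qpoch_recip q (int n - 2 * int r) = 0" by simp
      moreover have "0 \<le> C" using order_trans[OF norm_ge_zero C] .
      ultimately show ?thesis by (simp only: mult_zero_right mult_zero_left div_0 norm_zero) simp
    qed
    show "(\<Sum>r\<le>n. ?t n r) = (\<Sum>k=-int n - 1..int n. ?g n k)" for n
    proof -
      let ?d = "\<lambda>r. h powi (4 * int r + (int n - 2 * int r)^2 + (int n - 2 * int r)) * qpoch_recip q (int n - 2 * int r)"
      let ?f = "\<lambda>k. (-1) powi k * q powi (-(k^2) - k)"
      let ?w = "q powi (int n^2 - 2 * int n) / qpoch q (q^2) n"
      have "(\<Sum>r\<le>n. ?t n r) = ?w * (\<Sum>r\<le>n. ?d r * (\<Sum>k=-int n - 1..int n + 1. ?f k * (qpoch_recip (q^2) (int r - k) * qpoch_recip (q^2) (int r + k))))"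
        unfolding sum_distrib_left[of ?w]
      proof (rule sum.cong[OF refl])
        fix r assume "r \<in> {..n}"
        then have b: "(-1) ^ r * q powi (-(int r^2) - int r) * qpoch_recip (q^2) (int r)
            = (\<Sum>k=-int n - 1..int n + 1. ?f k * (qpoch_recip (q^2) (int r - k) * qpoch_recip (q^2) (int r + k)))"
          using pair[of r "int n + 1"] by simp
        show "?t n r = ?w * (?d r * (\<Sum>k=-int n - 1..int n + 1. ?f k * (qpoch_recip (q^2) (int r - k) * qpoch_recip (q^2) (int r + k))))"
          unfolding b by (simp only: times_divide_eq_left)
      qed
      also have "(\<Sum>r\<le>n. ?d r * (\<Sum>k=-int n - 1..int n + 1. ?f k * (qpoch_recip (q^2) (int r - k) * qpoch_recip (q^2) (int r + k))))
         = (\<Sum>r\<le>n. \<Sum>k=-int n - 1..int n + 1. ?f k * (?d r * (qpoch_recip (q^2) (int r - k) * qpoch_recip (q^2) (int r + k))))"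
        unfolding sum_distrib_left by (intro sum.cong refl) (simp add: mult_ac)
      also have "\<dots> = (\<Sum>k=-int n - 1..int n + 1. ?f k * (\<Sum>r\<le>n. ?d r * (qpoch_recip (q^2) (int r - k) * qpoch_recip (q^2) (int r + k))))"
        unfolding sum_distrib_left by (rule sum.swap)
      also have "\<dots> = (\<Sum>k=-int n - 1..int n + 1. ?f k * (qpoch q (q^2) n * q ^ n * ?V n k))"
        unfolding dual_quadratic_dilation[OF gen hq] ..
      also have "?w * \<dots> = (\<Sum>k=-int n - 1..int n + 1. ?g n k)"
      proof -
        have "q powi (int n^2 - 2 * int n) * q powi int n = q powi (int n^2 - int n)"
          unfolding powi_mult[OF q(2)] by (simp add: algebra_simps)
        then have w: "?w * (qpoch q (q^2) n * q ^ n) = q powi (int n^2 - int n)" using qpoch_odd_nonzero[OF gen, of n] by simp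
        have "?w * (?f k * (qpoch q (q^2) n * q ^ n * ?V n k)) = ?w * (qpoch q (q^2) n * q ^ n) * (?f k * ?V n k)" for k
          by (simp add: mult_ac)
        then show ?thesis unfolding sum_distrib_left w by simp
      qed
      \<comment> \<open>The pair relation was used with the symmetric bound R = n + 1, to reach k =
        -n-1; the surplus term k = n + 1 vanishes.\<close>
      also have "\<dots> = (\<Sum>k=-int n - 1..int n. ?g n k)"
        by (rule sum.mono_neutral_right) auto
      finally show ?thesis .
    qed
    let ?G = "\<lambda>k. (-1) powi k * q powi (-(k^2) - k) * (q powi ((2 * k)^2 - 2 * k) / pinf q q + q powi ((2 * k)^2 + 2 * k) / pinf q q)"
    show "((\<lambda>n. ?g n k) has_sum ?G k) UNIV" for k
      using has_sum_cmult_right[OF weight_shifted_square[OF q, of "2 * k"], of "(-1) powi k * q powi (-(k^2) - k)"]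
      by (simp add: mult_ac)
    have G: "?G k = ((-1) powi k * q powi (3 * k^2 - 3 * k) + (-1) powi k * q powi (int 3 * k^2 + 1 * k)) * (1 / pinf q q)" for k
    proof -
      have "q powi (-(k^2) - k) * q powi ((2 * k)^2 - 2 * k) = q powi (3 * k^2 - 3 * k)"
        "q powi (-(k^2) - k) * q powi ((2 * k)^2 + 2 * k) = q powi (int 3 * k^2 + 1 * k)"
        unfolding powi_mult[OF q(2)] by (simp_all add: power2_eq_square algebra_simps)
      then show ?thesis by (simp add: distrib_left add_divide_distrib mult.assoc)
    qed
    show "(?G has_sum (qpoch_inf [q^2, q^4, q^6] (q^6) / qpoch_inf [q] q)) UNIV"
      using has_sum_cmult_left[OF has_sum_add[OF antisymmetric_theta_sum[OF q] theta_sum[OF q(2,1) refl, of 1 3]], of "1 / pinf q q"]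
      unfolding G[symmetric] qpoch_inf_triple qpoch_inf_single by simp
  qed
qed

lemma identity_1:
  "((\<lambda>(n, r). (-1)^r * q powi (3 * int n * (int n - 1) div 2 + int r^2 - 2 * int n * int r) / (qpoch q (q^2) n * qpoch (q^2) (q^2) r) * qpoch_recip q (int n - 2 * int r))
        has_sum (qpoch_inf [q^2, q^4, q^6] (q^6) / qpoch_inf [q] q)) (UNIV \<times> UNIV)"
proof (rule has_sum_pair_cong[OF dual_dilation_sum])
  fix n r :: nat
  let ?E = "3 * int n * (int n - 1) div 2 + int r^2 - 2 * int n * int r"
  have "2 * (3 * int n * (int n - 1) div 2) = 3 * int n * (int n - 1)" by simp
  then have E: "2 * ?E = 3 * int n * (int n - 1) + 2 * int r^2 - 4 * int n * int r" by (simp only: distrib_left right_diff_distrib; simp)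
  have "q powi (int n^2 - 2 * int n) * h powi (4 * int r + (int n - 2 * int r)^2 + (int n - 2 * int r)) * q powi (-(int r^2) - int r) = q powi ?E"
    unfolding hq power_int_power powi_mult[OF h(1)] of_nat_numeral E by (simp add: power2_eq_square algebra_simps)
  then show "q powi (int n^2 - 2 * int n) * (h powi (4 * int r + (int n - 2 * int r)^2 + (int n - 2 * int r)) * qpoch_recip q (int n - 2 * int r)
       * ((-1) ^ r * q powi (-(int r^2) - int r) * qpoch_recip (q^2) (int r))) / qpoch q (q^2) n
     = (-1)^r * q powi ?E / (qpoch q (q^2) n * qpoch (q^2) (q^2) r) * qpoch_recip q (int n - 2 * int r)"
    by (simp add: mult_ac flip: \<open>_ = q powi ?E\<close>)
qed simp

end

subsection \<open>The identities with quartic dilation\<close>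

text \<open>Identities 21, 25 and 26 are one sum over (n, i) with n = 2m or n = 2m + 1 and i = m -
  r, so that n - 2i becomes 2r or 2r + 1. The term at (0, 0) is the leading 1.\<close>

lemma has_sum_parity_split:
  fixes t a b :: "nat \<Rightarrow> nat \<Rightarrow> complex"
  assumes t: "((\<lambda>(n, i). t n i) has_sum Z) (UNIV \<times> UNIV)"
    and t0: "t 0 0 = 1" and tz: "\<And>n i. n < 2 * i \<Longrightarrow> t n i = 0"
    and a: "\<And>m r. m \<ge> 1 \<Longrightarrow> a m r = (if r \<le> m then t (2 * m) (m - r) else 0)"
    and b: "\<And>m r. b m r = (if r \<le> m then t (2 * m + 1) (m - r) else 0)"
    and Z: "Z = Z'"
  shows "\<exists>S T. ((\<lambda>(m, r). a m r) has_sum S) ({1..} \<times> UNIV) \<and> ((\<lambda>(m, r). b m r) has_sum T) (UNIV \<times> UNIV) \<and> 1 + S + T = Z'"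
proof -
  let ?t = "\<lambda>(n, i). t n i"
  let ?E = "{(n, i). even n \<and> n \<ge> 1 \<and> 2 * i \<le> n}" and ?O = "{(n, i). odd n \<and> 2 * i \<le> n}"
  have sub: "?t summable_on X" for X
    using t by (intro summable_on_subset_banach[of ?t "UNIV \<times> UNIV" X]) (auto simp: summable_on_def)
  obtain S where S: "(?t has_sum S) ?E" using sub[of ?E] by (auto simp: summable_on_def)
  obtain T where T: "(?t has_sum T) ?O" using sub[of ?O] by (auto simp: summable_on_def)
  have one: "(?t has_sum 1) {(0, 0)}" using has_sum_finite[of "{(0, 0)}" ?t] t0 by simp
  have "(?t has_sum (1 + S)) ({(0, 0)} \<union> ?E)" by (rule has_sum_Un_disjoint[OF one S]) auto
  then have "(?t has_sum (1 + S + T)) ({(0, 0)} \<union> ?E \<union> ?O)" by (rule has_sum_Un_disjoint[OF _ T]) auto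
  moreover have "(?t has_sum (1 + S + T)) ({(0, 0)} \<union> ?E \<union> ?O) \<longleftrightarrow> (?t has_sum (1 + S + T)) (UNIV \<times> UNIV)"
  proof (rule has_sum_cong_neutral)
    fix x :: "nat \<times> nat" assume "x \<in> UNIV \<times> UNIV - ({(0, 0)} \<union> ?E \<union> ?O)"
    then show "?t x = 0" by (cases x) (auto intro!: tz)
  qed auto
  ultimately have eq: "1 + S + T = Z" using has_sum_unique[OF t] by auto
  have "((\<lambda>(m, r). a m r) has_sum S) {(m, r). m \<ge> 1 \<and> r \<le> m} \<longleftrightarrow> (?t has_sum S) ?E"
    by (rule has_sum_reindex_bij_witness[where j = "\<lambda>(m, r). (2 * m, m - r)" and i = "\<lambda>(n, i). (n div 2, n div 2 - i)"])
      (auto simp: a elim!: evenE)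
  moreover have "((\<lambda>(m, r). a m r) has_sum S) {(m, r). m \<ge> 1 \<and> r \<le> m} \<longleftrightarrow> ((\<lambda>(m, r). a m r) has_sum S) ({1..} \<times> UNIV)"
    by (rule has_sum_cong_neutral) (auto simp: a split: if_splits)
  ultimately have aS: "((\<lambda>(m, r). a m r) has_sum S) ({1..} \<times> UNIV)" using S by simp
  have "((\<lambda>(m, r). b m r) has_sum T) {(m, r). r \<le> m} \<longleftrightarrow> (?t has_sum T) ?O"
    by (rule has_sum_reindex_bij_witness[where j = "\<lambda>(m, r). (2 * m + 1, m - r)" and i = "\<lambda>(n, i). (n div 2, n div 2 - i)"])
      (auto simp: b elim!: oddE)
  moreover have "((\<lambda>(m, r). b m r) has_sum T) {(m, r). r \<le> m} \<longleftrightarrow> ((\<lambda>(m, r). b m r) has_sum T) (UNIV \<times> UNIV)"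
    by (rule has_sum_cong_neutral) (auto simp: b split: if_splits)
  ultimately have "((\<lambda>(m, r). b m r) has_sum T) (UNIV \<times> UNIV)" using T by simp
  with aS eq Z show ?thesis by blast
qed

text \<open>The row n = 0 is set by hand, as in \<open>cubic_term\<close>, because (q^4;q^4)_{n-i-1}
  and (q;q)_{2n-1} have negative index there.\<close>

definition quartic_term :: "complex \<Rightarrow> complex \<Rightarrow> (nat \<Rightarrow> complex) \<Rightarrow> nat \<Rightarrow> nat \<Rightarrow> complex" where
  "quartic_term h q w n i = (if n = 0 then (if i = 0 then 1 else 0)
     else w n * ((-1) ^ i * h powi (2 * int i^2 - 2 * int i + int n - int n^2) * qpoch (q^4) (q^4) (n - i - 1)
       * qpoch_recip (q^2) (int i) * qpoch_recip q (int n - 2 * int i)) / qpoch q q (2 * n - 1))"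

lemma quartic_term_even:
  assumes "m \<ge> 1" "w (2 * m) * h powi (2 * (int m - int r)^2 - 2 * (int m - int r) + 2 * int m - 4 * int m^2) = E * X"
    and "q^4 = p" "q^2 = p2"
  shows "(-1)^(m + r) * E * qpoch p p (m + r - 1) * X / (qpoch q q (4 * m - 1) * qpoch q q (2 * r)) * qpoch_recip p2 (int m - int r)
     = (if r \<le> m then quartic_term h q w (2 * m) (m - r) else 0)"
proof (cases "r \<le> m")
  case True
  then have i: "int (m - r) = int m - int r" by simp
  have s: "(-1 :: complex) ^ (m - r) = (-1) ^ (m + r)" using True by (simp add: minus_one_power_iff)
  have "2 * m - (m - r) - 1 = m + r - 1" "int (2 * m) - 2 * (int m - int r) = int (2 * r)" "2 * (2 * m) - 1 = 4 * m - 1"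
    "2 * (int m - int r)^2 - 2 * (int m - int r) + int (2 * m) - int (2 * m)^2 = 2 * (int m - int r)^2 - 2 * (int m - int r) + 2 * int m - 4 * int m^2"
    using True by (simp_all add: power2_eq_square)
  note e = this
  have "quartic_term h q w (2 * m) (m - r) = (w (2 * m) * h powi (2 * (int m - int r)^2 - 2 * (int m - int r) + 2 * int m - 4 * int m^2))
     * ((-1) ^ (m + r) * qpoch p p (m + r - 1) * qpoch_recip p2 (int m - int r) * qpoch_recip q (int (2 * r))) / qpoch q q (4 * m - 1)"
    using assms(1) unfolding quartic_term_def i e s assms(3,4) by (simp only: if_False mult_eq_0_iff zero_neq_numeral) (simp add: mult_ac)
  then show ?thesis unfolding assms(2) qpoch_recip_of_nat using True by (simp add: mult_ac)
qed simp

lemma quartic_term_odd: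
  assumes "w (2 * m + 1) * h powi (2 * (int m - int r)^2 - 2 * (int m - int r) - 2 * int m - 4 * int m^2) = E * X"
    and "q^4 = p" "q^2 = p2"
  shows "(-1)^(m + r) * E * qpoch p p (m + r) * X / (qpoch q q (4 * m + 1) * qpoch q q (2 * r + 1)) * qpoch_recip p2 (int m - int r)
     = (if r \<le> m then quartic_term h q w (2 * m + 1) (m - r) else 0)"
proof (cases "r \<le> m")
  case True
  then have i: "int (m - r) = int m - int r" by simp
  have s: "(-1 :: complex) ^ (m - r) = (-1) ^ (m + r)" using True by (simp add: minus_one_power_iff)
  have "2 * m + 1 - (m - r) - 1 = m + r" "int (2 * m + 1) - 2 * (int m - int r) = int (2 * r + 1)" "2 * (2 * m + 1) - 1 = 4 * m + 1"
    "2 * (int m - int r)^2 - 2 * (int m - int r) + int (2 * m + 1) - int (2 * m + 1)^2 = 2 * (int m - int r)^2 - 2 * (int m - int r) - 2 * int m - 4 * int m^2"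
    using True by (simp_all add: power2_eq_square algebra_simps)
  note e = this
  have "quartic_term h q w (2 * m + 1) (m - r) = (w (2 * m + 1) * h powi (2 * (int m - int r)^2 - 2 * (int m - int r) - 2 * int m - 4 * int m^2))
     * ((-1) ^ (m + r) * qpoch p p (m + r) * qpoch_recip p2 (int m - int r) * qpoch_recip q (int (2 * r + 1))) / qpoch q q (4 * m + 1)"
    unfolding quartic_term_def i e s assms(2,3) by (simp only: if_False add_eq_0_iff_both_eq_0 one_neq_zero) (simp add: mult_ac)
  then show ?thesis unfolding assms(1) qpoch_recip_of_nat using True by (simp add: mult_ac)
qed simp

context
  fixes h q :: complex
  assumes h: "h \<noteq> 0" "norm h < 1" and hq: "q = h^2"
begin

text \<open>The counterpart of \<open>dilation_sum\<close> for the merged identity; \<phi> is f_k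
  together with the dilation factor. The finite identity carries the growing power h^(n-n^2), so
  \<open>wb\<close> demands that w decay strongly enough to absorb it.\<close>

lemma quartic_sum:
  fixes \<phi> :: "int \<Rightarrow> complex"
  assumes \<phi>: "bounded_fun \<phi>" "\<phi> 0 = 1"
    and pair: "\<And>n R. n \<ge> 1 \<Longrightarrow> int n \<le> R \<Longrightarrow>
      (\<Sum>i\<le>n. (-1) ^ i * h powi (2 * int i^2 - 2 * int i + int n - int n^2) * qpoch (q^4) (q^4) (n - i - 1)
         * qpoch_recip (q^2) (int i) * qpoch_recip q (int n - 2 * int i)) / qpoch q q (2 * n - 1)
      = (\<Sum>k=-R..R. (-1) powi k * \<phi> k * (qpoch_recip q (int n - 4*k) * qpoch_recip q (int n + 4*k)))"
    and w: "summation_weight 0 q w \<omega>" and w0: "w 0 = 1"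
    and wb: "\<And>n. norm (w n * h powi (int n - int n^2)) \<le> A * norm h ^ n"
    and Z: "((\<lambda>k. (-1) powi k * \<phi> k * \<omega> (4 * k)) has_sum Z) UNIV"
  shows "((\<lambda>(n, i). quartic_term h q w n i) has_sum Z) (UNIV \<times> UNIV)"
proof -
  note q = q_lt(1,2)[OF h hq]
  have qs: "norm (q^2) < 1" "norm (q^4) < 1" using q by (simp_all add: norm_power power_less_one_iff)
  let ?V = "\<lambda>n k. qpoch_recip q (int n - 4 * k) * qpoch_recip q (int n + 4 * k)"
  let ?g = "\<lambda>n k. w n * ((-1) powi k * \<phi> k * ?V n k)"
  let ?x = "\<lambda>n i. (-1) ^ i * h powi (2 * int i^2 - 2 * int i) * (qpoch (q^4) (q^4) (n - i - 1)
       * qpoch_recip (q^2) (int i) * qpoch_recip q (int n - 2 * int i) / qpoch q q (2 * n - 1))"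
  have A0: "0 \<le> A" using order_trans[OF norm_ge_zero wb[of 0]] by simp
  have w': "norm (w n) \<le> A * norm h ^ n" for n
  proof -
    have "int n \<le> int n^2" by (rule int_square_bounds)
    then have "norm h powi 0 \<le> norm h powi (int n - int n^2)" using h by (intro power_int_decreasing) auto
    then have "norm (w n) * 1 \<le> norm (w n) * norm h powi (int n - int n^2)" by (intro mult_left_mono) auto
    also have "\<dots> \<le> A * norm h ^ n" using wb[of n] by (simp add: norm_mult norm_power_int)
    finally show ?thesis by simp
  qed
  have t: "quartic_term h q w n i = (w n * h powi (int n - int n^2)) * ?x n i" if "n \<noteq> 0" for n i
  proof -
    have "h powi (2 * int i^2 - 2 * int i + int n - int n^2) = h powi (2 * int i^2 - 2 * int i) * h powi (int n - int n^2)"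
      unfolding powi_mult[OF h(1)] by (simp add: algebra_simps)
    then show ?thesis using that by (simp add: quartic_term_def mult_ac)
  qed
  have "bounded_fun (\<lambda>x. ?x (fst x) (snd x))"
  proof (intro bounded_fun_intros q qs bounded_fun_powi[of h 0])
    show "- 0 \<le> 2 * int (snd x)^2 - 2 * int (snd x)" for x :: "nat \<times> nat"
      using int_square_bounds(1)[of "int (snd x)"] by simp
  qed (use h in auto)
  then obtain C where C: "\<And>n i. norm (?x n i) \<le> C" by (auto simp: bounded_fun_def)
  have C0: "0 \<le> C" using order_trans[OF norm_ge_zero C] .
  have "bounded_fun (\<lambda>x. (-1) powi (snd x) * \<phi> (snd x) * ?V (fst x) (snd x))"
    by (intro bounded_fun_intros q bounded_fun_compose[OF \<phi>(1)])
  then obtain D where D: "\<And>n k. norm ((-1) powi k * \<phi> k * ?V n k) \<le> D" by (auto simp: bounded_fun_def)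
  show ?thesis
  proof (rule double_sum_interchange[where y = "norm h" and g = ?g and C = "max 1 (A * C)" and D = "A * D"])
    show "0 < norm h" "norm h < 1" using h by auto
    show "quartic_term h q w n i = 0" if "i > n" for n i using that by (simp add: quartic_term_def)
    show "?g n k = 0" if "k < - int n - 1 \<or> k > int n" for n k using that by auto
    show "norm (quartic_term h q w n i) \<le> max 1 (A * C) * norm h ^ n" for n i
    proof (cases "n = 0")
      case True
      then show ?thesis by (simp add: quartic_term_def le_max_iff_disj)
    next
      case False
      have "norm (quartic_term h q w n i) \<le> (A * norm h ^ n) * C"
        unfolding t[OF False] norm_mult[of "w n * _"] using A0 by (intro mult_mono wb C) auto
      also have "\<dots> = (A * C) * norm h ^ n" by simp
      also have "\<dots> \<le> max 1 (A * C) * norm h ^ n" by (intro mult_right_mono) auto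
      finally show ?thesis .
    qed
    show "norm (?g n k) \<le> A * D * norm h ^ n" for n k
    proof -
      have "norm (?g n k) \<le> (A * norm h ^ n) * D"
        unfolding norm_mult[of "w n"] using A0 by (intro mult_mono w' D) auto
      then show ?thesis by (simp only: mult_ac)
    qed
    show "(\<Sum>i\<le>n. quartic_term h q w n i) = (\<Sum>k=-int n - 1..int n. ?g n k)" for n
    proof (cases "n = 0")
      case True
      have "(\<Sum>k=-int 0 - 1..int 0. ?g 0 k) = (\<Sum>k\<in>{0}. ?g 0 k)"
        by (rule sum.mono_neutral_right) auto
      then show ?thesis unfolding True using \<phi>(2) w0 by (simp add: quartic_term_def qpoch_recip_def)
    next
      case False
      then have "(\<Sum>i\<le>n. quartic_term h q w n i) = w n * ((\<Sum>i\<le>n. (-1) ^ i * h powi (2 * int i^2 - 2 * int i + int n - int n^2) * qpoch (q^4) (q^4) (n - i - 1)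
         * qpoch_recip (q^2) (int i) * qpoch_recip q (int n - 2 * int i)) / qpoch q q (2 * n - 1))"
        unfolding sum_divide_distrib sum_distrib_left quartic_term_def by simp
      also have "\<dots> = w n * (\<Sum>k=-int n..int n. (-1) powi k * \<phi> k * ?V n k)"
        using False by (subst pair[of n "int n"]) auto
      also have "\<dots> = (\<Sum>k=-int n..int n. ?g n k)" by (rule sum_distrib_left)
      also have "\<dots> = (\<Sum>k=-int n - 1..int n. ?g n k)" by (rule sum.mono_neutral_left) auto
      finally show ?thesis .
    qed
    show "((\<lambda>n. ?g n k) has_sum ((-1) powi k * \<phi> k * \<omega> (4 * k))) UNIV" for k
    proof -
      have "((\<lambda>n. w n * (qpoch_recip q (int n - 4 * k) * qpoch_recip q (int n + 4 * k + 0))) has_sum \<omega> (4 * k)) UNIV"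
        using w le_cases[of 0 "4 * k"] unfolding summation_weight_def minus_zero by blast
      from has_sum_cmult_right[OF this, of "(-1) powi k * \<phi> k"] show ?thesis by (simp add: mult_ac)
    qed
    show "((\<lambda>k. (-1) powi k * \<phi> k * \<omega> (4 * k)) has_sum Z) UNIV" by (rule Z)
  qed
qed

lemma quartic_factor_bounded: "bounded_fun (\<lambda>k. q powi (10 * k^2 + 2 * k))" "bounded_fun (\<lambda>k. q powi (10 * k^2 - 2 * k))"
proof -
  have "0 \<le> 10 * k^2 + 2 * k" "0 \<le> 10 * k^2 - 2 * k" for k :: int using int_square_bounds[of k] by linarith+
  then show "bounded_fun (\<lambda>k. q powi (10 * k^2 + 2 * k))" "bounded_fun (\<lambda>k. q powi (10 * k^2 - 2 * k))"
    using q_lt(1,2)[OF h hq] by (auto intro!: bounded_fun_powi[of q 0])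
qed

text \<open>The even form of \<phi>, needed with the triangular weight so that its denominator 1 +
  q^(4k) cancels.\<close>

lemma quartic_pair_symmetrized:
  assumes n: "n \<ge> 1" "int n \<le> R"
  shows "(\<Sum>i\<le>n. (-1) ^ i * h powi (2 * int i^2 - 2 * int i + int n - int n^2) * qpoch (q^4) (q^4) (n - i - 1)
         * qpoch_recip (q^2) (int i) * qpoch_recip q (int n - 2 * int i)) / qpoch q q (2 * n - 1)
      = (\<Sum>k=-R..R. (-1) powi k * ((q powi (10*k^2 + 2*k) + q powi (10*k^2 - 2*k)) / 2) * (qpoch_recip q (int n - 4*k) * qpoch_recip q (int n + 4*k)))"
    (is "?L = _")
proof -
  let ?f = "\<lambda>k. (-1) powi k * q powi (10*k^2 + 2*k) * (qpoch_recip q (int n - 4*k) * qpoch_recip q (int n + 4*k))"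
  have L: "?L = sum ?f {-R..R}" by (rule quartic_pair[OF q_lt(3)[OF h hq] hq n])
  have "sum ?f {-R..R} = (\<Sum>k=-R..R. ?f (- k))"
    by (rule sum.reindex_bij_witness[of _ uminus uminus]) auto
  then have "?L = (\<Sum>k=-R..R. (?f k + ?f (- k)) / 2)"
    unfolding L sum_divide_distrib[symmetric] sum.distrib by simp
  also have "\<dots> = (\<Sum>k=-R..R. (-1) powi k * ((q powi (10*k^2 + 2*k) + q powi (10*k^2 - 2*k)) / 2) * (qpoch_recip q (int n - 4*k) * qpoch_recip q (int n + 4*k)))"
  proof (rule sum.cong[OF refl])
    fix k :: int
    have "(-1 :: complex) powi (- k) = (-1) powi k" by (simp add: power_int_minus flip: power_int_inverse)
    then show "(?f k + ?f (- k)) / 2 = (-1) powi k * ((q powi (10*k^2 + 2*k) + q powi (10*k^2 - 2*k)) / 2) * (qpoch_recip q (int n - 4*k) * qpoch_recip q (int n + 4*k))"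
      by (simp add: algebra_simps)
  qed
  finally show ?thesis .
qed


lemma square_weight_decay: "norm (q powi (int n^2 + 0 * int n) * h powi (int n - int n^2)) \<le> 1 * norm h ^ n"
proof -
  have "q powi (int n^2 + 0 * int n) * h powi (int n - int n^2) = h powi (int n + int n^2)"
    unfolding hq power_int_power powi_mult[OF h(1)] by (simp add: algebra_simps)
  moreover have "norm h powi (int n + int n^2) \<le> norm h powi int n" using h by (intro power_int_decreasing) auto
  ultimately show ?thesis by (simp add: norm_power_int)
qed

text \<open>A borderline case: the quadratic parts of q^(n(n+1)/2) and h^(n-n^2) cancel exactly and
  leave h^(2n).\<close>

lemma triangular_weight_decay:
  obtains A where "\<And>n. norm (q ^ (n * (n + 1) div 2) * qpoch (-1) q n * h powi (int n - int n^2)) \<le> A * norm h ^ n"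
proof -
  obtain C where C: "\<And>n. norm (qpoch (-1) q n) \<le> C" using qpoch_bounded[OF q_lt(1)[OF h hq]] by blast
  have "norm (q ^ (n * (n + 1) div 2) * qpoch (-1) q n * h powi (int n - int n^2)) \<le> C * norm h ^ n" for n
  proof -
    have "h powi (int n * (int n + 1)) * h powi (int n - int n^2) = h powi (2 * int n)"
      unfolding powi_mult[OF h(1)] by (simp add: power2_eq_square algebra_simps)
    then have e: "q ^ (n * (n + 1) div 2) * qpoch (-1) q n * h powi (int n - int n^2) = qpoch (-1) q n * h powi (2 * int n)"
      unfolding half_powi(4)[OF h hq] by (metis mult.assoc mult.commute)
    have "norm h powi (2 * int n) \<le> norm h powi int n" using h by (intro power_int_decreasing) auto
    then show ?thesis unfolding e norm_mult norm_power_int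
      using C[of n] order_trans[OF norm_ge_zero C[of n]] by (intro mult_mono) auto
  qed
  then show ?thesis by (rule that)
qed

lemma identity_25:
  "(\<exists>S T. ((\<lambda>(m, r). (-1)^(m + r) * q powi (3 * int m^2 + int r^2 + int r - 2 * int m * int r) * qpoch (q^4) (q^4) (m + r - 1) / (qpoch q q (4 * m - 1) * qpoch q q (2 * r)) * qpoch_recip (q^2) (int m - int r))
        has_sum S) ({1..} \<times> UNIV)
      \<and> ((\<lambda>(m, r). (-1)^(m + r) * q powi (3 * int m^2 + 2 * int m + int r^2 + int r - 2 * int m * int r + 1) * qpoch (q^4) (q^4) (m + r) / (qpoch q q (4 * m + 1) * qpoch q q (2 * r + 1)) * qpoch_recip (q^2) (int m - int r))
        has_sum T) (UNIV \<times> UNIV)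
      \<and> 1 + S + T = qpoch_inf [q^24, q^28, q^52] (q^52) / qpoch_inf [q] q)"
proof (rule has_sum_parity_split)
  let ?w = "\<lambda>n. q powi (int n^2 + 0 * int n)"
  have "((\<lambda>k. (-1) powi k * q powi (10 * k^2 + 2 * k) * (q powi ((4 * k)^2 + 0 * (4 * k)) / pinf q q)) has_sum
    (qpoch_inf [h ^ nat (int 52 - 4), h ^ nat (int 52 + 4), h ^ (2 * 52)] (h ^ (2 * 52)) * (1 / pinf q q))) UNIV"
  proof (rule theta_closing[OF h hq])
    fix k :: int
    have "q powi (10 * k^2 + 2 * k) * q powi ((4 * k)^2 + 0 * (4 * k)) = h powi (int 52 * k^2 + 4 * k)"
      unfolding hq power_int_power powi_mult[OF h(1)] by (simp add: power2_eq_square algebra_simps)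
    then show "(-1) powi k * q powi (10 * k^2 + 2 * k) * (q powi ((4 * k)^2 + 0 * (4 * k)) / pinf q q)
      = (-1) powi k * h powi (int 52 * k^2 + 4 * k) * (1 / pinf q q)" by (simp add: mult.assoc)
  qed simp
  then show "((\<lambda>(n, i). quartic_term h q ?w n i) has_sum
    (qpoch_inf [h ^ nat (int 52 - 4), h ^ nat (int 52 + 4), h ^ (2 * 52)] (h ^ (2 * 52)) * (1 / pinf q q))) (UNIV \<times> UNIV)"
    by (intro quartic_sum[OF quartic_factor_bounded(1) _ quartic_pair[OF q_lt(3)[OF h hq] hq]
        summation_weight_square[OF q_lt(1,2)[OF h hq] order_refl] _ square_weight_decay]) auto
  show "qpoch_inf [h ^ nat (int 52 - 4), h ^ nat (int 52 + 4), h ^ (2 * 52)] (h ^ (2 * 52)) * (1 / pinf q q)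
    = qpoch_inf [q^24, q^28, q^52] (q^52) / qpoch_inf [q] q"
    by (simp add: hq qpoch_inf_single flip: power_mult)
  fix m r :: nat
  show "(-1)^(m + r) * q powi (3 * int m^2 + int r^2 + int r - 2 * int m * int r) * qpoch (q^4) (q^4) (m + r - 1) / (qpoch q q (4 * m - 1) * qpoch q q (2 * r)) * qpoch_recip (q^2) (int m - int r)
    = (if r \<le> m then quartic_term h q ?w (2 * m) (m - r) else 0)" if "m \<ge> 1"
    by (rule quartic_term_even[where X = 1, unfolded mult_1_right, OF that _ refl refl], unfold as_powi[OF h hq] powi_mult[OF h(1)])
      (simp add: power2_eq_square algebra_simps)
  show "(-1)^(m + r) * q powi (3 * int m^2 + 2 * int m + int r^2 + int r - 2 * int m * int r + 1) * qpoch (q^4) (q^4) (m + r) / (qpoch q q (4 * m + 1) * qpoch q q (2 * r + 1)) * qpoch_recip (q^2) (int m - int r)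
    = (if r \<le> m then quartic_term h q ?w (2 * m + 1) (m - r) else 0)"
    by (rule quartic_term_odd[where X = 1, unfolded mult_1_right, OF _ refl refl], unfold as_powi[OF h hq] powi_mult[OF h(1)])
      (simp add: power2_eq_square algebra_simps)
qed (auto simp: quartic_term_def)

lemma identity_21:
  "(\<exists>S T. ((\<lambda>(m, r). (-1)^(m + r) * q powi (int m^2 + int m + int r^2 + int r - 2 * int m * int r) * qpoch (q^4) (q^4) (m + r - 1) * qpoch (-1) q (2 * m) / (qpoch q q (4 * m - 1) * qpoch q q (2 * r)) * qpoch_recip (q^2) (int m - int r))
        has_sum S) ({1..} \<times> UNIV)
      \<and> ((\<lambda>(m, r). (-1)^(m + r) * q powi (int m^2 + int m + int r^2 + int r - 2 * int m * int r + 1) * qpoch (q^4) (q^4) (m + r) * qpoch (-1) q (2 * m + 1) / (qpoch q q (4 * m + 1) * qpoch q q (2 * r + 1)) * qpoch_recip (q^2) (int m - int r))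
        has_sum T) (UNIV \<times> UNIV)
      \<and> 1 + S + T = qpoch_inf [q^18, q^18, q^36] (q^36) * qpoch_inf [-q] q / qpoch_inf [q] q)"
proof (rule has_sum_parity_split)
  let ?w = "\<lambda>n. q ^ (n * (n + 1) div 2) * qpoch (-1) q n"
  let ?\<phi> = "\<lambda>k. (q powi (10 * k^2 + 2 * k) + q powi (10 * k^2 - 2 * k)) / 2"
  have "((\<lambda>k. (-1) powi k * ?\<phi> k * (2 * h powi ((4 * k)^2 + 4 * k) / (1 + q powi (4 * k)) * (pinf (-q) q / pinf q q))) has_sum
    (qpoch_inf [h ^ nat (int 36 - 0), h ^ nat (int 36 + 0), h ^ (2 * 36)] (h ^ (2 * 36)) * (pinf (-q) q / pinf q q))) UNIV"
  proof (rule theta_closing[OF h hq])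
    fix k :: int
    \<comment> \<open>The dilation factor is already contained in \<phi>; a factor q^0 is inserted
      to give the term the shape of \<open>powi_triangular\<close>.\<close>
    have *: "20 * k^2 + 2 * 0 + (4 * k)^2 = int 36 * k^2 + 0 * k" by (simp add: power2_eq_square)
    have "(-1) powi k * (((h^2) powi (10 * k^2 + 2 * k) + (h^2) powi (10 * k^2 - 2 * k)) / 2) * q powi 0 * (2 * h powi ((4 * k)^2 + 4 * k) / (1 + q powi (4 * k)) * (pinf (-q) q / pinf q q))
      = (-1) powi k * h powi (int 36 * k^2 + 0 * k) * (pinf (-q) q / pinf q q)"
      by (rule powi_triangular[OF h hq _ _ *]) simp_all
    then show "(-1) powi k * ?\<phi> k * (2 * h powi ((4 * k)^2 + 4 * k) / (1 + q powi (4 * k)) * (pinf (-q) q / pinf q q))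
      = (-1) powi k * h powi (int 36 * k^2 + 0 * k) * (pinf (-q) q / pinf q q)"
      unfolding power_int_0_right mult_1_right hq[symmetric] .
  qed simp
  moreover obtain A where "\<And>n. norm (?w n * h powi (int n - int n^2)) \<le> A * norm h ^ n"
    using triangular_weight_decay by blast
  moreover have "bounded_fun ?\<phi>"
    using bounded_fun_mult[OF bounded_fun_const[of "1/2"] bounded_fun_add[OF quartic_factor_bounded]] by simp
  ultimately show "((\<lambda>(n, i). quartic_term h q ?w n i) has_sum
    (qpoch_inf [h ^ nat (int 36 - 0), h ^ nat (int 36 + 0), h ^ (2 * 36)] (h ^ (2 * 36)) * (pinf (-q) q / pinf q q))) (UNIV \<times> UNIV)"
    by (intro quartic_sum[OF _ _ quartic_pair_symmetrized summation_weight_triangular[OF q_lt(1,2)[OF h hq] hq]]) auto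
  show "qpoch_inf [h ^ nat (int 36 - 0), h ^ nat (int 36 + 0), h ^ (2 * 36)] (h ^ (2 * 36)) * (pinf (-q) q / pinf q q)
    = qpoch_inf [q^18, q^18, q^36] (q^36) * qpoch_inf [-q] q / qpoch_inf [q] q"
    by (simp add: hq qpoch_inf_single flip: power_mult)
  have w: "w * u * v = E * u" if "w * v = E" for w u v E :: complex using that by (simp add: mult_ac)
  fix m r :: nat
  have e: "2 * m * (2 * m + 1) div 2 = m * (2 * m + 1)" "(2 * m + 1) * (2 * m + 1 + 1) div 2 = (2 * m + 1) * (m + 1)" by simp_all
  show "(-1)^(m + r) * q powi (int m^2 + int m + int r^2 + int r - 2 * int m * int r) * qpoch (q^4) (q^4) (m + r - 1) * qpoch (-1) q (2 * m) / (qpoch q q (4 * m - 1) * qpoch q q (2 * r)) * qpoch_recip (q^2) (int m - int r)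
    = (if r \<le> m then quartic_term h q ?w (2 * m) (m - r) else 0)" if "m \<ge> 1"
    by (rule quartic_term_even[OF that w refl refl], unfold e as_powi[OF h hq] powi_mult[OF h(1)])
      (simp add: power2_eq_square algebra_simps)
  show "(-1)^(m + r) * q powi (int m^2 + int m + int r^2 + int r - 2 * int m * int r + 1) * qpoch (q^4) (q^4) (m + r) * qpoch (-1) q (2 * m + 1) / (qpoch q q (4 * m + 1) * qpoch q q (2 * r + 1)) * qpoch_recip (q^2) (int m - int r)
    = (if r \<le> m then quartic_term h q ?w (2 * m + 1) (m - r) else 0)"
    by (rule quartic_term_odd[OF w refl refl], unfold e as_powi[OF h hq] powi_mult[OF h(1)])
      (simp add: power2_eq_square algebra_simps)
qed (auto simp: quartic_term_def)

end

text \<open>With q in the role of h the quadratic exponents cancel exactly and q^n remains.\<close>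

lemma odd_weight_decay:
  assumes q: "q \<noteq> 0" "norm q < 1"
  obtains A where "\<And>n. norm (q ^ (n^2) * qpoch (-q) (q^2) n * q powi (int n - int n^2)) \<le> A * norm q ^ n"
proof -
  have "norm (q^2) < 1" using q by (simp add: norm_power power_less_one_iff)
  then obtain C where C: "\<And>n. norm (qpoch (-q) (q^2) n) \<le> C" using qpoch_bounded by blast
  have "norm (q ^ (n^2) * qpoch (-q) (q^2) n * q powi (int n - int n^2)) \<le> C * norm q ^ n" for n
  proof -
    have "q ^ (n^2) * q powi (int n - int n^2) = q ^ n"
      unfolding as_powi_self(1)[OF q] powi_mult[OF q(1)] by simp
    then have e: "q ^ (n^2) * qpoch (-q) (q^2) n * q powi (int n - int n^2) = qpoch (-q) (q^2) n * q ^ n"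
      by (metis mult.assoc mult.commute)
    show ?thesis unfolding e norm_mult norm_power by (intro mult_right_mono C) simp
  qed
  then show ?thesis by (rule that)
qed

lemma identity_26:
  assumes q: "q \<noteq> 0" "norm q < 1"
  shows "(\<exists>S T. ((\<lambda>(m, r). (-1)^(m + r) * q powi (2 * int m^2 + 2 * int r^2 + 2 * int r - 4 * int m * int r) * qpoch (q^8) (q^8) (m + r - 1) * qpoch (-q) (q^2) (2 * m) / (qpoch (q^2) (q^2) (4 * m - 1) * qpoch (q^2) (q^2) (2 * r)) * qpoch_recip (q^4) (int m - int r))
        has_sum S) ({1..} \<times> UNIV)
      \<and> ((\<lambda>(m, r). (-1)^(m + r) * q powi (2 * int m^2 + 2 * int r^2 + 2 * int r - 4 * int m * int r + 1) * qpoch (q^8) (q^8) (m + r) * qpoch (-q) (q^2) (2 * m + 1) / (qpoch (q^2) (q^2) (4 * m + 1) * qpoch (q^2) (q^2) (2 * r + 1)) * qpoch_recip (q^4) (int m - int r))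
        has_sum T) (UNIV \<times> UNIV)
      \<and> 1 + S + T = qpoch_inf [q^32, q^40, q^72] (q^72) * qpoch_inf [-q] (q^2) / qpoch_inf [q^2] (q^2))"
proof (rule has_sum_parity_split)
  let ?w = "\<lambda>n. q ^ (n^2) * qpoch (-q) (q^2) n"
  let ?c = "pinf (-q) (q^2) / pinf (q^2) (q^2)"
  note qq = q_lt[OF q refl]
  have "((\<lambda>k. (-1) powi k * (q^2) powi (10 * k^2 + 2 * k) * (q powi ((4 * k)^2) * ?c)) has_sum
    (qpoch_inf [q ^ nat (int 36 - 4), q ^ nat (int 36 + 4), q ^ (2 * 36)] (q ^ (2 * 36)) * ?c)) UNIV"
  proof (rule theta_closing[OF q refl])
    fix k :: int
    have "(q^2) powi (10 * k^2 + 2 * k) * q powi ((4 * k)^2) = q powi (int 36 * k^2 + 4 * k)"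
      unfolding power_int_power powi_mult[OF q(1)] by (simp add: power2_eq_square algebra_simps)
    then show "(-1) powi k * (q^2) powi (10 * k^2 + 2 * k) * (q powi ((4 * k)^2) * ?c) = (-1) powi k * q powi (int 36 * k^2 + 4 * k) * ?c"
      by (metis mult.assoc)
  qed simp
  moreover obtain A where "\<And>n. norm (?w n * q powi (int n - int n^2)) \<le> A * norm q ^ n"
    using odd_weight_decay[OF q] by blast
  ultimately show "((\<lambda>(n, i). quartic_term q (q^2) ?w n i) has_sum
    (qpoch_inf [q ^ nat (int 36 - 4), q ^ nat (int 36 + 4), q ^ (2 * 36)] (q ^ (2 * 36)) * ?c)) (UNIV \<times> UNIV)"
    by (intro quartic_sum[OF q refl quartic_factor_bounded(1)[OF q refl] _ quartic_pair[OF qq(3) refl]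
        summation_weight_odd_square[OF q(2,1)]]) auto
  show "qpoch_inf [q ^ nat (int 36 - 4), q ^ nat (int 36 + 4), q ^ (2 * 36)] (q ^ (2 * 36)) * ?c
    = qpoch_inf [q^32, q^40, q^72] (q^72) * qpoch_inf [-q] (q^2) / qpoch_inf [q^2] (q^2)"
    by (simp add: qpoch_inf_single)
  have w: "w * u * v = E * u" if "w * v = E" for w u v E :: complex using that by (simp add: mult_ac)
  have p: "(q^2)^4 = q^8" "(q^2)^2 = q^4" by (simp_all flip: power_mult)
  fix m r :: nat
  show "(-1)^(m + r) * q powi (2 * int m^2 + 2 * int r^2 + 2 * int r - 4 * int m * int r) * qpoch (q^8) (q^8) (m + r - 1) * qpoch (-q) (q^2) (2 * m) / (qpoch (q^2) (q^2) (4 * m - 1) * qpoch (q^2) (q^2) (2 * r)) * qpoch_recip (q^4) (int m - int r)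
    = (if r \<le> m then quartic_term q (q^2) ?w (2 * m) (m - r) else 0)" if "m \<ge> 1"
    by (rule quartic_term_even[OF that w p], unfold as_powi_self(1)[OF q] powi_mult[OF q(1)])
      (simp add: power2_eq_square algebra_simps)
  show "(-1)^(m + r) * q powi (2 * int m^2 + 2 * int r^2 + 2 * int r - 4 * int m * int r + 1) * qpoch (q^8) (q^8) (m + r) * qpoch (-q) (q^2) (2 * m + 1) / (qpoch (q^2) (q^2) (4 * m + 1) * qpoch (q^2) (q^2) (2 * r + 1)) * qpoch_recip (q^4) (int m - int r)
    = (if r \<le> m then quartic_term q (q^2) ?w (2 * m + 1) (m - r) else 0)"
    by (rule quartic_term_odd[OF w p], unfold as_powi_self(1)[OF q] powi_mult[OF q(1)])
      (simp add: power2_eq_square algebra_simps)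
qed (auto simp: quartic_term_def)

subsection \<open>The degenerate base\<close>

text \<open>
  For \<open>q = 0\<close> the powers with negative exponents that the general argument manipulates are junk
  (\<open>0 powi k = 0\<close> for \<open>k < 0\<close>), so the sums are evaluated term by term.
\<close>

lemma qpoch_zero_base: "qpoch 0 0 n = 1"
  by (simp add: qpoch_def)

lemma qpoch_inf_zero_base: "qpoch_inf [0] 0 = 1" "qpoch_inf [0, 0, 0] 0 = 1"
  by (simp_all add: qpoch_inf_single qpoch_inf_triple)

lemma has_sum_origin:
  fixes f :: "nat \<Rightarrow> nat \<Rightarrow> complex"
  assumes "\<And>n r. n \<noteq> 0 \<Longrightarrow> f n r = 0" "\<And>r. r \<noteq> 0 \<Longrightarrow> f 0 r = 0" "f 0 0 = 1" "Z = 1"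
  shows "((\<lambda>(n, r). f n r) has_sum Z) (UNIV \<times> UNIV)"
proof -
  have "((\<lambda>(n, r). f n r) has_sum (\<Sum>(n, r)\<in>{(0, 0)}. f n r)) UNIV"
  proof (rule has_sum_finite_support)
    fix x :: "nat \<times> nat" assume "x \<notin> {(0, 0)}"
    then show "(case x of (n, r) \<Rightarrow> f n r) = 0" using assms(1,2) by (cases x; cases "fst x = 0") auto
  qed simp
  then show ?thesis using assms(3,4) by simp
qed

lemma has_sum_rows_zero:
  fixes f :: "nat \<Rightarrow> nat \<Rightarrow> complex"
  assumes "\<And>n r. n \<noteq> 0 \<Longrightarrow> f n r = 0" "Z = 1"
  shows "\<exists>S. ((\<lambda>(n, r). f n r) has_sum S) ({1..} \<times> UNIV) \<and> 1 + S = Z"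
proof (intro exI conjI)
  show "((\<lambda>(n, r). f n r) has_sum 0) ({1..} \<times> UNIV)" using assms(1) by (intro has_sum_0) auto
qed (use assms in simp)

lemma has_sum_parities_zero:
  fixes f g :: "nat \<Rightarrow> nat \<Rightarrow> complex"
  assumes "\<And>m r. m \<noteq> 0 \<Longrightarrow> f m r = 0" "\<And>m r. g m r = 0" "Z = 1"
  shows "\<exists>S T. ((\<lambda>(m, r). f m r) has_sum S) ({1..} \<times> UNIV) \<and> ((\<lambda>(m, r). g m r) has_sum T) (UNIV \<times> UNIV) \<and> 1 + S + T = Z"
proof (intro exI conjI)
  show "((\<lambda>(m, r). f m r) has_sum 0) ({1..} \<times> UNIV)" using assms(1) by (intro has_sum_0) auto
  show "((\<lambda>(m, r). g m r) has_sum 0) (UNIV \<times> UNIV)" using assms(2) by (intro has_sum_0) auto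
qed (use assms in simp)

text \<open>Lets the vanishing of a term be proved under the assumption that its index is
  non-negative.\<close>

lemma mult_recip_eq_0: "(0 \<le> d \<Longrightarrow> X = 0) \<Longrightarrow> X * qpoch_recip q d = 0"
  by (cases "0 \<le> d") auto

lemma exponent_bounds:
  fixes n r :: nat
  shows "0 \<le> 3 * int r * (int r - 1) div 2" "- 3 \<le> 3 * int r * (int r - 3) div 2"
    and "n \<noteq> 0 \<Longrightarrow> 0 < int n * (int n + 1) div 2" "n \<noteq> 0 \<Longrightarrow> 0 < n * (n + 1) div 2"
    and "0 \<le> int n - 3 * int r \<Longrightarrow> 9 * int r^2 \<le> int n^2" "n \<noteq> 0 \<Longrightarrow> 1 \<le> int n^2" "r \<noteq> 0 \<Longrightarrow> 1 \<le> int r^2"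
    and "0 \<le> int r * (int r - 1)" "- 2 \<le> int r * (int r - 3)"
proof -
  show 1: "0 \<le> int r * (int r - 1)" by (cases r) auto
  show 2: "- 2 \<le> int r * (int r - 3)"
  proof (cases "r \<le> 1")
    case True
    then show ?thesis by (cases r) auto
  next
    case False
    then have "0 \<le> (int r - 1) * (int r - 2)" by (intro mult_nonneg_nonneg) auto
    then show ?thesis by (simp add: algebra_simps)
  qed
  have "3 * int r * (int r - 3) \<ge> (- 3) * 2" using 2 by (simp only: mult.assoc)
  from zdiv_mono1[OF this, of 2] show "- 3 \<le> 3 * int r * (int r - 3) div 2" by simp
  show "0 \<le> 3 * int r * (int r - 1) div 2" using 1 by (simp add: mult.assoc)
  show n: "0 < n * (n + 1) div 2" if "n \<noteq> 0" using that by (cases n) auto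
  show "0 < int n * (int n + 1) div 2" if "n \<noteq> 0" 
  proof -
    have "int (n * (n + 1) div 2) = int n * (int n + 1) div 2" by (simp only: zdiv_int of_nat_mult of_nat_add of_nat_1 of_nat_numeral)
    then show ?thesis using n[OF that] by linarith
  qed
  show "9 * int r^2 \<le> int n^2" if "0 \<le> int n - 3 * int r"
  proof -
    have "(3 * int r)^2 \<le> int n^2" using that by (intro power_mono) auto
    then show ?thesis by (simp add: power_mult_distrib)
  qed
  show "n \<noteq> 0 \<Longrightarrow> 1 \<le> int n^2" "r \<noteq> 0 \<Longrightarrow> 1 \<le> int r^2"
    by (simp_all add: Suc_le_eq flip: of_nat_power)
qed

text \<open>Since 0 to any non-zero integer power is 0, it is enough that the exponent is not 0. In
  the last two cases with r = 0 the exponent is not examined: the bracket is 1 + 0 - 1 = 0.\<close>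

lemma vanishing_powers:
  fixes n r :: nat
  assumes "n \<noteq> 0"
  shows "(0 :: complex) ^ (n * (n + 1) div 2 + k) = 0" "(0 :: complex) powi (int n * (int n + 1) div 2 + 3 * int r * (int r - 1) div 2) = 0"
    "(0 :: complex) powi (int n^2 + 3 * int n + 3 * int r * (int r - 1) div 2) = 0"
    "(0 :: complex) powi (int n^2 + 3 * int r * (int r - 1) div 2) = 0" "(0 :: complex) powi (int n^2 + 3 * int r * (int r - 1)) = 0"
    and "0 \<le> int n - 3 * int r \<Longrightarrow> (0 :: complex) powi (int n^2 + 3 * int r * (int r - 3) div 2) = 0"
    and "0 \<le> int n - 3 * int r \<Longrightarrow> (0 :: complex) powi (int n^2 + 3 * int r * (int r - 3)) = 0"
    and "0 \<le> int n - 3 * int r \<Longrightarrow> (0 :: complex) powi (int n^2 + 3 * int r^2 - 3) * X * (0 ^ (3 * r) + 0 ^ (6 * r + 3) - 1) = 0"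
    and "0 \<le> int n - 3 * int r \<Longrightarrow> (0 :: complex) powi (int n^2 + 6 * int r^2 - 6) * X * Y * (0 ^ (6 * r) + 0 ^ (12 * r + 6) - 1) = 0"
proof -
  note b = exponent_bounds(1)[of r] exponent_bounds(3,4,6)[OF assms] exponent_bounds(8)[of r]
  have m: "3 * int r * (int r - 1) = 3 * (int r * (int r - 1))" "3 * int r * (int r - 3) = 3 * (int r * (int r - 3))" by simp_all
  show "(0 :: complex) ^ (n * (n + 1) div 2 + k) = 0" using b(3) by (intro zero_power) linarith
  show "(0 :: complex) powi (int n * (int n + 1) div 2 + 3 * int r * (int r - 1) div 2) = 0"
    "(0 :: complex) powi (int n^2 + 3 * int n + 3 * int r * (int r - 1) div 2) = 0"
    "(0 :: complex) powi (int n^2 + 3 * int r * (int r - 1) div 2) = 0"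
    using b by (intro power_int_0_left; linarith)+
  show "(0 :: complex) powi (int n^2 + 3 * int r * (int r - 1)) = 0" using b m by (intro power_int_0_left) linarith
  assume d: "0 \<le> int n - 3 * int r"
  have r: "r = 0 \<or> int n^2 \<ge> 9 \<and> 1 \<le> int r^2"
  proof (cases "r = 0")
    case False
    show ?thesis using exponent_bounds(5)[OF d] exponent_bounds(7)[OF False] by linarith
  qed simp
  show "(0 :: complex) powi (int n^2 + 3 * int r * (int r - 3) div 2) = 0"
    using r exponent_bounds(2)[of r] assms by (intro power_int_0_left) auto
  show "(0 :: complex) powi (int n^2 + 3 * int r * (int r - 3)) = 0"
    using r exponent_bounds(9)[of r] m assms by (intro power_int_0_left) auto
  have p: "(0 :: complex) powi (int n^2 + 3 * int r^2 - 3) = 0" "(0 :: complex) powi (int n^2 + 6 * int r^2 - 6) = 0" if "r \<noteq> 0"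
  proof -
    have "9 \<le> int n^2" "1 \<le> int r^2" using r that by auto
    then show "(0 :: complex) powi (int n^2 + 3 * int r^2 - 3) = 0" "(0 :: complex) powi (int n^2 + 6 * int r^2 - 6) = 0"
      by (intro power_int_0_left; linarith)+
  qed
  show "(0 :: complex) powi (int n^2 + 3 * int r^2 - 3) * X * (0 ^ (3 * r) + 0 ^ (6 * r + 3) - 1) = 0"
    using p by (cases "r = 0") simp_all
  show "(0 :: complex) powi (int n^2 + 6 * int r^2 - 6) * X * Y * (0 ^ (6 * r) + 0 ^ (12 * r + 6) - 1) = 0"
    using p by (cases "r = 0") simp_all
qed

text \<open>Completing the square (m - r)^2 shows that every exponent is positive.\<close>

lemma vanishing_powers_quartic:
  fixes m r :: nat
  assumes "0 \<le> int m - int r"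
  shows "m \<noteq> 0 \<Longrightarrow> (0 :: complex) powi (int m^2 + int m + int r^2 + int r - 2 * int m * int r) = 0"
    and "(0 :: complex) powi (int m^2 + int m + int r^2 + int r - 2 * int m * int r + 1) = 0"
    and "m \<noteq> 0 \<Longrightarrow> (0 :: complex) powi (3 * int m^2 + int r^2 + int r - 2 * int m * int r) = 0"
    and "(0 :: complex) powi (3 * int m^2 + 2 * int m + int r^2 + int r - 2 * int m * int r + 1) = 0"
    and "m \<noteq> 0 \<Longrightarrow> (0 :: complex) powi (2 * int m^2 + 2 * int r^2 + 2 * int r - 4 * int m * int r) = 0"
    and "(0 :: complex) powi (2 * int m^2 + 2 * int r^2 + 2 * int r - 4 * int m * int r + 1) = 0"
proof -
  have d: "0 \<le> (int m - int r)^2" "(int m - int r)^2 = int m^2 + int r^2 - 2 * int m * int r"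
    by (rule zero_le_power2, rule power2_diff)
  show "(0 :: complex) powi (int m^2 + int m + int r^2 + int r - 2 * int m * int r + 1) = 0"
    "(0 :: complex) powi (3 * int m^2 + 2 * int m + int r^2 + int r - 2 * int m * int r + 1) = 0"
    "(0 :: complex) powi (2 * int m^2 + 2 * int r^2 + 2 * int r - 4 * int m * int r + 1) = 0"
    using d zero_le_power2[of "int m"] by (intro power_int_0_left; linarith)+
  assume "m \<noteq> 0"
  then have m: "1 \<le> int m" "1 \<le> int m^2" by (simp_all add: exponent_bounds(6))
  show "(0 :: complex) powi (int m^2 + int m + int r^2 + int r - 2 * int m * int r) = 0"
    "(0 :: complex) powi (3 * int m^2 + int r^2 + int r - 2 * int m * int r) = 0"
    using d m by (intro power_int_0_left; linarith)+
  have "0 < 2 * int m^2 + 2 * int r^2 + 2 * int r - 4 * int m * int r"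
  proof (cases "r = 0")
    case True
    then show ?thesis using m by simp
  next
    case False
    then have "1 \<le> int r" by simp
    then show ?thesis using d by linarith
  qed
  then show "(0 :: complex) powi (2 * int m^2 + 2 * int r^2 + 2 * int r - 4 * int m * int r) = 0"
    by (intro power_int_0_left) linarith
qed

text \<open>
  Here three terms survive: those at \<open>(1, 0)\<close> and \<open>(2, 1)\<close> have exponent \<open>0\<close> and opposite signs.
\<close>

lemma identity_1_zero:
  fixes q :: complex
  assumes "q = 0"
  shows "((\<lambda>(n, r). (-1)^r * q powi (3 * int n * (int n - 1) div 2 + int r^2 - 2 * int n * int r) / (qpoch q (q^2) n * qpoch (q^2) (q^2) r) * qpoch_recip q (int n - 2 * int r))
        has_sum (qpoch_inf [q^2, q^4, q^6] (q^6) / qpoch_inf [q] q)) (UNIV \<times> UNIV)"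
proof -
  define t where "t n r = (-1)^r * q powi (3 * int n * (int n - 1) div 2 + int r^2 - 2 * int n * int r) / (qpoch q (q^2) n * qpoch (q^2) (q^2) r) * qpoch_recip q (int n - 2 * int r)" for n r
  have zero: "t n r = 0" if "(n, r) \<notin> {(0, 0), (1, 0), (2, 1)}" for n r
  proof -
    let ?E = "3 * int n * (int n - 1) div 2 + int r^2 - 2 * int n * int r"
    have E: "?E \<noteq> 0" if d: "0 \<le> int n - 2 * int r"
    proof (cases "n \<ge> 3")
      case True
      have "2 * (3 * int n * (int n - 1) div 2) = 3 * int n * (int n - 1)" by simp
      then have "2 * ?E = 3 * int n * (int n - 1) + 2 * int r^2 - 4 * int n * int r" by (simp only: distrib_left right_diff_distrib; simp)
      moreover have "0 \<le> (int n - 2 * int r) * (3 * int n - 2 * int r)" using d by (intro mult_nonneg_nonneg) auto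
      moreover have "0 < int n * (int n - 2)" using True by (intro mult_pos_pos) auto
      moreover have "(int n - 2 * int r) * (3 * int n - 2 * int r) = 3 * int n^2 + 4 * int r^2 - 8 * int n * int r"
        "int n * (int n - 2) = int n^2 - 2 * int n" "3 * int n * (int n - 1) = 3 * int n^2 - 3 * int n"
        by (simp_all add: power2_eq_square algebra_simps)
      ultimately have "0 < 2 * ?E" by linarith
      then have "0 < ?E" by (rule zero_less_mult_pos) simp
      then show ?thesis by (metis less_irrefl)
    next
      case False
      then consider "n = 0" | "n = 1" | "n = 2" by linarith
      then show ?thesis using d \<open>(n, r) \<notin> _\<close> by cases (auto simp: le_Suc_eq)
    qed
    then show ?thesis unfolding t_def assms by (intro mult_recip_eq_0) simp
  qed
  have "(case x of (n, r) \<Rightarrow> t n r) = 0" if "x \<notin> {(0, 0), (1, 0), (2, 1)}" for x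
    using that zero by (cases x) auto
  then have "((\<lambda>(n, r). t n r) has_sum (\<Sum>(n, r)\<in>{(0, 0), (1, 0), (2, 1)}. t n r)) UNIV"
    by (intro has_sum_finite_support) simp_all
  then have "((\<lambda>(n, r). t n r) has_sum 1) (UNIV \<times> UNIV)"
    by (simp add: t_def assms qpoch_zero_base qpoch_recip_def)
  then show ?thesis unfolding t_def by (simp add: assms qpoch_inf_zero_base)
qed

theorem mainTheorem9:
  fixes q :: complex
  assumes "norm q < 1"
  shows "
    \<comment> \<open>1\<close>
    ((\<lambda>(n, r). (-1)^r * q powi (3 * int n * (int n - 1) div 2 + int r^2 - 2 * int n * int r) / (qpoch q (q^2) n * qpoch (q^2) (q^2) r) * qpoch_recip q (int n - 2 * int r))
        has_sum (qpoch_inf [q^2, q^4, q^6] (q^6) / qpoch_inf [q] q)) (UNIV \<times> UNIV)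
    \<and> qpoch_inf [q^2, q^4, q^6] (q^6) / qpoch_inf [q] q = qpoch_inf [-q] q
    \<and>
    \<comment> \<open>2\<close>
    (\<exists>S. ((\<lambda>(n, r). (-1)^r * q powi (int n * (int n + 1) div 2 + 3 * int r * (int r - 1) div 2) * qpoch (-1) q n * qpoch (q^3) (q^3) (n - r - 1) / (qpoch q q (2 * n - 1) * qpoch (q^3) (q^3) r) * qpoch_recip q (int n - 3 * int r))
        has_sum S) ({1..} \<times> UNIV)
      \<and> 1 + S = qpoch_inf [q^6, q^6, q^12] (q^12) * qpoch_inf [-q] q / qpoch_inf [q] q)
    \<and>
    \<comment> \<open>3\<close>
    ((\<lambda>(n, r). q ^ (n * (n + 1) div 2 + 2 * r^2) * qpoch (-1) q n / (qpoch q (q^2) n * qpoch (q^2) (q^2) r) * qpoch_recip q (int n - 2 * int r))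
        has_sum (qpoch_inf [q^7, q^7, q^14] (q^14) * qpoch_inf [-q] q / qpoch_inf [q] q)) (UNIV \<times> UNIV)
    \<and>
    \<comment> \<open>4\<close>
    ((\<lambda>(n, r). q ^ (n^2 + 2 * n + 2 * r^2 + 2 * r) / (qpoch q (q^2) (n + 1) * qpoch (q^2) (q^2) r) * qpoch_recip q (int n - 2 * int r))
        has_sum (qpoch_inf [q^2, q^16, q^18] (q^18) / qpoch_inf [q] q)) (UNIV \<times> UNIV)
    \<and>
    \<comment> \<open>5\<close>
    ((\<lambda>(n, r). q ^ (n^2 + 2 * n + 2 * r^2 + 2 * r) * (1 + q ^ (2 * r + 2)) / (qpoch q (q^2) (n + 1) * qpoch (q^2) (q^2) r) * qpoch_recip q (int n - 2 * int r))
        has_sum (qpoch_inf [q^4, q^14, q^18] (q^18) / qpoch_inf [q] q)) (UNIV \<times> UNIV)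
    \<and>
    \<comment> \<open>6\<close>
    ((\<lambda>(n, r). q ^ (n^2 + 2 * r^2 + 2 * r) / (qpoch q (q^2) n * qpoch (q^2) (q^2) r) * qpoch_recip q (int n - 2 * int r))
        has_sum (qpoch_inf [q^6, q^12, q^18] (q^18) / qpoch_inf [q] q)) (UNIV \<times> UNIV)
    \<and>
    \<comment> \<open>7\<close>
    ((\<lambda>(n, r). q ^ (n^2 + 2 * r^2) / (qpoch q (q^2) n * qpoch (q^2) (q^2) r) * qpoch_recip q (int n - 2 * int r))
        has_sum (qpoch_inf [q^8, q^10, q^18] (q^18) / qpoch_inf [q] q)) (UNIV \<times> UNIV)
    \<and>
    \<comment> \<open>8\<close>
    ((\<lambda>(n, r). (-1)^r * q powi (int n^2 + 3 * int n + 3 * int r * (int r - 1) div 2) * qpoch (q^3) (q^3) (n - r) / (qpoch q q (2 * n + 2) * qpoch (q^3) (q^3) r) * qpoch_recip q (int n - 3 * int r))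
        has_sum (qpoch_inf [q^3, q^18, q^21] (q^21) / qpoch_inf [q] q)) (UNIV \<times> UNIV)
    \<and>
    \<comment> \<open>9\<close>
    (\<exists>S. ((\<lambda>(n, r). (-1)^r * q powi (int n^2 + 3 * int r * (int r - 3) div 2) * qpoch (q^3) (q^3) (n - r - 1) / (qpoch q q (2 * n - 1) * qpoch (q^3) (q^3) r) * qpoch_recip q (int n - 3 * int r))
        has_sum S) ({1..} \<times> UNIV)
      \<and> 1 + S = qpoch_inf [q^6, q^15, q^21] (q^21) / qpoch_inf [q] q)
    \<and>
    \<comment> \<open>10\<close>
    (\<exists>S. ((\<lambda>(n, r). (-1)^r * q powi (int n^2 + 3 * int r * (int r - 1) div 2) * qpoch (q^3) (q^3) (n - r - 1) / (qpoch q q (2 * n - 1) * qpoch (q^3) (q^3) r) * qpoch_recip q (int n - 3 * int r))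
        has_sum S) ({1..} \<times> UNIV)
      \<and> 1 + S = qpoch_inf [q^9, q^12, q^21] (q^21) / qpoch_inf [q] q)
    \<and>
    \<comment> \<open>11\<close>
    (\<exists>S. ((\<lambda>(n, r). (-1)^r * q powi (int n^2 + 3 * int r * (int r - 3)) * qpoch (-q) (q^2) n * qpoch (q^6) (q^6) (n - r - 1) / (qpoch (q^2) (q^2) (2 * n - 1) * qpoch (q^6) (q^6) r) * qpoch_recip (q^2) (int n - 3 * int r))
        has_sum S) ({1..} \<times> UNIV)
      \<and> 1 + S = qpoch_inf [q^3, q^21, q^24] (q^24) * qpoch_inf [-q] (q^2) / qpoch_inf [q^2] (q^2))
    \<and>
    \<comment> \<open>12\<close>
    (\<exists>S. ((\<lambda>(n, r). (-1)^r * q powi (int n^2 + 3 * int r * (int r - 1)) * qpoch (-q) (q^2) n * qpoch (q^6) (q^6) (n - r - 1) / (qpoch (q^2) (q^2) (2 * n - 1) * qpoch (q^6) (q^6) r) * qpoch_recip (q^2) (int n - 3 * int r))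
        has_sum S) ({1..} \<times> UNIV)
      \<and> 1 + S = qpoch_inf [q^9, q^15, q^24] (q^24) * qpoch_inf [-q] (q^2) / qpoch_inf [q^2] (q^2))
    \<and>
    \<comment> \<open>13\<close>
    (\<exists>S. ((\<lambda>(n, r). q ^ (n * (n + 1) div 2 + 3 * r^2) * qpoch (-1) q n * qpoch (q^3) (q^3) (n - r - 1) / (qpoch q q (2 * n - 1) * qpoch (q^3) (q^3) r) * qpoch_recip q (int n - 3 * int r))
        has_sum S) ({1..} \<times> UNIV)
      \<and> 1 + S = qpoch_inf [q^12, q^12, q^24] (q^24) * qpoch_inf [-q] q / qpoch_inf [q] q)
    \<and>
    \<comment> \<open>14\<close>
    ((\<lambda>(n, r). q ^ (n^2 + 4 * r^2 + 4 * r) / (qpoch q (q^2) n * qpoch (q^4) (q^4) r) * qpoch_recip (q^2) (int n - 2 * int r))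
        has_sum (qpoch_inf [q^8, q^20, q^28] (q^28) * qpoch_inf [-q] (q^2) / qpoch_inf [q^2] (q^2))) (UNIV \<times> UNIV)
    \<and>
    \<comment> \<open>15\<close>
    ((\<lambda>(n, r). q ^ (n^2 + 4 * r^2) / (qpoch q (q^2) n * qpoch (q^4) (q^4) r) * qpoch_recip (q^2) (int n - 2 * int r))
        has_sum (qpoch_inf [q^12, q^16, q^28] (q^28) * qpoch_inf [-q] (q^2) / qpoch_inf [q^2] (q^2))) (UNIV \<times> UNIV)
    \<and>
    \<comment> \<open>16\<close>
    ((\<lambda>(n, r). q ^ (n^2 + 3 * n + 3 * r^2 + 3 * r) * qpoch (q^3) (q^3) (n - r) / (qpoch q q (2 * n + 2) * qpoch (q^3) (q^3) r) * qpoch_recip q (int n - 3 * int r))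
        has_sum (qpoch_inf [q^3, q^30, q^33] (q^33) / qpoch_inf [q] q)) (UNIV \<times> UNIV)
    \<and>
    \<comment> \<open>17\<close>
    ((\<lambda>(n, r). q ^ (n^2 + 3 * n + 3 * r^2 + 3 * r) * qpoch (q^3) (q^3) (n - r) * (1 + q ^ (3 * r + 3)) / (qpoch q q (2 * n + 2) * qpoch (q^3) (q^3) r) * qpoch_recip q (int n - 3 * int r))
        has_sum (qpoch_inf [q^6, q^27, q^33] (q^33) / qpoch_inf [q] q)) (UNIV \<times> UNIV)
    \<and>
    \<comment> \<open>18\<close>
    (\<exists>S. ((\<lambda>(n, r). q powi (int n^2 + 3 * int r^2 - 3) * qpoch (q^3) (q^3) (n - r - 1) * (q ^ (3 * r) + q ^ (6 * r + 3) - 1) / (qpoch q q (2 * n - 1) * qpoch (q^3) (q^3) r) * qpoch_recip q (int n - 3 * int r))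
        has_sum S) ({1..} \<times> UNIV)
      \<and> 1 + S = qpoch_inf [q^9, q^24, q^33] (q^33) / qpoch_inf [q] q)
    \<and>
    \<comment> \<open>19\<close>
    (\<exists>S. ((\<lambda>(n, r). q ^ (n^2 + 3 * r^2 + 3 * r) * qpoch (q^3) (q^3) (n - r - 1) / (qpoch q q (2 * n - 1) * qpoch (q^3) (q^3) r) * qpoch_recip q (int n - 3 * int r))
        has_sum S) ({1..} \<times> UNIV)
      \<and> 1 + S = qpoch_inf [q^12, q^21, q^33] (q^33) / qpoch_inf [q] q)
    \<and>
    \<comment> \<open>20\<close>
    (\<exists>S. ((\<lambda>(n, r). q ^ (n^2 + 3 * r^2) * qpoch (q^3) (q^3) (n - r - 1) / (qpoch q q (2 * n - 1) * qpoch (q^3) (q^3) r) * qpoch_recip q (int n - 3 * int r))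
        has_sum S) ({1..} \<times> UNIV)
      \<and> 1 + S = qpoch_inf [q^15, q^18, q^33] (q^33) / qpoch_inf [q] q)
    \<and>
    \<comment> \<open>21\<close>
    (\<exists>S T. ((\<lambda>(m, r). (-1)^(m + r) * q powi (int m^2 + int m + int r^2 + int r - 2 * int m * int r) * qpoch (q^4) (q^4) (m + r - 1) * qpoch (-1) q (2 * m) / (qpoch q q (4 * m - 1) * qpoch q q (2 * r)) * qpoch_recip (q^2) (int m - int r))
        has_sum S) ({1..} \<times> UNIV)
      \<and> ((\<lambda>(m, r). (-1)^(m + r) * q powi (int m^2 + int m + int r^2 + int r - 2 * int m * int r + 1) * qpoch (q^4) (q^4) (m + r) * qpoch (-1) q (2 * m + 1) / (qpoch q q (4 * m + 1) * qpoch q q (2 * r + 1)) * qpoch_recip (q^2) (int m - int r))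
        has_sum T) (UNIV \<times> UNIV)
      \<and> 1 + S + T = qpoch_inf [q^18, q^18, q^36] (q^36) * qpoch_inf [-q] q / qpoch_inf [q] q)
    \<and>
    \<comment> \<open>22\<close>
    (\<exists>S. ((\<lambda>(n, r). q powi (int n^2 + 6 * int r^2 - 6) * qpoch (-q) (q^2) n * qpoch (q^6) (q^6) (n - r - 1) * (q ^ (6 * r) + q ^ (12 * r + 6) - 1) / (qpoch (q^2) (q^2) (2 * n - 1) * qpoch (q^6) (q^6) r) * qpoch_recip (q^2) (int n - 3 * int r))
        has_sum S) ({1..} \<times> UNIV)
      \<and> 1 + S = qpoch_inf [q^9, q^39, q^48] (q^48) * qpoch_inf [-q] (q^2) / qpoch_inf [q^2] (q^2))
    \<and>
    \<comment> \<open>23\<close>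
    (\<exists>S. ((\<lambda>(n, r). q ^ (n^2 + 6 * r^2 + 6 * r) * qpoch (-q) (q^2) n * qpoch (q^6) (q^6) (n - r - 1) / (qpoch (q^2) (q^2) (2 * n - 1) * qpoch (q^6) (q^6) r) * qpoch_recip (q^2) (int n - 3 * int r))
        has_sum S) ({1..} \<times> UNIV)
      \<and> 1 + S = qpoch_inf [q^15, q^33, q^48] (q^48) * qpoch_inf [-q] (q^2) / qpoch_inf [q^2] (q^2))
    \<and>
    \<comment> \<open>24\<close>
    (\<exists>S. ((\<lambda>(n, r). q ^ (n^2 + 6 * r^2) * qpoch (-q) (q^2) n * qpoch (q^6) (q^6) (n - r - 1) / (qpoch (q^2) (q^2) (2 * n - 1) * qpoch (q^6) (q^6) r) * qpoch_recip (q^2) (int n - 3 * int r))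
        has_sum S) ({1..} \<times> UNIV)
      \<and> 1 + S = qpoch_inf [q^21, q^27, q^48] (q^48) * qpoch_inf [-q] (q^2) / qpoch_inf [q^2] (q^2))
    \<and>
    \<comment> \<open>25\<close>
    (\<exists>S T. ((\<lambda>(m, r). (-1)^(m + r) * q powi (3 * int m^2 + int r^2 + int r - 2 * int m * int r) * qpoch (q^4) (q^4) (m + r - 1) / (qpoch q q (4 * m - 1) * qpoch q q (2 * r)) * qpoch_recip (q^2) (int m - int r))
        has_sum S) ({1..} \<times> UNIV)
      \<and> ((\<lambda>(m, r). (-1)^(m + r) * q powi (3 * int m^2 + 2 * int m + int r^2 + int r - 2 * int m * int r + 1) * qpoch (q^4) (q^4) (m + r) / (qpoch q q (4 * m + 1) * qpoch q q (2 * r + 1)) * qpoch_recip (q^2) (int m - int r))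
        has_sum T) (UNIV \<times> UNIV)
      \<and> 1 + S + T = qpoch_inf [q^24, q^28, q^52] (q^52) / qpoch_inf [q] q)
    \<and>
    \<comment> \<open>26\<close>
    (\<exists>S T. ((\<lambda>(m, r). (-1)^(m + r) * q powi (2 * int m^2 + 2 * int r^2 + 2 * int r - 4 * int m * int r) * qpoch (q^8) (q^8) (m + r - 1) * qpoch (-q) (q^2) (2 * m) / (qpoch (q^2) (q^2) (4 * m - 1) * qpoch (q^2) (q^2) (2 * r)) * qpoch_recip (q^4) (int m - int r))
        has_sum S) ({1..} \<times> UNIV)
      \<and> ((\<lambda>(m, r). (-1)^(m + r) * q powi (2 * int m^2 + 2 * int r^2 + 2 * int r - 4 * int m * int r + 1) * qpoch (q^8) (q^8) (m + r) * qpoch (-q) (q^2) (2 * m + 1) / (qpoch (q^2) (q^2) (4 * m + 1) * qpoch (q^2) (q^2) (2 * r + 1)) * qpoch_recip (q^4) (int m - int r))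
        has_sum T) (UNIV \<times> UNIV)
      \<and> 1 + S + T = qpoch_inf [q^32, q^40, q^72] (q^72) * qpoch_inf [-q] (q^2) / qpoch_inf [q^2] (q^2))"
proof (cases "q = 0")
  case False
  \<comment> \<open>Either square root serves, since the identities themselves involve integral
    powers of q only.\<close>
  obtain h where h: "q = h^2" using power2_csqrt[of q] by metis
  have "h \<noteq> 0" using False h by auto
  moreover have "norm h < 1" using assms unfolding h norm_power by (simp add: power_less_one_iff)
  ultimately have hq: "h \<noteq> 0" "norm h < 1" "q = h^2" using h by auto
  note q = False assms
  show ?thesis
    by (intro conjI identity_1[OF hq] triple_product_eq[OF assms] identity_2[OF hq] identity_3[OF hq] identity_4[OF hq]
      identity_5[OF hq] identity_6[OF hq] identity_7[OF hq] identity_8[OF hq] identity_9[OF hq] identity_10[OF hq]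
      identity_11[OF q] identity_12[OF q] identity_13[OF hq] identity_14[OF q] identity_15[OF q] identity_16[OF hq]
      identity_17[OF hq] identity_18[OF hq] identity_19[OF hq] identity_20[OF hq] identity_21[OF hq] identity_22[OF q]
      identity_23[OF q] identity_24[OF q] identity_25[OF hq] identity_26[OF q])
next
  case True
  show ?thesis
    \<comment> \<open>Simplification evaluates the terms at the origin and the products, all equal
      to 1; the goals it leaves are products with a power of 0 that the vanishing lemmas
      remove.\<close>
    by (rule conjI[OF identity_1_zero[OF True]], rule conjI[OF triple_product_eq[OF assms]], unfold True,
      (intro conjI has_sum_origin has_sum_rows_zero has_sum_parities_zero mult_recip_eq_0;
        (simp add: qpoch_zero_base qpoch_inf_zero_base qpoch_recip_def; fail)?),
      (simp_all only: vanishing_powers vanishing_powers_quartic mult_zero_left mult_zero_right div_0 simp_thms))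
qed

end
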